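(* Let $p\in(1,\infty)$. Then for every $f\in\mathfrak C_0\cap\Lambda_1$, $$\mathrm{dist}\left(f,W^{1,p}\cap\Lambda_1\right)_{\Lambda_1}\sim\inf\left\{\varepsilon\in(0,\infty):\left\|\left[\int_0^1\mathbf 1_{\{(x,y)\in\mathbb R^n\times(0,1]:\,y^{-1}\Delta_2f(x,y)>\varepsilon\}}(\cdot,y)\frac{dy}{y}\right]^{1/2}\right\|_{L^p(\mathbb R^n)}<\infty\right\}$$ with positive equivalence constants independent of $f$.
   Context: $\mathfrak C_0$ is the space of continuous functions on $\mathbb R^n$ with $\lim_{|x|\to\infty}f(x)=0$. $\Delta_hf(x):=f(x+h/2)-f(x-h/2)$, $\Delta^2_h:=\Delta_h\Delta_h$, $\Delta_2f(x,y):=\sup_{h\in\mathbb R^n,|h|=y}|\Delta_h^2f(x)|$. $\Lambda_1$: bounded continuous $f$ with $\|f\|_{\Lambda_1}:=\|f\|_{L^\infty}+\sup_{x\in\mathbb R^n,y\in(0,1]}\Delta_2f(x,y)/y<\infty$. $W^{1,p}$ is the usual Sobolev space. $\mathrm{dist}(f,V)_{\Lambda_1}:=\inf_{g\in V}\|f-g\|_{\Lambda_1}$. *)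

theory Defs
  imports "HOL-Analysis.Analysis"
begin

definition C0 :: "('a::euclidean_space \<Rightarrow> real) set" where
  "C0 = {f. continuous_on UNIV f \<and> (f \<longlongrightarrow> 0) at_infinity}"

definition Dh :: "'a::euclidean_space \<Rightarrow> ('a \<Rightarrow> real) \<Rightarrow> 'a \<Rightarrow> real" where
  "Dh h f x = f (x + (1/2) *\<^sub>R h) - f (x - (1/2) *\<^sub>R h)"

definition Dh2 :: "'a::euclidean_space \<Rightarrow> ('a \<Rightarrow> real) \<Rightarrow> 'a \<Rightarrow> real" where
  "Dh2 h f = Dh h (Dh h f)"

definition Delta2 :: "('a::euclidean_space \<Rightarrow> real) \<Rightarrow> 'a \<Rightarrow> real \<Rightarrow> real" where
  "Delta2 f x y = (SUP h\<in>{h. norm h = y}. \<bar>Dh2 h f x\<bar>)"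

definition Lambda1 :: "('a::euclidean_space \<Rightarrow> real) set" where
  "Lambda1 = {f. continuous_on UNIV f \<and> bounded (range f) \<and>
      bdd_above {Delta2 f x y / y | x y. y \<in> {0<..1}}}"

definition Lambda1_norm :: "('a::euclidean_space \<Rightarrow> real) \<Rightarrow> real" where
  "Lambda1_norm f = (SUP x. \<bar>f x\<bar>) + (SUP (x,y)\<in>UNIV \<times> {0<..1}. Delta2 f x y / y)"

definition pderiv_dir :: "'a::euclidean_space \<Rightarrow> ('a \<Rightarrow> real) \<Rightarrow> 'a \<Rightarrow> real" where
  "pderiv_dir i \<phi> x = deriv (\<lambda>t. \<phi> (x + t *\<^sub>R i)) 0"

(* C_c^\<infinity> test functions: compact support and all iterated partial derivatives
   exist everywhere and are continuous *)
definition test_function :: "('a::euclidean_space \<Rightarrow> real) \<Rightarrow> bool" where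
  "test_function \<phi> \<longleftrightarrow> compact (closure {x. \<phi> x \<noteq> 0}) \<and>
     (\<exists>D :: 'a list \<Rightarrow> 'a \<Rightarrow> real. D [] = \<phi> \<and> (\<forall>\<alpha>. continuous_on UNIV (D \<alpha>)) \<and>
        (\<forall>\<alpha>. \<forall>i\<in>Basis. \<forall>x. ((\<lambda>t. D \<alpha> (x + t *\<^sub>R i)) has_real_derivative D (i # \<alpha>) x) (at 0)))"

definition Lp :: "real \<Rightarrow> ('a::euclidean_space \<Rightarrow> real) set" where
  "Lp p = {f. f \<in> borel_measurable lebesgue \<and> integrable lebesgue (\<lambda>x. \<bar>f x\<bar> powr p)}"

definition weak_pderiv :: "'a::euclidean_space \<Rightarrow> ('a \<Rightarrow> real) \<Rightarrow> ('a \<Rightarrow> real) \<Rightarrow> bool" where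
  "weak_pderiv i f g \<longleftrightarrow> (\<forall>\<phi>. test_function \<phi> \<longrightarrow>
      integral\<^sup>L lebesgue (\<lambda>x. f x * pderiv_dir i \<phi> x) = - integral\<^sup>L lebesgue (\<lambda>x. g x * \<phi> x))"

definition W1p :: "real \<Rightarrow> ('a::euclidean_space \<Rightarrow> real) set" where
  "W1p p = {f. f \<in> Lp p \<and> (\<forall>i\<in>Basis. \<exists>g. g \<in> Lp p \<and> weak_pderiv i f g)}"

definition dist_Lambda1 :: "('a::euclidean_space \<Rightarrow> real) \<Rightarrow> ('a \<Rightarrow> real) set \<Rightarrow> real" where
  "dist_Lambda1 f V = (INF g\<in>V. Lambda1_norm (\<lambda>x. f x - g x))"

definition sq_inner :: "('a::euclidean_space \<Rightarrow> real) \<Rightarrow> real \<Rightarrow> 'a \<Rightarrow> ennreal" where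
  "sq_inner f \<epsilon> x = (\<integral>\<^sup>+ y. indicator {y \<in> {0<..1}. Delta2 f x y / y > \<epsilon>} y * ennreal (1 / y) \<partial>lborel)"

definition enn_powr :: "ennreal \<Rightarrow> real \<Rightarrow> ennreal" where
  "enn_powr a r = (if a = \<infinity> then \<infinity> else ennreal (enn2real a powr r))"

(* ||[...]^{1/2}||_{L^p} < \<infinity>  iff  \<integral> [...]^{p/2} < \<infinity> *)
definition sq_Lp_finite :: "real \<Rightarrow> ('a::euclidean_space \<Rightarrow> real) \<Rightarrow> real \<Rightarrow> bool" where
  "sq_Lp_finite p f \<epsilon> \<longleftrightarrow> (\<integral>\<^sup>+ x. enn_powr (sq_inner f \<epsilon> x) (p / 2) \<partial>lebesgue) < \<infinity>"

definition eps_Lambda :: "real \<Rightarrow> ('a::euclidean_space \<Rightarrow> real) \<Rightarrow> real" where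
  "eps_Lambda p f = Inf {\<epsilon>. \<epsilon> > 0 \<and> sq_Lp_finite p f \<epsilon>}"

end

theory Submission
  imports Defs "HOL-Probability.Probability" "HOL-Computational_Algebra.Polynomial"
begin

text \<open>
  Both halves rest on the comparison, in \<open>L\<^sup>p\<close>, of a dyadic martingale whose jumps are bounded by 1 with
  the number of its large (respectively nonzero) jumps; the comparison is obtained from explicit Bellman functions.

  Lower bound. For \<open>g\<close> in \<open>W\<^sup>1\<^sup>,\<^sup>p\<close> and in the Zygmund class, the dyadic slopes of \<open>g\<close> along a line form a
  martingale whose jumps are second differences of \<open>g\<close> and which is closed by the directional derivative of \<open>g\<close>.
  Hence the number of scales with a large second difference is controlled in \<open>L\<^sup>p\<^sup>/\<^sup>2\<close>, first for second differences
  taken at dyadic cells and then, averaging over the translates of the dyadic grid, at every point. If \<open>f - g\<close> has norm below \<open>\<epsilon>\<close>,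
  a second difference quotient of \<open>f\<close> beyond \<open>2 \<epsilon>\<close> forces one of \<open>g\<close> beyond \<open>\<epsilon>\<close>.

  Upper bound. Let \<open>B\<^sub>k\<close> be the average at scale \<open>2\<^sup>-\<^sup>k\<close> against the tent kernel. Telescoping gives
  \<open>f = \<Sum>\<^sub>k B\<^sub>k a\<^sub>k\<close> with \<open>a\<^sub>k = B\<^sub>k\<^sub>+\<^sub>1 f - B\<^sub>k\<^sub>-\<^sub>1 f\<close>, an average of second differences of \<open>f\<close>. The part of \<open>a\<^sub>k\<close> below
  a multiple of \<open>\<epsilon> 2\<^sup>-\<^sup>k\<close> sums to a function of norm \<open>O(\<epsilon>)\<close>. Let \<open>b\<^sub>k\<close> be the remaining part. The derivative of the tent
  is a Haar function averaged over the position of the cell, so the derivative of \<open>\<Sum>\<^sub>k B\<^sub>k b\<^sub>k\<close> is an average of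
  martingales, and its \<open>L\<^sup>p\<close> norm is bounded by the number of scales at which the support of \<open>b\<^sub>k\<close> is near. That number
  is dominated by the square function of \<open>f\<close> at level \<open>\<epsilon>\<close>, because second differences of a Zygmund
  function vary slowly on their own scale.
\<close>

section \<open>Bellman functions\<close>

text \<open>The exponent \<open>p / 2\<close> may lie below 1, so neither the triangle inequality
  nor duality is available for the counts of scales; comparisons of counts are therefore made for
  every positive exponent. The hypothesis \<open>p > 1\<close> enters as \<open>q > 1/2\<close>,
  which keeps the second derivative of \<open>(m + x^2)^q\<close> comparable to
  \<open>(m + x^2)^(q-1)\<close>; the Bellman functions rest on this. The other obstacle is the
  passage between dyadic cells and points: an event observed at the centre of a cell must be
  compared with one at a given point. In place of a maximal function, randomness is used. Inside its
  cell a point is uniform and independent of the cell, so it is near the centre with a fixed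
  probability, and \<open>count_powr_dominated\<close> shows that keeping only these lucky events
  costs a constant factor in every moment. The tent is chosen because it is a convolution square
  with explicit moduli, and because its derivative, rescaled, lives on exactly one cell with
  opposite signs on the two halves. The decay of \<open>f\<close> at infinity takes care of the
  finitely many coarse scales, which the square function, restricted to \<open>y <= 1\<close>, does
  not control.\<close>

lemma symmetric_second_difference:
  fixes f f' f'' :: "real \<Rightarrow> real"
  assumes f: "\<And>y. (f has_real_derivative f' y) (at y)"
    and f': "\<And>y. (f' has_real_derivative f'' y) (at y)"
  shows "\<exists>y z. \<bar>y - x\<bar> \<le> \<bar>a\<bar> \<and> \<bar>z - x\<bar> \<le> \<bar>a\<bar> \<and>
    (f (x + a) + f (x - a)) / 2 - f x = (f'' y + f'' z) / 4 * a\<^sup>2"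
proof (cases "a = 0")
  case True
  then show ?thesis by auto
next
  case False
  define g where "g = (\<lambda>t. f (x + t) + f (x - t))"
  define d where "d = (\<lambda>m::nat. if m = 0 then g else if m = 1 then (\<lambda>t. f' (x + t) - f' (x - t))
     else (\<lambda>t. f'' (x + t) + f'' (x - t)))"
  have "\<exists>t>0. t < \<bar>a\<bar> \<and> g \<bar>a\<bar> = (\<Sum>m<2. d m 0 / fact m * \<bar>a\<bar> ^ m) + d 2 t / fact 2 * \<bar>a\<bar> ^ 2"
  proof (rule Maclaurin)
    show "\<forall>m t. m < 2 \<and> 0 \<le> t \<and> t \<le> \<bar>a\<bar> \<longrightarrow> (d m has_real_derivative d (Suc m) t) (at t)"
    proof (intro allI impI)
      fix m :: nat and t :: real assume m: "m < 2 \<and> 0 \<le> t \<and> t \<le> \<bar>a\<bar>"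
      have "(g has_real_derivative (f' (x + t) - f' (x - t))) (at t)"
        unfolding g_def
        by (rule derivative_eq_intros DERIV_chain2[OF f] refl | simp)+
      moreover have "((\<lambda>t. f' (x + t) - f' (x - t)) has_real_derivative (f'' (x + t) + f'' (x - t))) (at t)"
        by (rule derivative_eq_intros DERIV_chain2[OF f'] refl | simp)+
      ultimately show "(d m has_real_derivative d (Suc m) t) (at t)"
        using m by (cases m) (auto simp: d_def)
    qed
  qed (use False in \<open>auto simp: d_def\<close>)
  then obtain t where t: "0 < t" "t < \<bar>a\<bar>"
    and e: "g \<bar>a\<bar> = (\<Sum>m<2. d m 0 / fact m * \<bar>a\<bar> ^ m) + d 2 t / fact 2 * \<bar>a\<bar> ^ 2" by auto
  \<comment> \<open>\<open>g\<close> is even, so its first-order term at 0 vanishes. The remainder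
    carries \<open>f''\<close> at both \<open>x + t\<close> and \<open>x - t\<close>, hence the two
    intermediate points of the statement.\<close>
  have "(\<Sum>m<2. d m 0 / fact m * \<bar>a\<bar> ^ m) = 2 * f x"
    by (simp add: d_def g_def numeral_2_eq_2)
  moreover have "g \<bar>a\<bar> = f (x + a) + f (x - a)" by (auto simp: g_def abs_if)
  ultimately have "(f (x + a) + f (x - a)) / 2 - f x = (f'' (x + t) + f'' (x - t)) / 4 * a\<^sup>2"
    using e by (simp add: d_def field_simps)
  then show ?thesis
    using t by (intro exI[of _ "x + t"] exI[of _ "x - t"]) auto
qed

text \<open>Comparability within a factor 3 survives powers of either sign; the exponent
  \<open>q - 1\<close> of the application is negative when \<open>p < 2\<close>.\<close>

lemma powr_le_cmult_powr:
  fixes u v r :: real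
  assumes "0 < u" "0 < v" "u \<le> 3 * v" "v \<le> 3 * u"
  shows "u powr r \<le> 3 powr \<bar>r\<bar> * v powr r"
proof (cases "r \<ge> 0")
  case True
  then have "u powr r \<le> (3 * v) powr r" using assms by (intro powr_mono2) auto
  then show ?thesis using True assms by (simp add: powr_mult)
next
  case False
  then have "u powr r \<le> (v / 3) powr r" using assms by (intro powr_mono2') auto
  also have "\<dots> = 3 powr \<bar>r\<bar> * v powr r"
    using False assms by (simp add: powr_divide powr_minus field_simps)
  finally show ?thesis .
qed

text \<open>The second derivative of \<open>(m + y^2)^q\<close> is
  \<open>2 q (m + y^2)^(q-1)\<close> times the ratio \<open>(m + (2q-1) y^2) / (m + y^2)\<close>,
  and this ratio lies between two constants, the lower one being positive because
  \<open>q > 1/2\<close>. A displacement by at most 1 changes \<open>m + x^2\<close> by a bounded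
  factor since \<open>m >= 1\<close>, so the intermediate points can be replaced by
  \<open>x\<close>.\<close>

lemma quad_powr_second_difference:
  fixes q :: real
  assumes q: "q > 1/2"
  obtains c C where "c > 0" "C > 0"
    "\<And>m x a. 1 \<le> m \<Longrightarrow> \<bar>a\<bar> \<le> 1 \<Longrightarrow> c * a\<^sup>2 * (m + x\<^sup>2) powr (q - 1)
        \<le> ((m + (x + a)\<^sup>2) powr q + (m + (x - a)\<^sup>2) powr q) / 2 - (m + x\<^sup>2) powr q"
    "\<And>m x a. 1 \<le> m \<Longrightarrow> \<bar>a\<bar> \<le> 1 \<Longrightarrow>
       ((m + (x + a)\<^sup>2) powr q + (m + (x - a)\<^sup>2) powr q) / 2 - (m + x\<^sup>2) powr q
        \<le> C * a\<^sup>2 * (m + x\<^sup>2) powr (q - 1)"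
proof -
  \<comment> \<open>\<open>k\<close> and \<open>l\<close> bound the ratio in \<open>f''_eq\<close>
    from below and above; \<open>w\<close> is the loss when the base point moves by at most
    1.\<close>
  define k where "k = min 1 (2 * q - 1)"
  define l where "l = max 1 (2 * q - 1)"
  define w where "w = 3 powr \<bar>q - 1\<bar>"
  have kl: "k > 0" "l > 0" "w > 0" using q by (auto simp: k_def l_def w_def)
  have main: "k * q / w * a\<^sup>2 * (m + x\<^sup>2) powr (q - 1)
        \<le> ((m + (x + a)\<^sup>2) powr q + (m + (x - a)\<^sup>2) powr q) / 2 - (m + x\<^sup>2) powr q \<and>
       ((m + (x + a)\<^sup>2) powr q + (m + (x - a)\<^sup>2) powr q) / 2 - (m + x\<^sup>2) powr q
        \<le> l * q * w * a\<^sup>2 * (m + x\<^sup>2) powr (q - 1)" if m: "1 \<le> m" and a: "\<bar>a\<bar> \<le> 1" for m x a :: real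
  proof -
    define f where "f = (\<lambda>y::real. (m + y\<^sup>2) powr q)"
    define f' where "f' = (\<lambda>y::real. 2 * q * y * (m + y\<^sup>2) powr (q - 1))"
    define f'' where "f'' = (\<lambda>y::real. 2 * q * (m + y\<^sup>2) powr (q - 1)
         + 2 * q * y * ((q - 1) * (m + y\<^sup>2) powr (q - 2) * (2 * y)))"
    have pos: "m + y\<^sup>2 > 0" for y :: real using m by (smt (verit) zero_le_power2)
    have dp: "((\<lambda>y. (m + y\<^sup>2) powr r) has_real_derivative r * (m + y\<^sup>2) powr (r - 1) * (2 * y)) (at y)" for r y
    proof -
      have "((\<lambda>y. m + y\<^sup>2) has_real_derivative 2 * y) (at y)"
        by (auto intro!: derivative_eq_intros)
      from DERIV_fun_powr[OF this pos, of r] show ?thesis by simp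
    qed
    have d1: "(f has_real_derivative f' y) (at y)" for y
      using dp[of q y] unfolding f_def f'_def by (simp add: mult_ac)
    have d2: "(f' has_real_derivative f'' y) (at y)" for y
    proof -
      have "((\<lambda>y. 2 * q * y) has_real_derivative 2 * q) (at y)"
        by (auto intro!: derivative_eq_intros)
      from DERIV_mult[OF this dp[of "q - 1" y]] show ?thesis
        unfolding f'_def f''_def by (simp add: algebra_simps)
    qed
    have f''_eq: "f'' y = 2 * q * (m + y\<^sup>2) powr (q - 1) * ((m + (2 * q - 1) * y\<^sup>2) / (m + y\<^sup>2))" for y
    proof -
      have "(m + y\<^sup>2) powr (q - 2) = (m + y\<^sup>2) powr (q - 1) / (m + y\<^sup>2)"
        using pos[of y] powr_diff[of "m + y\<^sup>2" "q - 1" 1] by simp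
      then show ?thesis
        using pos[of y] unfolding f''_def by (simp add: field_simps power2_eq_square)
    qed
    have ratio: "k \<le> (m + (2 * q - 1) * y\<^sup>2) / (m + y\<^sup>2)" "(m + (2 * q - 1) * y\<^sup>2) / (m + y\<^sup>2) \<le> l" for y
    proof -
      have "k * m \<le> m" "k * y\<^sup>2 \<le> (2 * q - 1) * y\<^sup>2" "m \<le> l * m" "(2 * q - 1) * y\<^sup>2 \<le> l * y\<^sup>2"
        using m by (auto simp: k_def l_def intro!: mult_right_mono)
      then show "k \<le> (m + (2 * q - 1) * y\<^sup>2) / (m + y\<^sup>2)" "(m + (2 * q - 1) * y\<^sup>2) / (m + y\<^sup>2) \<le> l"
        using pos[of y] by (simp_all add: field_simps)
    qed
    have comp: "(m + y\<^sup>2) powr (q - 1) \<le> w * (m + x\<^sup>2) powr (q - 1)"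
      "(m + x\<^sup>2) powr (q - 1) \<le> w * (m + y\<^sup>2) powr (q - 1)" if "\<bar>y - x\<bar> \<le> \<bar>a\<bar>" for y
    proof -
      have y1: "\<bar>y - x\<bar> \<le> 1" using that a by simp
      have s: "u\<^sup>2 \<le> 2 * v\<^sup>2 + 2" if "\<bar>u - v\<bar> \<le> 1" for u v :: real
      proof -
        have "(u - v)\<^sup>2 \<le> 1" using that by (simp add: abs_square_le_1)
        moreover have "0 \<le> (u - 2 * v)\<^sup>2" by simp
        moreover have "u\<^sup>2 = 2 * v\<^sup>2 + 2 * (u - v)\<^sup>2 - (u - 2 * v)\<^sup>2"
          by (simp add: power2_eq_square algebra_simps)
        ultimately show ?thesis by linarith
      qed
      \<comment> \<open>\<open>m >= 1\<close> absorbs the additive constant 2. For the same reason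
        the Bellman functions built from this lemma contain \<open>1 + real n\<close>.\<close>
      have "m + y\<^sup>2 \<le> 3 * (m + x\<^sup>2)" "m + x\<^sup>2 \<le> 3 * (m + y\<^sup>2)"
        using s[of y x] s[of x y] y1 m by (auto simp: abs_minus_commute) (smt (verit) zero_le_power2)+
      then show "(m + y\<^sup>2) powr (q - 1) \<le> w * (m + x\<^sup>2) powr (q - 1)"
        "(m + x\<^sup>2) powr (q - 1) \<le> w * (m + y\<^sup>2) powr (q - 1)"
        unfolding w_def using pos by (auto intro!: powr_le_cmult_powr)
    qed
    have lo: "2 * (k * q / w) * (m + x\<^sup>2) powr (q - 1) \<le> f'' y" if "\<bar>y - x\<bar> \<le> \<bar>a\<bar>" for y
    proof -
      have "2 * (k * q / w) * (m + x\<^sup>2) powr (q - 1) \<le> 2 * (k * q / w) * (w * (m + y\<^sup>2) powr (q - 1))"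
        using comp(2)[OF that] kl q by (intro mult_left_mono) auto
      also have "\<dots> = 2 * q * (m + y\<^sup>2) powr (q - 1) * k" using kl by simp
      also have "\<dots> \<le> f'' y" unfolding f''_eq using ratio(1) q by (intro mult_left_mono) auto
      finally show ?thesis .
    qed
    have hi: "f'' y \<le> 2 * (l * q * w) * (m + x\<^sup>2) powr (q - 1)" if "\<bar>y - x\<bar> \<le> \<bar>a\<bar>" for y
    proof -
      have "f'' y \<le> 2 * q * (m + y\<^sup>2) powr (q - 1) * l"
        unfolding f''_eq using ratio(2) q by (intro mult_left_mono) auto
      also have "\<dots> \<le> 2 * q * (w * (m + x\<^sup>2) powr (q - 1)) * l"
        using comp(1)[OF that] kl q by (intro mult_left_mono mult_right_mono) auto
      finally show ?thesis by (simp add: mult_ac)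
    qed
    obtain y z where yz: "\<bar>y - x\<bar> \<le> \<bar>a\<bar>" "\<bar>z - x\<bar> \<le> \<bar>a\<bar>"
      and e: "(f (x + a) + f (x - a)) / 2 - f x = (f'' y + f'' z) / 4 * a\<^sup>2"
      using symmetric_second_difference[OF d1 d2] by blast
    define v where "v = k * q / w * (m + x\<^sup>2) powr (q - 1)"
    have "2 * v \<le> f'' y" "2 * v \<le> f'' z"
      using lo[OF yz(1)] lo[OF yz(2)] unfolding v_def by (simp_all only: mult.assoc)
    then have "k * q / w * (m + x\<^sup>2) powr (q - 1) \<le> (f'' y + f'' z) / 4" unfolding v_def[symmetric] by simp
    then have "k * q / w * (m + x\<^sup>2) powr (q - 1) * a\<^sup>2 \<le> (f'' y + f'' z) / 4 * a\<^sup>2"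
      by (rule mult_right_mono) simp
    moreover have "(f'' y + f'' z) / 4 * a\<^sup>2 \<le> l * q * w * (m + x\<^sup>2) powr (q - 1) * a\<^sup>2"
      using hi[OF yz(1)] hi[OF yz(2)] by (intro mult_right_mono) auto
    ultimately show ?thesis unfolding e[unfolded f_def] by (simp only: mult_ac)
  qed
  show ?thesis
    by (rule that[of "k * q / w" "l * q * w"]) (use main kl q in auto)
qed

lemma powr_increment_bounds:
  fixes x y r :: real
  assumes xy: "0 \<le> x" "x \<le> y" "0 < y"
  shows powr_increment_le: "r \<ge> 1 \<Longrightarrow> y powr r - x powr r \<le> r * (y - x) * y powr (r - 1)"
    and powr_increment_ge: "0 < r \<Longrightarrow> r \<le> 1 \<Longrightarrow> r * (y - x) * y powr (r - 1) \<le> y powr r - x powr r"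
    and powr_increment_le': "0 < x \<Longrightarrow> 0 < r \<Longrightarrow> r \<le> 1 \<Longrightarrow> y powr r - x powr r \<le> r * (y - x) * x powr (r - 1)"
proof -
  have mvt: "\<exists>z>x. z < y \<and> y powr r - x powr r = (y - x) * (r * z powr (r - 1))" if "x < y" "r > 0"
  proof -
    have "\<exists>l z. x < z \<and> z < y \<and> DERIV (\<lambda>z. z powr r) z :> l \<and> y powr r - x powr r = (y - x) * l"
    proof (rule MVT)
      show "continuous_on {x..y} (\<lambda>z. z powr r)"
        using that xy by (intro continuous_on_powr') (auto intro!: continuous_intros)
      fix z assume "x < z" "z < y"
      then have "DERIV (\<lambda>z. z powr r) z :> r * z powr (r - 1)"
        using xy has_real_derivative_powr by auto
      then show "(\<lambda>z. z powr r) differentiable (at z)"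
        using real_differentiable_def by blast
    qed (use that in auto)
    then obtain l z where z: "x < z" "z < y" "DERIV (\<lambda>z. z powr r) z :> l"
      "y powr r - x powr r = (y - x) * l" by blast
    have "DERIV (\<lambda>z. z powr r) z :> r * z powr (r - 1)"
      using z xy has_real_derivative_powr by auto
    then show ?thesis using z DERIV_unique by blast
  qed
  show "y powr r - x powr r \<le> r * (y - x) * y powr (r - 1)" if r: "r \<ge> 1"
  proof (cases "x < y")
    case True
    then obtain z where z: "x < z" "z < y" "y powr r - x powr r = (y - x) * (r * z powr (r - 1))"
      using mvt r by auto
    then show ?thesis using r xy by (auto simp: mult_ac intro!: mult_left_mono powr_mono2)
  qed (use xy in auto)
  show "r * (y - x) * y powr (r - 1) \<le> y powr r - x powr r" if r: "0 < r" "r \<le> 1"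
  proof (cases "x < y")
    case True
    then obtain z where z: "x < z" "z < y" "y powr r - x powr r = (y - x) * (r * z powr (r - 1))"
      using mvt r by auto
    then show ?thesis using r xy by (auto simp: mult_ac intro!: mult_left_mono powr_mono2')
  qed (use xy in auto)
  show "y powr r - x powr r \<le> r * (y - x) * x powr (r - 1)" if r: "0 < x" "0 < r" "r \<le> 1"
  proof (cases "x < y")
    case True
    then obtain z where z: "x < z" "z < y" "y powr r - x powr r = (y - x) * (r * z powr (r - 1))"
      using mvt r by auto
    then show ?thesis using r xy by (auto simp: mult_ac intro!: mult_left_mono powr_mono2')
  qed (use xy in auto)
qed

text \<open>A form of Young's inequality: either \<open>c * x\<close> is at most
  \<open>y / 2\<close>, or \<open>y\<close> can be replaced by \<open>2 * c * x\<close>. The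
  coefficient one half is what later allows the first term to be absorbed.\<close>

lemma weighted_powr_le:
  fixes x y r c :: real
  assumes "0 \<le> x" "0 \<le> y" "1 \<le> r" "0 < c"
  shows "c * x * y powr (r - 1) \<le> y powr r / 2 + c * (2 * c) powr (r - 1) * x powr r"
proof (cases "c * x \<le> y / 2")
  case True
  then have "c * x * y powr (r - 1) \<le> y / 2 * y powr (r - 1)"
    by (intro mult_right_mono) auto
  also have "\<dots> = y powr r / 2"
    using assms by (cases "y = 0") (auto simp: powr_diff)
  finally show ?thesis using assms by (smt (verit) mult_nonneg_nonneg powr_ge_zero)
next
  case False
  have "c * x * y powr (r - 1) \<le> c * x * (2 * c * x) powr (r - 1)"
    using False assms by (intro mult_left_mono powr_mono2) auto
  also have "\<dots> = c * (2 * c) powr (r - 1) * x powr r"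
    using assms by (cases "x = 0") (auto simp: powr_mult powr_diff)
  finally show ?thesis using powr_ge_zero[of y r] by linarith
qed

lemma one_plus_powr_bounds:
  fixes y q :: real
  assumes "0 < q" "q \<le> 1" "0 \<le> y"
  shows "(1 + y) powr q - 1 \<le> y powr q"
    and "1 \<le> y \<Longrightarrow> q * 2 powr (q - 1) * y powr q \<le> (1 + y) powr q - 1"
proof -
  have sub: "(a + b) powr q \<le> a powr q + b powr q" if "0 < a" "0 < b" for a b :: real
  proof -
    have "(a + b) powr q = (a + b) * (a + b) powr (q - 1)"
      using that by (simp add: powr_diff)
    also have "\<dots> = a * (a + b) powr (q - 1) + b * (a + b) powr (q - 1)"
      by (simp add: distrib_right)
    also have "\<dots> \<le> a * a powr (q - 1) + b * b powr (q - 1)"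
      using that assms by (intro add_mono mult_left_mono powr_mono2') auto
    also have "\<dots> = a powr q + b powr q" using that by (simp add: powr_diff)
    finally show ?thesis .
  qed
  show "(1 + y) powr q - 1 \<le> y powr q"
    using sub[of 1 y] assms by (cases "y = 0") auto
  assume y: "1 \<le> y"
  have "q * 2 powr (q - 1) * y powr q = q * y * (2 * y) powr (q - 1)"
    using y by (simp add: powr_mult powr_diff)
  also have "\<dots> \<le> q * y * (1 + y) powr (q - 1)"
    using y assms by (intro mult_left_mono powr_mono2') auto
  also have "\<dots> \<le> (1 + y) powr q - 1"
    using powr_increment_ge[of 1 "1 + y" q] y assms by auto
  finally show "q * 2 powr (q - 1) * y powr q \<le> (1 + y) powr q - 1" .
qed

lemma abs_powr_double: "\<bar>x\<bar> powr (2 * q) = (x\<^sup>2) powr q" for x q :: real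
proof (cases "x = 0")
  case False
  then have "\<bar>x\<bar> powr 2 = x\<^sup>2" by simp
  then show ?thesis by (metis powr_powr)
qed simp

text \<open>\<open>x\<close> stands for the value of the martingale and \<open>n\<close> for the
  number of its nonzero jumps so far. By the step inequality the mean of \<open>U\<close> does not
  increase, so it stays below \<open>U 0 0 = 0\<close>, and the last inequality then bounds the
  moment of \<open>x\<close> by that of \<open>n\<close>. Without any jump the walk is still at 0,
  hence the side condition. For \<open>q <= 1\<close> a multiple of \<open>(1 + n)^q\<close> is
  subtracted to pay for the steps. For \<open>q > 1\<close> a step costs about
  \<open>R^(q-1)\<close> with \<open>R = 1 + n + x^2\<close>, which can far exceed
  \<open>n^(q-1)\<close>, so the subtracted term has to grow with \<open>x\<close> too.\<close>

lemma bellman_upper: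
  fixes q :: real
  assumes q: "q > 1/2"
  obtains U :: "real \<Rightarrow> nat \<Rightarrow> real" and c C where "c > 0" "C \<ge> 0" "U 0 0 = 0"
    "\<And>n. continuous_on UNIV (\<lambda>x. U x n)"
    "\<And>x n a. \<bar>a\<bar> \<le> 1 \<Longrightarrow> (U (x + a) (Suc n) + U (x - a) (Suc n)) / 2 \<le> U x n"
    "\<And>x n. (n = 0 \<Longrightarrow> x = 0) \<Longrightarrow> c * \<bar>x\<bar> powr (2 * q) \<le> U x n + C * real n powr q"
proof -
  obtain c0 C0 where C0: "C0 > 0" and up: "\<And>m x a. 1 \<le> m \<Longrightarrow> \<bar>a\<bar> \<le> 1 \<Longrightarrow>
       ((m + (x + a)\<^sup>2) powr q + (m + (x - a)\<^sup>2) powr q) / 2 - (m + x\<^sup>2) powr q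
        \<le> C0 * a\<^sup>2 * (m + x\<^sup>2) powr (q - 1)"
    using quad_powr_second_difference[OF q] by metis
  have up1: "((m + (x + a)\<^sup>2) powr q + (m + (x - a)\<^sup>2) powr q) / 2 - (m + x\<^sup>2) powr q
        \<le> C0 * (m + x\<^sup>2) powr (q - 1)" if "1 \<le> m" "\<bar>a\<bar> \<le> 1" for m x a
  proof -
    have "C0 * a\<^sup>2 * (m + x\<^sup>2) powr (q - 1) \<le> C0 * 1 * (m + x\<^sup>2) powr (q - 1)"
      using that C0 by (intro mult_right_mono mult_left_mono) (auto simp: abs_square_le_1)
    then show ?thesis using up[OF that, of x] by simp
  qed
  note absp = abs_powr_double[of _ q]
  show ?thesis
  proof (cases "q \<le> 1")
    case True
    \<comment> \<open>A step costs at most \<open>(C0 + q) m^(q-1)\<close>: \<open>C0\<close> for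
      the second difference in \<open>x\<close> and \<open>q\<close> for the larger counter. The
      subtracted term gains at least \<open>q 2^(q-1) m^(q-1)\<close> per unit of \<open>K\<close>;
      \<open>K\<close> is the quotient.\<close>
    define K where "K = (C0 + q) / (q * 2 powr (q - 1))"
    have K: "K > 0" using C0 q by (auto simp: K_def)
    define U where "U = (\<lambda>x (n::nat). (1 + real n + x\<^sup>2) powr q - 1 - K * ((1 + real n) powr q - 1))"
    have step: "(U (x + a) (Suc n) + U (x - a) (Suc n)) / 2 \<le> U x n" if a: "\<bar>a\<bar> \<le> 1" for x n a
    proof -
      define m where "m = 1 + real n"
      have m: "m \<ge> 1" by (simp add: m_def)
      have mx: "m + x\<^sup>2 \<ge> m" by simp
      have 1: "((m + 1 + (x + a)\<^sup>2) powr q + (m + 1 + (x - a)\<^sup>2) powr q) / 2 - (m + 1 + x\<^sup>2) powr q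
          \<le> C0 * m powr (q - 1)"
      proof -
        have "(m + 1 + x\<^sup>2) powr (q - 1) \<le> m powr (q - 1)"
          using m mx True by (intro powr_mono2') auto
        then show ?thesis
          using up1[of "m + 1" a x] a m C0 by (smt (verit) mult_left_mono)
      qed
      have 2: "(m + 1 + x\<^sup>2) powr q - (m + x\<^sup>2) powr q \<le> q * m powr (q - 1)"
      proof -
        have "(m + 1 + x\<^sup>2) powr q - (m + x\<^sup>2) powr q \<le> q * (m + x\<^sup>2) powr (q - 1)"
          using powr_increment_le'[of "m + x\<^sup>2" "m + 1 + x\<^sup>2" q] m mx True q by simp
        also have "\<dots> \<le> q * m powr (q - 1)"
          using m mx True q by (intro mult_left_mono powr_mono2') auto
        finally show ?thesis .
      qed
      have 3: "q * 2 powr (q - 1) * m powr (q - 1) \<le> (m + 1) powr q - m powr q"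
      proof -
        have "q * 2 powr (q - 1) * m powr (q - 1) = q * (2 * m) powr (q - 1)"
          using m by (simp add: powr_mult)
        also have "\<dots> \<le> q * (m + 1) powr (q - 1)"
          using m True q by (intro mult_left_mono powr_mono2') auto
        also have "\<dots> \<le> (m + 1) powr q - m powr q"
          using powr_increment_ge[of m "m + 1" q] m True q by simp
        finally show ?thesis .
      qed
      have "(C0 + q) * m powr (q - 1) = K * (q * 2 powr (q - 1) * m powr (q - 1))"
        using q by (simp add: K_def)
      also have "\<dots> \<le> K * ((m + 1) powr q - m powr q)"
        using 3 K by (intro mult_left_mono) auto
      finally have 4: "(C0 + q) * m powr (q - 1) \<le> K * ((m + 1) powr q - m powr q)" .
      have "U (x + a) (Suc n) = (m + 1 + (x + a)\<^sup>2) powr q - 1 - K * ((m + 1) powr q - 1)"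
        "U (x - a) (Suc n) = (m + 1 + (x - a)\<^sup>2) powr q - 1 - K * ((m + 1) powr q - 1)"
        "U x n = (m + x\<^sup>2) powr q - 1 - K * (m powr q - 1)"
        by (simp_all add: U_def m_def add_ac)
      then show ?thesis using 1 2 4 by (simp add: algebra_simps)
    qed
    have low: "q * 2 powr (q - 1) * \<bar>x\<bar> powr (2 * q) \<le> U x n + K * real n powr q"
      if n: "n = 0 \<Longrightarrow> x = 0" for x n
    proof (cases "n = 0")
      case False
      have "q * 2 powr (q - 1) * \<bar>x\<bar> powr (2 * q) \<le> q * 2 powr (q - 1) * (real n + x\<^sup>2) powr q"
        unfolding absp using q by (intro mult_left_mono powr_mono2) auto
      also have "\<dots> \<le> (1 + (real n + x\<^sup>2)) powr q - 1"
      proof (rule one_plus_powr_bounds(2))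
        have "1 \<le> real n" using False by simp
        then show "1 \<le> real n + x\<^sup>2" by (rule order_trans) simp
      qed (use q True in auto)
      finally have "q * 2 powr (q - 1) * \<bar>x\<bar> powr (2 * q) \<le> (1 + real n + x\<^sup>2) powr q - 1"
        by (simp add: add_ac)
      moreover have "K * ((1 + real n) powr q - 1) \<le> K * real n powr q"
        using one_plus_powr_bounds(1)[of q "real n"] True q K by (intro mult_left_mono) auto
      ultimately show ?thesis unfolding U_def by linarith
    qed (use n in \<open>auto simp: U_def\<close>)
    show ?thesis
    proof (rule that[of "q * 2 powr (q - 1)" K U])
      show "continuous_on UNIV (\<lambda>x. U x n)" for n
        unfolding U_def by (intro continuous_intros) (smt (verit) of_nat_0_le_iff zero_le_power2)
    qed (use step low K q in \<open>auto simp: U_def\<close>)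
  next
    case False
    then have q1: "q \<ge> 1" by simp
    \<comment> \<open>The cost of a step is \<open>(C0 + q) (R + 1)^(q-1)\<close>, and passing from
      \<open>R + 1\<close> to \<open>R\<close> costs another \<open>2^(q-1)\<close>.\<close>
    define b where "b = (C0 + q) * 2 powr (q - 1)"
    have b: "b > 0" using C0 q by (auto simp: b_def)
    define U where "U = (\<lambda>x (n::nat). (1 + real n + x\<^sup>2) powr q - 1 - b * real n * (1 + real n + x\<^sup>2) powr (q - 1))"
    have step: "(U (x + a) (Suc n) + U (x - a) (Suc n)) / 2 \<le> U x n" if a: "\<bar>a\<bar> \<le> 1" for x n a
    proof -
      define m where "m = 1 + real n"
      have m: "m \<ge> 1" by (simp add: m_def)
      define R where "R = m + x\<^sup>2"
      have R: "R \<ge> 1" "R \<ge> m" using m by (auto simp: R_def) (smt (verit) zero_le_power2)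
      have Rp: "(R + 1) powr (q - 1) \<le> 2 powr (q - 1) * R powr (q - 1)"
      proof -
        have "(R + 1) powr (q - 1) \<le> (2 * R) powr (q - 1)" using R q1 by (intro powr_mono2) auto
        then show ?thesis using R by (simp add: powr_mult)
      qed
      have 1: "((m + 1 + (x + a)\<^sup>2) powr q + (m + 1 + (x - a)\<^sup>2) powr q) / 2 - (R + 1) powr q
          \<le> C0 * (R + 1) powr (q - 1)"
        using up1[of "m + 1" a x] a m by (simp add: R_def algebra_simps)
      have 2: "(R + 1) powr q - R powr q \<le> q * (R + 1) powr (q - 1)"
        using powr_increment_le[of R "R + 1" q] R q1 by simp
      have 3: "(C0 + q) * (R + 1) powr (q - 1) \<le> b * R powr (q - 1)"
        using mult_left_mono[OF Rp, of "C0 + q"] C0 q by (simp add: b_def mult_ac)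
      define u where "u = m + 1 + (x + a)\<^sup>2"
      define v where "v = m + 1 + (x - a)\<^sup>2"
      have uv: "u > 0" "v > 0" using m by (auto simp: u_def v_def intro!: add_pos_nonneg)
      \<comment> \<open>the geometric mean of u and v is at least R, as \<open>u v = (R + 1 + a\<^sup>2)\<^sup>2 - 4 a\<^sup>2 x\<^sup>2\<close>\<close>
      have "R\<^sup>2 \<le> u * v"
      proof -
        have "u * v = (R + 1 + a\<^sup>2)\<^sup>2 - 4 * a\<^sup>2 * x\<^sup>2"
          unfolding u_def v_def R_def by (simp add: power2_eq_square algebra_simps)
        also have "\<dots> = R\<^sup>2 + ((1 + a\<^sup>2)\<^sup>2 + 2 * m * (1 + a\<^sup>2) + 2 * x\<^sup>2 * (1 - a\<^sup>2))"
          unfolding R_def by (simp add: power2_eq_square algebra_simps)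
        finally have "u * v = R\<^sup>2 + ((1 + a\<^sup>2)\<^sup>2 + 2 * m * (1 + a\<^sup>2) + 2 * x\<^sup>2 * (1 - a\<^sup>2))" .
        moreover have "0 \<le> (1 + a\<^sup>2)\<^sup>2" "0 \<le> 2 * m * (1 + a\<^sup>2)" "0 \<le> 2 * x\<^sup>2 * (1 - a\<^sup>2)"
          using a m by (auto simp: abs_square_le_1 intro!: mult_nonneg_nonneg)
        ultimately show ?thesis by linarith
      qed
      \<comment> \<open>For \<open>1 < q < 3/2\<close> the function \<open>(m + x^2)^(q-1)\<close>
        is not convex in \<open>x\<close>, so convexity cannot give this midpoint bound. The unit
        added to the counter compensates for that, through the geometric mean.\<close>
      have "R powr (q - 1) \<le> (u powr (q - 1) + v powr (q - 1)) / 2"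
      proof -
        have "R powr (q - 1) = (R\<^sup>2) powr ((q - 1) / 2)"
          using R abs_powr_double[of R "(q - 1) / 2"] by (simp add: diff_divide_distrib)
        also have "\<dots> \<le> (u * v) powr ((q - 1) / 2)"
          using \<open>R\<^sup>2 \<le> u * v\<close> q1 by (intro powr_mono2) auto
        also have "\<dots> = sqrt (u powr (q - 1) * v powr (q - 1))"
          using uv by (simp add: powr_half_sqrt[symmetric] powr_mult powr_powr)
        also have "\<dots> \<le> (u powr (q - 1) + v powr (q - 1)) / 2"
          by (rule arith_geo_mean_sqrt) auto
        finally show ?thesis .
      qed
      then have "b * m * R powr (q - 1) \<le> b * m * ((u powr (q - 1) + v powr (q - 1)) / 2)"
        using b m by (intro mult_left_mono) auto
      moreover have "b * m * R powr (q - 1) = b * R powr (q - 1) + b * real n * R powr (q - 1)"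
        by (simp add: m_def algebra_simps)
      moreover have "U (x + a) (Suc n) = u powr q - 1 - b * m * u powr (q - 1)"
        "U (x - a) (Suc n) = v powr q - 1 - b * m * v powr (q - 1)"
        "U x n = R powr q - 1 - b * real n * R powr (q - 1)"
        by (simp_all add: U_def m_def u_def v_def R_def add_ac)
      ultimately show ?thesis using 1 2 3 unfolding u_def[symmetric] v_def[symmetric]
        by (simp add: algebra_simps)
    qed
    \<comment> \<open>The summand 1 pays for the \<open>- 1\<close> in \<open>U\<close>, which is at
      most \<open>n^q\<close> once \<open>n >= 1\<close>; the rest comes from
      \<open>weighted_powr_le\<close>, whose term \<open>R^q / 2\<close> leaves the factor
      \<open>1/2\<close> of the bound.\<close>
    define C where "C = 1 + b * (2 * b) powr (q - 1)"
    have low: "1/2 * \<bar>x\<bar> powr (2 * q) \<le> U x n + C * real n powr q"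
      if n: "n = 0 \<Longrightarrow> x = 0" for x n
    proof (cases "n = 0")
      case False
      define R where "R = 1 + real n + x\<^sup>2"
      have R: "R \<ge> x\<^sup>2" "R \<ge> 0" by (auto simp: R_def add_nonneg_nonneg)
      have "b * real n * R powr (q - 1) \<le> R powr q / 2 + b * (2 * b) powr (q - 1) * real n powr q"
        using weighted_powr_le[of "real n" R q b] q1 b R by auto
      moreover have "(x\<^sup>2) powr q \<le> R powr q" using R q by (intro powr_mono2) auto
      moreover have "1 \<le> real n powr q" using False q by (intro ge_one_powr_ge_zero) auto
      ultimately show ?thesis unfolding absp U_def C_def R_def[symmetric]
        by (simp add: algebra_simps)
    qed (use n in \<open>auto simp: U_def\<close>)
    show ?thesis
    proof (rule that[of "1/2" C U])
      show "continuous_on UNIV (\<lambda>x. U x n)" for n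
        unfolding U_def by (intro continuous_intros) (smt (verit) of_nat_0_le_iff zero_le_power2)+
    qed (use step low b q in \<open>auto simp: U_def C_def\<close>)
  qed
qed

text \<open>The mirror image of \<open>bellman_upper\<close>: the mean of \<open>U\<close> must not
  decrease, neither at an uncounted jump of any size nor when a jump of size at least \<delta>
  raises the counter. The starting value is arbitrary, so \<open>U x 0 >= 0\<close> is required for
  all \<open>x\<close>. For \<open>q <= 1\<close> a large multiple of a convex function of
  \<open>x\<close> outweighs the term containing \<open>n\<close>; for \<open>q > 1\<close> a
  function quadratic in \<open>x\<close> is enough, and its second difference is exact.\<close>

lemma bellman_lower:
  fixes q \<delta> :: real
  assumes q: "q > 1/2" and \<delta>: "0 < \<delta>"
  obtains U :: "real \<Rightarrow> nat \<Rightarrow> real" and c C where "c > 0" "C \<ge> 0" "\<And>x. U x 0 \<ge> 0"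
    "\<And>n. continuous_on UNIV (\<lambda>x. U x n)"
    "\<And>x n a. \<bar>a\<bar> \<le> 1 \<Longrightarrow> U x n \<le> (U (x + a) n + U (x - a) n) / 2"
    "\<And>x n a. \<bar>a\<bar> \<le> 1 \<Longrightarrow> \<delta> \<le> \<bar>a\<bar> \<Longrightarrow> U x n \<le> (U (x + a) (Suc n) + U (x - a) (Suc n)) / 2"
    "\<And>x n. U x n + c * real n powr q \<le> C * \<bar>x\<bar> powr (2 * q)"
proof -
  note absp = abs_powr_double[of _ q]
  show ?thesis
  proof (cases "q \<le> 1")
    case True
    obtain c0 C0 where c0: "c0 > 0" "C0 > 0"
      and lo: "\<And>m x a. 1 \<le> m \<Longrightarrow> \<bar>a\<bar> \<le> 1 \<Longrightarrow> c0 * a\<^sup>2 * (m + x\<^sup>2) powr (q - 1)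
        \<le> ((m + (x + a)\<^sup>2) powr q + (m + (x - a)\<^sup>2) powr q) / 2 - (m + x\<^sup>2) powr q"
      and up: "\<And>m x a. 1 \<le> m \<Longrightarrow> \<bar>a\<bar> \<le> 1 \<Longrightarrow>
       ((m + (x + a)\<^sup>2) powr q + (m + (x - a)\<^sup>2) powr q) / 2 - (m + x\<^sup>2) powr q
        \<le> C0 * a\<^sup>2 * (m + x\<^sup>2) powr (q - 1)"
      using quad_powr_second_difference[OF q] by metis
    \<comment> \<open>The three summands pay, in this order, for \<open>U x 0 >= 0\<close>, for the
      second difference of the subtracted power, and for a unit increase of the counter, which
      happens only when \<open>a^2 >= \<delta>^2\<close>.\<close>
    define A where "A = 1 + C0 / c0 + q / (c0 * \<delta>\<^sup>2)"
    have A: "A \<ge> 1" "A * c0 \<ge> C0" "A * c0 * \<delta>\<^sup>2 \<ge> C0 * \<delta>\<^sup>2 + q"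
      using c0 \<delta> q by (auto simp: A_def field_simps)
    define U where "U = (\<lambda>x (n::nat). A * ((1 + x\<^sup>2) powr q - 1) - ((1 + real n + x\<^sup>2) powr q - 1))"
    have pm: "(1 + real n + x\<^sup>2) powr (q - 1) \<le> (1 + x\<^sup>2) powr (q - 1)" for n and x :: real
      using True by (intro powr_mono2') (auto simp: add_pos_nonneg)
    have step0: "U x n \<le> (U (x + a) n + U (x - a) n) / 2" if a: "\<bar>a\<bar> \<le> 1" for x n a
    proof -
      have "C0 * a\<^sup>2 * (1 + real n + x\<^sup>2) powr (q - 1) \<le> A * c0 * a\<^sup>2 * (1 + x\<^sup>2) powr (q - 1)"
        using A c0 pm by (intro mult_mono) auto
      also have "\<dots> \<le> A * (((1 + (x + a)\<^sup>2) powr q + (1 + (x - a)\<^sup>2) powr q) / 2 - (1 + x\<^sup>2) powr q)"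
        using mult_left_mono[OF lo[of 1 a x], of A] a A by (simp add: mult_ac)
      finally show ?thesis
        using up[of "1 + real n" a x] a unfolding U_def by (simp add: algebra_simps)
    qed
    have step1: "U x n \<le> (U (x + a) (Suc n) + U (x - a) (Suc n)) / 2" if a: "\<bar>a\<bar> \<le> 1" "\<delta> \<le> \<bar>a\<bar>" for x n a
    proof -
      have d: "\<delta>\<^sup>2 \<le> a\<^sup>2" using a \<delta> by (metis abs_le_square_iff abs_of_pos)
      define P where "P = (1 + x\<^sup>2) powr (q - 1)"
      have P: "P \<ge> 0" by (simp add: P_def)
      have 1: "C0 * a\<^sup>2 * (2 + real n + x\<^sup>2) powr (q - 1) \<le> C0 * a\<^sup>2 * P"
        using pm[of "Suc n" x] c0 unfolding P_def by (intro mult_left_mono) (auto simp: add_ac)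
      have 2: "(2 + real n + x\<^sup>2) powr q - (1 + real n + x\<^sup>2) powr q \<le> q * P"
      proof -
        have "(2 + real n + x\<^sup>2) powr q - (1 + real n + x\<^sup>2) powr q \<le> q * (1 + real n + x\<^sup>2) powr (q - 1)"
          using powr_increment_le'[of "1 + real n + x\<^sup>2" "2 + real n + x\<^sup>2" q] q True
          by (auto simp: add_pos_nonneg)
        also have "\<dots> \<le> q * P" using pm[of n x] q unfolding P_def by (intro mult_left_mono) auto
        finally show ?thesis .
      qed
      have "(C0 * a\<^sup>2 + q) \<le> A * c0 * a\<^sup>2"
      proof -
        have "q / \<delta>\<^sup>2 * a\<^sup>2 \<ge> q" using d \<delta> q by (simp add: field_simps)
        moreover have "A * c0 * a\<^sup>2 = c0 * a\<^sup>2 + C0 * a\<^sup>2 + q / \<delta>\<^sup>2 * a\<^sup>2"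
          using c0 \<delta> by (simp add: A_def field_simps)
        moreover have "0 \<le> c0 * a\<^sup>2" using c0 by simp
        ultimately show ?thesis by linarith
      qed
      then have "(C0 * a\<^sup>2 + q) * P \<le> A * c0 * a\<^sup>2 * P" using P by (rule mult_right_mono)
      also have "\<dots> \<le> A * (((1 + (x + a)\<^sup>2) powr q + (1 + (x - a)\<^sup>2) powr q) / 2 - (1 + x\<^sup>2) powr q)"
        using mult_left_mono[OF lo[of 1 a x], of A] a A by (simp add: mult_ac P_def)
      finally show ?thesis
        using up[of "2 + real n" a x] a 1 2 unfolding U_def by (simp add: algebra_simps)
    qed
    have u0: "U x 0 \<ge> 0" for x
    proof -
      have "1 * ((1 + x\<^sup>2) powr q - 1) \<le> A * ((1 + x\<^sup>2) powr q - 1)"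
        using A q by (intro mult_right_mono) (auto simp: ge_one_powr_ge_zero)
      then show ?thesis by (simp add: U_def)
    qed
    have hi: "U x n + q * 2 powr (q - 1) * real n powr q \<le> A * \<bar>x\<bar> powr (2 * q)" for x n
    proof -
      have 1: "A * ((1 + x\<^sup>2) powr q - 1) \<le> A * (x\<^sup>2) powr q"
        using one_plus_powr_bounds(1)[of q "x\<^sup>2"] True q A by (intro mult_left_mono) auto
      have "q * 2 powr (q - 1) * real n powr q \<le> (1 + real n) powr q - 1"
        using one_plus_powr_bounds(2)[of q "real n"] True q by (cases "n = 0") auto
      also have "\<dots> \<le> (1 + real n + x\<^sup>2) powr q - 1" using q by (auto intro!: powr_mono2)
      finally show ?thesis using 1 by (simp add: U_def absp)
    qed
    show ?thesis
    proof (rule that[of "q * 2 powr (q - 1)" A U])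
      show "continuous_on UNIV (\<lambda>x. U x n)" for n
        unfolding U_def by (intro continuous_intros) (smt (verit) of_nat_0_le_iff zero_le_power2)+
    qed (use step0 step1 u0 hi q A in auto)
  next
    case False
    \<comment> \<open>Chosen so that \<open>k * a^2 >= q\<close> for a counted jump; the gain
      \<open>k a^2 (n+1)^(q-1)\<close> then covers the increment of \<open>n^q\<close>.\<close>
    define k where "k = q / \<delta>\<^sup>2"
    have k: "k > 0" using q \<delta> by (auto simp: k_def)
    define U where "U = (\<lambda>x (n::nat). k * x\<^sup>2 * real n powr (q - 1) - real n powr q)"
    have mid: "(U (x + a) n + U (x - a) n) / 2 = k * (x\<^sup>2 + a\<^sup>2) * real n powr (q - 1) - real n powr q" for x a n
      unfolding U_def by (simp add: power2_eq_square field_simps)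
    have step0: "U x n \<le> (U (x + a) n + U (x - a) n) / 2" for x n a
      unfolding mid unfolding U_def using k by (auto intro!: mult_right_mono mult_left_mono)
    have step1: "U x n \<le> (U (x + a) (Suc n) + U (x - a) (Suc n)) / 2" if a: "\<delta> \<le> \<bar>a\<bar>" for x n a
    proof -
      have d: "\<delta>\<^sup>2 \<le> a\<^sup>2" using a \<delta> by (metis abs_le_square_iff abs_of_pos)
      have "real (Suc n) powr q - real n powr q \<le> q * real (Suc n) powr (q - 1)"
        using powr_increment_le[of "real n" "real (Suc n)" q] False by simp
      also have "\<dots> \<le> (k * a\<^sup>2) * real (Suc n) powr (q - 1)"
        using d \<delta> q by (intro mult_right_mono) (auto simp: k_def field_simps)
      finally have 1: "real (Suc n) powr q - real n powr q \<le> k * a\<^sup>2 * real (Suc n) powr (q - 1)" .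
      have "k * x\<^sup>2 * real n powr (q - 1) \<le> k * x\<^sup>2 * real (Suc n) powr (q - 1)"
        using k False by (intro mult_left_mono powr_mono2) auto
      with 1 show ?thesis unfolding mid unfolding U_def by (simp add: algebra_simps)
    qed
    have hi: "U x n + 1/2 * real n powr q \<le> k * (2 * k) powr (q - 1) * \<bar>x\<bar> powr (2 * q)" for x n
      using weighted_powr_le[of "x\<^sup>2" "real n" q k] False k by (simp add: U_def absp)
    show ?thesis
    proof (rule that[of "1/2" "k * (2 * k) powr (q - 1)" U])
      show "continuous_on UNIV (\<lambda>x. U x n)" for n
        unfolding U_def by (intro continuous_intros)
    qed (use step0 step1 hi k in \<open>auto simp: U_def\<close>)
  qed
qed

section \<open>Martingales with a flip symmetry\<close>

definition count_upto :: "(nat \<Rightarrow> 'b \<Rightarrow> bool) \<Rightarrow> nat \<Rightarrow> 'b \<Rightarrow> nat" where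
  "count_upto e K \<omega> = card {k. k < K \<and> e k \<omega>}"

lemma count_upto_0 [simp]: "count_upto e 0 \<omega> = 0"
  by (simp add: count_upto_def)

lemma count_upto_Suc: "count_upto e (Suc K) \<omega> = count_upto e K \<omega> + (if e K \<omega> then 1 else 0)"
proof -
  have "{k. k < Suc K \<and> e k \<omega>} = (if e K \<omega> then insert K {k. k < K \<and> e k \<omega>} else {k. k < K \<and> e k \<omega>})"
    by (auto simp: less_Suc_eq)
  then show ?thesis by (auto simp: count_upto_def)
qed

lemma count_upto_eq_sum: "real (count_upto e K \<omega>) = (\<Sum>k<K. of_bool (e k \<omega>))"
  by (induction K) (auto simp: count_upto_Suc)

lemma count_upto_le: "count_upto e K \<omega> \<le> K"
  by (induction K) (auto simp: count_upto_Suc)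

lemma count_upto_mono:
  assumes "\<And>k. k < K \<Longrightarrow> e k \<omega> \<Longrightarrow> e' k \<omega>'"
  shows "count_upto e K \<omega> \<le> count_upto e' K \<omega>'"
  unfolding count_upto_def using assms by (intro card_mono) auto

lemma count_upto_cong:
  assumes "\<And>k. k < K \<Longrightarrow> e k \<omega> = e' k \<omega>'"
  shows "count_upto e K \<omega> = count_upto e' K \<omega>'"
  using assms by (intro antisym count_upto_mono) auto

lemma measurable_count_upto [measurable]:
  assumes [measurable]: "\<And>k. Measurable.pred M (e k)"
  shows "count_upto e K \<in> measurable M (count_space UNIV)"
proof (induction K)
  case (Suc K)
  note Suc [measurable]
  have "(\<lambda>\<omega>. count_upto e K \<omega> + (if e K \<omega> then 1 else 0)) \<in> measurable M (count_space UNIV)"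
    by measurable
  then show ?case by (simp add: count_upto_Suc[abs_def])
qed (simp add: count_upto_def[abs_def])

text \<open>A martingale described without a filtration. \<open>T k\<close> preserves the measure,
  reverses the k-th jump and leaves the initial value, the earlier jumps and the events up to
  \<open>k\<close> unchanged; so the k-th jump is symmetric given the past. The event
  \<open>e k\<close> is the one counted at time \<open>k\<close>; it may depend on the size of the
  jump but not on its sign.\<close>

locale flip_martingale = prob_space M for M :: "'b measure" +
  fixes T :: "nat \<Rightarrow> 'b \<Rightarrow> 'b" and X0 :: "'b \<Rightarrow> real" and d :: "nat \<Rightarrow> 'b \<Rightarrow> real"
    and e :: "nat \<Rightarrow> 'b \<Rightarrow> bool"
  assumes T_measurable [measurable]: "\<And>k. T k \<in> measurable M M"
    and T_distr: "\<And>k. distr M M (T k) = M"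
    and X0_measurable [measurable]: "X0 \<in> borel_measurable M"
    and X0_bounded: "\<exists>B. \<forall>\<omega>. \<bar>X0 \<omega>\<bar> \<le> B"
    and d_measurable [measurable]: "\<And>k. d k \<in> borel_measurable M"
    and d_bounded: "\<And>k \<omega>. \<bar>d k \<omega>\<bar> \<le> 1"
    and e_measurable [measurable]: "\<And>k. Measurable.pred M (e k)"
    and X0_flip: "\<And>k \<omega>. X0 (T k \<omega>) = X0 \<omega>"
    and d_flip: "\<And>k \<omega>. d k (T k \<omega>) = - d k \<omega>"
    and d_flip_less: "\<And>j k \<omega>. j < k \<Longrightarrow> d j (T k \<omega>) = d j \<omega>"
    and e_flip: "\<And>j k \<omega>. j \<le> k \<Longrightarrow> e j (T k \<omega>) = e j \<omega>"
begin

definition X :: "nat \<Rightarrow> 'b \<Rightarrow> real" where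
  "X K \<omega> = X0 \<omega> + (\<Sum>k<K. d k \<omega>)"

lemma X_measurable [measurable]: "X K \<in> borel_measurable M"
  unfolding X_def[abs_def] by measurable

lemma X_Suc: "X (Suc K) \<omega> = X K \<omega> + d K \<omega>"
  by (simp add: X_def)

lemma X_flip: "j \<le> k \<Longrightarrow> X j (T k \<omega>) = X j \<omega>"
  unfolding X_def X0_flip by (auto intro!: sum.cong d_flip_less)

lemma count_flip: "j \<le> Suc k \<Longrightarrow> count_upto e j (T k \<omega>) = count_upto e j \<omega>"
  by (intro count_upto_cong e_flip) auto

text \<open>No growth condition on \<open>U\<close> is required: the counter takes only the values
  up to \<open>K\<close>, and each \<open>U\<close> is bounded on a compact interval.\<close>

lemma integrable_bellman:
  fixes U :: "real \<Rightarrow> nat \<Rightarrow> real"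
  assumes U: "\<And>n. continuous_on UNIV (\<lambda>x. U x n)"
    and f [measurable]: "f \<in> borel_measurable M" and f_bd: "\<And>\<omega>. \<bar>f \<omega>\<bar> \<le> B"
  shows "integrable M (\<lambda>\<omega>. U (f \<omega>) (count_upto e K \<omega>))"
proof -
  have "\<exists>b. \<forall>x\<in>{-B..B}. \<bar>U x n\<bar> \<le> b" for n
  proof -
    have "compact ((\<lambda>x. U x n) ` {-B..B})"
      using U by (intro compact_continuous_image) (auto intro: continuous_on_subset)
    then have "bounded ((\<lambda>x. U x n) ` {-B..B})" by (rule compact_imp_bounded)
    then show ?thesis unfolding bounded_iff by auto
  qed
  then obtain b where b: "\<And>n x. x \<in> {-B..B} \<Longrightarrow> \<bar>U x n\<bar> \<le> b n" by metis
  have bd: "\<bar>U (f \<omega>) (count_upto e K \<omega>)\<bar> \<le> (\<Sum>n\<le>K. \<bar>b n\<bar>)" for \<omega>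
  proof -
    have "\<bar>U (f \<omega>) (count_upto e K \<omega>)\<bar> \<le> b (count_upto e K \<omega>)"
      using f_bd[of \<omega>] by (intro b) auto
    also have "\<dots> \<le> \<bar>b (count_upto e K \<omega>)\<bar>" by simp
    also have "\<dots> \<le> (\<Sum>n\<le>K. \<bar>b n\<bar>)"
      using count_upto_le by (intro member_le_sum) auto
    finally show ?thesis .
  qed
  have [measurable]: "(\<lambda>x. U x n) \<in> borel_measurable borel" for n
    using U by (rule borel_measurable_continuous_onI)
  have "(\<lambda>\<omega>. U (f \<omega>) (count_upto e K \<omega>)) \<in> borel_measurable M"
    by (rule measurable_compose_countable[where g="count_upto e K" and f="\<lambda>n \<omega>. U (f \<omega>) n"]) measurable
  then show ?thesis
    using bd by (intro integrable_const_bound[where B="\<Sum>n\<le>K. \<bar>b n\<bar>"]) auto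
qed

lemma X_bounded: "\<exists>B. \<forall>\<omega>. \<bar>X K \<omega>\<bar> \<le> B"
proof -
  obtain B where B: "\<And>\<omega>. \<bar>X0 \<omega>\<bar> \<le> B" using X0_bounded by auto
  have "\<bar>X K \<omega>\<bar> \<le> B + real K" for \<omega>
  proof -
    have "\<bar>X K \<omega>\<bar> \<le> \<bar>X0 \<omega>\<bar> + (\<Sum>k<K. \<bar>d k \<omega>\<bar>)"
      unfolding X_def by (rule order_trans[OF abs_triangle_ineq]) (simp add: sum_abs)
    also have "\<dots> \<le> B + (\<Sum>k<K. 1)" using B d_bounded by (intro add_mono sum_mono) auto
    finally show ?thesis by simp
  qed
  then show ?thesis by blast
qed

text \<open>Averaging over the flip \<open>T k\<close> replaces the conditional expectation given the past.\<close>

lemma bellman_increase: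
  fixes U :: "real \<Rightarrow> nat \<Rightarrow> real"
  assumes U: "\<And>n. continuous_on UNIV (\<lambda>x. U x n)"
    and step: "\<And>k \<omega>. k < K \<Longrightarrow> U (X k \<omega>) (count_upto e k \<omega>)
      \<le> (U (X k \<omega> + d k \<omega>) (count_upto e (Suc k) \<omega>) + U (X k \<omega> - d k \<omega>) (count_upto e (Suc k) \<omega>)) / 2"
  shows "(\<integral>\<omega>. U (X0 \<omega>) 0 \<partial>M) \<le> (\<integral>\<omega>. U (X K \<omega>) (count_upto e K \<omega>) \<partial>M)"
  using step
proof (induction K)
  case 0
  then show ?case by (simp add: X_def)
next
  case (Suc K)
  let ?n = "count_upto e (Suc K)"
  obtain B where B: "\<And>\<omega>. \<bar>X K \<omega>\<bar> \<le> B" using X_bounded by blast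
  have p: "\<bar>X K \<omega> + d K \<omega>\<bar> \<le> B + 1" "\<bar>X K \<omega> - d K \<omega>\<bar> \<le> B + 1" for \<omega>
    using B[of \<omega>] d_bounded[of K \<omega>] by linarith+
  have i0: "integrable M (\<lambda>\<omega>. U (X K \<omega>) (count_upto e K \<omega>))"
    using B by (intro integrable_bellman[OF U]) auto
  have i1: "integrable M (\<lambda>\<omega>. U (X K \<omega> + d K \<omega>) (?n \<omega>))"
    using p by (intro integrable_bellman[OF U]) auto
  have i2: "integrable M (\<lambda>\<omega>. U (X K \<omega> - d K \<omega>) (?n \<omega>))"
    using p by (intro integrable_bellman[OF U]) auto
  \<comment> \<open>\<open>T K\<close> fixes \<open>X K\<close> and the counter, including the event
    \<open>e K\<close>, and changes the sign of \<open>d K\<close>. The two halves of the average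
    therefore have the same integral.\<close>
  have "(\<integral>\<omega>. U (X K \<omega> + d K \<omega>) (?n \<omega>) \<partial>M) = (\<integral>\<omega>. U (X K \<omega> + d K \<omega>) (?n \<omega>) \<partial>distr M M (T K))"
    by (simp add: T_distr)
  also have "\<dots> = (\<integral>\<omega>. U (X K (T K \<omega>) + d K (T K \<omega>)) (?n (T K \<omega>)) \<partial>M)"
    using i1 by (intro integral_distr) auto
  also have "\<dots> = (\<integral>\<omega>. U (X K \<omega> - d K \<omega>) (?n \<omega>) \<partial>M)"
    by (simp add: X_flip d_flip count_flip)
  finally have eq: "(\<integral>\<omega>. U (X K \<omega> + d K \<omega>) (?n \<omega>) \<partial>M) = (\<integral>\<omega>. U (X K \<omega> - d K \<omega>) (?n \<omega>) \<partial>M)" .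
  have "(\<integral>\<omega>. U (X0 \<omega>) 0 \<partial>M) \<le> (\<integral>\<omega>. U (X K \<omega>) (count_upto e K \<omega>) \<partial>M)"
    using Suc by auto
  also have "\<dots> \<le> (\<integral>\<omega>. (U (X K \<omega> + d K \<omega>) (?n \<omega>) + U (X K \<omega> - d K \<omega>) (?n \<omega>)) / 2 \<partial>M)"
    using i0 i1 i2 Suc.prems[of K] by (intro integral_mono) auto
  also have "\<dots> = (\<integral>\<omega>. U (X K \<omega> + d K \<omega>) (?n \<omega>) \<partial>M)"
    using i1 i2 eq by simp
  finally show ?case by (simp add: X_Suc)
qed

lemma integrable_powr:
  "0 \<le> r \<Longrightarrow> integrable M (\<lambda>\<omega>. real (count_upto e K \<omega>) powr r)"
  "0 < r \<Longrightarrow> integrable M (\<lambda>\<omega>. \<bar>X K \<omega>\<bar> powr r)"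
proof -
  show "integrable M (\<lambda>\<omega>. real (count_upto e K \<omega>) powr r)"
    by (rule integrable_bellman[where f="\<lambda>_. 0" and B=0 and U="\<lambda>x n. real n powr r"]) auto
  obtain B where "\<And>\<omega>. \<bar>X K \<omega>\<bar> \<le> B" using X_bounded by blast
  then show "integrable M (\<lambda>\<omega>. \<bar>X K \<omega>\<bar> powr r)" if "0 < r"
    using that by (intro integrable_bellman[where U="\<lambda>x n. \<bar>x\<bar> powr r"] continuous_on_powr' continuous_intros) auto
qed

end

section \<open>Moments of a martingale against moments of its number of jumps\<close>

text \<open>\<open>bellman_increase\<close> is applied to \<open>- U\<close>; where the event fails
  the jump is zero and neither the martingale nor the counter moves. The constant depends on
  \<open>q\<close> alone, not on the measure, the flips or \<open>K\<close>, so that it can be used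
  for all translates of the grid at once.\<close>

lemma square_function_upper:
  fixes q :: real
  assumes q: "q > 1/2"
  obtains C where "C \<ge> 0"
    "\<And>(M :: 'b measure) T d e K. flip_martingale M T (\<lambda>_. 0) d e \<Longrightarrow> (\<And>k \<omega>. \<not> e k \<omega> \<Longrightarrow> d k \<omega> = 0) \<Longrightarrow>
       (\<integral>\<^sup>+\<omega>. ennreal (\<bar>\<Sum>k<K. d k \<omega>\<bar> powr (2 * q)) \<partial>M)
        \<le> ennreal C * (\<integral>\<^sup>+\<omega>. ennreal (real (count_upto e K \<omega>) powr q) \<partial>M)"
proof -
  obtain U :: "real \<Rightarrow> nat \<Rightarrow> real" and c C where cC: "c > 0" "C \<ge> 0" and U0: "U 0 0 = 0"
    and cont: "\<And>n. continuous_on UNIV (\<lambda>x. U x n)"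
    and step: "\<And>x n a. \<bar>a\<bar> \<le> 1 \<Longrightarrow> (U (x + a) (Suc n) + U (x - a) (Suc n)) / 2 \<le> U x n"
    and low: "\<And>x n. (n = 0 \<Longrightarrow> x = 0) \<Longrightarrow> c * \<bar>x\<bar> powr (2 * q) \<le> U x n + C * real n powr q"
    using bellman_upper[OF q] by metis
  have "(\<integral>\<^sup>+\<omega>. ennreal (\<bar>\<Sum>k<K. d k \<omega>\<bar> powr (2 * q)) \<partial>M)
        \<le> ennreal (C / c) * (\<integral>\<^sup>+\<omega>. ennreal (real (count_upto e K \<omega>) powr q) \<partial>M)"
    if fm: "flip_martingale M T (\<lambda>_. 0) d e" and de: "\<And>k \<omega>. \<not> e k \<omega> \<Longrightarrow> d k \<omega> = 0"
    for M :: "'b measure" and T d e K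
  proof -
    interpret flip_martingale M T "\<lambda>_. 0" d e by (rule fm)
    have X: "X K \<omega> = (\<Sum>k<K. d k \<omega>)" for K \<omega> by (simp add: X_def)
    have "(\<integral>\<omega>. - U 0 0 \<partial>M) \<le> (\<integral>\<omega>. - U (X K \<omega>) (count_upto e K \<omega>) \<partial>M)"
    proof (rule bellman_increase)
      show "continuous_on UNIV (\<lambda>x. - U x n)" for n by (intro continuous_intros cont)
      show "- U (X k \<omega>) (count_upto e k \<omega>) \<le> (- U (X k \<omega> + d k \<omega>) (count_upto e (Suc k) \<omega>)
          + - U (X k \<omega> - d k \<omega>) (count_upto e (Suc k) \<omega>)) / 2" for k \<omega>
        using step[OF d_bounded[of k \<omega>], of "X k \<omega>" "count_upto e k \<omega>"] de[of k \<omega>]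
        by (cases "e k \<omega>") (auto simp: count_upto_Suc)
    qed
    then have U_le: "(\<integral>\<omega>. U (X K \<omega>) (count_upto e K \<omega>) \<partial>M) \<le> 0" by (simp add: U0)
    obtain B where B: "\<And>\<omega>. \<bar>X K \<omega>\<bar> \<le> B" using X_bounded by blast
    have iU: "integrable M (\<lambda>\<omega>. U (X K \<omega>) (count_upto e K \<omega>))"
      using B by (intro integrable_bellman[OF cont]) auto
    have "c * (\<integral>\<omega>. \<bar>X K \<omega>\<bar> powr (2 * q) \<partial>M) = (\<integral>\<omega>. c * \<bar>X K \<omega>\<bar> powr (2 * q) \<partial>M)" by simp
    also have "\<dots> \<le> (\<integral>\<omega>. U (X K \<omega>) (count_upto e K \<omega>) + C * real (count_upto e K \<omega>) powr q \<partial>M)"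
    proof (rule integral_mono)
      fix \<omega>
      show "c * \<bar>X K \<omega>\<bar> powr (2 * q) \<le> U (X K \<omega>) (count_upto e K \<omega>) + C * real (count_upto e K \<omega>) powr q"
      proof (rule low)
        assume "count_upto e K \<omega> = 0"
        then have "\<And>k. k < K \<Longrightarrow> \<not> e k \<omega>" by (auto simp: count_upto_def)
        then show "X K \<omega> = 0" using de by (simp add: X)
      qed
    qed (use q iU integrable_powr[of q] integrable_powr[of "2 * q"] in auto)
    also have "\<dots> \<le> C * (\<integral>\<omega>. real (count_upto e K \<omega>) powr q \<partial>M)"
      using iU integrable_powr(1)[of q K] U_le q by simp
    finally have "(\<integral>\<omega>. \<bar>X K \<omega>\<bar> powr (2 * q) \<partial>M) \<le> C / c * (\<integral>\<omega>. real (count_upto e K \<omega>) powr q \<partial>M)"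
      using cC by (simp add: field_simps)
    then show ?thesis
      using cC q unfolding X[symmetric]
      by (simp add: nn_integral_eq_integral integrable_powr ennreal_mult[symmetric])
  qed
  then show ?thesis using that[of "C / c"] cC by auto
qed

text \<open>Here the initial value need not vanish and small uncounted jumps are allowed; only the
  counted jumps have a lower bound. Uniformity of the constant in \<open>X0\<close> and
  \<open>K\<close> permits integration over lines and the limit of infinitely many scales.\<close>

lemma square_function_lower:
  fixes q \<delta> :: real
  assumes q: "q > 1/2" and \<delta>: "\<delta> > 0"
  obtains C where "C \<ge> 0"
    "\<And>(M :: 'b measure) T X0 d e K. flip_martingale M T X0 d e \<Longrightarrow> (\<And>k \<omega>. e k \<omega> \<Longrightarrow> \<delta> \<le> \<bar>d k \<omega>\<bar>) \<Longrightarrow>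
       (\<integral>\<^sup>+\<omega>. ennreal (real (count_upto e K \<omega>) powr q) \<partial>M)
        \<le> ennreal C * (\<integral>\<^sup>+\<omega>. ennreal (\<bar>X0 \<omega> + (\<Sum>k<K. d k \<omega>)\<bar> powr (2 * q)) \<partial>M)"
proof -
  obtain U :: "real \<Rightarrow> nat \<Rightarrow> real" and c C where cC: "c > 0" "C \<ge> 0" and U0: "\<And>x. U x 0 \<ge> 0"
    and cont: "\<And>n. continuous_on UNIV (\<lambda>x. U x n)"
    and step0: "\<And>x n a. \<bar>a\<bar> \<le> 1 \<Longrightarrow> U x n \<le> (U (x + a) n + U (x - a) n) / 2"
    and step1: "\<And>x n a. \<bar>a\<bar> \<le> 1 \<Longrightarrow> \<delta> \<le> \<bar>a\<bar> \<Longrightarrow> U x n \<le> (U (x + a) (Suc n) + U (x - a) (Suc n)) / 2"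
    and hi: "\<And>x n. U x n + c * real n powr q \<le> C * \<bar>x\<bar> powr (2 * q)"
    using bellman_lower[OF q \<delta>] by metis
  have "(\<integral>\<^sup>+\<omega>. ennreal (real (count_upto e K \<omega>) powr q) \<partial>M)
        \<le> ennreal (C / c) * (\<integral>\<^sup>+\<omega>. ennreal (\<bar>X0 \<omega> + (\<Sum>k<K. d k \<omega>)\<bar> powr (2 * q)) \<partial>M)"
    if fm: "flip_martingale M T X0 d e" and de: "\<And>k \<omega>. e k \<omega> \<Longrightarrow> \<delta> \<le> \<bar>d k \<omega>\<bar>"
    for M :: "'b measure" and T X0 d e K
  proof -
    interpret flip_martingale M T X0 d e by (rule fm)
    have "(\<integral>\<omega>. U (X0 \<omega>) 0 \<partial>M) \<le> (\<integral>\<omega>. U (X K \<omega>) (count_upto e K \<omega>) \<partial>M)"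
    proof (rule bellman_increase[OF cont])
      show "U (X k \<omega>) (count_upto e k \<omega>) \<le> (U (X k \<omega> + d k \<omega>) (count_upto e (Suc k) \<omega>)
          + U (X k \<omega> - d k \<omega>) (count_upto e (Suc k) \<omega>)) / 2" for k \<omega>
        using step0[OF d_bounded[of k \<omega>], of "X k \<omega>" "count_upto e k \<omega>"]
          step1[OF d_bounded[of k \<omega>], of "X k \<omega>" "count_upto e k \<omega>"] de[of k \<omega>]
        by (cases "e k \<omega>") (auto simp: count_upto_Suc)
    qed
    moreover have "0 \<le> (\<integral>\<omega>. U (X0 \<omega>) 0 \<partial>M)" using U0 by simp
    ultimately have U_ge: "0 \<le> (\<integral>\<omega>. U (X K \<omega>) (count_upto e K \<omega>) \<partial>M)" by simp
    obtain B where B: "\<And>\<omega>. \<bar>X K \<omega>\<bar> \<le> B" using X_bounded by blast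
    have iU: "integrable M (\<lambda>\<omega>. U (X K \<omega>) (count_upto e K \<omega>))"
      using B by (intro integrable_bellman[OF cont]) auto
    have "c * (\<integral>\<omega>. real (count_upto e K \<omega>) powr q \<partial>M)
        \<le> (\<integral>\<omega>. U (X K \<omega>) (count_upto e K \<omega>) + c * real (count_upto e K \<omega>) powr q \<partial>M)"
      using iU integrable_powr(1)[of q K] U_ge q by simp
    also have "\<dots> \<le> (\<integral>\<omega>. C * \<bar>X K \<omega>\<bar> powr (2 * q) \<partial>M)"
      using hi q iU integrable_powr[of q] integrable_powr[of "2 * q"] by (intro integral_mono) auto
    also have "\<dots> = C * (\<integral>\<omega>. \<bar>X K \<omega>\<bar> powr (2 * q) \<partial>M)" by simp
    finally have "(\<integral>\<omega>. real (count_upto e K \<omega>) powr q \<partial>M) \<le> C / c * (\<integral>\<omega>. \<bar>X K \<omega>\<bar> powr (2 * q) \<partial>M)"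
      using cC by (simp add: field_simps)
    then show ?thesis
      using cC q unfolding X_def[symmetric]
      by (simp add: nn_integral_eq_integral integrable_powr ennreal_mult[symmetric])
  qed
  then show ?thesis using that[of "C / c"] cC by auto
qed

section \<open>Thinning: keeping a fixed proportion of the events\<close>

lemma ennreal_absorb_half:
  fixes a b :: ennreal
  assumes "a \<le> a / 2 + b" "a < \<infinity>"
  shows "a \<le> 2 * b"
proof (cases b)
  case (real r)
  obtain s where s: "a = ennreal s" "s \<ge> 0" using assms(2) by (cases a) auto
  have "ennreal s \<le> ennreal (s / 2 + r)"
    using assms(1) real s by (simp add: ennreal_plus divide_ennreal[symmetric])
  then have "s \<le> s / 2 + r" using s real by (subst (asm) ennreal_le_iff) auto
  then have "s \<le> 2 * r" by simp
  then show ?thesis using s real by (simp add: ennreal_mult[symmetric] flip: ennreal_numeral)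
qed (auto simp: ennreal_mult_top)

lemma sum_of_bool_ennreal:
  assumes "\<And>k. 0 \<le> f k"
  shows "(\<Sum>k\<in>A. of_bool (P k) * ennreal (f k)) = ennreal (\<Sum>k\<in>A. of_bool (P k) * f k)"
proof -
  have "(\<Sum>k\<in>A. of_bool (P k) * ennreal (f k)) = (\<Sum>k\<in>A. ennreal (of_bool (P k) * f k))"
    by (intro sum.cong) (auto simp: of_bool_def)
  also have "\<dots> = ennreal (\<Sum>k\<in>A. of_bool (P k) * f k)"
    using assms by (intro sum_ennreal) auto
  finally show ?thesis .
qed

text \<open>The last hypothesis says that an event of \<open>e\<close> is kept in \<open>e'\<close>
  with probability at least \<open>1 / c0\<close> even when the current value of the counter is
  known. A discrete chain rule writes \<open>N^q\<close> as a sum over events of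
  \<open>N^(q-1)\<close>, which is a function of the counter, so \<open>e\<close> may be replaced by
  \<open>e'\<close> in each term. For \<open>q <= 1\<close> the result telescopes to a power of
  \<open>N'\<close>; for \<open>q > 1\<close> it is at most a multiple of \<open>N' N^(q-1)\<close>,
  and Young's inequality allows the part with \<open>N^q\<close> to be absorbed.\<close>

lemma count_powr_dominated:
  fixes q c0 :: real
  assumes q: "q > 0" and c0: "c0 > 0"
  obtains C where "C \<ge> 0"
    "\<And>(M :: 'b measure) e e' K. finite_measure M \<Longrightarrow> (\<And>k. Measurable.pred M (e k)) \<Longrightarrow>
       (\<And>k. Measurable.pred M (e' k)) \<Longrightarrow> (\<And>k \<omega>. e' k \<omega> \<Longrightarrow> e k \<omega>) \<Longrightarrow>
       (\<And>k h. (\<integral>\<^sup>+\<omega>. of_bool (e k \<omega>) * h (count_upto e (Suc k) \<omega>) \<partial>M)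
          \<le> ennreal c0 * (\<integral>\<^sup>+\<omega>. of_bool (e' k \<omega>) * h (count_upto e (Suc k) \<omega>) \<partial>M)) \<Longrightarrow>
       (\<integral>\<^sup>+\<omega>. ennreal (real (count_upto e K \<omega>) powr q) \<partial>M)
        \<le> ennreal C * (\<integral>\<^sup>+\<omega>. ennreal (real (count_upto e' K \<omega>) powr q) \<partial>M)"
proof -
  define A where "A = max 1 q * c0"
  have A: "A > 0" using c0 by (auto simp: A_def)
  define C where "C = max (A / q) (2 * (A * (2 * A) powr (q - 1)))"
  have C: "C \<ge> 0" using A q by (auto simp: C_def le_max_iff_disj)
  have "(\<integral>\<^sup>+\<omega>. ennreal (real (count_upto e K \<omega>) powr q) \<partial>M)
        \<le> ennreal C * (\<integral>\<^sup>+\<omega>. ennreal (real (count_upto e' K \<omega>) powr q) \<partial>M)"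
    if "finite_measure M" and [measurable]: "\<And>k. Measurable.pred M (e k)" "\<And>k. Measurable.pred M (e' k)"
      and sub: "\<And>k \<omega>. e' k \<omega> \<Longrightarrow> e k \<omega>"
      and dom: "\<And>k h. (\<integral>\<^sup>+\<omega>. of_bool (e k \<omega>) * h (count_upto e (Suc k) \<omega>) \<partial>M)
          \<le> ennreal c0 * (\<integral>\<^sup>+\<omega>. of_bool (e' k \<omega>) * h (count_upto e (Suc k) \<omega>) \<partial>M)"
    for M :: "'b measure" and e e' K
  proof -
    interpret finite_measure M by fact
    let ?N = "count_upto e" and ?N' = "count_upto e'"
    let ?h = "\<lambda>n. ennreal (max 1 q * real n powr (q - 1))"
    \<comment> \<open>The discrete chain rule. The factor \<open>max 1 q\<close> serves both cases:
      \<open>q\<close> is the derivative bound for \<open>q >= 1\<close>, and 1 is needed for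
      \<open>q < 1\<close> because the very first event raises \<open>N^q\<close> from 0 to
      1.\<close>
    have N_le: "real (?N K \<omega>) powr q \<le> (\<Sum>k<K. of_bool (e k \<omega>) * (max 1 q * real (?N (Suc k) \<omega>) powr (q - 1)))" for \<omega>
    proof (induction K)
      case (Suc K)
      have "real (?N (Suc K) \<omega>) powr q - real (?N K \<omega>) powr q
         \<le> of_bool (e K \<omega>) * (max 1 q * real (?N (Suc K) \<omega>) powr (q - 1))"
      proof (cases "e K \<omega>")
        case True
        define n where "n = real (?N K \<omega>)"
        have n: "n \<ge> 0" "real (?N (Suc K) \<omega>) = n + 1" using True by (auto simp: n_def count_upto_Suc)
        have "(n + 1) powr q - n powr q \<le> max 1 q * (n + 1) powr (q - 1)"
        proof (cases "q \<ge> 1")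
          case True
          then show ?thesis using powr_increment_le[of n "n + 1" q] n by auto
        next
          case False
          have "n * (n + 1) powr (q - 1) \<le> n powr q"
          proof (cases "n = 0")
            case False
            then have "n * (n + 1) powr (q - 1) \<le> n * n powr (q - 1)"
              using n \<open>\<not> q \<ge> 1\<close> by (intro mult_left_mono powr_mono2') auto
            then show ?thesis using n False by (simp add: powr_diff)
          qed auto
          moreover have "(n + 1) powr q = n * (n + 1) powr (q - 1) + (n + 1) powr (q - 1)"
          proof -
            have "(n + 1) powr q = (n + 1) * (n + 1) powr (q - 1)" using n by (simp add: powr_diff)
            then show ?thesis by (simp add: distrib_right)
          qed
          ultimately show ?thesis using False by simp
        qed
        then show ?thesis using True n by (simp add: n_def)
      qed (simp add: count_upto_Suc)
      then show ?case using Suc by simp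
    qed simp
    have "(\<integral>\<^sup>+\<omega>. ennreal (real (?N K \<omega>) powr q) \<partial>M)
       \<le> (\<integral>\<^sup>+\<omega>. (\<Sum>k<K. of_bool (e k \<omega>) * ?h (?N (Suc k) \<omega>)) \<partial>M)"
    proof (rule nn_integral_mono)
      fix \<omega>
      have "(\<Sum>k<K. of_bool (e k \<omega>) * ?h (?N (Suc k) \<omega>)) =
         ennreal (\<Sum>k<K. of_bool (e k \<omega>) * (max 1 q * real (?N (Suc k) \<omega>) powr (q - 1)))"
        using q by (intro sum_of_bool_ennreal) auto
      then show "ennreal (real (?N K \<omega>) powr q) \<le> (\<Sum>k<K. of_bool (e k \<omega>) * ?h (?N (Suc k) \<omega>))"
        using N_le[of \<omega>] by (simp add: ennreal_leI)
    qed
    also have "\<dots> = (\<Sum>k<K. \<integral>\<^sup>+\<omega>. of_bool (e k \<omega>) * ?h (?N (Suc k) \<omega>) \<partial>M)"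
      by (intro nn_integral_sum) measurable
    also have "\<dots> \<le> (\<Sum>k<K. ennreal c0 * (\<integral>\<^sup>+\<omega>. of_bool (e' k \<omega>) * ?h (?N (Suc k) \<omega>) \<partial>M))"
      by (intro sum_mono dom)
    also have "\<dots> = (\<integral>\<^sup>+\<omega>. ennreal c0 * (\<Sum>k<K. of_bool (e' k \<omega>) * ?h (?N (Suc k) \<omega>)) \<partial>M)"
      by (subst nn_integral_cmult, measurable, subst nn_integral_sum, measurable)
         (simp add: sum_distrib_left)
    also have "\<dots> = (\<integral>\<^sup>+\<omega>. ennreal (A * (\<Sum>k<K. of_bool (e' k \<omega>) * real (?N (Suc k) \<omega>) powr (q - 1))) \<partial>M)"
    proof (rule nn_integral_cong)
      fix \<omega>
      have "(\<Sum>k<K. of_bool (e' k \<omega>) * ?h (?N (Suc k) \<omega>)) =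
         ennreal (\<Sum>k<K. of_bool (e' k \<omega>) * (max 1 q * real (?N (Suc k) \<omega>) powr (q - 1)))"
        using q by (intro sum_of_bool_ennreal) auto
      also have "ennreal c0 * \<dots> = ennreal (c0 * (\<Sum>k<K. of_bool (e' k \<omega>) * (max 1 q * real (?N (Suc k) \<omega>) powr (q - 1))))"
        using c0 by (intro ennreal_mult[symmetric] sum_nonneg) auto
      also have "c0 * (\<Sum>k<K. of_bool (e' k \<omega>) * (max 1 q * real (?N (Suc k) \<omega>) powr (q - 1)))
          = A * (\<Sum>k<K. of_bool (e' k \<omega>) * real (?N (Suc k) \<omega>) powr (q - 1))"
        unfolding A_def sum_distrib_left by (intro sum.cong) (auto simp only: mult_ac)
      finally show "ennreal c0 * (\<Sum>k<K. of_bool (e' k \<omega>) * ?h (?N (Suc k) \<omega>)) =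
          ennreal (A * (\<Sum>k<K. of_bool (e' k \<omega>) * real (?N (Suc k) \<omega>) powr (q - 1)))" .
    qed
    finally have main: "(\<integral>\<^sup>+\<omega>. ennreal (real (?N K \<omega>) powr q) \<partial>M) \<le>
       (\<integral>\<^sup>+\<omega>. ennreal (A * (\<Sum>k<K. of_bool (e' k \<omega>) * real (?N (Suc k) \<omega>) powr (q - 1))) \<partial>M)" .
    show ?thesis
    proof (cases "q \<le> 1")
      case True
      have "(\<Sum>k<K. of_bool (e' k \<omega>) * real (?N (Suc k) \<omega>) powr (q - 1)) \<le> real (?N' K \<omega>) powr q / q" for \<omega>
      proof (induction K)
        case (Suc K)
        have "of_bool (e' K \<omega>) * real (?N (Suc K) \<omega>) powr (q - 1) \<le> (real (?N' (Suc K) \<omega>) powr q - real (?N' K \<omega>) powr q) / q"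
        proof (cases "e' K \<omega>")
          case e': True
          define n where "n = real (?N' K \<omega>)"
          have n: "n \<ge> 0" "real (?N' (Suc K) \<omega>) = n + 1" using e' by (auto simp: n_def count_upto_Suc)
          \<comment> \<open>\<open>e'\<close> implies \<open>e\<close>, so \<open>N >= N'\<close>;
            since the exponent \<open>q - 1\<close> is not positive, the larger counter may be
            replaced by the smaller one.\<close>
          have "n + 1 \<le> real (?N (Suc K) \<omega>)"
            unfolding n(2)[symmetric] of_nat_le_iff using sub by (intro count_upto_mono) auto
          then have "real (?N (Suc K) \<omega>) powr (q - 1) \<le> (n + 1) powr (q - 1)"
            using True n by (intro powr_mono2') auto
          also have "\<dots> \<le> ((n + 1) powr q - n powr q) / q"
            using powr_increment_ge[of n "n + 1" q] n True q by (simp add: field_simps)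
          finally show ?thesis using e' n by (simp add: n_def)
        qed (simp add: count_upto_Suc)
        then show ?case using Suc by (simp add: diff_divide_distrib)
      qed simp
      then have "A * (\<Sum>k<K. of_bool (e' k \<omega>) * real (?N (Suc k) \<omega>) powr (q - 1)) \<le> C * real (?N' K \<omega>) powr q" for \<omega>
      proof -
        have "A * (\<Sum>k<K. of_bool (e' k \<omega>) * real (?N (Suc k) \<omega>) powr (q - 1)) \<le> A * (real (?N' K \<omega>) powr q / q)"
          using \<open>\<And>\<omega>. _ \<le> real (?N' K \<omega>) powr q / q\<close>[of \<omega>] A by (intro mult_left_mono) auto
        also have "\<dots> \<le> C * real (?N' K \<omega>) powr q"
          using mult_right_mono[of "A / q" C "real (?N' K \<omega>) powr q"] by (simp add: C_def)
        finally show ?thesis .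
      qed
      then have "(\<integral>\<^sup>+\<omega>. ennreal (real (?N K \<omega>) powr q) \<partial>M) \<le> (\<integral>\<^sup>+\<omega>. ennreal (C * real (?N' K \<omega>) powr q) \<partial>M)"
        by (intro order_trans[OF main] nn_integral_mono ennreal_leI)
      then show ?thesis using C by (simp add: ennreal_mult nn_integral_cmult)
    next
      case False
      define C' where "C' = A * (2 * A) powr (q - 1)"
      have C': "C' \<ge> 0" "2 * C' \<le> C" using A by (auto simp: C'_def C_def)
      have "A * (\<Sum>k<K. of_bool (e' k \<omega>) * real (?N (Suc k) \<omega>) powr (q - 1))
         \<le> real (?N K \<omega>) powr q / 2 + C' * real (?N' K \<omega>) powr q" for \<omega>
      proof -
        have "(\<Sum>k<K. of_bool (e' k \<omega>) * real (?N (Suc k) \<omega>) powr (q - 1))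
           \<le> (\<Sum>k<K. of_bool (e' k \<omega>) * real (?N K \<omega>) powr (q - 1))"
        proof (intro sum_mono mult_left_mono powr_mono2)
          fix k assume "k \<in> {..<K}"
          then show "real (?N (Suc k) \<omega>) \<le> real (?N K \<omega>)"
            unfolding count_upto_def of_nat_le_iff by (intro card_mono) auto
        qed (use False in auto)
        also have "\<dots> = real (?N' K \<omega>) * real (?N K \<omega>) powr (q - 1)"
          by (simp add: count_upto_eq_sum sum_distrib_right)
        finally have "A * (\<Sum>k<K. of_bool (e' k \<omega>) * real (?N (Suc k) \<omega>) powr (q - 1))
           \<le> A * (real (?N' K \<omega>) * real (?N K \<omega>) powr (q - 1))"
          using A by (intro mult_left_mono) auto
        also have "\<dots> \<le> real (?N K \<omega>) powr q / 2 + C' * real (?N' K \<omega>) powr q"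
          using weighted_powr_le[of "real (?N' K \<omega>)" "real (?N K \<omega>)" q A] A False
          by (simp add: C'_def mult_ac)
        finally show ?thesis .
      qed
      then have "(\<integral>\<^sup>+\<omega>. ennreal (real (?N K \<omega>) powr q) \<partial>M)
         \<le> (\<integral>\<^sup>+\<omega>. ennreal (real (?N K \<omega>) powr q / 2 + C' * real (?N' K \<omega>) powr q) \<partial>M)"
        by (intro order_trans[OF main] nn_integral_mono ennreal_leI)
      also have "\<dots> = (\<integral>\<^sup>+\<omega>. ennreal (real (?N K \<omega>) powr q) / 2 + ennreal C' * ennreal (real (?N' K \<omega>) powr q) \<partial>M)"
        using C' by (intro nn_integral_cong) (simp add: ennreal_plus ennreal_mult divide_ennreal[symmetric])
      also have "\<dots> = (\<integral>\<^sup>+\<omega>. ennreal (real (?N K \<omega>) powr q) \<partial>M) / 2 + ennreal C' * (\<integral>\<^sup>+\<omega>. ennreal (real (?N' K \<omega>) powr q) \<partial>M)"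
        by (subst nn_integral_add) (auto simp: nn_integral_cmult nn_integral_divide)
      finally have "(\<integral>\<^sup>+\<omega>. ennreal (real (?N K \<omega>) powr q) \<partial>M) \<le> 2 * (ennreal C' * (\<integral>\<^sup>+\<omega>. ennreal (real (?N' K \<omega>) powr q) \<partial>M))"
      \<comment> \<open>The absorption is legitimate because the moment is finite: the counter never
        exceeds \<open>K\<close> and the measure is finite.\<close>
      proof (rule ennreal_absorb_half)
        have "(\<integral>\<^sup>+\<omega>. ennreal (real (?N K \<omega>) powr q) \<partial>M) \<le> (\<integral>\<^sup>+\<omega>. ennreal (real K powr q) \<partial>M)"
          using q by (intro nn_integral_mono ennreal_leI powr_mono2) (auto simp: count_upto_le)
        also have "\<dots> < \<infinity>" by (simp add: ennreal_mult_eq_top_iff less_top[symmetric])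
        finally show "(\<integral>\<^sup>+\<omega>. ennreal (real (?N K \<omega>) powr q) \<partial>M) < \<infinity>" .
      qed
      also have "\<dots> = ennreal (2 * C') * (\<integral>\<^sup>+\<omega>. ennreal (real (?N' K \<omega>) powr q) \<partial>M)"
        using C' by (simp add: ennreal_mult mult.assoc)
      also have "\<dots> \<le> ennreal C * (\<integral>\<^sup>+\<omega>. ennreal (real (?N' K \<omega>) powr q) \<partial>M)"
        using C' by (intro mult_right_mono ennreal_leI) auto
      finally show ?thesis .
    qed
  qed
  then show ?thesis using that[OF C] by blast
qed

section \<open>Dyadic cells of the unit cube\<close>

definition unit_cube :: "'a::euclidean_space set" where
  "unit_cube = {u. \<forall>b\<in>Basis. 0 \<le> u \<bullet> b \<and> u \<bullet> b < 1}"

text \<open>The integer label of the half-open dyadic cell of side \<open>1 / 2 ^ k\<close>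
  containing \<open>u\<close>, rather than the cell itself. Labels exist on the whole space;
  \<open>cell_pos\<close> is the position inside the cell rescaled to the unit cube, and
  \<open>cell_flip i k\<close> exchanges by translation the two halves of each cell in direction
  \<open>i\<close>.\<close>

definition cell :: "nat \<Rightarrow> 'a::euclidean_space \<Rightarrow> 'a" where
  "cell k u = (\<Sum>b\<in>Basis. of_int \<lfloor>2 ^ k * (u \<bullet> b)\<rfloor> *\<^sub>R b)"

definition cell_pos :: "nat \<Rightarrow> 'a::euclidean_space \<Rightarrow> 'a" where
  "cell_pos k u = 2 ^ k *\<^sub>R u - cell k u"

definition cell_centre :: "nat \<Rightarrow> 'a::euclidean_space \<Rightarrow> 'a" where
  "cell_centre k u = (1 / 2 ^ k) *\<^sub>R (cell k u + (1/2) *\<^sub>R One)"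

definition cell_flip :: "'a::euclidean_space \<Rightarrow> nat \<Rightarrow> 'a \<Rightarrow> 'a" where
  "cell_flip i k u = (if cell_pos k u \<bullet> i < 1/2 then u + (1 / 2 ^ Suc k) *\<^sub>R i else u - (1 / 2 ^ Suc k) *\<^sub>R i)"

definition cube_measure :: "'a::euclidean_space measure" where
  "cube_measure = density lborel (indicator unit_cube)"

lemma unit_cube_measurable [measurable]: "unit_cube \<in> sets borel"
proof -
  have "unit_cube = (\<Inter>b\<in>Basis. {u :: 'a. 0 \<le> u \<bullet> b \<and> u \<bullet> b < 1})" by (auto simp: unit_cube_def)
  also have "\<dots> \<in> sets borel" by (intro sets.finite_INT) auto
  finally show ?thesis .
qed

lemma cell_measurable [measurable]: "cell k \<in> borel_measurable borel"
  unfolding cell_def[abs_def] by measurable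

lemma cell_pos_measurable [measurable]: "cell_pos k \<in> borel_measurable borel"
  unfolding cell_pos_def[abs_def] by measurable

lemma cell_centre_measurable [measurable]: "cell_centre k \<in> borel_measurable borel"
  unfolding cell_centre_def[abs_def] by measurable

lemma cell_flip_measurable [measurable]: "cell_flip i k \<in> borel_measurable borel"
  unfolding cell_flip_def[abs_def] by measurable

lemma sets_cube_measure [measurable_cong, simp]: "sets cube_measure = sets borel"
  and space_cube_measure [simp]: "space cube_measure = UNIV"
  by (auto simp: cube_measure_def)

lemma nn_integral_cube_measure:
  "f \<in> borel_measurable borel \<Longrightarrow> (\<integral>\<^sup>+u. f u \<partial>cube_measure) = (\<integral>\<^sup>+u. indicator unit_cube u * f u \<partial>lborel)"
  unfolding cube_measure_def by (subst nn_integral_density) auto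

lemma emeasure_unit_cube: "emeasure lborel (unit_cube :: 'a::euclidean_space set) = 1"
proof -
  have "emeasure lborel (box 0 One :: 'a set) \<le> emeasure lborel (unit_cube :: 'a set)"
    by (intro emeasure_mono) (auto simp: unit_cube_def mem_box intro: less_imp_le)
  moreover have "emeasure lborel (unit_cube :: 'a set) \<le> emeasure lborel (cbox 0 One :: 'a set)"
    by (intro emeasure_mono) (auto simp: unit_cube_def mem_box less_imp_le)
  ultimately show ?thesis by (simp add: emeasure_lborel_box_eq emeasure_lborel_cbox_eq)
qed

lemma prob_space_cube_measure: "prob_space (cube_measure :: 'a::euclidean_space measure)"
proof
  show "emeasure (cube_measure :: 'a measure) (space cube_measure) = 1"
    using emeasure_unit_cube[where 'a='a]
    by (simp add: cube_measure_def emeasure_density)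
qed

lemma cell_inner [simp]: "b \<in> Basis \<Longrightarrow> cell k u \<bullet> b = of_int \<lfloor>2 ^ k * (u \<bullet> b)\<rfloor>"
  by (simp add: cell_def)

lemma cell_pos_inner [simp]: "b \<in> Basis \<Longrightarrow> cell_pos k u \<bullet> b = frac (2 ^ k * (u \<bullet> b))"
  by (simp add: cell_pos_def inner_diff_left frac_def)

lemma cell_pos_in_unit_cube [simp]: "cell_pos k u \<in> unit_cube"
  by (auto simp: unit_cube_def frac_lt_1)

lemma cell_eq_iff: "cell k u = cell k v \<longleftrightarrow> (\<forall>b\<in>Basis. \<lfloor>2 ^ k * (u \<bullet> b)\<rfloor> = \<lfloor>2 ^ k * (v \<bullet> b)\<rfloor>)"
  by (simp add: euclidean_eq_iff[of "cell k u"])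

lemma floor_pow2_nested:
  fixes s t :: real
  assumes "\<lfloor>2 ^ k * s\<rfloor> = \<lfloor>2 ^ k * t\<rfloor>" "j \<le> k"
  shows "\<lfloor>2 ^ j * s\<rfloor> = \<lfloor>2 ^ j * t\<rfloor>"
proof -
  have "\<lfloor>2 ^ j * r\<rfloor> = \<lfloor>2 ^ k * r\<rfloor> div 2 ^ (k - j)" for r :: real
  proof -
    have "(2::real) ^ k = 2 ^ j * 2 ^ (k - j)" using assms(2) by (simp add: power_add[symmetric])
    then have "2 ^ j * r = (2 ^ k * r) / real_of_int (2 ^ (k - j))" by simp
    then show ?thesis using floor_divide_real_eq_div[of "2 ^ (k - j)" "2 ^ k * r"] by simp
  qed
  then show ?thesis using assms by simp
qed

lemma cell_nested: "cell k u = cell k v \<Longrightarrow> j \<le> k \<Longrightarrow> cell j u = cell j v"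
  unfolding cell_eq_iff using floor_pow2_nested by blast

lemma cell_centre_diff: "u - cell_centre k u = (1 / 2 ^ k) *\<^sub>R (cell_pos k u - (1/2) *\<^sub>R One)"
proof -
  have "(1 / 2 ^ k) *\<^sub>R (2 ^ k *\<^sub>R u) = u" by simp
  then show ?thesis
    unfolding cell_centre_def cell_pos_def by (simp add: algebra_simps)
qed

lemma unit_cube_cell: "cell k u = cell k v \<Longrightarrow> u \<in> unit_cube \<longleftrightarrow> v \<in> unit_cube"
proof -
  have "u \<in> unit_cube \<longleftrightarrow> cell 0 u = 0" for u :: 'a
    unfolding euclidean_eq_iff[of "cell 0 u" 0]
    by (auto simp: unit_cube_def floor_eq_iff)
  then show "cell k u = cell k v \<Longrightarrow> u \<in> unit_cube \<longleftrightarrow> v \<in> unit_cube"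
    using cell_nested[of k u v 0] by simp
qed

lemma nn_integral_lborel_affine:
  fixes t :: "'a::euclidean_space"
  assumes [measurable]: "f \<in> borel_measurable borel" and c: "c \<noteq> 0"
  shows "(\<integral>\<^sup>+x. f x \<partial>lborel) = ennreal (\<bar>c\<bar> ^ DIM('a)) * (\<integral>\<^sup>+x. f (t + c *\<^sub>R x) \<partial>lborel)"
  by (subst lborel_affine[OF c, of t]) (simp add: nn_integral_density nn_integral_distr nn_integral_cmult)

lemma nn_integral_lborel_shift:
  fixes t :: "'a::euclidean_space"
  assumes [measurable]: "f \<in> borel_measurable borel"
  shows "(\<integral>\<^sup>+x. f (x + t) \<partial>lborel) = (\<integral>\<^sup>+x. f x \<partial>lborel)"
  using nn_integral_lborel_affine[OF assms, of 1 t] by (simp add: add.commute)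

lemma nn_integral_same_cell:
  fixes u :: "'a::euclidean_space"
  assumes [measurable]: "G \<in> borel_measurable borel"
  shows "(\<integral>\<^sup>+z. of_bool (cell k z = cell k u) * G (cell_pos k z) \<partial>lborel)
    = ennreal ((1 / 2 ^ k) ^ DIM('a)) * (\<integral>\<^sup>+v. indicator unit_cube v * G v \<partial>lborel)"
proof -
  let ?z = "\<lambda>v::'a. (1 / 2 ^ k) *\<^sub>R cell k u + (1 / 2 ^ k) *\<^sub>R v"
  have inz: "2 ^ k * (?z v \<bullet> b) = of_int \<lfloor>2 ^ k * (u \<bullet> b)\<rfloor> + v \<bullet> b" if "b \<in> Basis" for v b
    using that by (simp add: inner_add_left field_simps)
  have eq: "cell k (?z v) = cell k u \<longleftrightarrow> v \<in> unit_cube" for v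
    unfolding cell_eq_iff unit_cube_def mem_Collect_eq
    by (intro ball_cong refl) (simp only: inz floor_eq_iff, auto)
  have pos: "cell_pos k (?z v) = v" if "v \<in> unit_cube" for v
  proof (rule euclidean_eqI)
    fix b :: 'a assume b: "b \<in> Basis"
    then have "0 \<le> v \<bullet> b" "v \<bullet> b < 1" using that by (auto simp: unit_cube_def)
    then show "cell_pos k (?z v) \<bullet> b = v \<bullet> b"
      unfolding cell_pos_inner[OF b] inz[OF b] frac_def by (simp add: floor_eq_iff)
  qed
  have "(\<integral>\<^sup>+z. of_bool (cell k z = cell k u) * G (cell_pos k z) \<partial>lborel)
      = ennreal (\<bar>1 / 2 ^ k\<bar> ^ DIM('a)) * (\<integral>\<^sup>+v. of_bool (cell k (?z v) = cell k u) * G (cell_pos k (?z v)) \<partial>lborel)"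
    by (rule nn_integral_lborel_affine) auto
  also have "(\<integral>\<^sup>+v. of_bool (cell k (?z v) = cell k u) * G (cell_pos k (?z v)) \<partial>lborel)
      = (\<integral>\<^sup>+v. indicator unit_cube v * G v \<partial>lborel)"
    by (intro nn_integral_cong) (auto simp: eq pos indicator_def)
  finally show ?thesis by simp
qed

text \<open>The position inside the cell is independent of the cell. A second point
  \<open>z\<close>, uniform in the cell of \<open>u\<close>, is introduced; \<open>Y u\<close>
  equals \<open>Y z\<close>, and after Fubini the integral over \<open>u\<close> in the cell of
  \<open>z\<close> is a full integral of \<open>F\<close>, independent of \<open>z\<close>.\<close>

lemma nn_integral_cell_independent:
  fixes Y F :: "'a::euclidean_space \<Rightarrow> ennreal"
  assumes [measurable]: "Y \<in> borel_measurable borel" "F \<in> borel_measurable borel"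
    and Y: "\<And>u v. cell k u = cell k v \<Longrightarrow> Y u = Y v"
  shows "(\<integral>\<^sup>+u. Y u * F (cell_pos k u) \<partial>cube_measure) = (\<integral>\<^sup>+u. Y u \<partial>cube_measure) * (\<integral>\<^sup>+u. F u \<partial>cube_measure)"
proof -
  define c where "c = ennreal ((1 / 2 ^ k) ^ DIM('a))"
  define c' where "c' = ennreal ((2 ^ k) ^ DIM('a))"
  have cc: "c' * c = 1"
    unfolding c_def c'_def by (subst ennreal_mult[symmetric]) (auto simp: power_mult_distrib[symmetric])
  let ?S = "\<lambda>u z :: 'a. of_bool (cell k z = cell k u) :: ennreal"
  let ?w = "\<lambda>u. indicator unit_cube u * Y u :: ennreal"
  have w: "?w u = ?w v" if "cell k u = cell k v" for u v
    using Y[OF that] unit_cube_cell[OF that] by (auto simp: indicator_def)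
  have S1: "c' * (\<integral>\<^sup>+z. ?S u z \<partial>lborel) = 1" for u
    using nn_integral_same_cell[of "\<lambda>_. 1" k u] emeasure_unit_cube[where 'a='a] cc
    by (simp add: c_def mult.assoc)
  have S2: "(\<integral>\<^sup>+u. ?S u z * F (cell_pos k u) \<partial>lborel) = c * (\<integral>\<^sup>+u. F u \<partial>cube_measure)" for z
    using nn_integral_same_cell[of F k z] by (simp add: c_def nn_integral_cube_measure eq_commute)
  have "(\<integral>\<^sup>+u. Y u * F (cell_pos k u) \<partial>cube_measure) = (\<integral>\<^sup>+u. ?w u * F (cell_pos k u) * (c' * (\<integral>\<^sup>+z. ?S u z \<partial>lborel)) \<partial>lborel)"
    by (simp add: nn_integral_cube_measure S1 mult.assoc)
  also have "\<dots> = (\<integral>\<^sup>+u. (\<integral>\<^sup>+z. c' * (?w u * F (cell_pos k u) * ?S u z) \<partial>lborel) \<partial>lborel)"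
    by (intro nn_integral_cong) (simp add: nn_integral_cmult[symmetric] mult_ac)
  \<comment> \<open>The decisive exchange: on the set where the two cells agree, the weight at
    \<open>u\<close> is the weight at \<open>z\<close>. The factor \<open>c'\<close> is the
    reciprocal of the volume of a cell.\<close>
  also have "\<dots> = (\<integral>\<^sup>+u. (\<integral>\<^sup>+z. c' * (?w z * (?S u z * F (cell_pos k u))) \<partial>lborel) \<partial>lborel)"
  proof (intro nn_integral_cong)
    fix u z
    show "c' * (?w u * F (cell_pos k u) * ?S u z) = c' * (?w z * (?S u z * F (cell_pos k u)))"
      using w[of u z] by (cases "cell k z = cell k u") (auto simp: mult_ac)
  qed
  also have "\<dots> = (\<integral>\<^sup>+z. (\<integral>\<^sup>+u. c' * (?w z * (?S u z * F (cell_pos k u))) \<partial>lborel) \<partial>lborel)"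
    by (rule lborel_pair.Fubini') measurable
  also have "\<dots> = (\<integral>\<^sup>+z. c' * (?w z * (\<integral>\<^sup>+u. ?S u z * F (cell_pos k u) \<partial>lborel)) \<partial>lborel)"
    by (intro nn_integral_cong) (simp add: nn_integral_cmult)
  also have "\<dots> = (\<integral>\<^sup>+z. ?w z * (\<integral>\<^sup>+u. F u \<partial>cube_measure) \<partial>lborel)"
  proof (intro nn_integral_cong)
    fix z :: 'a
    have "c' * (?w z * (c * (\<integral>\<^sup>+u. F u \<partial>cube_measure))) = (c' * c) * (?w z * (\<integral>\<^sup>+u. F u \<partial>cube_measure))"
      by (simp only: mult_ac)
    then show "c' * (?w z * (\<integral>\<^sup>+u. ?S u z * F (cell_pos k u) \<partial>lborel)) = ?w z * (\<integral>\<^sup>+u. F u \<partial>cube_measure)"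
      by (simp only: S2 cc mult_1)
  qed
  also have "\<dots> = (\<integral>\<^sup>+u. Y u \<partial>cube_measure) * (\<integral>\<^sup>+u. F u \<partial>cube_measure)"
    by (simp add: nn_integral_multc nn_integral_cube_measure)
  finally show ?thesis .
qed

lemma cell_flip_inner: "b \<in> Basis \<Longrightarrow> i \<in> Basis \<Longrightarrow> b \<noteq> i \<Longrightarrow> cell_flip i k u \<bullet> b = u \<bullet> b"
  by (auto simp: cell_flip_def inner_add_left inner_diff_left inner_Basis)

lemma cell_flip_inner_same: "i \<in> Basis \<Longrightarrow>
   2 ^ k * (cell_flip i k u \<bullet> i) = 2 ^ k * (u \<bullet> i) + (if frac (2 ^ k * (u \<bullet> i)) < 1/2 then 1/2 else -1/2)"
  by (auto simp: cell_flip_def inner_add_left inner_diff_left field_simps)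

lemma floor_cell_flip:
  assumes i: "i \<in> Basis"
  shows "\<lfloor>2 ^ k * (cell_flip i k u \<bullet> i)\<rfloor> = \<lfloor>2 ^ k * (u \<bullet> i)\<rfloor>"
proof -
  define t where "t = 2 ^ k * (u \<bullet> i)"
  have "t = of_int \<lfloor>t\<rfloor> + frac t" "0 \<le> frac t" "frac t < 1" by (auto simp: frac_def frac_lt_1 frac_ge_0) linarith
  then have "\<lfloor>t + (if frac t < 1/2 then 1/2 else -1/2)\<rfloor> = \<lfloor>t\<rfloor>"
    by (cases "frac t < 1/2"; intro floor_unique; simp; linarith)
  then show ?thesis unfolding cell_flip_inner_same[OF i] t_def .
qed

lemma cell_cell_flip: "i \<in> Basis \<Longrightarrow> j \<le> k \<Longrightarrow> cell j (cell_flip i k u) = cell j u"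
proof (rule cell_nested)
  assume i: "i \<in> Basis"
  show "cell k (cell_flip i k u) = cell k u"
    unfolding cell_eq_iff using floor_cell_flip[OF i] cell_flip_inner[OF _ i] by metis
qed

lemma cell_pos_cell_flip_other: "b \<in> Basis \<Longrightarrow> i \<in> Basis \<Longrightarrow> b \<noteq> i \<Longrightarrow> cell_pos j (cell_flip i k u) \<bullet> b = cell_pos j u \<bullet> b"
  by (simp add: cell_flip_inner)

lemma cell_pos_cell_flip_half:
  assumes i: "i \<in> Basis"
  shows "cell_pos k (cell_flip i k u) \<bullet> i < 1/2 \<longleftrightarrow> \<not> cell_pos k u \<bullet> i < 1/2"
proof -
  have "cell_pos k (cell_flip i k u) \<bullet> i = cell_pos k u \<bullet> i + (if cell_pos k u \<bullet> i < 1/2 then 1/2 else -1/2)"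
    using floor_cell_flip[OF i, of k u] cell_flip_inner_same[OF i, of k u] i by (auto simp: frac_def)
  moreover have "0 \<le> cell_pos k u \<bullet> i" "cell_pos k u \<bullet> i < 1" using i by (auto simp: frac_lt_1)
  ultimately show ?thesis by (auto split: if_splits)
qed

text \<open>The half of a level-\<open>j\<close> cell in which a point lies is determined by its
  cell at level \<open>Suc j\<close>; flips at finer levels thus do not alter it.\<close>

lemma frac_half_iff:
  fixes t :: real
  shows "frac (2 ^ j * t) < 1/2 \<longleftrightarrow> \<lfloor>2 ^ Suc j * t\<rfloor> = 2 * \<lfloor>2 ^ j * t\<rfloor>"
proof -
  define s where "s = 2 ^ j * t"
  have "\<lfloor>2 * s\<rfloor> = 2 * \<lfloor>s\<rfloor> \<longleftrightarrow> frac s < 1/2"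
    unfolding floor_eq_iff frac_def by auto
  then show ?thesis by (simp add: s_def mult.assoc)
qed

lemma cell_pos_cell_flip_less:
  assumes i: "i \<in> Basis" and j: "j < k"
  shows "cell_pos j (cell_flip i k u) \<bullet> i < 1/2 \<longleftrightarrow> cell_pos j u \<bullet> i < 1/2"
proof -
  have "cell (Suc j) (cell_flip i k u) = cell (Suc j) u" "cell j (cell_flip i k u) = cell j u"
    using i j by (auto intro!: cell_cell_flip)
  then show ?thesis unfolding cell_pos_inner[OF i] frac_half_iff using i by (simp add: cell_eq_iff)
qed

text \<open>On the left halves of the cells the flip is the translation by \<open>h\<close>, on the
  right halves the translation by \<open>- h\<close>, and it maps each kind of half onto the other
  inside the unit cube. Translation invariance is applied to the two parts separately.\<close>

lemma distr_cell_flip: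
  fixes i :: "'a::euclidean_space"
  assumes i: "i \<in> Basis"
  shows "distr cube_measure cube_measure (cell_flip i k) = cube_measure"
proof (rule measure_eqI)
  fix A :: "'a set" assume "A \<in> sets (distr cube_measure cube_measure (cell_flip i k))"
  then have [measurable]: "A \<in> sets borel" by simp
  define h where "h = (1 / 2 ^ Suc k) *\<^sub>R i"
  note flip = cell_flip_def[of i k, folded h_def]
  let ?f = "cell_flip i k"
  let ?L = "\<lambda>u. of_bool (cell_pos k u \<bullet> i < 1/2) :: ennreal"
  let ?R = "\<lambda>u. of_bool (\<not> cell_pos k u \<bullet> i < 1/2) :: ennreal"
  let ?Q = "indicator unit_cube :: 'a \<Rightarrow> ennreal" and ?A = "indicator A :: 'a \<Rightarrow> ennreal"
  have cube: "?Q (?f u) = ?Q u" for u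
    using unit_cube_cell[OF cell_cell_flip[OF i order_refl, of k u]] by (simp add: indicator_def)
  \<comment> \<open>Translating the left halves by \<open>h\<close> gives the right halves, with the
    restriction to the unit cube included.\<close>
  have shift: "?L (u - h) * ?Q (u - h) = ?R u * ?Q u" for u
  proof (cases "cell_pos k u \<bullet> i < 1/2")
    case True
    have "\<not> cell_pos k (u - h) \<bullet> i < 1/2"
    proof
      assume "cell_pos k (u - h) \<bullet> i < 1/2"
      then have "?f (u - h) = u" by (simp add: flip)
      then show False using cell_pos_cell_flip_half[OF i, of k "u - h"] True \<open>cell_pos k (u - h) \<bullet> i < 1/2\<close> by simp
    qed
    then show ?thesis using True by simp
  next
    case False
    then have f: "?f u = u - h" by (simp add: flip)
    then show ?thesis using False cell_pos_cell_flip_half[OF i, of k u] cube[of u] by simp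
  qed
  have shift': "?R (u + h) * ?Q (u + h) = ?L u * ?Q u" for u
    using shift[of "u + h"] by simp
  have "emeasure (distr cube_measure cube_measure ?f) A = (\<integral>\<^sup>+u. ?A (?f u) \<partial>cube_measure)"
    by (subst nn_integral_distr[symmetric, of _ _ cube_measure]) (auto simp: nn_integral_indicator)
  also have "\<dots> = (\<integral>\<^sup>+u. ?L u * ?Q u * ?A (u + h) + ?R u * ?Q u * ?A (u - h) \<partial>lborel)"
    by (simp add: nn_integral_cube_measure) (intro nn_integral_cong, auto simp: flip)
  also have "\<dots> = (\<integral>\<^sup>+u. ?L u * ?Q u * ?A (u + h) \<partial>lborel) + (\<integral>\<^sup>+u. ?R u * ?Q u * ?A (u - h) \<partial>lborel)"
    by (rule nn_integral_add) measurable
  also have "(\<integral>\<^sup>+u. ?L u * ?Q u * ?A (u + h) \<partial>lborel) = (\<integral>\<^sup>+u. ?R u * ?Q u * ?A u \<partial>lborel)"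
    using nn_integral_lborel_shift[of "\<lambda>u. ?L (u - h) * ?Q (u - h) * ?A u" h]
    by (simp only: add_diff_cancel_right' shift) measurable
  also have "(\<integral>\<^sup>+u. ?R u * ?Q u * ?A (u - h) \<partial>lborel) = (\<integral>\<^sup>+u. ?L u * ?Q u * ?A u \<partial>lborel)"
    using nn_integral_lborel_shift[of "\<lambda>u. ?R (u + h) * ?Q (u + h) * ?A u" "- h"]
    by (simp only: diff_add_cancel shift' add_uminus_conv_diff) measurable
  also have "(\<integral>\<^sup>+u. ?R u * ?Q u * ?A u \<partial>lborel) + (\<integral>\<^sup>+u. ?L u * ?Q u * ?A u \<partial>lborel)
     = (\<integral>\<^sup>+u. ?R u * ?Q u * ?A u + ?L u * ?Q u * ?A u \<partial>lborel)"
    by (rule nn_integral_add[symmetric]) measurable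
  also have "\<dots> = (\<integral>\<^sup>+u. ?A u \<partial>cube_measure)"
    by (subst nn_integral_cube_measure, measurable) (intro nn_integral_cong, auto)
  also have "\<dots> = emeasure cube_measure A" by simp
  finally show "emeasure (distr cube_measure cube_measure ?f) A = emeasure cube_measure A" .
qed simp

section \<open>Second differences and the Zygmund class\<close>

lemma Dh2_eq: "Dh2 h f x = f (x + h) - 2 * f x + f (x - h)"
proof -
  have "(1/2) *\<^sub>R h + (1/2) *\<^sub>R h = h"
    by (simp flip: scaleR_left_distrib)
  then have "x + (1/2) *\<^sub>R h + (1/2) *\<^sub>R h = x + h" "x - (1/2) *\<^sub>R h - (1/2) *\<^sub>R h = x - h"
    by (simp_all only: add.assoc diff_diff_eq)
  then show ?thesis
    by (simp only: Dh2_def Dh_def add_diff_cancel_right' diff_add_cancel)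
qed

lemma Dh2_diff: "Dh2 h (\<lambda>x. f x - g x) x = Dh2 h f x - Dh2 h g x"
  by (simp add: Dh2_eq)

lemma Dh2_bounded:
  assumes "\<And>x. \<bar>f x\<bar> \<le> S"
  shows "\<bar>Dh2 h f x\<bar> \<le> 4 * S"
  unfolding Dh2_eq using assms[of "x + h"] assms[of x] assms[of "x - h"] by linarith

lemma bdd_above_Dh2:
  assumes "bounded (range f)"
  shows "bdd_above ((\<lambda>h. \<bar>Dh2 h f x\<bar>) ` A)"
proof -
  obtain S where "\<And>x. \<bar>f x\<bar> \<le> S" using assms by (auto simp: bounded_iff)
  from Dh2_bounded[OF this] show ?thesis by (intro bdd_aboveI2[where M="4 * S"])
qed

lemma Delta2_ge:
  assumes "bounded (range f)" "norm h = y"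
  shows "\<bar>Dh2 h f x\<bar> \<le> Delta2 f x y"
  unfolding Delta2_def using assms by (intro cSUP_upper bdd_above_Dh2) auto

lemma Delta2_le:
  fixes f :: "'a::euclidean_space \<Rightarrow> real"
  assumes "0 \<le> y" "\<And>h. norm h = y \<Longrightarrow> \<bar>Dh2 h f x\<bar> \<le> B"
  shows "Delta2 f x y \<le> B"
proof -
  obtain h0 :: 'a where "norm h0 = y" using vector_choose_size[OF assms(1)] by auto
  then show ?thesis unfolding Delta2_def using assms(2) by (intro cSUP_least) auto
qed

lemma less_Delta2D:
  fixes f :: "'a::euclidean_space \<Rightarrow> real"
  assumes "0 \<le> y" "c < Delta2 f x y"
  obtains h where "norm h = y" "c < \<bar>Dh2 h f x\<bar>"
  using Delta2_le[OF assms(1), of f x c] assms(2) by (meson not_le)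

lemma Delta2_nonneg:
  fixes f :: "'a::euclidean_space \<Rightarrow> real"
  assumes "bounded (range f)" "0 \<le> y"
  shows "0 \<le> Delta2 f x y"
proof -
  obtain h0 :: 'a where "norm h0 = y" using vector_choose_size[OF assms(2)] by auto
  from Delta2_ge[OF assms(1) this] show ?thesis by (smt (verit) abs_ge_zero)
qed

lemma Lambda1I:
  fixes f :: "'a::euclidean_space \<Rightarrow> real"
  assumes cont: "continuous_on UNIV f" and S: "\<And>x. \<bar>f x\<bar> \<le> S"
    and M: "\<And>x h. norm h \<le> 1 \<Longrightarrow> \<bar>Dh2 h f x\<bar> \<le> M * norm h"
  shows "f \<in> Lambda1" and "Lambda1_norm f \<le> S + M"
proof -
  have D: "Delta2 f x y / y \<le> M" if "y \<in> {0<..1}" for x y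
  proof -
    have "Delta2 f x y \<le> M * y"
      using that M by (intro Delta2_le) auto
    then show ?thesis using that by (simp add: field_simps)
  qed
  have "bounded (range f)" using S by (auto simp: bounded_iff)
  moreover have "bdd_above {Delta2 f x y / y | x y. y \<in> {0<..1}}"
    by (rule bdd_aboveI[where M=M]) (use D in auto)
  ultimately show "f \<in> Lambda1" using cont by (simp add: Lambda1_def)
  have "(SUP x. \<bar>f x\<bar>) \<le> S" using S by (intro cSUP_least) auto
  moreover have "(SUP (x,y)\<in>UNIV \<times> {0<..1}. Delta2 f x y / y) \<le> M"
  proof (rule cSUP_least)
    have "(0, 1) \<in> (UNIV :: 'a set) \<times> {0<..1::real}" by simp
    then show "(UNIV :: 'a set) \<times> {0<..1::real} \<noteq> {}" by blast
  qed (use D in auto)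
  ultimately show "Lambda1_norm f \<le> S + M" by (simp add: Lambda1_norm_def)
qed

lemma Lambda1D:
  fixes f :: "'a::euclidean_space \<Rightarrow> real"
  assumes f: "f \<in> Lambda1"
  shows Lambda1_norm_ge_abs: "\<bar>f x\<bar> \<le> Lambda1_norm f"
    and Lambda1_norm_ge_Dh2: "norm h \<le> 1 \<Longrightarrow> \<bar>Dh2 h f x\<bar> \<le> Lambda1_norm f * norm h"
proof -
  have bd: "bounded (range f)" and bdd: "bdd_above {Delta2 f x y / y | x y. y \<in> {0<..1}}"
    using f by (auto simp: Lambda1_def)
  have eq: "(\<lambda>(x, y). Delta2 f x y / y) ` (UNIV \<times> {0<..1}) = {Delta2 f x y / y | x y. y \<in> {0<..1}}"
    by (force simp: image_iff)
  obtain S where "\<And>x. \<bar>f x\<bar> \<le> S" using bd by (auto simp: bounded_iff)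
  then have "bdd_above (range (\<lambda>x. \<bar>f x\<bar>))" by (intro bdd_aboveI2)
  then have 1: "\<bar>f x\<bar> \<le> (SUP x. \<bar>f x\<bar>)" for x by (intro cSUP_upper) auto
  have 2: "Delta2 f x y / y \<le> (SUP (x,y)\<in>UNIV \<times> {0<..1}. Delta2 f x y / y)" if "y \<in> {0<..1}" for x y
  proof -
    have "bdd_above ((\<lambda>(x, y). Delta2 f x y / y) ` (UNIV \<times> {0<..1}))" unfolding eq by (rule bdd)
    from cSUP_upper[OF _ this, of "(x, y)"] that show ?thesis by auto
  qed
  have 3: "0 \<le> (SUP (x,y)\<in>UNIV \<times> {0<..1}. Delta2 f x y / y)"
    using 2[of 1 0] Delta2_nonneg[OF bd, of 1 0] by simp
  have 4: "0 \<le> (SUP x. \<bar>f x\<bar>)" using 1[of 0] by linarith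
  show "\<bar>f x\<bar> \<le> Lambda1_norm f" using 1[of x] 3 by (simp add: Lambda1_norm_def)
  show "\<bar>Dh2 h f x\<bar> \<le> Lambda1_norm f * norm h" if "norm h \<le> 1"
  proof (cases "h = 0")
    case True
    then show ?thesis by (simp add: Dh2_eq)
  next
    case False
    have "\<bar>Dh2 h f x\<bar> \<le> Delta2 f x (norm h)" by (rule Delta2_ge[OF bd]) simp
    also have "\<dots> \<le> (SUP (x,y)\<in>UNIV \<times> {0<..1}. Delta2 f x y / y) * norm h"
      using 2[of "norm h" x] that False by (simp add: field_simps)
    also have "\<dots> \<le> Lambda1_norm f * norm h"
      using 4 by (intro mult_right_mono) (auto simp: Lambda1_norm_def)
    finally show ?thesis .
  qed
qed

lemma Lambda1_norm_nonneg: "f \<in> Lambda1 \<Longrightarrow> 0 \<le> Lambda1_norm f"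
  using Lambda1_norm_ge_abs[of f 0] by linarith

text \<open>The norm sees only steps of length at most 1; for longer ones the sup norm already gives
  a bound proportional to \<open>norm h\<close>. The normalisation \<open>M >= 1\<close> makes later
  divisions by \<open>M\<close> harmless.\<close>

lemma Lambda1_Dh2_bound:
  fixes f :: "'a::euclidean_space \<Rightarrow> real"
  assumes f: "f \<in> Lambda1"
  obtains M where "M \<ge> 1" "\<And>x h. \<bar>Dh2 h f x\<bar> \<le> M * norm h"
proof (rule that[of "1 + 4 * Lambda1_norm f"])
  have n: "0 \<le> Lambda1_norm f" by (rule Lambda1_norm_nonneg[OF f])
  then show "1 \<le> 1 + 4 * Lambda1_norm f" by simp
  show "\<bar>Dh2 h f x\<bar> \<le> (1 + 4 * Lambda1_norm f) * norm h" for x h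
  proof (cases "norm h \<le> 1")
    case True
    have "\<bar>Dh2 h f x\<bar> \<le> Lambda1_norm f * norm h" by (rule Lambda1_norm_ge_Dh2[OF f True])
    also have "\<dots> \<le> (1 + 4 * Lambda1_norm f) * norm h" using n by (intro mult_right_mono) auto
    finally show ?thesis .
  next
    case False
    have "\<bar>Dh2 h f x\<bar> \<le> 4 * Lambda1_norm f" by (rule Dh2_bounded) (rule Lambda1_norm_ge_abs[OF f])
    also have "\<dots> \<le> (1 + 4 * Lambda1_norm f) * 1" by simp
    also have "\<dots> \<le> (1 + 4 * Lambda1_norm f) * norm h" using n False by (intro mult_left_mono) auto
    finally show ?thesis .
  qed
qed

lemma Lambda1_diff:
  assumes f: "f \<in> Lambda1" and g: "g \<in> Lambda1"
  shows "(\<lambda>x. f x - g x) \<in> Lambda1"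
proof (rule Lambda1I(1))
  show "continuous_on UNIV (\<lambda>x. f x - g x)"
    using f g by (intro continuous_intros) (auto simp: Lambda1_def)
  show "\<bar>f x - g x\<bar> \<le> Lambda1_norm f + Lambda1_norm g" for x
    using Lambda1_norm_ge_abs[OF f, of x] Lambda1_norm_ge_abs[OF g, of x] by linarith
  show "\<bar>Dh2 h (\<lambda>x. f x - g x) x\<bar> \<le> (Lambda1_norm f + Lambda1_norm g) * norm h" if "norm h \<le> 1" for x h
    using Lambda1_norm_ge_Dh2[OF f that, of x] Lambda1_norm_ge_Dh2[OF g that, of x]
    unfolding Dh2_diff distrib_right by linarith
qed

text \<open>Doubling the step replaces a first difference by half of the longer one, with a second
  difference as error. After division by the powers of two every doubling costs the same amount, so
  the error is linear in \<open>j\<close>: the logarithmic loss in the modulus of continuity of a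
  Zygmund function.\<close>

lemma first_difference_doubling:
  fixes f :: "'a::euclidean_space \<Rightarrow> real"
  assumes M: "\<And>x h. \<bar>Dh2 h f x\<bar> \<le> M * norm h"
  shows "\<bar>(f (x + u) - f x) - (f (x + 2 ^ j *\<^sub>R u) - f x) / 2 ^ j\<bar> \<le> real j * M * norm u / 2"
proof (induction j)
  case (Suc j)
  define U where "U = (2 ^ j) *\<^sub>R u"
  have U2: "(2 ^ Suc j) *\<^sub>R u = U + U" by (simp add: U_def flip: scaleR_2)
  have "(f (x + U) - f x) / 2 ^ j - (f (x + (U + U)) - f x) / 2 ^ Suc j = - Dh2 U f (x + U) / 2 ^ Suc j"
    by (simp add: Dh2_eq field_simps)
  then have "\<bar>(f (x + U) - f x) / 2 ^ j - (f (x + (U + U)) - f x) / 2 ^ Suc j\<bar> = \<bar>Dh2 U f (x + U)\<bar> / 2 ^ Suc j"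
    by simp
  also have "\<dots> \<le> M * norm U / 2 ^ Suc j" using M by (intro divide_right_mono) auto
  also have "\<dots> = M * norm u / 2" by (simp add: U_def)
  finally have "\<bar>(f (x + U) - f x) / 2 ^ j - (f (x + (U + U)) - f x) / 2 ^ Suc j\<bar> \<le> M * norm u / 2" .
  moreover have "real (Suc j) * M * norm u / 2 = real j * M * norm u / 2 + M * norm u / 2"
    by (simp add: field_simps)
  ultimately show ?case using Suc unfolding U2 unfolding U_def[symmetric] by linarith
qed simp

text \<open>A first difference over a small step is compared with the one over a dyadic multiple of the step; the error
  is small because it gains a power of two while losing only a factor linear in the exponent.\<close>

lemma Dh2_scale_invariant_continuity:
  fixes M R \<eta> :: real
  assumes M: "M \<ge> 0" and R: "R \<ge> 0" and \<eta>: "\<eta> > 0"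
  obtains \<kappa> where "\<kappa> > 0" "\<kappa> \<le> 1/2"
    "\<And>(f :: 'a::euclidean_space \<Rightarrow> real) x x' h h' t. (\<And>x h. \<bar>Dh2 h f x\<bar> \<le> M * norm h) \<Longrightarrow> t > 0 \<Longrightarrow>
       norm h \<le> R * t \<Longrightarrow> norm (x' - x) \<le> \<kappa> * t \<Longrightarrow> norm (h' - h) \<le> \<kappa> * t \<Longrightarrow>
       \<bar>Dh2 h' f x' - Dh2 h f x\<bar> \<le> \<eta> * t"
proof -
  have "(\<lambda>j. (3 * real j + 4 * R + 2) * M * (1/2) ^ j) \<longlonglongrightarrow> 0"
  proof -
    have 1: "(\<lambda>j. real j * (1/2) ^ j) \<longlonglongrightarrow> (0::real)"
      using powser_times_n_limit_0[of "1/2 :: real"] by simp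
    have 2: "(\<lambda>j. (1/2) ^ j) \<longlonglongrightarrow> (0::real)" by (rule LIMSEQ_realpow_zero) auto
    have "(\<lambda>j. 3 * M * (real j * (1/2) ^ j) + (4 * R + 2) * M * (1/2) ^ j) \<longlonglongrightarrow> 3 * M * 0 + (4 * R + 2) * M * 0"
      by (intro tendsto_intros 1 2)
    then show ?thesis by (simp add: algebra_simps)
  qed
  from order_tendstoD(2)[OF this \<eta>] have ev: "eventually (\<lambda>j. (3 * real j + 4 * R + 2) * M * (1/2) ^ j < \<eta>) sequentially" .
  then obtain j0 where j0: "\<And>j. j \<ge> j0 \<Longrightarrow> (3 * real j + 4 * R + 2) * M * (1/2) ^ j < \<eta>"
    by (auto simp: eventually_sequentially)
  \<comment> \<open>\<open>j\<close> makes the total error of the two parts below smaller than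
    \<eta>; the successor ensures \<open>(1/2) ^ j <= 1/2\<close>.\<close>
  define j where "j = Suc j0"
  have j: "(3 * real j + 4 * R + 2) * M * (1/2) ^ j < \<eta>" using j0[of j] by (simp add: j_def)
  show ?thesis
  proof (rule that[of "(1/2) ^ j"])
    show "(1/2 :: real) ^ j > 0" by simp
    show "(1/2 :: real) ^ j \<le> 1/2" by (simp add: j_def power_le_one)
    fix f :: "'a \<Rightarrow> real" and x x' h h' :: 'a and t :: real
    assume D: "\<And>x h. \<bar>Dh2 h f x\<bar> \<le> M * norm h" and t: "t > 0" and h: "norm h \<le> R * t"
      and x': "norm (x' - x) \<le> (1/2) ^ j * t" and h': "norm (h' - h) \<le> (1/2) ^ j * t"
    define k where "k = (1/2 :: real) ^ j"
    have k: "k > 0" "k \<le> 1" "1 / 2 ^ j = k" by (auto simp: k_def power_le_one power_one_over)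
    define Du where "Du = (\<lambda>u y. f (y + u) - f y)"
    have dbl: "\<bar>Du u y - Du (2 ^ j *\<^sub>R u) y * k\<bar> \<le> real j * M * (k * t) / 2" if "norm u \<le> k * t" for u y
    proof -
      have "\<bar>Du u y - Du (2 ^ j *\<^sub>R u) y * k\<bar> \<le> real j * M * norm u / 2"
        using first_difference_doubling[OF D, of y u j] unfolding Du_def k(3)[symmetric] by simp
      also have "\<dots> \<le> real j * M * (k * t) / 2"
        using that M by (intro divide_right_mono mult_left_mono) auto
      finally show ?thesis .
    qed
    have big: "norm (2 ^ j *\<^sub>R u) \<le> t" if "norm u \<le> k * t" for u :: 'a
    proof -
      have "norm (2 ^ j *\<^sub>R u) \<le> 2 ^ j * (k * t)" using that by simp
      also have "\<dots> = t" by (simp flip: k(3))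
      finally show ?thesis .
    qed
    have A: "\<bar>Dh2 h f x' - Dh2 h f x\<bar> \<le> (2 * real j + 2 * R) * M * k * t"
    proof -
      define u where "u = x' - x"
      define U where "U = 2 ^ j *\<^sub>R u"
      have u: "norm u \<le> k * t" using x' by (simp add: u_def k_def)
      \<comment> \<open>Moving the base point by \<open>u\<close> gives a combination of first
        differences with step \<open>u\<close>. Up to the doubling error it is \<open>k\<close>
        times the same combination with the long step \<open>U\<close>, which is again a difference
        of two second differences with step \<open>h\<close>, hence of size
        \<open>M * R * t\<close>.\<close>
      have e1: "Dh2 h f x' - Dh2 h f x = Du u (x + h) - 2 * Du u x + Du u (x - h)"
        unfolding Du_def Dh2_eq u_def by (simp add: algebra_simps)
      have e2: "Dh2 h f (x + U) - Dh2 h f x = Du U (x + h) - 2 * Du U x + Du U (x - h)"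
        unfolding Du_def Dh2_eq by (simp add: algebra_simps)
      have "\<bar>Dh2 h f (x + U) - Dh2 h f x\<bar> \<le> 2 * (M * norm h)"
        using D[of h "x + U"] D[of h x] by linarith
      also have "\<dots> \<le> 2 * (M * (R * t))" using h M by (intro mult_left_mono) auto
      finally have "k * \<bar>Dh2 h f (x + U) - Dh2 h f x\<bar> \<le> k * (2 * (M * (R * t)))"
        using k by (intro mult_left_mono) auto
      then have "\<bar>(Dh2 h f (x + U) - Dh2 h f x) * k\<bar> \<le> 2 * R * M * k * t"
        using k by (simp add: abs_mult mult_ac)
      moreover have "(Dh2 h f (x + U) - Dh2 h f x) * k = Du U (x + h) * k - 2 * (Du U x * k) + Du U (x - h) * k"
        unfolding e2 by (simp add: algebra_simps)
      moreover have "(2 * real j + 2 * R) * M * k * t = 4 * (real j * M * (k * t) / 2) + 2 * R * M * k * t"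
        by (simp add: algebra_simps)
      ultimately show ?thesis
        using dbl[OF u, of "x + h"] dbl[OF u, of x] dbl[OF u, of "x - h"]
        unfolding e1 U_def[symmetric] by linarith
    qed
    have B: "\<bar>Dh2 h' f x' - Dh2 h f x'\<bar> \<le> (real j + 2 * R + 2) * M * k * t"
    proof -
      define u where "u = h' - h"
      define U where "U = 2 ^ j *\<^sub>R u"
      have u: "norm u \<le> k * t" using h' by (simp add: u_def k_def)
      have U: "norm U \<le> t" using big[OF u] by (simp add: U_def)
      have e1: "Dh2 h' f x' - Dh2 h f x' = Du u (x' + h) - Du u (x' - h - u)"
        unfolding Du_def Dh2_eq u_def by (simp add: algebra_simps)
      define v where "v = (1/2) *\<^sub>R U"
      define w where "w = (1/2) *\<^sub>R u"
      \<comment> \<open>The four points occurring in the two first differences with step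
        \<open>U\<close> pair up symmetrically around this centre. Subtracting two second
        differences centred at \<open>y\<close> cancels the middle values, and only the four points
        remain.\<close>
      define y where "y = x' + v - w"
      have vw: "U = v + v" "u = w + w"
        by (simp_all add: v_def w_def flip: scaleR_left_distrib)
      have c: "y + (h + (v + w)) = x' + h + U" "y - (h + (v + w)) = x' - h - u"
        "y + (h - (v - w)) = x' + h" "y - (h - (v - w)) = x' - h - u + U"
        unfolding y_def vw by (simp_all add: algebra_simps)
      have e2: "Dh2 (h + (v + w)) f y - Dh2 (h - (v - w)) f y = Du U (x' + h) - Du U (x' - h - u)"
        unfolding Dh2_eq c Du_def by simp
      have "k * t \<le> t" using k t by (simp add: mult_left_le_one_le)
      then have "norm v \<le> t / 2" "norm w \<le> t / 2" using U u by (simp_all add: v_def w_def)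
      then have n1: "norm (h + (v + w)) \<le> R * t + t" and n2: "norm (h - (v - w)) \<le> R * t + t"
        using h norm_triangle_ineq[of h "v + w"] norm_triangle_ineq[of v w]
          norm_triangle_ineq4[of h "v - w"] norm_triangle_ineq4[of v w] by linarith+
      have "\<bar>Du U (x' + h) - Du U (x' - h - u)\<bar> \<le> M * (R * t + t) + M * (R * t + t)"
        using D[of "h + (v + w)" y] D[of "h - (v - w)" y]
          mult_left_mono[OF n1 M] mult_left_mono[OF n2 M] unfolding e2[symmetric] by linarith
      then have "k * \<bar>Du U (x' + h) - Du U (x' - h - u)\<bar> \<le> k * (M * (R * t + t) + M * (R * t + t))"
        using k by (intro mult_left_mono) auto
      also have "k * \<bar>Du U (x' + h) - Du U (x' - h - u)\<bar> = \<bar>Du U (x' + h) * k - Du U (x' - h - u) * k\<bar>"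
        using k by (simp only: left_diff_distrib[symmetric] abs_mult) simp
      also have "k * (M * (R * t + t) + M * (R * t + t)) = (2 * R + 2) * M * k * t"
        by (simp add: algebra_simps)
      finally have "\<bar>Du U (x' + h) * k - Du U (x' - h - u) * k\<bar> \<le> (2 * R + 2) * M * k * t" .
      moreover have "(real j + 2 * R + 2) * M * k * t = 2 * (real j * M * (k * t) / 2) + (2 * R + 2) * M * k * t"
        by (simp add: algebra_simps)
      ultimately show ?thesis
        using dbl[OF u, of "x' + h"] dbl[OF u, of "x' - h - u"]
        unfolding e1 U_def[symmetric] by linarith
    qed
    have "\<bar>Dh2 h' f x' - Dh2 h f x\<bar> \<le> (3 * real j + 4 * R + 2) * M * k * t"
      using A B by (simp add: algebra_simps)
    also have "\<dots> \<le> \<eta> * t" using j t by (intro mult_right_mono) (auto simp: k_def)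
    finally show "\<bar>Dh2 h' f x' - Dh2 h f x\<bar> \<le> \<eta> * t" .
  qed
qed

section \<open>Real powers of extended nonnegative reals\<close>

lemma enn_powr_ennreal [simp]: "0 \<le> a \<Longrightarrow> enn_powr (ennreal a) r = ennreal (a powr r)"
  by (simp add: enn_powr_def)

lemma enn_powr_top [simp]: "enn_powr \<top> r = \<top>"
  by (simp add: enn_powr_def)

lemma enn_powr_mono:
  assumes "a \<le> b" "0 \<le> r"
  shows "enn_powr a r \<le> enn_powr b r"
proof (cases b)
  case (real y)
  then obtain x where "a = ennreal x" "0 \<le> x" using assms by (cases a) (auto simp: top_unique)
  then show ?thesis using real assms by (auto intro!: ennreal_leI powr_mono2)
qed simp

lemma enn_powr_powr:
  assumes "0 < r" "0 < s"
  shows "enn_powr (enn_powr a r) s = enn_powr a (r * s)"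
  by (cases a) (auto simp: powr_powr)

lemma enn_powr_one [simp]: "enn_powr a 1 = a"
  by (cases a) auto

text \<open>A positive power is monotone with the monotone inverse \<open>1 / r\<close>, so it
  commutes with suprema without any continuity argument.\<close>

lemma enn_powr_SUP:
  assumes r: "0 < r"
  shows "enn_powr (SUP n. f n) r = (SUP n. enn_powr (f n) r)"
proof (rule antisym)
  let ?s = "SUP n. enn_powr (f n) r"
  have "f n \<le> enn_powr ?s (1 / r)" for n
  proof -
    have "f n = enn_powr (enn_powr (f n) r) (1 / r)" using r by (simp add: enn_powr_powr)
    also have "\<dots> \<le> enn_powr ?s (1 / r)" using r by (intro enn_powr_mono SUP_upper) auto
    finally show ?thesis .
  qed
  then have "enn_powr (SUP n. f n) r \<le> enn_powr (enn_powr ?s (1 / r)) r"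
    using r by (intro enn_powr_mono SUP_least) auto
  then show "enn_powr (SUP n. f n) r \<le> ?s" using r by (simp add: enn_powr_powr)
  show "?s \<le> enn_powr (SUP n. f n) r" using r by (intro SUP_least enn_powr_mono SUP_upper) auto
qed

lemma enn_powr_cmult:
  assumes "0 < c" "0 < r"
  shows "enn_powr (ennreal c * a) r = ennreal (c powr r) * enn_powr a r"
  using assms by (cases a) (auto simp: ennreal_mult[symmetric] powr_mult ennreal_mult_top)

text \<open>The sum is at most its number of terms times the largest one. This works for exponents
  below and above 1 alike, as needed for \<open>p / 2\<close>.\<close>

lemma enn_powr_sum_le:
  assumes r: "0 < r" and A: "finite A"
  shows "enn_powr (\<Sum>i\<in>A. f i) r \<le> ennreal (real (card A) powr r) * (\<Sum>i\<in>A. enn_powr (f i) r)"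
proof (cases "A = {}")
  case True
  then show ?thesis using r enn_powr_ennreal[of 0 r] by simp
next
  case False
  have "Max (f ` A) \<in> f ` A" using A False by (intro Max_in) auto
  then obtain j where j: "j \<in> A" "f j = Max (f ` A)" by auto
  have j': "f i \<le> f j" if "i \<in> A" for i using A that by (simp add: j(2))
  have "(\<Sum>i\<in>A. f i) \<le> of_nat (card A) * f j" using j' by (intro sum_bounded_above) auto
  then have "enn_powr (\<Sum>i\<in>A. f i) r \<le> enn_powr (ennreal (real (card A)) * f j) r"
    using r by (intro enn_powr_mono) (auto simp: ennreal_of_nat_eq_real_of_nat)
  also have "\<dots> = ennreal (real (card A) powr r) * enn_powr (f j) r"
    using r A False by (intro enn_powr_cmult) (auto simp: card_gt_0_iff)
  also have "\<dots> \<le> ennreal (real (card A) powr r) * (\<Sum>i\<in>A. enn_powr (f i) r)"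
    using j A by (intro mult_left_mono member_le_sum) auto
  finally show ?thesis .
qed

lemma enn_powr_measurable [measurable]: "(\<lambda>a. enn_powr a r) \<in> borel_measurable borel"
  unfolding enn_powr_def by measurable

section \<open>Dyadic slopes on a line\<close>

lemma powr_above_tangent:
  fixes y m p :: real
  assumes "1 \<le> p" "0 < m" "0 \<le> y"
  shows "m powr p + p * m powr (p - 1) * (y - m) \<le> y powr p"
proof (cases "y = 0")
  case True
  then show ?thesis using assms by (simp add: powr_diff)
next
  case False
  have "((\<lambda>x. x powr p) has_real_derivative p * m powr (p - 1)) (at m within {0<..})"
    using has_field_derivative_at_within[OF has_real_derivative_powr[OF assms(2)]] .
  moreover have "m \<in> interior {0<..}" "y \<in> {0<..}" "connected {0::real<..}"
    using assms False by (auto simp: interior_open)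
  ultimately have "p * m powr (p - 1) * (y - m) \<le> y powr p - m powr p"
    using convex_on_imp_above_tangent[OF powr_convex[OF assms(1)], of m y "p * m powr (p - 1)"] by blast
  then show ?thesis by simp
qed

text \<open>Stated with an extended integral so that integrability need not be checked when it is
  applied. If the right side is finite, then \<open>Y\<close> is integrable and the tangent of the
  power at the mean of the absolute value gives the bound; otherwise there is nothing to
  prove.\<close>

lemma (in prob_space) jensen_powr:
  fixes Y :: "'a \<Rightarrow> real"
  assumes [measurable]: "Y \<in> borel_measurable M" and p: "1 \<le> p"
  shows "ennreal (\<bar>\<integral>\<omega>. Y \<omega> \<partial>M\<bar> powr p) \<le> (\<integral>\<^sup>+\<omega>. ennreal (\<bar>Y \<omega>\<bar> powr p) \<partial>M)"
proof (cases "(\<integral>\<^sup>+\<omega>. ennreal (\<bar>Y \<omega>\<bar> powr p) \<partial>M) = \<infinity>")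
  case False
  have ip: "integrable M (\<lambda>\<omega>. \<bar>Y \<omega>\<bar> powr p)"
    using False by (intro integrableI_bounded) (auto simp: less_top)
  have "\<bar>y\<bar> \<le> 1 + \<bar>y\<bar> powr p" for y :: real
    using powr_above_tangent[of p 1 "\<bar>y\<bar>"] p
    by (smt (verit) mult_left_mono mult_cancel_right1 powr_one_eq_one powr_ge_zero mult_le_cancel_right1)
  then have i: "integrable M (\<lambda>\<omega>. \<bar>Y \<omega>\<bar>)"
    by (intro Bochner_Integration.integrable_bound[OF Bochner_Integration.integrable_add[OF integrable_const[of 1] ip]]) auto
  define m where "m = (\<integral>\<omega>. \<bar>Y \<omega>\<bar> \<partial>M)"
  have m: "\<bar>\<integral>\<omega>. Y \<omega> \<partial>M\<bar> \<le> m" unfolding m_def by (rule integral_abs_bound)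
  have "m powr p \<le> (\<integral>\<omega>. \<bar>Y \<omega>\<bar> powr p \<partial>M)"
  proof (cases "m = 0")
    case False
    then have mp: "m > 0" using m by linarith
    have "m powr p = (\<integral>\<omega>. m powr p + p * m powr (p - 1) * (\<bar>Y \<omega>\<bar> - m) \<partial>M)"
      using i by (simp add: prob_space m_def[symmetric])
    also have "\<dots> \<le> (\<integral>\<omega>. \<bar>Y \<omega>\<bar> powr p \<partial>M)"
      using i ip p mp by (intro integral_mono powr_above_tangent) auto
    finally show ?thesis .
  qed auto
  moreover have "\<bar>\<integral>\<omega>. Y \<omega> \<partial>M\<bar> powr p \<le> m powr p" using m p by (intro powr_mono2) auto
  ultimately show ?thesis using ip by (simp add: nn_integral_eq_integral ennreal_leI)
qed simp

lemma cell_real: "cell k (u::real) = of_int \<lfloor>2 ^ k * u\<rfloor>"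
  by (simp add: cell_def)

lemma cell_pos_real: "cell_pos k (u::real) = frac (2 ^ k * u)"
  using cell_pos_inner[of 1 k u] by simp

lemma cell_Suc_real: "cell (Suc k) (u::real) = 2 * cell k u + (if cell_pos k u < 1/2 then 0 else 1)"
proof -
  have "\<lfloor>2 * t\<rfloor> = 2 * \<lfloor>t\<rfloor> + (if frac t < 1/2 then 0 else 1)" for t :: real
    by (auto simp: frac_def floor_eq_iff) linarith+
  from this[of "2 ^ k * u"] show ?thesis unfolding cell_real cell_pos_real by (simp add: mult.assoc)
qed

lemma cell_centre_real: "cell_centre k (u::real) = (cell k u + 1/2) / 2 ^ k"
  by (simp add: cell_centre_def)

definition dyadic_slope :: "(real \<Rightarrow> real) \<Rightarrow> nat \<Rightarrow> real \<Rightarrow> real" where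
  "dyadic_slope \<phi> k u = 2 ^ k * (\<phi> ((cell k u + 1) / 2 ^ k) - \<phi> (cell k u / 2 ^ k))"

definition slope_jump :: "(real \<Rightarrow> real) \<Rightarrow> nat \<Rightarrow> real \<Rightarrow> real" where
  "slope_jump \<phi> k u = (if cell_pos k u < 1/2 then -1 else 1) * 2 ^ k * Dh2 (1 / 2 ^ Suc k) \<phi> (cell_centre k u)"

text \<open>Bisecting an interval changes the slope by a second difference at the midpoint, with
  opposite signs on the two halves. This is the source of the martingale property.\<close>

lemma dyadic_slope_Suc: "dyadic_slope \<phi> (Suc k) u = dyadic_slope \<phi> k u + slope_jump \<phi> k u"
proof -
  define c where "c = cell k u"
  have e: "cell_centre k u + 1 / 2 ^ Suc k = (c + 1) / 2 ^ k" "cell_centre k u - 1 / 2 ^ Suc k = c / 2 ^ k"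
    "(2 * c + 1) / 2 ^ Suc k = cell_centre k u" "2 * c / 2 ^ Suc k = c / 2 ^ k"
    "(2 * c + 1 + 1) / 2 ^ Suc k = (c + 1) / 2 ^ k"
    unfolding cell_centre_real c_def by (simp_all add: field_simps)
  show ?thesis
  proof (cases "cell_pos k u < 1/2")
    case True
    then have cS: "cell (Suc k) u = 2 * c" by (simp add: cell_Suc_real c_def)
    show ?thesis
      unfolding dyadic_slope_def slope_jump_def Dh2_eq cS c_def[symmetric] e
      using True by (simp add: algebra_simps)
  next
    case False
    then have cS: "cell (Suc k) u = 2 * c + 1" by (simp add: cell_Suc_real c_def)
    show ?thesis
      unfolding dyadic_slope_def slope_jump_def Dh2_eq cS c_def[symmetric] e
      using False by (simp add: algebra_simps)
  qed
qed

lemma dyadic_slope_eq_sum: "dyadic_slope \<phi> K u = dyadic_slope \<phi> 0 u + (\<Sum>k<K. slope_jump \<phi> k u)"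
  by (induction K) (auto simp: dyadic_slope_Suc)

text \<open>Division by \<open>M\<close> makes the jumps at most 1. The event depends only on the
  absolute second difference at the centre of the cell and is thus unaffected by flips at its own or
  finer levels.\<close>

lemma flip_martingale_slope:
  fixes \<phi> :: "real \<Rightarrow> real"
  assumes cont: "continuous_on UNIV \<phi>" and bd: "\<And>t. \<bar>\<phi> t\<bar> \<le> B"
    and D: "\<And>h t. \<bar>Dh2 h \<phi> t\<bar> \<le> M * \<bar>h\<bar>" and M: "M > 0"
  shows "flip_martingale cube_measure (cell_flip 1) (\<lambda>u. dyadic_slope \<phi> 0 u / M) (\<lambda>k u. slope_jump \<phi> k u / M)
    (\<lambda>k u. \<delta> / 2 ^ Suc k < \<bar>Dh2 (1 / 2 ^ Suc k) \<phi> (cell_centre k u)\<bar>)"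
proof (rule flip_martingale.intro[OF prob_space_cube_measure], unfold_locales)
  have [measurable]: "\<phi> \<in> borel_measurable borel" using cont by (rule borel_measurable_continuous_onI)
  have centre: "cell_centre j (cell_flip 1 k u) = cell_centre j u" if "j \<le> k" for j k and u :: real
    using cell_cell_flip[of 1 j k u] that by (simp add: cell_centre_def)
  show "cell_flip 1 k \<in> measurable cube_measure (cube_measure :: real measure)" for k by measurable
  show "distr cube_measure cube_measure (cell_flip (1::real) k) = cube_measure" for k
    by (rule distr_cell_flip) simp
  show "(\<lambda>u. dyadic_slope \<phi> 0 u / M) \<in> borel_measurable cube_measure"
    unfolding dyadic_slope_def by measurable
  show "\<exists>B. \<forall>\<omega>. \<bar>dyadic_slope \<phi> 0 \<omega> / M\<bar> \<le> B"
  proof (intro exI allI)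
    fix u
    have "\<bar>dyadic_slope \<phi> 0 u\<bar> \<le> 2 * B"
      unfolding dyadic_slope_def using bd[of "(cell 0 u + 1) / 2 ^ 0"] bd[of "cell 0 u / 2 ^ 0"] by simp
    then show "\<bar>dyadic_slope \<phi> 0 u / M\<bar> \<le> 2 * B / M" using M by (simp add: divide_right_mono)
  qed
  show "(\<lambda>u. slope_jump \<phi> k u / M) \<in> borel_measurable cube_measure" for k
    unfolding slope_jump_def Dh2_eq by measurable
  show "\<bar>slope_jump \<phi> k u / M\<bar> \<le> 1" for k u
  proof -
    have "\<bar>slope_jump \<phi> k u\<bar> = 2 ^ k * \<bar>Dh2 (1 / 2 ^ Suc k) \<phi> (cell_centre k u)\<bar>"
      by (simp add: slope_jump_def abs_mult)
    also have "\<dots> \<le> 2 ^ k * (M * \<bar>1 / 2 ^ Suc k\<bar>)" by (intro mult_left_mono D) auto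
    also have "\<dots> \<le> M" using M by simp
    finally show ?thesis using M by simp
  qed
  show "Measurable.pred cube_measure (\<lambda>u. \<delta> / 2 ^ Suc k < \<bar>Dh2 (1 / 2 ^ Suc k) \<phi> (cell_centre k u)\<bar>)" for k
    unfolding Dh2_eq by measurable
  show "dyadic_slope \<phi> 0 (cell_flip 1 k u) / M = dyadic_slope \<phi> 0 u / M" for k u
    unfolding dyadic_slope_def using cell_cell_flip[of "1::real" 0 k u] by simp
  show "slope_jump \<phi> k (cell_flip 1 k u) / M = - (slope_jump \<phi> k u / M)" for k u
    unfolding slope_jump_def using centre[of k k u] cell_pos_cell_flip_half[of "1::real" k u] by simp
  show "slope_jump \<phi> j (cell_flip 1 k u) / M = slope_jump \<phi> j u / M" if "j < k" for j k u
    unfolding slope_jump_def using centre[of j k u] cell_pos_cell_flip_less[of "1::real" j k u] that by simp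
  show "(\<delta> / 2 ^ Suc j < \<bar>Dh2 (1 / 2 ^ Suc j) \<phi> (cell_centre j (cell_flip 1 k u))\<bar>) =
     (\<delta> / 2 ^ Suc j < \<bar>Dh2 (1 / 2 ^ Suc j) \<phi> (cell_centre j u)\<bar>)" if "j \<le> k" for j k u
    using centre[OF that, of u] by simp
qed

text \<open>The slope over a dyadic interval is the average of the derivative \<psi> over it, that
  is, a conditional expectation. Jensen's inequality is applied on each interval, and Fubini sums
  over the intervals.\<close>

lemma nn_integral_dyadic_slope_le:
  fixes \<phi> \<psi> :: "real \<Rightarrow> real"
  assumes [measurable]: "\<phi> \<in> borel_measurable borel" "\<psi> \<in> borel_measurable borel"
    and FTC: "\<And>a b. a \<le> b \<Longrightarrow> \<phi> b - \<phi> a = (\<integral>\<tau>. indicator {a..<b} \<tau> * \<psi> \<tau> \<partial>lborel)"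
    and p: "1 \<le> p"
  shows "(\<integral>\<^sup>+u. ennreal (\<bar>dyadic_slope \<phi> K u\<bar> powr p) \<partial>cube_measure)
    \<le> (\<integral>\<^sup>+\<tau>. indicator unit_cube \<tau> * ennreal (\<bar>\<psi> \<tau>\<bar> powr p) \<partial>lborel)"
proof -
  have cell_iff: "cell K \<tau> = cell K u \<longleftrightarrow> \<tau> \<in> {cell K u / 2 ^ K..<(cell K u + 1) / 2 ^ K}" for \<tau> u :: real
    unfolding cell_real by (auto simp: floor_eq_iff field_simps)
  let ?S = "\<lambda>u \<tau>. of_bool (cell K \<tau> = cell K u) :: ennreal"
  have S1: "(\<integral>\<^sup>+\<tau>. 2 ^ K * ?S u \<tau> \<partial>lborel) = 1" for u :: real
  proof -
    have "(\<integral>\<^sup>+\<tau>. ?S u \<tau> \<partial>lborel) = ennreal (1 / 2 ^ K)"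
      using nn_integral_same_cell[of "\<lambda>_. 1" K u] emeasure_unit_cube[where 'a=real] by simp
    moreover have "(2::ennreal) ^ K = ennreal (2 ^ K)" by (simp flip: ennreal_power)
    ultimately show ?thesis by (simp add: nn_integral_cmult ennreal_mult[symmetric])
  qed
  have pt: "ennreal (\<bar>dyadic_slope \<phi> K u\<bar> powr p) \<le> (\<integral>\<^sup>+\<tau>. 2 ^ K * ?S u \<tau> * ennreal (\<bar>\<psi> \<tau>\<bar> powr p) \<partial>lborel)" for u
  proof -
    \<comment> \<open>The uniform distribution on the dyadic interval of level \<open>K\<close>
      containing \<open>u\<close>.\<close>
    define P where "P = density lborel (\<lambda>\<tau>. ennreal (2 ^ K * of_bool (cell K \<tau> = cell K u)))"
    have dens: "ennreal (2 ^ K * of_bool (cell K \<tau> = cell K u)) = 2 ^ K * ?S u \<tau>" for \<tau>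
      by (simp add: of_bool_def flip: ennreal_power)
    interpret P: prob_space P
    proof
      show "emeasure P (space P) = 1"
        unfolding P_def by (subst emeasure_density) (auto simp: dens S1)
    qed
    have sP [measurable_cong]: "sets P = sets borel" by (simp add: P_def)
    have "(\<integral>\<tau>. \<psi> \<tau> \<partial>P) = (\<integral>\<tau>. 2 ^ K * of_bool (cell K \<tau> = cell K u) * \<psi> \<tau> \<partial>lborel)"
      unfolding P_def by (subst integral_density) auto
    also have "\<dots> = 2 ^ K * (\<integral>\<tau>. indicator {cell K u / 2 ^ K..<(cell K u + 1) / 2 ^ K} \<tau> * \<psi> \<tau> \<partial>lborel)"
      by (subst integral_mult_right_zero[symmetric])
         (intro Bochner_Integration.integral_cong, auto simp: cell_iff indicator_def)
    also have "\<dots> = dyadic_slope \<phi> K u"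
      by (subst FTC[symmetric]) (auto simp: dyadic_slope_def divide_right_mono)
    finally have "ennreal (\<bar>dyadic_slope \<phi> K u\<bar> powr p) \<le> (\<integral>\<^sup>+\<tau>. ennreal (\<bar>\<psi> \<tau>\<bar> powr p) \<partial>P)"
      using P.jensen_powr[of \<psi> p] p by simp
    also have "\<dots> = (\<integral>\<^sup>+\<tau>. 2 ^ K * ?S u \<tau> * ennreal (\<bar>\<psi> \<tau>\<bar> powr p) \<partial>lborel)"
      unfolding P_def by (subst nn_integral_density) (auto simp: dens)
    finally show ?thesis .
  qed
  have [measurable]: "dyadic_slope \<phi> K \<in> borel_measurable borel" unfolding dyadic_slope_def by measurable
  have "(\<integral>\<^sup>+u. ennreal (\<bar>dyadic_slope \<phi> K u\<bar> powr p) \<partial>cube_measure)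
     = (\<integral>\<^sup>+u. indicator unit_cube u * ennreal (\<bar>dyadic_slope \<phi> K u\<bar> powr p) \<partial>lborel)"
    by (rule nn_integral_cube_measure) measurable
  also have "\<dots> \<le> (\<integral>\<^sup>+u. indicator unit_cube u * (\<integral>\<^sup>+\<tau>. 2 ^ K * ?S u \<tau> * ennreal (\<bar>\<psi> \<tau>\<bar> powr p) \<partial>lborel) \<partial>lborel)"
    using pt by (intro nn_integral_mono mult_left_mono) auto
  also have "\<dots> = (\<integral>\<^sup>+u. (\<integral>\<^sup>+\<tau>. indicator unit_cube u * (2 ^ K * ?S u \<tau> * ennreal (\<bar>\<psi> \<tau>\<bar> powr p)) \<partial>lborel) \<partial>lborel)"
    by (intro nn_integral_cong) (simp add: nn_integral_cmult)
  also have "\<dots> = (\<integral>\<^sup>+\<tau>. (\<integral>\<^sup>+u. indicator unit_cube u * (2 ^ K * ?S u \<tau> * ennreal (\<bar>\<psi> \<tau>\<bar> powr p)) \<partial>lborel) \<partial>lborel)"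
    by (rule lborel_pair.Fubini') measurable
  also have "\<dots> = (\<integral>\<^sup>+\<tau>. (\<integral>\<^sup>+u. indicator unit_cube \<tau> * ennreal (\<bar>\<psi> \<tau>\<bar> powr p) * (2 ^ K * ?S \<tau> u) \<partial>lborel) \<partial>lborel)"
  proof (intro nn_integral_cong)
    fix u \<tau> :: real
    show "indicator unit_cube u * (2 ^ K * ?S u \<tau> * ennreal (\<bar>\<psi> \<tau>\<bar> powr p))
       = indicator unit_cube \<tau> * ennreal (\<bar>\<psi> \<tau>\<bar> powr p) * (2 ^ K * ?S \<tau> u)"
      using unit_cube_cell[of K u \<tau>] by (cases "cell K u = cell K \<tau>") (auto simp: indicator_def mult_ac)
  qed
  also have "\<dots> = (\<integral>\<^sup>+\<tau>. indicator unit_cube \<tau> * ennreal (\<bar>\<psi> \<tau>\<bar> powr p) \<partial>lborel)"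
    by (intro nn_integral_cong) (simp add: nn_integral_cmult[of "\<lambda>u. 2 ^ K * ?S _ u"] S1)
  finally show ?thesis .
qed

text \<open>The constant depends on \<open>p\<close>, \<delta> and \<open>M\<close> only. It is
  independent of the sup bound \<open>B\<close>, of the function and of the number \<open>K\<close>
  of scales, so the estimate can be integrated over all parallel lines and survives the removal of
  the mollification.\<close>

lemma line_count_bound:
  fixes p \<delta> M :: real
  assumes p: "p > 1" and \<delta>: "\<delta> > 0" and M: "M > 0"
  obtains C where "C \<ge> 0"
    "\<And>\<phi> \<psi> B K. continuous_on UNIV \<phi> \<Longrightarrow> (\<And>t. \<bar>\<phi> t\<bar> \<le> B) \<Longrightarrow> (\<And>h t. \<bar>Dh2 h \<phi> t\<bar> \<le> M * \<bar>h\<bar>) \<Longrightarrow>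
      \<psi> \<in> borel_measurable borel \<Longrightarrow>
      (\<And>a b. a \<le> b \<Longrightarrow> \<phi> b - \<phi> a = (\<integral>\<tau>. indicator {a..<b} \<tau> * \<psi> \<tau> \<partial>lborel)) \<Longrightarrow>
      (\<integral>\<^sup>+u. ennreal (real (count_upto (\<lambda>k u. \<delta> / 2 ^ Suc k < \<bar>Dh2 (1 / 2 ^ Suc k) \<phi> (cell_centre k u)\<bar>) K u) powr (p / 2)) \<partial>cube_measure)
       \<le> ennreal C * (\<integral>\<^sup>+\<tau>. indicator unit_cube \<tau> * ennreal (\<bar>\<psi> \<tau>\<bar> powr p) \<partial>lborel)"
proof -
  \<comment> \<open>A counted event has a normalised jump of at least
    \<open>2^k (\<delta> / 2^(k+1)) / M\<close>, that is, \<open>\<delta> / (2 * M)\<close>.\<close>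
  have q: "p / 2 > 1/2" "\<delta> / (2 * M) > 0" using p \<delta> M by auto
  obtain C where C: "C \<ge> 0"
    and sq: "\<And>(MM :: real measure) T X0 d e K. flip_martingale MM T X0 d e \<Longrightarrow> (\<And>k \<omega>. e k \<omega> \<Longrightarrow> \<delta> / (2 * M) \<le> \<bar>d k \<omega>\<bar>) \<Longrightarrow>
       (\<integral>\<^sup>+\<omega>. ennreal (real (count_upto e K \<omega>) powr (p / 2)) \<partial>MM)
        \<le> ennreal C * (\<integral>\<^sup>+\<omega>. ennreal (\<bar>X0 \<omega> + (\<Sum>k<K. d k \<omega>)\<bar> powr (2 * (p / 2))) \<partial>MM)"
    by (rule square_function_lower[OF q, where 'b=real]) (rule that; blast)
  show ?thesis
  proof (rule that[of "C / M powr p"])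
    show "0 \<le> C / M powr p" using C by simp
    fix \<phi> \<psi> :: "real \<Rightarrow> real" and B K
    assume cont: "continuous_on UNIV \<phi>" and B: "\<And>t. \<bar>\<phi> t\<bar> \<le> B" and D: "\<And>h t. \<bar>Dh2 h \<phi> t\<bar> \<le> M * \<bar>h\<bar>"
      and [measurable]: "\<psi> \<in> borel_measurable borel"
      and FTC: "\<And>a b. a \<le> b \<Longrightarrow> \<phi> b - \<phi> a = (\<integral>\<tau>. indicator {a..<b} \<tau> * \<psi> \<tau> \<partial>lborel)"
    let ?e = "\<lambda>k u. \<delta> / 2 ^ Suc k < \<bar>Dh2 (1 / 2 ^ Suc k) \<phi> (cell_centre k u)\<bar>"
    have [measurable]: "\<phi> \<in> borel_measurable borel" using cont by (rule borel_measurable_continuous_onI)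
    have [measurable]: "dyadic_slope \<phi> K \<in> borel_measurable borel" unfolding dyadic_slope_def by measurable
    have "(\<integral>\<^sup>+u. ennreal (real (count_upto ?e K u) powr (p / 2)) \<partial>cube_measure) \<le>
       ennreal C * (\<integral>\<^sup>+u. ennreal (\<bar>dyadic_slope \<phi> 0 u / M + (\<Sum>k<K. slope_jump \<phi> k u / M)\<bar> powr (2 * (p / 2))) \<partial>cube_measure)"
    proof (rule sq[OF flip_martingale_slope[OF cont B D M]])
      fix k u assume e: "?e k u"
      have "\<bar>slope_jump \<phi> k u / M\<bar> = 2 ^ k * \<bar>Dh2 (1 / 2 ^ Suc k) \<phi> (cell_centre k u)\<bar> / M"
        using M by (simp add: slope_jump_def abs_mult)
      also have "\<dots> \<ge> 2 ^ k * (\<delta> / 2 ^ Suc k) / M"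
        using e M by (intro divide_right_mono mult_left_mono) auto
      finally show "\<delta> / (2 * M) \<le> \<bar>slope_jump \<phi> k u / M\<bar>" by simp
    qed
    also have "(\<integral>\<^sup>+u. ennreal (\<bar>dyadic_slope \<phi> 0 u / M + (\<Sum>k<K. slope_jump \<phi> k u / M)\<bar> powr (2 * (p / 2))) \<partial>cube_measure)
      = (\<integral>\<^sup>+u. ennreal (1 / M powr p) * ennreal (\<bar>dyadic_slope \<phi> K u\<bar> powr p) \<partial>cube_measure)"
    proof (intro nn_integral_cong)
      fix u
      have "dyadic_slope \<phi> 0 u / M + (\<Sum>k<K. slope_jump \<phi> k u / M) = dyadic_slope \<phi> K u / M"
        by (simp add: dyadic_slope_eq_sum[of \<phi> K] add_divide_distrib sum_divide_distrib)
      then show "ennreal (\<bar>dyadic_slope \<phi> 0 u / M + (\<Sum>k<K. slope_jump \<phi> k u / M)\<bar> powr (2 * (p / 2)))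
          = ennreal (1 / M powr p) * ennreal (\<bar>dyadic_slope \<phi> K u\<bar> powr p)"
        using M by (simp add: ennreal_mult[symmetric] powr_divide)
    qed
    also have "\<dots> = ennreal (1 / M powr p) * (\<integral>\<^sup>+u. ennreal (\<bar>dyadic_slope \<phi> K u\<bar> powr p) \<partial>cube_measure)"
      by (rule nn_integral_cmult) measurable
    also have "\<dots> \<le> ennreal (1 / M powr p) * (\<integral>\<^sup>+\<tau>. indicator unit_cube \<tau> * ennreal (\<bar>\<psi> \<tau>\<bar> powr p) \<partial>lborel)"
      using p by (intro mult_left_mono nn_integral_dyadic_slope_le FTC) auto
    finally show "(\<integral>\<^sup>+u. ennreal (real (count_upto ?e K u) powr (p / 2)) \<partial>cube_measure)
       \<le> ennreal (C / M powr p) * (\<integral>\<^sup>+\<tau>. indicator unit_cube \<tau> * ennreal (\<bar>\<psi> \<tau>\<bar> powr p) \<partial>lborel)"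
      using C by (simp add: mult.assoc[symmetric] ennreal_mult[symmetric] mult_left_mono)
  qed
qed

section \<open>Smooth bump functions\<close>

text \<open>The functions \<open>P(1/x) exp(-1/x)\<close>, extended by 0, form a class closed under
  differentiation: \<open>P\<close> becomes \<open>t^2 (P - P')\<close> in the variable
  \<open>t = 1/x\<close>. One differentiation rule thus yields all derivatives of the standard flat
  function at once.\<close>

definition flat_exp :: "real poly \<Rightarrow> real \<Rightarrow> real" where
  "flat_exp P x = (if x > 0 then poly P (1 / x) * exp (- (1 / x)) else 0)"

lemma poly_times_exp_minus_tendsto_0: "((\<lambda>t. poly P t * exp (- t)) \<longlongrightarrow> (0::real)) at_top"
proof -
  have "((\<lambda>t. \<Sum>i\<le>degree P. coeff P i * (t ^ i / exp t)) \<longlongrightarrow> (\<Sum>i\<le>degree P. coeff P i * 0)) at_top"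
    by (intro tendsto_intros tendsto_power_div_exp_0)
  moreover have "poly P t * exp (- t) = (\<Sum>i\<le>degree P. coeff P i * (t ^ i / exp t))" for t
    by (simp add: poly_altdef exp_minus sum_distrib_right divide_inverse mult.assoc)
  ultimately show ?thesis by simp
qed

lemma flat_exp_has_derivative:
  "(flat_exp P has_real_derivative flat_exp (monom 1 2 * (P - Polynomial.pderiv P)) x) (at x)"
proof -
  consider "x > 0" | "x < 0" | "x = 0" by linarith
  then show ?thesis
  proof cases
    case 1
    have "((\<lambda>x. poly P (1 / x) * exp (- (1 / x))) has_real_derivative
      flat_exp (monom 1 2 * (P - Polynomial.pderiv P)) x) (at x)"
    proof -
      have inv: "((\<lambda>x::real. 1 / x) has_real_derivative - (1 / x\<^sup>2)) (at x)"
        using 1 by (auto intro!: derivative_eq_intros simp: power2_eq_square)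
      have "((\<lambda>x. poly P (1 / x) * exp (- (1 / x))) has_real_derivative
        (poly (Polynomial.pderiv P) (1 / x) * (- (1 / x\<^sup>2))) * exp (- (1 / x))
          + (exp (- (1 / x)) * (- (- (1 / x\<^sup>2)))) * poly P (1 / x)) (at x)"
        by (intro DERIV_mult DERIV_chain2[OF poly_DERIV inv] DERIV_chain2[OF DERIV_exp DERIV_minus[OF inv]])
      then show ?thesis
        using 1 by (simp add: flat_exp_def poly_monom power_one_over algebra_simps)
    qed
    moreover have "eventually (\<lambda>y. poly P (1 / y) * exp (- (1 / y)) = flat_exp P y) (nhds x)"
    proof -
      have "eventually (\<lambda>y. y > 0) (nhds x)" using 1 eventually_nhds_top[of 0] order_tendstoD(1)[OF filterlim_ident[of "nhds x"]] by blast
      then show ?thesis by eventually_elim (simp add: flat_exp_def)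
    qed
    ultimately show ?thesis
      by (subst (asm) DERIV_cong_ev[OF refl _ refl]) auto
  next
    case 2
    have "eventually (\<lambda>y. 0 = flat_exp P y) (nhds x)"
    proof -
      have "eventually (\<lambda>y. y < 0) (nhds x)" using 2 order_tendstoD(2)[OF filterlim_ident[of "nhds x"]] by blast
      then show ?thesis by eventually_elim (simp add: flat_exp_def)
    qed
    moreover have "((\<lambda>_. 0) has_real_derivative flat_exp (monom 1 2 * (P - Polynomial.pderiv P)) x) (at x)"
      using 2 by (simp add: flat_exp_def)
    ultimately show ?thesis by (subst (asm) DERIV_cong_ev[OF refl _ refl]) auto
  next
    case 3
    have "((\<lambda>h. flat_exp P h / h) \<longlongrightarrow> 0) (at 0)"
    proof (rule filterlim_split_at)
      have "eventually (\<lambda>h. 0 = flat_exp P h / h) (at_left 0)"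
        by (auto simp: eventually_at_left_field flat_exp_def intro!: exI[of _ "-1"])
      then show "((\<lambda>h. flat_exp P h / h) \<longlongrightarrow> 0) (at_left 0)"
        by (rule Lim_transform_eventually[OF tendsto_const])
      \<comment> \<open>Division by \<open>h\<close> multiplies the polynomial in \<open>1/h\<close>
        by its variable, so the exponential still wins.\<close>
      have "((\<lambda>h. poly (monom 1 1 * P) (inverse h) * exp (- inverse h)) \<longlongrightarrow> 0) (at_right (0::real))"
        by (rule filterlim_compose[OF poly_times_exp_minus_tendsto_0 filterlim_inverse_at_top_right])
      moreover have "eventually (\<lambda>h. poly (monom 1 1 * P) (inverse h) * exp (- inverse h) = flat_exp P h / h) (at_right (0::real))"
        by (auto simp: eventually_at_right_field flat_exp_def poly_monom field_simps intro!: exI[of _ 1])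
      ultimately show "((\<lambda>h. flat_exp P h / h) \<longlongrightarrow> 0) (at_right 0)"
        by (rule Lim_transform_eventually)
    qed
    moreover have "flat_exp Q 0 = 0" for Q by (simp add: flat_exp_def)
    ultimately show ?thesis using 3 by (simp add: DERIV_def)
  qed
qed

text \<open>The m-th derivative of the product \<open>F i * G j\<close>, with the terms of the
  repeated product rule left uncollected, so that no binomial coefficients occur.\<close>

primrec leibniz_sum :: "(nat \<Rightarrow> real \<Rightarrow> real) \<Rightarrow> (nat \<Rightarrow> real \<Rightarrow> real) \<Rightarrow> nat \<Rightarrow> nat \<Rightarrow> nat \<Rightarrow> real \<Rightarrow> real" where
  "leibniz_sum F G 0 i j x = F i x * G j x"
| "leibniz_sum F G (Suc m) i j x = leibniz_sum F G m (Suc i) j x + leibniz_sum F G m i (Suc j) x"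

lemma leibniz_sum_has_derivative:
  assumes "\<And>m x. (F m has_real_derivative F (Suc m) x) (at x)" "\<And>m x. (G m has_real_derivative G (Suc m) x) (at x)"
  shows "(leibniz_sum F G m i j has_real_derivative leibniz_sum F G (Suc m) i j x) (at x)"
proof (induction m arbitrary: i j)
  case 0
  have "((\<lambda>x. F i x * G j x) has_real_derivative F (Suc i) x * G j x + G (Suc j) x * F i x) (at x)"
    by (intro DERIV_mult assms)
  moreover have "leibniz_sum F G 0 i j = (\<lambda>x. F i x * G j x)" by auto
  ultimately show ?case by (simp add: mult.commute)
next
  case (Suc m)
  have "leibniz_sum F G (Suc m) i j = (\<lambda>x. leibniz_sum F G m (Suc i) j x + leibniz_sum F G m i (Suc j) x)" by auto
  then show ?case using DERIV_add[OF Suc[of "Suc i" j] Suc[of i "Suc j"]] by simp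
qed

text \<open>\<open>test_function\<close> demands an explicit family of all iterated partial
  derivatives, so the bump comes with all its derivatives. It is a product of two flat functions,
  one vanishing left of \<open>- r\<close> and one right of \<open>r\<close>.\<close>

lemma smooth_bump:
  fixes r :: real
  assumes r: "r > 0"
  obtains \<psi> :: "nat \<Rightarrow> real \<Rightarrow> real" where "\<And>m x. (\<psi> m has_real_derivative \<psi> (Suc m) x) (at x)"
    "\<And>x. 0 \<le> \<psi> 0 x" "\<And>x. \<psi> 0 x \<noteq> 0 \<longleftrightarrow> \<bar>x\<bar> < r" "\<And>m x. r \<le> \<bar>x\<bar> \<Longrightarrow> \<psi> m x = 0"
proof -
  define P where "P = (\<lambda>m. ((\<lambda>P. monom 1 2 * (P - Polynomial.pderiv P)) ^^ m) (1 :: real poly))"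
  define F where "F = (\<lambda>m x. flat_exp (P m) (x + r))"
  define G where "G = (\<lambda>m x. (-1) ^ m * flat_exp (P m) (r - x))"
  have PS: "P (Suc m) = monom 1 2 * (P m - Polynomial.pderiv (P m))" for m by (simp add: P_def)
  have F: "(F m has_real_derivative F (Suc m) x) (at x)" for m x
  proof -
    have "((\<lambda>x. x + r) has_real_derivative 1) (at x)" by (auto intro!: derivative_eq_intros)
    from DERIV_chain2[OF flat_exp_has_derivative this, of "P m"] show ?thesis unfolding F_def PS by simp
  qed
  have G: "(G m has_real_derivative G (Suc m) x) (at x)" for m x
  proof -
    have "((\<lambda>x. r - x) has_real_derivative -1) (at x)" by (auto intro!: derivative_eq_intros)
    from DERIV_cmult[OF DERIV_chain2[OF flat_exp_has_derivative this, of "P m"], of "(-1) ^ m"]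
    show ?thesis unfolding G_def PS by simp
  qed
  have P0: "P 0 = 1" by (simp add: P_def)
  show ?thesis
  proof (rule that[of "\<lambda>m. leibniz_sum F G m 0 0"])
    show "(leibniz_sum F G m 0 0 has_real_derivative leibniz_sum F G (Suc m) 0 0 x) (at x)" for m x
      by (intro leibniz_sum_has_derivative F G)
    show "0 \<le> leibniz_sum F G 0 0 0 x" for x by (simp add: F_def G_def P0 flat_exp_def)
    show "leibniz_sum F G 0 0 0 x \<noteq> 0 \<longleftrightarrow> \<bar>x\<bar> < r" for x
      by (auto simp: F_def G_def P0 flat_exp_def)
    show "leibniz_sum F G m 0 0 x = 0" if x: "r \<le> \<bar>x\<bar>" for m x
    proof -
      have "F i x * G j x = 0" for i j
        using x by (auto simp: F_def G_def flat_exp_def)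
      then have "leibniz_sum F G m i j x = 0" for i j
        by (induction m arbitrary: i j) auto
      then show ?thesis .
    qed
  qed
qed

lemma product_has_partial_derivative:
  fixes x i :: "'a::euclidean_space"
  assumes i: "i \<in> Basis" and P: "\<And>s. (F i has_real_derivative F' s) (at s)"
  shows "((\<lambda>t. \<Prod>b\<in>Basis. F b ((x + t *\<^sub>R i) \<bullet> b)) has_real_derivative
     F' (x \<bullet> i) * (\<Prod>b\<in>Basis - {i}. F b (x \<bullet> b))) (at 0)"
proof -
  have "((\<lambda>t. F i (x \<bullet> i + t) * (\<Prod>b\<in>Basis - {i}. F b (x \<bullet> b))) has_real_derivative
     F' (x \<bullet> i) * (\<Prod>b\<in>Basis - {i}. F b (x \<bullet> b))) (at 0)"
  proof (rule DERIV_cmult_right)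
    have "((\<lambda>t. x \<bullet> i + t) has_real_derivative 1) (at 0)" by (auto intro!: derivative_eq_intros)
    from DERIV_chain2[OF _ this, of "F i" "F' (x \<bullet> i)"] P[of "x \<bullet> i"]
    show "((\<lambda>t. F i (x \<bullet> i + t)) has_real_derivative F' (x \<bullet> i)) (at 0)" by simp
  qed
  moreover have "(\<Prod>b\<in>Basis. F b ((x + t *\<^sub>R i) \<bullet> b)) = F i (x \<bullet> i + t) * (\<Prod>b\<in>Basis - {i}. F b (x \<bullet> b))" for t
  proof -
    have "(\<Prod>b\<in>Basis. F b ((x + t *\<^sub>R i) \<bullet> b)) = F i ((x + t *\<^sub>R i) \<bullet> i) * (\<Prod>b\<in>Basis - {i}. F b ((x + t *\<^sub>R i) \<bullet> b))"
      using i by (intro prod.remove) auto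
    also have "(\<Prod>b\<in>Basis - {i}. F b ((x + t *\<^sub>R i) \<bullet> b)) = (\<Prod>b\<in>Basis - {i}. F b (x \<bullet> b))"
      using i by (intro prod.cong) (auto simp: inner_add_left inner_Basis)
    finally show ?thesis using i by (simp add: inner_add_left)
  qed
  ultimately show ?thesis by simp
qed

lemma product_test_function:
  fixes P :: "'a::euclidean_space \<Rightarrow> nat \<Rightarrow> real \<Rightarrow> real"
  assumes P: "\<And>b m s. (P b m has_real_derivative P b (Suc m) s) (at s)"
    and R: "\<And>b s. b \<in> Basis \<Longrightarrow> R < \<bar>s\<bar> \<Longrightarrow> P b 0 s = 0"
  shows "test_function (\<lambda>y. \<Prod>b\<in>Basis. P b 0 (y \<bullet> b))"
    and "i \<in> Basis \<Longrightarrow> pderiv_dir i (\<lambda>y. \<Prod>b\<in>Basis. P b 0 (y \<bullet> b)) y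
      = P i 1 (y \<bullet> i) * (\<Prod>b\<in>Basis - {i}. P b 0 (y \<bullet> b))"
proof -
  let ?f = "\<lambda>y. \<Prod>b\<in>Basis. P b 0 (y \<bullet> b)"
  \<comment> \<open>For a product of functions of one coordinate each, an iterated partial
    derivative depends only on how often every basis vector occurs in the list.\<close>
  define D where "D = (\<lambda>\<alpha> y. \<Prod>b\<in>Basis. P b (count_list \<alpha> b) (y \<bullet> b))"
  have contP: "continuous_on UNIV (P b m)" for b m
    using P by (meson DERIV_isCont continuous_at_imp_continuous_on)
  have "compact (closure {y. ?f y \<noteq> 0})"
  proof -
    have "norm y \<le> real DIM('a) * \<bar>R\<bar>" if "?f y \<noteq> 0" for y
    proof -
      have "\<bar>y \<bullet> b\<bar> \<le> \<bar>R\<bar>" if "b \<in> Basis" for b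
        using R[OF that, of "y \<bullet> b"] \<open>?f y \<noteq> 0\<close> that by (force simp: not_le[symmetric])
      then have "(\<Sum>b\<in>Basis. \<bar>y \<bullet> b\<bar>) \<le> (\<Sum>b\<in>(Basis::'a set). \<bar>R\<bar>)" by (intro sum_mono)
      then show ?thesis using norm_le_l1[of y] by simp
    qed
    then have "bounded {y. ?f y \<noteq> 0}" by (auto simp: bounded_iff)
    then show ?thesis by simp
  qed
  moreover have "D [] = ?f" by (simp add: D_def)
  moreover have "continuous_on UNIV (D \<alpha>)" for \<alpha>
    unfolding D_def by (intro continuous_on_prod continuous_on_compose2[OF contP] continuous_intros) auto
  moreover have "((\<lambda>t. D \<alpha> (x + t *\<^sub>R i)) has_real_derivative D (i # \<alpha>) x) (at 0)" if i: "i \<in> Basis" for \<alpha> i x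
  proof -
    have "D (i # \<alpha>) x = P i (Suc (count_list \<alpha> i)) (x \<bullet> i) * (\<Prod>b\<in>Basis - {i}. P b (count_list (i # \<alpha>) b) (x \<bullet> b))"
      unfolding D_def using i by (subst prod.remove[of _ i]) auto
    also have "(\<Prod>b\<in>Basis - {i}. P b (count_list (i # \<alpha>) b) (x \<bullet> b)) = (\<Prod>b\<in>Basis - {i}. P b (count_list \<alpha> b) (x \<bullet> b))"
      by (intro prod.cong) auto
    finally show ?thesis
      unfolding D_def using product_has_partial_derivative[OF i, of "\<lambda>b. P b (count_list \<alpha> b)", OF P, of x] by simp
  qed
  ultimately show "test_function ?f" unfolding test_function_def by blast
  show "pderiv_dir i ?f y = P i 1 (y \<bullet> i) * (\<Prod>b\<in>Basis - {i}. P b 0 (y \<bullet> b))" if i: "i \<in> Basis"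
    unfolding pderiv_dir_def
    using product_has_partial_derivative[OF i, of "\<lambda>b. P b 0", OF P, of y] by (simp add: DERIV_imp_deriv)
qed

section \<open>Weak derivatives and mollification\<close>

lemma test_function_support:
  assumes "test_function \<phi>"
  shows "continuous_on UNIV \<phi>" and "i \<in> Basis \<Longrightarrow> continuous_on UNIV (pderiv_dir i \<phi>)"
    and "i \<in> Basis \<Longrightarrow> ((\<lambda>t. \<phi> (x + t *\<^sub>R i)) has_real_derivative pderiv_dir i \<phi> x) (at 0)"
    and "\<exists>R. (\<forall>x. R < norm x \<longrightarrow> \<phi> x = 0) \<and> (\<forall>i\<in>Basis. \<forall>x. R < norm x \<longrightarrow> pderiv_dir i \<phi> x = 0)"
proof -
  obtain D :: "'a list \<Rightarrow> 'a \<Rightarrow> real" where D0: "D [] = \<phi>" and Dc: "\<And>\<alpha>. continuous_on UNIV (D \<alpha>)"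
    and Dd: "\<And>\<alpha> i x. i \<in> Basis \<Longrightarrow> ((\<lambda>t. D \<alpha> (x + t *\<^sub>R i)) has_real_derivative D (i # \<alpha>) x) (at 0)"
    and cpt: "compact (closure {x. \<phi> x \<noteq> 0})"
    using assms unfolding test_function_def by blast
  have eq: "pderiv_dir i \<phi> x = D [i] x" if "i \<in> Basis" for i x
    unfolding pderiv_dir_def using Dd[OF that, of "[]" x] by (simp add: D0 DERIV_imp_deriv)
  show "continuous_on UNIV \<phi>" using Dc[of "[]"] by (simp add: D0)
  show "continuous_on UNIV (pderiv_dir i \<phi>)" if "i \<in> Basis"
    using Dc[of "[i]"] eq[OF that] by (metis ext)
  show "((\<lambda>t. \<phi> (x + t *\<^sub>R i)) has_real_derivative pderiv_dir i \<phi> x) (at 0)" if "i \<in> Basis" for i x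
    using Dd[OF that, of "[]" x] eq[OF that] by (simp add: D0)
  then have der: "((\<lambda>t. \<phi> (x + t *\<^sub>R i)) has_real_derivative pderiv_dir i \<phi> x) (at 0)" if "i \<in> Basis" for i x
    using that by blast
  have "bounded {x. \<phi> x \<noteq> 0}"
    using cpt bounded_subset[OF compact_imp_bounded closure_subset] by blast
  then obtain R where R: "\<And>x. \<phi> x \<noteq> 0 \<Longrightarrow> norm x \<le> R" by (auto simp: bounded_iff)
  have "pderiv_dir i \<phi> x = 0" if i: "i \<in> Basis" and x: "R < norm x" for i x
  proof -
    have "((\<lambda>t::real. norm (x + t *\<^sub>R i)) \<longlongrightarrow> norm (x + 0 *\<^sub>R i)) (nhds 0)"
      by (intro tendsto_intros filterlim_ident)
    then have "eventually (\<lambda>t. R < norm (x + t *\<^sub>R i)) (nhds 0)" using x order_tendstoD(1) by fastforce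
    then have "eventually (\<lambda>t. \<phi> (x + t *\<^sub>R i) = 0) (nhds 0)"
      by eventually_elim (use R in force)
    then have "((\<lambda>t. \<phi> (x + t *\<^sub>R i)) has_real_derivative 0) (at 0)"
      by (subst DERIV_cong_ev[OF refl _ refl]) auto
    then show ?thesis using DERIV_unique[OF der[OF i, of x]] by blast
  qed
  then show "\<exists>R. (\<forall>x. R < norm x \<longrightarrow> \<phi> x = 0) \<and> (\<forall>i\<in>Basis. \<forall>x. R < norm x \<longrightarrow> pderiv_dir i \<phi> x = 0)"
    using R by (intro exI[of _ R]) force
qed

lemma integrable_bounded_support:
  fixes f :: "'a::euclidean_space \<Rightarrow> real"
  assumes [measurable]: "f \<in> borel_measurable borel" and K: "\<And>x. \<bar>f x\<bar> \<le> K" and R: "\<And>x. R < norm x \<Longrightarrow> f x = 0"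
  shows "integrable lborel f"
proof (rule Bochner_Integration.integrable_bound)
  have "emeasure lborel (cball (0::'a) R) < \<infinity>" by (intro emeasure_bounded_finite bounded_cball)
  then show "integrable lborel (\<lambda>x::'a. K * indicator (cball 0 R) x :: real)"
    by (intro integrable_mult_right integrable_real_indicator) auto
  show "AE x in lborel. norm (f x) \<le> norm (K * indicator (cball 0 R) x :: real)"
  proof (intro AE_I2)
    fix x
    have "0 \<le> K" using K[of x] by linarith
    then show "norm (f x) \<le> norm (K * indicator (cball 0 R) x :: real)"
      using K[of x] R[of x] by (auto simp: indicator_def not_le)
  qed
qed simp

lemma lborel_integral_reflect:
  fixes f :: "'a::euclidean_space \<Rightarrow> real"
  assumes [measurable]: "f \<in> borel_measurable borel"
  shows "(\<integral>x. f (t - x) \<partial>lborel) = (\<integral>x. f x \<partial>lborel)"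
  by (subst (2) lborel_affine[of "-1" t]) (simp_all add: density_1 integral_distr)

text \<open>\<open>Lp\<close> is defined through Lebesgue measurability, whereas the Fubini
  arguments below require Borel functions. Changing the function on a null set affects neither its
  norm nor its integrals against test functions.\<close>

lemma Lp_borel_version:
  fixes g :: "'a::euclidean_space \<Rightarrow> real"
  assumes "g \<in> Lp p"
  obtains v where "v \<in> borel_measurable borel" "AE x in lborel. g x = v x"
    "(\<integral>\<^sup>+x. ennreal (\<bar>v x\<bar> powr p) \<partial>lborel) < \<infinity>"
proof -
  have g: "g \<in> borel_measurable lebesgue" "integrable lebesgue (\<lambda>x. \<bar>g x\<bar> powr p)"
    using assms by (auto simp: Lp_def)
  obtain v where v: "v \<in> borel_measurable lborel" "AE x in lborel. g x = v x"
    using completion_ex_borel_measurable_real[OF g(1)] by auto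
  have "(\<integral>\<^sup>+x. ennreal (\<bar>v x\<bar> powr p) \<partial>lborel) = (\<integral>\<^sup>+x. ennreal (\<bar>g x\<bar> powr p) \<partial>lborel)"
    using v(2) by (intro nn_integral_cong_AE) auto
  also have "\<dots> = (\<integral>\<^sup>+x. ennreal (\<bar>g x\<bar> powr p) \<partial>lebesgue)" by (simp add: nn_integral_completion)
  also have "\<dots> < \<infinity>" using g(2) by (simp add: nn_integral_eq_integral)
  finally show ?thesis using that[of v] v by simp
qed

lemma W1p_borel_derivative:
  fixes g :: "'a::euclidean_space \<Rightarrow> real"
  assumes g: "g \<in> W1p p" and [measurable]: "g \<in> borel_measurable borel" and i: "i \<in> Basis"
  obtains v where "v \<in> borel_measurable borel" "(\<integral>\<^sup>+x. ennreal (\<bar>v x\<bar> powr p) \<partial>lborel) < \<infinity>"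
    "\<And>\<phi>. test_function \<phi> \<Longrightarrow> (\<integral>x. g x * pderiv_dir i \<phi> x \<partial>lborel) = - (\<integral>x. v x * \<phi> x \<partial>lborel)"
proof -
  obtain v' where v': "v' \<in> Lp p" "weak_pderiv i g v'" using g i by (auto simp: W1p_def)
  obtain v where v [measurable]: "v \<in> borel_measurable borel" and ae: "AE x in lborel. v' x = v x"
    and fin: "(\<integral>\<^sup>+x. ennreal (\<bar>v x\<bar> powr p) \<partial>lborel) < \<infinity>" using Lp_borel_version[OF v'(1)] by blast
  show ?thesis
  proof (rule that[OF v fin])
    fix \<phi> :: "'a \<Rightarrow> real" assume \<phi>: "test_function \<phi>"
    have [measurable]: "\<phi> \<in> borel_measurable borel" "pderiv_dir i \<phi> \<in> borel_measurable borel"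
      using test_function_support[OF \<phi>] i by (auto intro: borel_measurable_continuous_onI)
    have "(\<integral>x. g x * pderiv_dir i \<phi> x \<partial>lborel) = (\<integral>x. g x * pderiv_dir i \<phi> x \<partial>lebesgue)"
      by (rule integral_completion[symmetric]) simp
    also have "\<dots> = - (\<integral>x. v' x * \<phi> x \<partial>lebesgue)" using v'(2) \<phi> by (simp add: weak_pderiv_def)
    also have "(\<integral>x. v' x * \<phi> x \<partial>lebesgue) = (\<integral>x. v x * \<phi> x \<partial>lebesgue)"
    proof (rule integral_cong_AE)
      show "(\<lambda>x. v' x * \<phi> x) \<in> borel_measurable lebesgue"
        using v'(1) by (intro borel_measurable_times) (auto simp: Lp_def measurable_completion)
      show "(\<lambda>x. v x * \<phi> x) \<in> borel_measurable lebesgue" by (intro measurable_completion) simp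
      show "AE x in lebesgue. v' x * \<phi> x = v x * \<phi> x" using AE_completion[OF ae] by auto
    qed
    also have "\<dots> = (\<integral>x. v x * \<phi> x \<partial>lborel)" by (rule integral_completion) simp
    finally show "(\<integral>x. g x * pderiv_dir i \<phi> x \<partial>lborel) = - (\<integral>x. v x * \<phi> x \<partial>lborel)" .
  qed
qed

text \<open>\<open>G\<close> is the average of translates of \<open>g\<close> against a probability
  density, so the sup bound and the Zygmund constant are inherited, and \<open>V\<close> is the same
  average of the weak derivative in direction \<open>w\<close>. Jensen bounds the norm of
  \<open>V\<close> by that of the weak derivative, uniformly in the radius \<open>r\<close>. In
  contrast to \<open>g\<close>, the mollification satisfies the fundamental theorem of calculus on
  every single line, which the one-dimensional estimate requires.\<close>

lemma mollify:
  fixes g :: "'a::euclidean_space \<Rightarrow> real" and v :: "'a \<Rightarrow> 'a \<Rightarrow> real" and w :: 'a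
  assumes r: "r > 0" and p: "p \<ge> 1"
    and cont: "continuous_on UNIV g" and B: "\<And>x. \<bar>g x\<bar> \<le> B" and D: "\<And>x h. \<bar>Dh2 h g x\<bar> \<le> M * norm h"
    and v [measurable]: "\<And>i. i \<in> Basis \<Longrightarrow> v i \<in> borel_measurable borel"
    and vp: "\<And>i. i \<in> Basis \<Longrightarrow> (\<integral>\<^sup>+x. ennreal (\<bar>v i x\<bar> powr p) \<partial>lborel) < \<infinity>"
    and weak: "\<And>i \<phi>. i \<in> Basis \<Longrightarrow> test_function \<phi> \<Longrightarrow> (\<integral>x. g x * pderiv_dir i \<phi> x \<partial>lborel) = - (\<integral>x. v i x * \<phi> x \<partial>lborel)"
  obtains G V where "continuous_on UNIV G" "\<And>x. \<bar>G x\<bar> \<le> B" "\<And>x h. \<bar>Dh2 h G x\<bar> \<le> M * norm h"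
    "\<And>x \<epsilon>. (\<And>z. norm z \<le> real DIM('a) * r \<Longrightarrow> \<bar>g (x - z) - g x\<bar> \<le> \<epsilon>) \<Longrightarrow> \<bar>G x - g x\<bar> \<le> \<epsilon>"
    "V \<in> borel_measurable borel"
    "(\<integral>\<^sup>+x. ennreal (\<bar>V x\<bar> powr p) \<partial>lborel) \<le> (\<integral>\<^sup>+x. ennreal (\<bar>\<Sum>i\<in>Basis. (w \<bullet> i) * v i x\<bar> powr p) \<partial>lborel)"
    "\<And>x a b. a \<le> b \<Longrightarrow> G (x + b *\<^sub>R w) - G (x + a *\<^sub>R w) = (\<integral>\<tau>. indicator {a..<b} \<tau> * V (x + \<tau> *\<^sub>R w) \<partial>lborel)"
proof -
  obtain \<psi> :: "nat \<Rightarrow> real \<Rightarrow> real" where \<psi>': "\<And>m x. (\<psi> m has_real_derivative \<psi> (Suc m) x) (at x)"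
    and \<psi>0: "\<And>x. 0 \<le> \<psi> 0 x" and \<psi>_iff: "\<And>x. \<psi> 0 x \<noteq> 0 \<longleftrightarrow> \<bar>x\<bar> < r"
    and \<psi>_out: "\<And>m x. r \<le> \<bar>x\<bar> \<Longrightarrow> \<psi> m x = 0"
    using smooth_bump[OF r] by blast
  have \<psi>c: "continuous_on UNIV (\<psi> m)" for m
    using \<psi>' by (meson DERIV_isCont continuous_at_imp_continuous_on)
  have [measurable]: "\<psi> m \<in> borel_measurable borel" for m
    using \<psi>c by (rule borel_measurable_continuous_onI)
  have [measurable]: "g \<in> borel_measurable borel" using cont by (rule borel_measurable_continuous_onI)
  define \<Psi> where "\<Psi> = (\<lambda>z::'a. \<Prod>b\<in>Basis. \<psi> 0 (z \<bullet> b))"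
  define \<Psi>' where "\<Psi>' = (\<lambda>i (z::'a). \<psi> 1 (z \<bullet> i) * (\<Prod>b\<in>Basis - {i}. \<psi> 0 (z \<bullet> b)))"
  define \<Theta> where "\<Theta> = (\<lambda>z. \<Sum>i\<in>Basis. (w \<bullet> i) * \<Psi>' i z)"
  have \<Psi>c: "continuous_on UNIV \<Psi>" "continuous_on UNIV \<Theta>"
    unfolding \<Psi>_def \<Psi>'_def \<Theta>_def
    by (intro continuous_intros continuous_on_compose2[OF \<psi>c] | simp)+
  have [measurable]: "\<Psi> \<in> borel_measurable borel" "\<Theta> \<in> borel_measurable borel" "\<Psi>' i \<in> borel_measurable borel" for i
    unfolding \<Psi>_def \<Psi>'_def \<Theta>_def by measurable
  have large: "\<exists>b\<in>Basis. r \<le> \<bar>z \<bullet> b\<bar>" if "real DIM('a) * r < norm z" for z :: 'a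
  proof (rule ccontr)
    assume "\<not> ?thesis"
    then have "(\<Sum>b\<in>Basis. \<bar>z \<bullet> b\<bar>) \<le> (\<Sum>b\<in>(Basis::'a set). r)" by (intro sum_mono) force
    then show False using that norm_le_l1[of z] by simp
  qed
  have out: "\<Psi> z = 0" "\<And>i. i \<in> Basis \<Longrightarrow> \<Psi>' i z = 0" "\<Theta> z = 0" if z: "real DIM('a) * r < norm z" for z
  proof -
    obtain b where b: "b \<in> Basis" "r \<le> \<bar>z \<bullet> b\<bar>" using large[OF z] by blast
    then show "\<Psi> z = 0" unfolding \<Psi>_def using \<psi>_out by (intro prod_zero) auto
    show \<Psi>': "\<Psi>' i z = 0" if "i \<in> Basis" for i
    proof (cases "i = b")
      case True
      then show ?thesis using \<psi>_out[OF b(2), of 1] by (simp add: \<Psi>'_def)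
    next
      case False
      then have "(\<Prod>b\<in>Basis - {i}. \<psi> 0 (z \<bullet> b)) = 0" using b \<psi>_out by (intro prod_zero) auto
      then show ?thesis by (simp add: \<Psi>'_def)
    qed
    show "\<Theta> z = 0" unfolding \<Theta>_def using \<Psi>' by simp
  qed
  have bdd: "\<exists>K. \<forall>z. \<bar>F z\<bar> \<le> K" if "continuous_on UNIV F" "\<And>z. real DIM('a) * r < norm z \<Longrightarrow> F z = 0" for F :: "'a \<Rightarrow> real"
  proof -
    have "compact (F ` cball 0 (real DIM('a) * r))"
      using that(1) by (intro compact_continuous_image) (auto intro: continuous_on_subset)
    then have "bounded (F ` cball 0 (real DIM('a) * r))" by (rule compact_imp_bounded)
    then obtain K where K: "\<And>z. norm z \<le> real DIM('a) * r \<Longrightarrow> \<bar>F z\<bar> \<le> K"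
      unfolding bounded_iff by force
    have "\<bar>F z\<bar> \<le> \<bar>K\<bar>" for z using K[of z] that(2)[of z] by (cases "norm z \<le> real DIM('a) * r") auto
    then show ?thesis by blast
  qed
  obtain K where K: "\<And>z. \<bar>\<Psi> z\<bar> \<le> K" using bdd[OF \<Psi>c(1) out(1)] by blast
  obtain K' where K': "\<And>z. \<bar>\<Theta> z\<bar> \<le> K'" using bdd[OF \<Psi>c(2) out(3)] by blast
  have \<Psi>0: "0 \<le> \<Psi> z" for z unfolding \<Psi>_def by (intro prod_nonneg) (use \<psi>0 in auto)
  have iY: "integrable lborel \<Psi>" using K out(1) by (intro integrable_bounded_support) auto
  define c where "c = (\<integral>z. \<Psi> z \<partial>lborel)"
  have c: "c > 0"
  proof -
    have "c \<noteq> 0"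
    proof
      assume "c = 0"
      then have "AE z in lborel. \<Psi> z = 0"
        unfolding c_def using iY \<Psi>0 by (subst (asm) integral_nonneg_eq_0_iff_AE) auto
      then have "AE z in lborel. z \<notin> box (- r *\<^sub>R One) (r *\<^sub>R One :: 'a)"
      proof eventually_elim
        case (elim z)
        show ?case
        proof
          assume "z \<in> box (- r *\<^sub>R One) (r *\<^sub>R One)"
          then have "\<bar>z \<bullet> b\<bar> < r" if "b \<in> Basis" for b using that by (auto simp: mem_box abs_less_iff)
          then have "\<Psi> z \<noteq> 0" unfolding \<Psi>_def using \<psi>_iff by simp
          then show False using elim by simp
        qed
      qed
      then have "emeasure lborel (box (- r *\<^sub>R One) (r *\<^sub>R One :: 'a)) = 0"
        by (subst (asm) AE_iff_measurable[where N="box (- r *\<^sub>R One) (r *\<^sub>R One)"]) auto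
      moreover have "emeasure lborel (box (- r *\<^sub>R One) (r *\<^sub>R One :: 'a)) = ennreal (\<Prod>b\<in>Basis. (r *\<^sub>R One - - r *\<^sub>R One :: 'a) \<bullet> b)"
        using r by (intro emeasure_lborel_box) auto
      moreover have "(\<Prod>b\<in>Basis. (r *\<^sub>R One - - r *\<^sub>R One :: 'a) \<bullet> b) > 0"
        using r by (intro prod_pos) (auto simp: inner_diff_left inner_add_left)
      ultimately show False by (metis ennreal_eq_0_iff not_le)
    qed
    moreover have "0 \<le> c" unfolding c_def using \<Psi>0 by simp
    ultimately show ?thesis by simp
  qed
  define P where "P = density lborel (\<lambda>z. ennreal (\<Psi> z / c))"
  have sP [measurable_cong, simp]: "sets P = sets borel" "space P = UNIV" by (simp_all add: P_def)
  interpret P: prob_space P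
  proof
    have "emeasure P (space P) = (\<integral>\<^sup>+z. ennreal (\<Psi> z / c) \<partial>lborel)"
      unfolding P_def by (subst emeasure_density) auto
    also have "\<dots> = ennreal (\<integral>z. \<Psi> z / c \<partial>lborel)"
      using iY \<Psi>0 c by (intro nn_integral_eq_integral) auto
    also have "\<dots> = 1" using c by (simp add: c_def)
    finally show "emeasure P (space P) = 1" .
  qed
  have P1: "P.prob UNIV = 1" and P1e: "emeasure P UNIV = 1"
    using P.prob_space P.emeasure_space_1 by simp_all
  have int_P: "(\<integral>z. F (x - z) \<partial>P) = (\<integral>y. F y * \<Psi> (x - y) \<partial>lborel) / c" if [measurable]: "F \<in> borel_measurable borel" for F :: "'a \<Rightarrow> real" and x
  proof -
    have "(\<integral>z. F (x - z) \<partial>P) = (\<integral>z. (\<Psi> z / c) * F (x - z) \<partial>lborel)"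
      unfolding P_def using \<Psi>0 c by (subst integral_density) auto
    also have "\<dots> = (\<integral>y. (\<Psi> (x - y) / c) * F (x - (x - y)) \<partial>lborel)"
      by (rule lborel_integral_reflect[symmetric]) simp
    also have "\<dots> = (\<integral>y. F y * \<Psi> (x - y) / c \<partial>lborel)" by (intro Bochner_Integration.integral_cong) auto
    also have "\<dots> = (\<integral>y. F y * \<Psi> (x - y) \<partial>lborel) / c" by simp
    finally show ?thesis .
  qed
  define vw where "vw = (\<lambda>x. \<Sum>i\<in>Basis. (w \<bullet> i) * v i x)"
  have [measurable]: "vw \<in> borel_measurable borel" unfolding vw_def by measurable
  define G where "G = (\<lambda>x. \<integral>z. g (x - z) \<partial>P)"
  define V where "V = (\<lambda>x. \<integral>z. vw (x - z) \<partial>P)"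
  have ig: "integrable P (\<lambda>z. g (x - z))" for x
    using B by (intro P.integrable_const_bound[where B=B]) auto
  have cG: "continuous_on UNIV G"
  proof -
    have "isCont G x" for x
      unfolding continuous_at_sequentially
    proof (intro allI impI)
      fix s :: "nat \<Rightarrow> 'a" assume s: "s \<longlonglongrightarrow> x"
      have "(\<lambda>n. \<integral>z. g (s n - z) \<partial>P) \<longlonglongrightarrow> (\<integral>z. g (x - z) \<partial>P)"
      proof (rule integral_dominated_convergence[where w="\<lambda>_. B"])
        show "AE z in P. (\<lambda>n. g (s n - z)) \<longlonglongrightarrow> g (x - z)"
          using cont s by (intro AE_I2 isCont_tendsto_compose[of _ g] tendsto_intros) (auto simp: continuous_on_eq_continuous_at)
        show "AE z in P. norm (g (s n - z)) \<le> B" for n using B by simp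
      qed auto
      then show "(G \<circ> s) \<longlonglongrightarrow> G x" by (simp add: G_def comp_def)
    qed
    then show ?thesis by (simp add: continuous_on_eq_continuous_at)
  qed
  have avg: "\<bar>\<integral>z. F z \<partial>P\<bar> \<le> b" if "F \<in> borel_measurable borel" "AE z in P. \<bar>F z\<bar> \<le> b" for F :: "'a \<Rightarrow> real" and b
  proof -
    have "\<bar>\<integral>z. F z \<partial>P\<bar> \<le> (\<integral>z. \<bar>F z\<bar> \<partial>P)" by (rule integral_abs_bound)
    also have "\<dots> \<le> (\<integral>z. b \<partial>P)"
    proof (rule integral_mono_AE)
      show "integrable P (\<lambda>z. \<bar>F z\<bar>)" using that by (intro P.integrable_const_bound[where B=b]) auto
    qed (use that in auto)
    finally show ?thesis by (simp add: P1)
  qed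
  have B': "\<bar>G x\<bar> \<le> B" for x unfolding G_def using B by (intro avg) auto
  have D': "\<bar>Dh2 h G x\<bar> \<le> M * norm h" for x h
  proof -
    have "Dh2 h G x = (\<integral>z. Dh2 h g (x - z) \<partial>P)"
      unfolding Dh2_eq G_def using ig[of "x + h"] ig[of x] ig[of "x - h"]
      by (simp add: algebra_simps)
    then show ?thesis using D by (auto intro!: avg simp: Dh2_eq)
  qed
  have app: "\<bar>G x - g x\<bar> \<le> \<epsilon>" if \<epsilon>: "\<And>z. norm z \<le> real DIM('a) * r \<Longrightarrow> \<bar>g (x - z) - g x\<bar> \<le> \<epsilon>" for x \<epsilon>
  proof -
    have "G x - g x = (\<integral>z. g (x - z) - g x \<partial>P)"
      unfolding G_def using ig[of x] by (simp add: P1)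
    also have "\<bar>\<dots>\<bar> \<le> \<epsilon>"
    proof (rule avg)
      have "AE z in lborel. 0 < ennreal (\<Psi> z / c) \<longrightarrow> \<bar>g (x - z) - g x\<bar> \<le> \<epsilon>"
        using \<epsilon> out(1) by (intro AE_I2) (metis div_0 ennreal_0 less_irrefl not_le)
      then show "AE z in P. \<bar>g (x - z) - g x\<bar> \<le> \<epsilon>" unfolding P_def by (subst AE_density) auto
    qed simp
    finally show ?thesis .
  qed
  have mV: "V \<in> borel_measurable borel"
    unfolding V_def by measurable
  have Vp: "(\<integral>\<^sup>+x. ennreal (\<bar>V x\<bar> powr p) \<partial>lborel) \<le> (\<integral>\<^sup>+x. ennreal (\<bar>vw x\<bar> powr p) \<partial>lborel)"
  proof -
    interpret pair_sigma_finite lborel P ..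
    have "(\<integral>\<^sup>+x. ennreal (\<bar>V x\<bar> powr p) \<partial>lborel) \<le> (\<integral>\<^sup>+x. (\<integral>\<^sup>+z. ennreal (\<bar>vw (x - z)\<bar> powr p) \<partial>P) \<partial>lborel)"
      unfolding V_def using p by (intro nn_integral_mono P.jensen_powr) auto
    also have "\<dots> = (\<integral>\<^sup>+z. (\<integral>\<^sup>+x. ennreal (\<bar>vw (x - z)\<bar> powr p) \<partial>lborel) \<partial>P)"
      by (rule Fubini'[symmetric]) measurable
    also have "\<dots> = (\<integral>\<^sup>+z. (\<integral>\<^sup>+x. ennreal (\<bar>vw x\<bar> powr p) \<partial>lborel) \<partial>P)"
      using nn_integral_lborel_shift[of "\<lambda>x. ennreal (\<bar>vw x\<bar> powr p)" "- z" for z] by simp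
    finally show ?thesis by (simp add: P1e)
  qed
  \<comment> \<open>The derivative is moved onto the kernel by testing each weak derivative with
    \<open>y\<close> mapped to \<open>\<Psi> (x - y)\<close>.\<close>
  have V_eq: "V x = (\<integral>y. g y * \<Theta> (x - y) \<partial>lborel) / c" for x
  proof -
    have i1: "integrable lborel (\<lambda>y. v i y * \<Psi> (x - y))" if i: "i \<in> Basis" for i
    proof -
      note v[OF i, measurable]
      have "integrable lborel (\<lambda>y. \<bar>v i y\<bar> powr p)"
        using vp[OF i] by (intro integrableI_bounded) auto
      moreover have "integrable lborel (\<lambda>y. \<Psi> (x - y))"
      proof (rule integrable_bounded_support[where K=K and R="norm x + real DIM('a) * r"])
        fix y :: 'a assume "norm x + real DIM('a) * r < norm y"
        then show "\<Psi> (x - y) = 0" using norm_triangle_ineq2[of y x] by (intro out) (simp add: norm_minus_commute)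
      qed (use K in auto)
      ultimately have "integrable lborel (\<lambda>y. \<Psi> (x - y) + K * \<bar>v i y\<bar> powr p)" by simp
      then show ?thesis
      proof (rule Bochner_Integration.integrable_bound)
        show "AE y in lborel. norm (v i y * \<Psi> (x - y)) \<le> norm (\<Psi> (x - y) + K * \<bar>v i y\<bar> powr p)"
        proof (rule AE_I2)
          fix y
          have "\<bar>v i y\<bar> \<le> 1 + \<bar>v i y\<bar> powr p"
          proof (cases "\<bar>v i y\<bar> \<le> 1")
            case False
            then have "\<bar>v i y\<bar> powr 1 \<le> \<bar>v i y\<bar> powr p" using p by (intro powr_mono) auto
            then show ?thesis by simp
          qed (use powr_ge_zero[of "\<bar>v i y\<bar>" p] in linarith)
          then have "\<bar>v i y\<bar> * \<Psi> (x - y) \<le> (1 + \<bar>v i y\<bar> powr p) * \<Psi> (x - y)"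
            using \<Psi>0 by (intro mult_right_mono) auto
          also have "\<dots> \<le> \<Psi> (x - y) + K * \<bar>v i y\<bar> powr p"
            using mult_right_mono[of "\<Psi> (x - y)" K "\<bar>v i y\<bar> powr p"] K[of "x - y"] by (simp add: algebra_simps)
          finally show "norm (v i y * \<Psi> (x - y)) \<le> norm (\<Psi> (x - y) + K * \<bar>v i y\<bar> powr p)"
            using \<Psi>0 by (simp add: abs_mult)
        qed
      qed simp
    qed
    have w1: "(\<integral>y. g y * \<Psi>' i (x - y) \<partial>lborel) = (\<integral>y. v i y * \<Psi> (x - y) \<partial>lborel)" if i: "i \<in> Basis" for i
    proof -
      \<comment> \<open>The sign comes from differentiating \<open>m\<close> times a function of
        \<open>x \<bullet> b - s\<close> with respect to \<open>s\<close>.\<close>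
      let ?P = "\<lambda>b m s. (-1) ^ m * \<psi> m (x \<bullet> b - s)"
      have d: "(?P b m has_real_derivative ?P b (Suc m) s) (at s)" for b :: 'a and m s
      proof -
        have "((\<lambda>s. x \<bullet> b - s) has_real_derivative -1) (at s)" by (auto intro!: derivative_eq_intros)
        from DERIV_cmult[OF DERIV_chain2[OF \<psi>' this], of "(-1) ^ m" m] show ?thesis by simp
      qed
      have o: "?P b 0 s = 0" if "b \<in> Basis" "norm x + r < \<bar>s\<bar>" for b s
      proof -
        have "r \<le> \<bar>x \<bullet> b - s\<bar>" using that Basis_le_norm[OF that(1), of x] by linarith
        then show ?thesis using \<psi>_out by simp
      qed
      have eq: "(\<lambda>y. \<Prod>b\<in>Basis. ?P b 0 (y \<bullet> b)) = (\<lambda>y. \<Psi> (x - y))"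
        by (simp add: \<Psi>_def inner_diff_left)
      have pd: "pderiv_dir i (\<lambda>y. \<Psi> (x - y)) y = - \<Psi>' i (x - y)" for y
        using product_test_function(2)[of ?P "norm x + r" i y, OF d o i] unfolding eq
        by (simp add: \<Psi>'_def inner_diff_left)
      have "test_function (\<lambda>y. \<Psi> (x - y))"
        using product_test_function(1)[of ?P "norm x + r", OF d o] unfolding eq .
      from weak[OF i this] show ?thesis unfolding pd by simp
    qed
    have i2: "integrable lborel (\<lambda>y. g y * \<Psi>' i (x - y))" if i: "i \<in> Basis" for i
    proof -
      have "continuous_on UNIV (\<Psi>' i)" unfolding \<Psi>'_def
        by (intro continuous_intros continuous_on_compose2[OF \<psi>c] | simp)+
      from bdd[OF this out(2)[OF _ i]] obtain L where L: "\<And>z. \<bar>\<Psi>' i z\<bar> \<le> L" by blast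
      show ?thesis
      proof (rule integrable_bounded_support[where K="B * L" and R="norm x + real DIM('a) * r"])
        show "\<bar>g y * \<Psi>' i (x - y)\<bar> \<le> B * L" for y
          unfolding abs_mult using B[of y] L[of "x - y"] by (intro mult_mono) (auto intro: order_trans[OF abs_ge_zero])
        fix y :: 'a assume "norm x + real DIM('a) * r < norm y"
        then have "\<Psi>' i (x - y) = 0" using norm_triangle_ineq2[of y x] i by (intro out) (auto simp: norm_minus_commute)
        then show "g y * \<Psi>' i (x - y) = 0" by simp
      qed simp
    qed
    have "V x = (\<integral>y. vw y * \<Psi> (x - y) \<partial>lborel) / c" unfolding V_def by (rule int_P) simp
    also have "(\<integral>y. vw y * \<Psi> (x - y) \<partial>lborel) = (\<integral>y. (\<Sum>i\<in>Basis. (w \<bullet> i) * (v i y * \<Psi> (x - y))) \<partial>lborel)"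
      by (simp add: vw_def sum_distrib_right mult.assoc)
    also have "\<dots> = (\<Sum>i\<in>Basis. (w \<bullet> i) * (\<integral>y. v i y * \<Psi> (x - y) \<partial>lborel))"
      using i1 by (subst Bochner_Integration.integral_sum) auto
    also have "\<dots> = (\<Sum>i\<in>Basis. (w \<bullet> i) * (\<integral>y. g y * \<Psi>' i (x - y) \<partial>lborel))" by (simp add: w1)
    also have "\<dots> = (\<integral>y. (\<Sum>i\<in>Basis. (w \<bullet> i) * (g y * \<Psi>' i (x - y))) \<partial>lborel)"
      using i2 by (subst Bochner_Integration.integral_sum) auto
    also have "\<dots> = (\<integral>y. g y * \<Theta> (x - y) \<partial>lborel)"
      by (intro Bochner_Integration.integral_cong) (auto simp: \<Theta>_def sum_distrib_left mult_ac)
    finally show ?thesis .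
  qed
  \<comment> \<open>All smoothness lies in the kernel: the fundamental theorem is used for
    \<open>\<tau>\<close> mapped to \<open>\<Psi> (x + \<tau> w - y)\<close> with \<open>y\<close>
    fixed, and the result is integrated against \<open>g\<close>. Nothing is assumed of
    \<open>g\<close> along the line.\<close>
  have FTC: "G (x + b *\<^sub>R w) - G (x + a *\<^sub>R w) = (\<integral>\<tau>. indicator {a..<b} \<tau> * V (x + \<tau> *\<^sub>R w) \<partial>lborel)" if ab: "a \<le> b" for x a b
  proof -
    have der: "((\<lambda>\<tau>. \<Psi> (x + \<tau> *\<^sub>R w - y)) has_real_derivative \<Theta> (x + \<tau> *\<^sub>R w - y)) (at \<tau>)" for y \<tau>
    proof -
      have "((\<lambda>\<tau>. \<psi> 0 ((x + \<tau> *\<^sub>R w - y) \<bullet> i)) has_real_derivative \<psi> 1 ((x + \<tau> *\<^sub>R w - y) \<bullet> i) * (w \<bullet> i)) (at \<tau>)" for i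
      proof -
        have "((\<lambda>\<tau>. (x + \<tau> *\<^sub>R w - y) \<bullet> i) has_real_derivative (w \<bullet> i)) (at \<tau>)"
          unfolding inner_add_left inner_diff_left inner_scaleR_left by (auto intro!: derivative_eq_intros)
        from DERIV_chain2[OF \<psi>'[of 0] this] show ?thesis by simp
      qed
      from has_field_derivative_prod[where A=Basis, OF this] show ?thesis
        unfolding \<Psi>_def \<Theta>_def \<Psi>'_def by (simp add: mult_ac)
    qed
    have inner: "(\<integral>\<tau>. indicator {a..<b} \<tau> * \<Theta> (x + \<tau> *\<^sub>R w - y) \<partial>lborel) = \<Psi> (x + b *\<^sub>R w - y) - \<Psi> (x + a *\<^sub>R w - y)" for y
    proof -
      have "isCont (\<lambda>\<tau>. \<Theta> (x + \<tau> *\<^sub>R w - y)) \<tau>" for \<tau>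
      proof -
        have "continuous_on UNIV (\<lambda>\<tau>. \<Theta> (x + \<tau> *\<^sub>R w - y))"
          by (intro continuous_on_compose2[OF \<Psi>c(2)] continuous_intros) auto
        then show ?thesis by (simp add: continuous_on_eq_continuous_at)
      qed
      then have "(\<integral>\<tau>. \<Theta> (x + \<tau> *\<^sub>R w - y) * indicator {a..b} \<tau> \<partial>lborel) = \<Psi> (x + b *\<^sub>R w - y) - \<Psi> (x + a *\<^sub>R w - y)"
        using ab der by (intro integral_FTC_Icc_real) auto
      moreover have "(\<integral>\<tau>. indicator {a..<b} \<tau> * \<Theta> (x + \<tau> *\<^sub>R w - y) \<partial>lborel) = (\<integral>\<tau>. \<Theta> (x + \<tau> *\<^sub>R w - y) * indicator {a..b} \<tau> \<partial>lborel)"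
        using AE_lborel_singleton[of b] by (intro integral_cong_AE) (auto simp: indicator_def elim!: eventually_mono)
      ultimately show ?thesis by simp
    qed
    have iG: "integrable lborel (\<lambda>y. g y * \<Psi> (x' - y))" for x'
    proof (rule integrable_bounded_support[where K="B * K" and R="norm x' + real DIM('a) * r"])
      show "\<bar>g y * \<Psi> (x' - y)\<bar> \<le> B * K" for y
        unfolding abs_mult using B[of y] K[of "x' - y"] by (intro mult_mono) (auto intro: order_trans[OF abs_ge_zero])
      fix y :: 'a assume "norm x' + real DIM('a) * r < norm y"
      then have "\<Psi> (x' - y) = 0" using norm_triangle_ineq2[of y x'] by (intro out) (auto simp: norm_minus_commute)
      then show "g y * \<Psi> (x' - y) = 0" by simp
    qed simp
    let ?F = "\<lambda>\<tau> y. indicator {a..<b} \<tau> * (g y * \<Theta> (x + \<tau> *\<^sub>R w - y))"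
    have int2: "integrable (lborel \<Otimes>\<^sub>M lborel) (case_prod ?F)"
      unfolding lborel_prod
    proof (rule integrable_bounded_support[where K="B * K'" and R="\<bar>a\<bar> + \<bar>b\<bar> + (norm x + (\<bar>a\<bar> + \<bar>b\<bar>) * norm w + real DIM('a) * r)"])
      have "case_prod ?F \<in> borel_measurable (borel \<Otimes>\<^sub>M borel)" by measurable
      then show "case_prod ?F \<in> borel_measurable borel" by (simp add: borel_prod)
      show "\<bar>case_prod ?F z\<bar> \<le> B * K'" for z
      proof -
        have "\<bar>g (snd z)\<bar> * \<bar>\<Theta> (x + fst z *\<^sub>R w - snd z)\<bar> \<le> B * K'"
          using B[of "snd z"] K' by (intro mult_mono) (auto intro: order_trans[OF abs_ge_zero])
        moreover from this have "0 \<le> B * K'" by (rule order_trans[rotated]) simp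
        ultimately show ?thesis by (auto simp: case_prod_beta abs_mult indicator_def)
      qed
      fix z :: "real \<times> 'a" assume z: "\<bar>a\<bar> + \<bar>b\<bar> + (norm x + (\<bar>a\<bar> + \<bar>b\<bar>) * norm w + real DIM('a) * r) < norm z"
      show "case_prod ?F z = 0"
      proof (cases "fst z \<in> {a..<b}")
        case True
        have f: "\<bar>fst z\<bar> \<le> \<bar>a\<bar> + \<bar>b\<bar>" using True by auto
        have "norm z \<le> \<bar>fst z\<bar> + norm (snd z)"
          using norm_Pair_le[of "fst z" "snd z"] by simp
        then have n: "norm x + (\<bar>a\<bar> + \<bar>b\<bar>) * norm w + real DIM('a) * r < norm (snd z)"
          using z f by linarith
        have "norm (x + fst z *\<^sub>R w) \<le> norm x + (\<bar>a\<bar> + \<bar>b\<bar>) * norm w"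
          using norm_triangle_ineq[of x "fst z *\<^sub>R w"] mult_right_mono[OF f, of "norm w"] by simp
        then have "real DIM('a) * r < norm (x + fst z *\<^sub>R w - snd z)"
          using n norm_triangle_ineq2[of "snd z" "x + fst z *\<^sub>R w"] by (simp add: norm_minus_commute)
        then show ?thesis using out(3) by (simp add: case_prod_beta)
      qed (simp add: case_prod_beta)
    qed
    have "G (x + b *\<^sub>R w) - G (x + a *\<^sub>R w) = ((\<integral>y. g y * \<Psi> (x + b *\<^sub>R w - y) \<partial>lborel) - (\<integral>y. g y * \<Psi> (x + a *\<^sub>R w - y) \<partial>lborel)) / c"
      unfolding G_def by (simp add: int_P diff_divide_distrib)
    also have "\<dots> = (\<integral>y. g y * (\<integral>\<tau>. indicator {a..<b} \<tau> * \<Theta> (x + \<tau> *\<^sub>R w - y) \<partial>lborel) \<partial>lborel) / c"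
      unfolding inner using iG[of "x + b *\<^sub>R w"] iG[of "x + a *\<^sub>R w"] by (simp add: right_diff_distrib)
    also have "(\<integral>y. g y * (\<integral>\<tau>. indicator {a..<b} \<tau> * \<Theta> (x + \<tau> *\<^sub>R w - y) \<partial>lborel) \<partial>lborel) = (\<integral>y. (\<integral>\<tau>. ?F \<tau> y \<partial>lborel) \<partial>lborel)"
      by (simp add: mult.left_commute flip: integral_mult_right_zero)
    also have "\<dots> = (\<integral>\<tau>. (\<integral>y. ?F \<tau> y \<partial>lborel) \<partial>lborel)"
      by (rule lborel_pair.Fubini_integral[OF int2])
    also have "\<dots> / c = (\<integral>\<tau>. indicator {a..<b} \<tau> * V (x + \<tau> *\<^sub>R w) \<partial>lborel)"
      by (simp add: V_eq)
    finally show ?thesis .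
  qed
  show ?thesis
    by (rule that[OF cG B' D' app mV Vp[unfolded vw_def] FTC])
qed

section \<open>Sobolev functions have a finite square function\<close>

lemma Dh2_line: "Dh2 h (\<lambda>\<tau>. G (s + \<tau> *\<^sub>R w)) \<tau> = Dh2 (h *\<^sub>R w) G (s + \<tau> *\<^sub>R w)" for h :: real
  by (simp add: Dh2_eq algebra_simps)

lemma nn_integral_abs_powr_sum_finite:
  fixes f :: "'i \<Rightarrow> 'b \<Rightarrow> real"
  assumes "finite A" "0 < p" and [measurable]: "\<And>i. i \<in> A \<Longrightarrow> f i \<in> borel_measurable M"
    and fin: "\<And>i. i \<in> A \<Longrightarrow> (\<integral>\<^sup>+x. ennreal (\<bar>f i x\<bar> powr p) \<partial>M) < \<infinity>"
  shows "(\<integral>\<^sup>+x. ennreal (\<bar>\<Sum>i\<in>A. f i x\<bar> powr p) \<partial>M) < \<infinity>"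
proof -
  have "ennreal (\<bar>\<Sum>i\<in>A. f i x\<bar> powr p) \<le> ennreal (real (card A) powr p) * (\<Sum>i\<in>A. ennreal (\<bar>f i x\<bar> powr p))" for x
  proof -
    have "ennreal (\<bar>\<Sum>i\<in>A. f i x\<bar> powr p) \<le> ennreal ((\<Sum>i\<in>A. \<bar>f i x\<bar>) powr p)"
      using assms by (intro ennreal_leI powr_mono2) auto
    also have "\<dots> = enn_powr (\<Sum>i\<in>A. ennreal \<bar>f i x\<bar>) p"
      by (simp add: sum_nonneg)
    also have "\<dots> \<le> ennreal (real (card A) powr p) * (\<Sum>i\<in>A. enn_powr (ennreal \<bar>f i x\<bar>) p)"
      using assms by (intro enn_powr_sum_le) auto
    finally show ?thesis by simp
  qed
  then have "(\<integral>\<^sup>+x. ennreal (\<bar>\<Sum>i\<in>A. f i x\<bar> powr p) \<partial>M)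
     \<le> (\<integral>\<^sup>+x. ennreal (real (card A) powr p) * (\<Sum>i\<in>A. ennreal (\<bar>f i x\<bar> powr p)) \<partial>M)"
    by (intro nn_integral_mono)
  also have "\<dots> = ennreal (real (card A) powr p) * (\<Sum>i\<in>A. \<integral>\<^sup>+x. ennreal (\<bar>f i x\<bar> powr p) \<partial>M)"
    by (subst nn_integral_cmult, measurable) (subst nn_integral_sum, auto)
  also have "\<dots> < \<infinity>"
    using fin assms(1) by (auto simp: ennreal_mult_less_top)
  finally show ?thesis .
qed

definition line_event :: "('a::euclidean_space \<Rightarrow> real) \<Rightarrow> 'a \<Rightarrow> real \<Rightarrow> 'a \<Rightarrow> nat \<Rightarrow> real \<Rightarrow> bool" where
  "line_event G w \<delta> s k u \<longleftrightarrow> \<delta> / 2 ^ Suc k < \<bar>Dh2 ((1 / 2 ^ Suc k) *\<^sub>R w) G (s + cell_centre k u *\<^sub>R w)\<bar>"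

lemma line_event_measurable [measurable]:
  assumes [measurable]: "G \<in> borel_measurable borel" "f \<in> borel_measurable N" "h \<in> borel_measurable N"
  shows "Measurable.pred N (\<lambda>z. line_event G w \<delta> (f z) k (h z))"
  unfolding line_event_def Dh2_eq by measurable

text \<open>Every point \<open>s\<close> of the space serves as the start of a segment in direction
  \<open>w\<close>. Integrating the one-dimensional bound over \<open>s\<close> returns, by
  translation invariance, the full norm of the directional derivative. The bound is applied to
  mollifications, whose derivative norms and Zygmund constants do not exceed those of
  \<open>g\<close>, and Fatou's lemma transfers it to \<open>g\<close>.\<close>

lemma line_counts_bounded:
  fixes g :: "'a::euclidean_space \<Rightarrow> real"
  assumes p: "p > 1" and g: "g \<in> W1p p" "g \<in> Lambda1" and \<delta>: "\<delta> > 0"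
  obtains D :: ennreal where "D < \<infinity>"
    "\<And>K. (\<integral>\<^sup>+s. (\<integral>\<^sup>+u. ennreal (real (count_upto (line_event g w \<delta> s) K u) powr (p / 2)) \<partial>cube_measure) \<partial>lborel) \<le> D"
proof -
  have cont: "continuous_on UNIV g" using g(2) by (simp add: Lambda1_def)
  then have gm: "g \<in> borel_measurable borel" by (rule borel_measurable_continuous_onI)
  obtain M where M: "M \<ge> 1" "\<And>x h. \<bar>Dh2 h g x\<bar> \<le> M * norm h" using Lambda1_Dh2_bound[OF g(2)] by blast
  \<comment> \<open>The Zygmund constant of a restriction to a line is \<open>M * norm w\<close>;
    the added 1 keeps it positive when \<open>w = 0\<close>.\<close>
  define M' where "M' = M * (norm w + 1)"
  have M': "M' > 0" using M by (simp add: M'_def add_nonneg_pos)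
  obtain C where C: "C \<ge> 0" and line: "\<And>\<phi> \<psi> B K. continuous_on UNIV \<phi> \<Longrightarrow> (\<And>t. \<bar>\<phi> t\<bar> \<le> B) \<Longrightarrow> (\<And>h t. \<bar>Dh2 h \<phi> t\<bar> \<le> M' * \<bar>h\<bar>) \<Longrightarrow>
      \<psi> \<in> borel_measurable borel \<Longrightarrow>
      (\<And>a b. a \<le> b \<Longrightarrow> \<phi> b - \<phi> a = (\<integral>\<tau>. indicator {a..<b} \<tau> * \<psi> \<tau> \<partial>lborel)) \<Longrightarrow>
      (\<integral>\<^sup>+u. ennreal (real (count_upto (\<lambda>k u. \<delta> / 2 ^ Suc k < \<bar>Dh2 (1 / 2 ^ Suc k) \<phi> (cell_centre k u)\<bar>) K u) powr (p / 2)) \<partial>cube_measure)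
       \<le> ennreal C * (\<integral>\<^sup>+\<tau>. indicator unit_cube \<tau> * ennreal (\<bar>\<psi> \<tau>\<bar> powr p) \<partial>lborel)"
    by (rule line_count_bound[OF p \<delta> M']) (rule that; blast)
  define isD where "isD = (\<lambda>i v. v \<in> borel_measurable borel \<and> (\<integral>\<^sup>+x. ennreal (\<bar>v x\<bar> powr p) \<partial>lborel) < \<infinity> \<and>
    (\<forall>\<phi>. test_function \<phi> \<longrightarrow> (\<integral>x. g x * pderiv_dir i \<phi> x \<partial>lborel) = - (\<integral>x. v x * \<phi> x \<partial>lborel)))"
  have "\<exists>v. isD i v" if "i \<in> Basis" for i
    by (rule W1p_borel_derivative[OF g(1) gm that]) (unfold isD_def, blast)
  then obtain v where vD: "\<And>i. i \<in> Basis \<Longrightarrow> isD i (v i)" by metis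
  have v [measurable]: "v i \<in> borel_measurable borel" if "i \<in> Basis" for i
    using vD[OF that] by (simp add: isD_def)
  have vp: "(\<integral>\<^sup>+x. ennreal (\<bar>v i x\<bar> powr p) \<partial>lborel) < \<infinity>" if "i \<in> Basis" for i
    using vD[OF that] by (simp add: isD_def)
  have weak: "(\<integral>x. g x * pderiv_dir i \<phi> x \<partial>lborel) = - (\<integral>x. v i x * \<phi> x \<partial>lborel)" if "i \<in> Basis" "test_function \<phi>" for i \<phi>
    using vD[OF that(1)] that(2) by (simp add: isD_def)
  define V0 where "V0 = (\<integral>\<^sup>+x. ennreal (\<bar>\<Sum>i\<in>Basis. (w \<bullet> i) * v i x\<bar> powr p) \<partial>lborel)"
  have V0: "V0 < \<infinity>" unfolding V0_def
  proof (rule nn_integral_abs_powr_sum_finite)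
    fix i :: 'a assume i: "i \<in> Basis"
    have "(\<integral>\<^sup>+x. ennreal (\<bar>(w \<bullet> i) * v i x\<bar> powr p) \<partial>lborel) = ennreal (\<bar>w \<bullet> i\<bar> powr p) * (\<integral>\<^sup>+x. ennreal (\<bar>v i x\<bar> powr p) \<partial>lborel)"
      using i by (subst nn_integral_cmult[symmetric]) (auto simp: abs_mult powr_mult ennreal_mult)
    also have "\<dots> < \<infinity>" using vp[OF i] by (simp add: ennreal_mult_less_top)
    finally show "(\<integral>\<^sup>+x. ennreal (\<bar>(w \<bullet> i) * v i x\<bar> powr p) \<partial>lborel) < \<infinity>" .
  qed (use p in auto)
  define D where "D = ennreal C * V0"
  have D: "D < \<infinity>" using V0 by (simp add: D_def ennreal_mult_less_top)
  define ct where "ct = (\<lambda>G K s u. ennreal (real (count_upto (line_event G w \<delta> s) K u) powr (p / 2)))"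
  define Q where "Q = (\<lambda>(m::nat) (G::'a \<Rightarrow> real). G \<in> borel_measurable borel \<and>
     (\<forall>K. (\<integral>\<^sup>+s. (\<integral>\<^sup>+u. ct G K s u \<partial>cube_measure) \<partial>lborel) \<le> D) \<and>
     (\<forall>x \<epsilon>. (\<forall>z. norm z \<le> real DIM('a) * (1 / (real m + 1)) \<longrightarrow> \<bar>g (x - z) - g x\<bar> \<le> \<epsilon>) \<longrightarrow> \<bar>G x - g x\<bar> \<le> \<epsilon>))"
  have "\<exists>G. Q m G" for m
  proof (rule mollify[where r="1 / (real m + 1)" and g=g and v=v and w=w and p=p and B="Lambda1_norm g" and M=M])
    fix G V assume G: "continuous_on UNIV G" "\<And>x. \<bar>G x\<bar> \<le> Lambda1_norm g" "\<And>x h. \<bar>Dh2 h G x\<bar> \<le> M * norm h"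
      and app: "\<And>x \<epsilon>. (\<And>z. norm z \<le> real DIM('a) * (1 / (real m + 1)) \<Longrightarrow> \<bar>g (x - z) - g x\<bar> \<le> \<epsilon>) \<Longrightarrow> \<bar>G x - g x\<bar> \<le> \<epsilon>"
      and V [measurable]: "V \<in> borel_measurable borel"
      and Vp: "(\<integral>\<^sup>+x. ennreal (\<bar>V x\<bar> powr p) \<partial>lborel) \<le> (\<integral>\<^sup>+x. ennreal (\<bar>\<Sum>i\<in>Basis. (w \<bullet> i) * v i x\<bar> powr p) \<partial>lborel)"
      and FTC: "\<And>x a b. a \<le> b \<Longrightarrow> G (x + b *\<^sub>R w) - G (x + a *\<^sub>R w) = (\<integral>\<tau>. indicator {a..<b} \<tau> * V (x + \<tau> *\<^sub>R w) \<partial>lborel)"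
    have Gm [measurable]: "G \<in> borel_measurable borel" using G(1) by (rule borel_measurable_continuous_onI)
    have bd: "(\<integral>\<^sup>+u. ct G K s u \<partial>cube_measure) \<le> ennreal C * (\<integral>\<^sup>+\<tau>. indicator unit_cube \<tau> * ennreal (\<bar>V (s + \<tau> *\<^sub>R w)\<bar> powr p) \<partial>lborel)" for K s
    proof -
      let ?\<phi> = "\<lambda>\<tau>. G (s + \<tau> *\<^sub>R w)"
      have ev: "line_event G w \<delta> s = (\<lambda>k u. \<delta> / 2 ^ Suc k < \<bar>Dh2 (1 / 2 ^ Suc k) ?\<phi> (cell_centre k u)\<bar>)"
        by (intro ext) (simp only: line_event_def Dh2_line)
      show ?thesis unfolding ct_def ev
      proof (rule line)
        show "continuous_on UNIV ?\<phi>" by (intro continuous_on_compose2[OF G(1)] continuous_intros) auto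
        show "\<bar>?\<phi> t\<bar> \<le> Lambda1_norm g" for t by (rule G(2))
        show "\<bar>Dh2 h ?\<phi> t\<bar> \<le> M' * \<bar>h\<bar>" for h t
        proof -
          have "\<bar>Dh2 h ?\<phi> t\<bar> \<le> M * norm (h *\<^sub>R w)" unfolding Dh2_line by (rule G(3))
          also have "\<dots> \<le> M' * \<bar>h\<bar>" using M by (simp add: M'_def algebra_simps mult_nonneg_nonneg)
          finally show ?thesis .
        qed
        show "?\<phi> b - ?\<phi> a = (\<integral>\<tau>. indicator {a..<b} \<tau> * V (s + \<tau> *\<^sub>R w) \<partial>lborel)" if "a \<le> b" for a b
          by (rule FTC[OF that])
      qed measurable
    qed
    have "(\<integral>\<^sup>+s. (\<integral>\<^sup>+u. ct G K s u \<partial>cube_measure) \<partial>lborel) \<le> D" for K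
    proof -
      have "(\<integral>\<^sup>+s. (\<integral>\<^sup>+u. ct G K s u \<partial>cube_measure) \<partial>lborel)
        \<le> (\<integral>\<^sup>+s. ennreal C * (\<integral>\<^sup>+\<tau>. indicator unit_cube \<tau> * ennreal (\<bar>V (s + \<tau> *\<^sub>R w)\<bar> powr p) \<partial>lborel) \<partial>lborel)"
        by (intro nn_integral_mono bd)
      also have "\<dots> = ennreal C * (\<integral>\<^sup>+s. (\<integral>\<^sup>+\<tau>. indicator unit_cube \<tau> * ennreal (\<bar>V (s + \<tau> *\<^sub>R w)\<bar> powr p) \<partial>lborel) \<partial>lborel)"
        by (rule nn_integral_cmult) measurable
      also have "(\<integral>\<^sup>+s. (\<integral>\<^sup>+\<tau>. indicator unit_cube \<tau> * ennreal (\<bar>V (s + \<tau> *\<^sub>R w)\<bar> powr p) \<partial>lborel) \<partial>lborel)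
         = (\<integral>\<^sup>+\<tau>. (\<integral>\<^sup>+s. indicator unit_cube \<tau> * ennreal (\<bar>V (s + \<tau> *\<^sub>R w)\<bar> powr p) \<partial>lborel) \<partial>lborel)"
        by (rule lborel_pair.Fubini') measurable
      also have "\<dots> = (\<integral>\<^sup>+(\<tau>::real). indicator unit_cube \<tau> * (\<integral>\<^sup>+s. ennreal (\<bar>V s\<bar> powr p) \<partial>lborel) \<partial>lborel)"
      proof (intro nn_integral_cong)
        fix \<tau> :: real
        have "(\<integral>\<^sup>+s. indicator unit_cube \<tau> * ennreal (\<bar>V (s + \<tau> *\<^sub>R w)\<bar> powr p) \<partial>lborel)
           = indicator unit_cube \<tau> * (\<integral>\<^sup>+s. ennreal (\<bar>V (s + \<tau> *\<^sub>R w)\<bar> powr p) \<partial>lborel)"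
          by (rule nn_integral_cmult) measurable
        also have "(\<integral>\<^sup>+s. ennreal (\<bar>V (s + \<tau> *\<^sub>R w)\<bar> powr p) \<partial>lborel) = (\<integral>\<^sup>+s. ennreal (\<bar>V s\<bar> powr p) \<partial>lborel)"
          by (rule nn_integral_lborel_shift) measurable
        finally show "(\<integral>\<^sup>+s. indicator unit_cube \<tau> * ennreal (\<bar>V (s + \<tau> *\<^sub>R w)\<bar> powr p) \<partial>lborel)
           = indicator unit_cube \<tau> * (\<integral>\<^sup>+s. ennreal (\<bar>V s\<bar> powr p) \<partial>lborel)" .
      qed
      also have "\<dots> = (\<integral>\<^sup>+s. ennreal (\<bar>V s\<bar> powr p) \<partial>lborel)"
        using emeasure_unit_cube[where 'a=real] by (subst nn_integral_multc) auto
      also have "ennreal C * \<dots> \<le> D" unfolding D_def V0_def using Vp by (intro mult_left_mono) auto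
      finally show ?thesis .
    qed
    then show "\<exists>G. Q m G" unfolding Q_def using Gm app by (intro exI[of _ G]) blast
  qed (use p cont Lambda1_norm_ge_abs[OF g(2)] M(2) v vp weak in auto)
  then obtain G where G: "\<And>m. Q m (G m)" by metis
  have Gm [measurable]: "G m \<in> borel_measurable borel" for m using G[of m] by (simp add: Q_def)
  have lim: "(\<lambda>m. G m x) \<longlonglongrightarrow> g x" for x
  proof (rule LIMSEQ_I)
    fix e :: real assume e: "0 < e"
    have "isCont g x" using cont by (simp add: continuous_on_eq_continuous_at)
    then obtain d where d: "d > 0" "\<And>y. dist y x < d \<Longrightarrow> dist (g y) (g x) < e / 2"
      using e unfolding continuous_at_eps_delta by (metis half_gt_zero)
    obtain m0 where m0: "real DIM('a) / d < real m0" using reals_Archimedean2 by blast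
    have "norm (G m x - g x) < e" if "m \<ge> m0" for m
    proof -
      have "real DIM('a) * (1 / (real m + 1)) < d"
      proof -
        have "real DIM('a) / d < real m + 1" using m0 that by linarith
        then show ?thesis using d(1) by (simp add: field_simps)
      qed
      then have "\<bar>g (x - z) - g x\<bar> \<le> e / 2" if "norm z \<le> real DIM('a) * (1 / (real m + 1))" for z
        using d(2)[of "x - z"] that by (simp add: dist_norm abs_le_iff less_imp_le)
      then have "\<bar>G m x - g x\<bar> \<le> e / 2" using G[of m] unfolding Q_def by blast
      then show ?thesis using e by simp
    qed
    then show "\<exists>m0. \<forall>m\<ge>m0. norm (G m x - g x) < e" by blast
  qed
  \<comment> \<open>The events are strict inequalities between continuous quantities and only
    finitely many scales are involved, so each event of \<open>g\<close> is eventually an event of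
    the mollifications.\<close>
  have pt: "ct g K s u \<le> liminf (\<lambda>m. ct (G m) K s u)" for K s u
  proof (rule Liminf_bounded)
    have "eventually (\<lambda>m. line_event (G m) w \<delta> s k u) sequentially" if "line_event g w \<delta> s k u" for k
    proof -
      let ?h = "(1 / 2 ^ Suc k) *\<^sub>R w" and ?x = "s + cell_centre k u *\<^sub>R w"
      have "(\<lambda>m. \<bar>Dh2 ?h (G m) ?x\<bar>) \<longlonglongrightarrow> \<bar>Dh2 ?h g ?x\<bar>"
        unfolding Dh2_eq by (intro tendsto_intros lim)
      then show ?thesis using that order_tendstoD(1) unfolding line_event_def by blast
    qed
    then have "eventually (\<lambda>m. \<forall>k\<in>{..<K}. line_event g w \<delta> s k u \<longrightarrow> line_event (G m) w \<delta> s k u) sequentially"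
      by (intro eventually_ball_finite) (auto elim: eventually_mono)
    then show "eventually (\<lambda>m. ct g K s u \<le> ct (G m) K s u) sequentially"
    proof eventually_elim
      case (elim m)
      then have "count_upto (line_event g w \<delta> s) K u \<le> count_upto (line_event (G m) w \<delta> s) K u"
        by (intro count_upto_mono) auto
      then show ?case unfolding ct_def using p by (intro ennreal_leI powr_mono2) auto
    qed
  qed
  have meas: "(\<lambda>(s, u). ct (G m) K s u) \<in> borel_measurable (lborel \<Otimes>\<^sub>M cube_measure)" for m K
    unfolding ct_def count_upto_eq_sum by measurable
  interpret cube: prob_space "cube_measure :: real measure" by (rule prob_space_cube_measure)
  show ?thesis
  proof (rule that[OF D])
    fix K
    have "(\<integral>\<^sup>+s. (\<integral>\<^sup>+u. ct g K s u \<partial>cube_measure) \<partial>lborel) \<le> (\<integral>\<^sup>+s. (\<integral>\<^sup>+u. liminf (\<lambda>m. ct (G m) K s u) \<partial>cube_measure) \<partial>lborel)"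
      by (intro nn_integral_mono pt)
    also have "\<dots> \<le> (\<integral>\<^sup>+s. liminf (\<lambda>m. \<integral>\<^sup>+u. ct (G m) K s u \<partial>cube_measure) \<partial>lborel)"
    proof (intro nn_integral_mono nn_integral_liminf)
      show "(\<lambda>u. ct (G m) K s u) \<in> borel_measurable cube_measure" for m s
        unfolding ct_def count_upto_eq_sum by measurable
    qed
    also have "\<dots> \<le> liminf (\<lambda>m. \<integral>\<^sup>+s. (\<integral>\<^sup>+u. ct (G m) K s u \<partial>cube_measure) \<partial>lborel)"
      using meas by (intro nn_integral_liminf cube.borel_measurable_nn_integral) (simp add: case_prod_beta)
    also have "\<dots> \<le> liminf (\<lambda>m. D)"
      by (intro Liminf_mono always_eventually allI) (use G in \<open>auto simp: Q_def\<close>)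
    also have "\<dots> = D" by (simp add: Liminf_const)
    finally show "(\<integral>\<^sup>+s. (\<integral>\<^sup>+u. ennreal (real (count_upto (line_event g w \<delta> s) K u) powr (p / 2)) \<partial>cube_measure) \<partial>lborel) \<le> D"
      by (simp only: ct_def)
  qed
qed

text \<open>Write \<open>x = s + u w\<close> with \<open>u\<close> uniform in the unit interval,
  that is, translate the grid at random. When the position of \<open>u\<close> in its cell is close
  to \<open>1/2\<close>, the centre of the cell is so close to \<open>x\<close> that a second
  difference beyond \<open>2 * \<delta>\<close> at \<open>x\<close> leaves one beyond \<delta> at
  the centre. This happens with a fixed probability at each scale, so
  \<open>count_powr_dominated\<close> bounds the count at \<open>x\<close> by the average of the
  line counts.\<close>

lemma point_counts_bounded:
  fixes g :: "'a::euclidean_space \<Rightarrow> real"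
  assumes p: "p > 1" and g: "g \<in> W1p p" "g \<in> Lambda1" and \<delta>: "\<delta> > 0"
  obtains D :: ennreal where "D < \<infinity>"
    "\<And>K. (\<integral>\<^sup>+x. ennreal (real (count_upto (\<lambda>k x. 2 * \<delta> / 2 ^ Suc k < \<bar>Dh2 ((1 / 2 ^ Suc k) *\<^sub>R w) g x\<bar>) K x) powr (p / 2)) \<partial>lborel) \<le> D"
proof -
  have "continuous_on UNIV g" using g(2) by (simp add: Lambda1_def)
  then have [measurable]: "g \<in> borel_measurable borel" by (rule borel_measurable_continuous_onI)
  obtain D0 :: ennreal where D0: "D0 < \<infinity>"
    "\<And>K. (\<integral>\<^sup>+s. (\<integral>\<^sup>+u. ennreal (real (count_upto (line_event g w \<delta> s) K u) powr (p / 2)) \<partial>cube_measure) \<partial>lborel) \<le> D0"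
    by (rule line_counts_bounded[OF p g \<delta>, of w]) (rule that; blast)
  obtain M where M: "M \<ge> 1" "\<And>x h. \<bar>Dh2 h g x\<bar> \<le> M * norm h" using Lambda1_Dh2_bound[OF g(2)] by blast
  have M0: "M \<ge> 0" using M by simp
  obtain \<kappa> where \<kappa>: "\<kappa> > 0" "\<kappa> \<le> 1/2" and reg: "\<And>(f :: 'a \<Rightarrow> real) x x' h h' t. (\<And>x h. \<bar>Dh2 h f x\<bar> \<le> M * norm h) \<Longrightarrow> t > 0 \<Longrightarrow>
       norm h \<le> norm w * t \<Longrightarrow> norm (x' - x) \<le> \<kappa> * t \<Longrightarrow> norm (h' - h) \<le> \<kappa> * t \<Longrightarrow>
       \<bar>Dh2 h' f x' - Dh2 h f x\<bar> \<le> \<delta> * t"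
    by (rule Dh2_scale_invariant_continuity[OF M0 norm_ge_zero \<delta>, of w]) (rule that; blast)
  \<comment> \<open>With \<open>t = 1 / 2 ^ Suc k\<close>, the centre is within
    \<open>2 * t * \<kappa>'\<close> of \<open>u\<close>, hence within \<open>\<kappa> * t\<close>
    of \<open>x\<close> after multiplication by \<open>norm w\<close>.\<close>
  define \<kappa>' where "\<kappa>' = \<kappa> / (2 * (norm w + 1))"
  have \<kappa>': "\<kappa>' > 0" "2 * \<kappa>' * norm w \<le> \<kappa>" "\<kappa>' \<le> 1/4"
  proof -
    have n: "norm w + 1 > 0" by (simp add: add_nonneg_pos)
    show "\<kappa>' > 0" unfolding \<kappa>'_def using \<kappa> n by simp
    have e: "2 * \<kappa>' * (norm w + 1) = \<kappa>" unfolding \<kappa>'_def using n by (simp add: field_simps)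
    show "2 * \<kappa>' * norm w \<le> \<kappa>" using e \<open>\<kappa>' > 0\<close> by (simp add: algebra_simps)
    have "2 * \<kappa>' * 1 \<le> 2 * \<kappa>' * (norm w + 1)" using \<open>\<kappa>' > 0\<close> by (intro mult_left_mono) auto
    then show "\<kappa>' \<le> 1/4" using e \<kappa> by simp
  qed
  define B where "B = (\<lambda>v::real. \<bar>v - 1/2\<bar> \<le> \<kappa>')"
  have [measurable]: "Measurable.pred borel B" unfolding B_def by measurable
  have mB: "(\<integral>\<^sup>+v. of_bool (B v) \<partial>cube_measure) = ennreal (2 * \<kappa>')"
  proof -
    have "(\<integral>\<^sup>+v. of_bool (B v) \<partial>cube_measure) = (\<integral>\<^sup>+v. indicator unit_cube v * of_bool (B v) \<partial>lborel)"
      by (rule nn_integral_cube_measure) measurable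
    also have "\<dots> = (\<integral>\<^sup>+v. indicator {1/2 - \<kappa>'..1/2 + \<kappa>'} v \<partial>lborel)"
      using \<kappa>' by (intro nn_integral_cong) (auto simp: B_def unit_cube_def indicator_def)
    also have "\<dots> = ennreal (2 * \<kappa>')" using \<kappa>' by (simp add: nn_integral_indicator)
    finally show ?thesis .
  qed
  have c0: "0 < 1 / (2 * \<kappa>')" and q: "0 < p / 2" using \<kappa>' p by auto
  obtain C where C: "C \<ge> 0" and dom: "\<And>(MM :: real measure) e e' K. finite_measure MM \<Longrightarrow> (\<And>k. Measurable.pred MM (e k)) \<Longrightarrow>
       (\<And>k. Measurable.pred MM (e' k)) \<Longrightarrow> (\<And>k \<omega>. e' k \<omega> \<Longrightarrow> e k \<omega>) \<Longrightarrow>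
       (\<And>k h. (\<integral>\<^sup>+\<omega>. of_bool (e k \<omega>) * h (count_upto e (Suc k) \<omega>) \<partial>MM)
          \<le> ennreal (1 / (2 * \<kappa>')) * (\<integral>\<^sup>+\<omega>. of_bool (e' k \<omega>) * h (count_upto e (Suc k) \<omega>) \<partial>MM)) \<Longrightarrow>
       (\<integral>\<^sup>+\<omega>. ennreal (real (count_upto e K \<omega>) powr (p / 2)) \<partial>MM)
        \<le> ennreal C * (\<integral>\<^sup>+\<omega>. ennreal (real (count_upto e' K \<omega>) powr (p / 2)) \<partial>MM)"
    by (rule count_powr_dominated[OF q c0, where 'b=real]) (rule that; blast)
  interpret cube: prob_space "cube_measure :: real measure" by (rule prob_space_cube_measure)
  interpret pair_sigma_finite lborel "cube_measure :: real measure" ..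
  define A where "A = (\<lambda>k x. 2 * \<delta> / 2 ^ Suc k < \<bar>Dh2 ((1 / 2 ^ Suc k) *\<^sub>R w) g x\<bar>)"
  define ct where "ct = (\<lambda>K s u. ennreal (real (count_upto (line_event g w \<delta> s) K u) powr (p / 2)))"
  have meas [measurable]: "(\<lambda>z. ct K (f z) (h z)) \<in> borel_measurable N"
    if [measurable]: "f \<in> borel_measurable N" "h \<in> borel_measurable N" for K f h and N :: "'c measure"
    unfolding ct_def count_upto_eq_sum by measurable
  have cubeUNIV: "emeasure (cube_measure :: real measure) UNIV = 1" using cube.emeasure_space_1 by simp
  have pt: "ennreal (real (count_upto A K x) powr (p / 2)) \<le> ennreal C * (\<integral>\<^sup>+u. ct K (x - u *\<^sub>R w) u \<partial>cube_measure)" for K x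
  proof -
    \<comment> \<open>\<open>?e\<close> does not depend on \<open>u\<close>: the count at
      \<open>x\<close> is deterministic and equals its own average over the grids, while
      \<open>?e'\<close> is its random thinning.\<close>
    let ?e = "\<lambda>k (u::real). A k x" and ?e' = "\<lambda>k u. A k x \<and> B (cell_pos k u)"
    have ce: "count_upto ?e K' u = count_upto A K' x" for K' u by (simp add: count_upto_def)
    have "ennreal (real (count_upto A K x) powr (p / 2)) = (\<integral>\<^sup>+u. ennreal (real (count_upto ?e K u) powr (p / 2)) \<partial>(cube_measure :: real measure))"
      by (simp add: ce cubeUNIV)
    also have "\<dots> \<le> ennreal C * (\<integral>\<^sup>+u. ennreal (real (count_upto ?e' K u) powr (p / 2)) \<partial>cube_measure)"
    proof (rule dom)
      fix k and h :: "nat \<Rightarrow> ennreal"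
      have "(\<integral>\<^sup>+u. 1 * of_bool (B (cell_pos k u)) \<partial>cube_measure) = (\<integral>\<^sup>+u. 1 \<partial>(cube_measure :: real measure)) * (\<integral>\<^sup>+u. of_bool (B u) \<partial>cube_measure)"
        by (rule nn_integral_cell_independent) auto
      then have mB': "(\<integral>\<^sup>+u. of_bool (B (cell_pos k u)) \<partial>cube_measure) = ennreal (2 * \<kappa>')" by (simp add: mB cubeUNIV)
      have one: "ennreal (1 / (2 * \<kappa>')) * ennreal (2 * \<kappa>') = 1"
        using \<kappa>' by (simp add: ennreal_mult[symmetric])
      have "(\<integral>\<^sup>+u. of_bool (?e' k u) * h (count_upto ?e (Suc k) u) \<partial>cube_measure)
          = (\<integral>\<^sup>+u. (of_bool (A k x) * h (count_upto A (Suc k) x)) * of_bool (B (cell_pos k u)) \<partial>cube_measure)"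
        by (intro nn_integral_cong) (auto simp: ce)
      also have "\<dots> = (of_bool (A k x) * h (count_upto A (Suc k) x)) * ennreal (2 * \<kappa>')"
        by (subst nn_integral_cmult) (auto simp: mB')
      finally have "ennreal (1 / (2 * \<kappa>')) * (\<integral>\<^sup>+u. of_bool (?e' k u) * h (count_upto ?e (Suc k) u) \<partial>cube_measure)
          = (ennreal (1 / (2 * \<kappa>')) * ennreal (2 * \<kappa>')) * (of_bool (A k x) * h (count_upto A (Suc k) x))"
        by (simp only: mult_ac)
      also have "\<dots> = (\<integral>\<^sup>+u. of_bool (?e k u) * h (count_upto ?e (Suc k) u) \<partial>cube_measure)"
        by (simp add: one ce cubeUNIV)
      finally show "(\<integral>\<^sup>+u. of_bool (?e k u) * h (count_upto ?e (Suc k) u) \<partial>cube_measure)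
          \<le> ennreal (1 / (2 * \<kappa>')) * (\<integral>\<^sup>+u. of_bool (?e' k u) * h (count_upto ?e (Suc k) u) \<partial>cube_measure)" by simp
    qed (auto intro: cube.finite_measure_axioms)
    also have "\<dots> \<le> ennreal C * (\<integral>\<^sup>+u. ct K (x - u *\<^sub>R w) u \<partial>cube_measure)"
    proof (intro mult_left_mono nn_integral_mono)
      fix u :: real
      have "count_upto ?e' K u \<le> count_upto (line_event g w \<delta> (x - u *\<^sub>R w)) K u"
      proof (rule count_upto_mono)
        fix k assume e': "?e' k u"
        define t where "t = (1 / 2 ^ Suc k :: real)"
        have t: "t > 0" by (simp add: t_def)
        have "x - u *\<^sub>R w + cell_centre k u *\<^sub>R w - x = - ((u - cell_centre k u) *\<^sub>R w)" by (simp add: algebra_simps)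
        then have "norm (x - u *\<^sub>R w + cell_centre k u *\<^sub>R w - x) = \<bar>u - cell_centre k u\<bar> * norm w" by (simp only: norm_minus_cancel norm_scaleR real_norm_def)
        also have "u - cell_centre k u = 2 * t * (cell_pos k u - 1/2)"
          using cell_centre_diff[of u k] by (simp add: t_def)
        also have "\<bar>2 * t * (cell_pos k u - 1/2)\<bar> * norm w \<le> (2 * t * \<kappa>') * norm w"
          using e' t unfolding B_def abs_mult by (intro mult_right_mono) auto
        also have "\<dots> = t * (2 * \<kappa>' * norm w)" by simp
        also have "\<dots> \<le> t * \<kappa>" using \<kappa>' t by (intro mult_left_mono) auto
        finally have "norm (x - u *\<^sub>R w + cell_centre k u *\<^sub>R w - x) \<le> \<kappa> * t" by (simp add: mult.commute)
        then have "\<bar>Dh2 (t *\<^sub>R w) g (x - u *\<^sub>R w + cell_centre k u *\<^sub>R w) - Dh2 (t *\<^sub>R w) g x\<bar> \<le> \<delta> * t"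
          using t \<kappa> by (intro reg[OF M(2)]) auto
        moreover have "2 * \<delta> * t < \<bar>Dh2 (t *\<^sub>R w) g x\<bar>" using e' by (simp add: A_def t_def)
        moreover have "2 * \<delta> * t = \<delta> * t + \<delta> * t" by simp
        ultimately have "\<delta> * t < \<bar>Dh2 (t *\<^sub>R w) g (x - u *\<^sub>R w + cell_centre k u *\<^sub>R w)\<bar>" by linarith
        then show "line_event g w \<delta> (x - u *\<^sub>R w) k u" by (simp add: line_event_def t_def)
      qed
      then show "ennreal (real (count_upto ?e' K u) powr (p / 2)) \<le> ct K (x - u *\<^sub>R w) u"
        unfolding ct_def using p by (intro ennreal_leI powr_mono2) auto
    qed auto
    finally show ?thesis .
  qed
  show ?thesis
  proof (rule that[of "ennreal C * D0"])
    show "ennreal C * D0 < \<infinity>" using D0 by (simp add: ennreal_mult_less_top)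
    fix K
    have "(\<integral>\<^sup>+x. ennreal (real (count_upto A K x) powr (p / 2)) \<partial>lborel)
       \<le> (\<integral>\<^sup>+x. ennreal C * (\<integral>\<^sup>+u. ct K (x - u *\<^sub>R w) u \<partial>cube_measure) \<partial>lborel)"
      by (intro nn_integral_mono pt)
    also have "\<dots> = ennreal C * (\<integral>\<^sup>+x. (\<integral>\<^sup>+u. ct K (x - u *\<^sub>R w) u \<partial>cube_measure) \<partial>lborel)"
      by (rule nn_integral_cmult) measurable
    also have "(\<integral>\<^sup>+x. (\<integral>\<^sup>+u. ct K (x - u *\<^sub>R w) u \<partial>cube_measure) \<partial>lborel) = (\<integral>\<^sup>+u. (\<integral>\<^sup>+x. ct K (x - u *\<^sub>R w) u \<partial>lborel) \<partial>cube_measure)"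
      by (rule Fubini'[symmetric]) measurable
    also have "\<dots> = (\<integral>\<^sup>+u. (\<integral>\<^sup>+s. ct K s u \<partial>lborel) \<partial>cube_measure)"
    proof (rule nn_integral_cong)
      fix u :: real
      show "(\<integral>\<^sup>+x. ct K (x - u *\<^sub>R w) u \<partial>lborel) = (\<integral>\<^sup>+s. ct K s u \<partial>lborel)"
        using nn_integral_lborel_shift[of "\<lambda>s. ct K s u" "- (u *\<^sub>R w)"] by simp
    qed
    also have "\<dots> = (\<integral>\<^sup>+s. (\<integral>\<^sup>+u. ct K s u \<partial>cube_measure) \<partial>lborel)"
      by (rule Fubini') measurable
    also have "ennreal C * \<dots> \<le> ennreal C * D0" using D0(2) unfolding ct_def by (intro mult_left_mono) auto
    finally show "(\<integral>\<^sup>+x. ennreal (real (count_upto (\<lambda>k x. 2 * \<delta> / 2 ^ Suc k < \<bar>Dh2 ((1 / 2 ^ Suc k) *\<^sub>R w) g x\<bar>) K x) powr (p / 2)) \<partial>lborel) \<le> ennreal C * D0"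
      by (simp only: A_def)
  qed
qed

lemma le_suminf_ennreal: "f k \<le> (\<Sum>k. f k)" for f :: "nat \<Rightarrow> ennreal"
  using sum_le_suminf[of f "{k}"] by simp

text \<open>The continuum of steps \<open>h\<close> with
  \<open>1 / 2 ^ Suc k < norm h <= 1 / 2 ^ k\<close> is reduced to finitely many: \<open>h\<close>
  is \<open>1 / 2 ^ Suc k\<close> times a vector of the ball of radius 2, and a net of that ball
  suffices by the scale-invariant continuity, at the price of half the threshold. The threshold is
  written as \<open>2 * (\<epsilon> / 4)\<close> to match
  \<open>point_counts_bounded\<close>.\<close>

lemma sq_inner_le_counts:
  fixes g :: "'a::euclidean_space \<Rightarrow> real"
  assumes g: "g \<in> Lambda1" and \<epsilon>: "\<epsilon> > 0"
  obtains W where "finite W"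
    "\<And>x. sq_inner g \<epsilon> x \<le> (\<Sum>w\<in>W. \<Sum>k. of_bool (2 * (\<epsilon> / 4) / 2 ^ Suc k < \<bar>Dh2 ((1 / 2 ^ Suc k) *\<^sub>R w) g x\<bar>))"
proof -
  obtain M where M: "M \<ge> 1" "\<And>x h. \<bar>Dh2 h g x\<bar> \<le> M * norm h" using Lambda1_Dh2_bound[OF g] by blast
  have M0: "M \<ge> 0" "(2::real) \<ge> 0" "\<epsilon> / 2 > 0" using M \<epsilon> by auto
  obtain \<kappa> where \<kappa>: "\<kappa> > 0" "\<kappa> \<le> 1/2" and reg: "\<And>(f :: 'a \<Rightarrow> real) x x' h h' t. (\<And>x h. \<bar>Dh2 h f x\<bar> \<le> M * norm h) \<Longrightarrow> t > 0 \<Longrightarrow>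
       norm h \<le> 2 * t \<Longrightarrow> norm (x' - x) \<le> \<kappa> * t \<Longrightarrow> norm (h' - h) \<le> \<kappa> * t \<Longrightarrow>
       \<bar>Dh2 h' f x' - Dh2 h f x\<bar> \<le> \<epsilon> / 2 * t"
    by (rule Dh2_scale_invariant_continuity[OF M0]) (rule that; blast)
  obtain W where W: "finite W" "cball (0::'a) 2 \<subseteq> (\<Union>w\<in>W. ball w \<kappa>)"
    using compact_cball[of "0::'a" 2] \<kappa>(1) unfolding compact_eq_totally_bounded by blast
  let ?A = "\<lambda>x w k. 2 * (\<epsilon> / 4) / 2 ^ Suc k < \<bar>Dh2 ((1 / 2 ^ Suc k) *\<^sub>R w) g x\<bar>"
  show ?thesis
  proof (rule that[OF W(1)])
    fix x
    have key: "indicator {y \<in> {0<..1}. Delta2 g x y / y > \<epsilon>} y * ennreal (1 / y) \<le>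
       (\<Sum>w\<in>W. \<Sum>k. of_bool (?A x w k) * (ennreal (2 ^ Suc k) * indicator {1 / 2 ^ Suc k..1 / 2 ^ k} y))" for y
    proof (cases "y \<in> {y \<in> {0<..1}. Delta2 g x y / y > \<epsilon>}")
      case True
      then have y: "0 < y" "y \<le> 1" "\<epsilon> * y < Delta2 g x y" by (auto simp: field_simps)
      obtain k where k: "1 / 2 ^ Suc k < y" "y \<le> 1 / 2 ^ k"
      proof -
        have ex: "\<exists>n. 1 / 2 ^ n < y"
          using real_arch_pow_inv[OF y(1), of "1/2"] by (auto simp: power_one_over)
        define n where "n = (LEAST n. 1 / 2 ^ n < y)"
        have n: "1 / 2 ^ n < y" unfolding n_def using ex by (rule LeastI_ex)
        obtain k where nk: "n = Suc k" using n y by (cases n) auto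
        have "\<not> 1 / 2 ^ k < y" using not_less_Least[of k "\<lambda>n. 1 / 2 ^ n < y"] nk by (simp add: n_def[symmetric])
        then show ?thesis using that[of k] n nk by simp
      qed
      obtain h where h: "norm h = y" "\<epsilon> * y < \<bar>Dh2 h g x\<bar>" using less_Delta2D[OF _ y(3)] y(1) by auto
      define t where "t = (1 / 2 ^ Suc k :: real)"
      have t: "t > 0" "y \<le> 2 * t" "t < y" using k by (auto simp: t_def)
      have "norm ((1 / t) *\<^sub>R h) \<le> 2" using t h by (simp add: field_simps)
      then have "(1 / t) *\<^sub>R h \<in> (\<Union>w\<in>W. ball w \<kappa>)" by (intro subsetD[OF W(2)]) (simp only: mem_cball_0)
      then obtain w where w: "w \<in> W" "dist w ((1 / t) *\<^sub>R h) < \<kappa>" by auto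
      have "norm (t *\<^sub>R w - h) = t * norm (w - (1 / t) *\<^sub>R h)"
      proof -
        have "t *\<^sub>R w - h = t *\<^sub>R (w - (1 / t) *\<^sub>R h)" using t by (simp add: scaleR_diff_right)
        then show ?thesis using t by simp
      qed
      also have "\<dots> \<le> t * \<kappa>" using w t by (intro mult_left_mono) (auto simp: dist_norm)
      finally have "\<bar>Dh2 (t *\<^sub>R w) g x - Dh2 h g x\<bar> \<le> \<epsilon> / 2 * t"
        using t h \<kappa> by (intro reg[OF M(2)]) (auto simp: mult.commute)
      moreover have "\<epsilon> * t < \<epsilon> * y" using t \<epsilon> by simp
      ultimately have "\<epsilon> / 2 * t < \<bar>Dh2 (t *\<^sub>R w) g x\<bar>" using h by linarith
      then have A: "?A x w k" by (simp add: t_def)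
      have "indicator {y \<in> {0<..1}. Delta2 g x y / y > \<epsilon>} y * ennreal (1 / y) = ennreal (1 / y)"
        using True by simp
      also have "\<dots> \<le> ennreal (2 ^ Suc k)" using k y by (intro ennreal_leI) (simp add: field_simps)
      also have "\<dots> = of_bool (?A x w k) * (ennreal (2 ^ Suc k) * indicator {1 / 2 ^ Suc k..1 / 2 ^ k} y)"
        using A k by simp
      also have "\<dots> \<le> (\<Sum>k. of_bool (?A x w k) * (ennreal (2 ^ Suc k) * indicator {1 / 2 ^ Suc k..1 / 2 ^ k} y))"
        by (rule le_suminf_ennreal)
      also have "\<dots> \<le> (\<Sum>w\<in>W. \<Sum>k. of_bool (?A x w k) * (ennreal (2 ^ Suc k) * indicator {1 / 2 ^ Suc k..1 / 2 ^ k} y))"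
        using w W(1) by (intro member_le_sum) auto
      finally show ?thesis .
    qed simp
    \<comment> \<open>On the k-th dyadic interval \<open>1 / y\<close> is at most
      \<open>2 ^ Suc k\<close>, the reciprocal of its length, so each scale contributes at most
      1.\<close>
    have len: "(\<integral>\<^sup>+(y::real). ennreal (2 ^ Suc k) * indicator {1 / 2 ^ Suc k..1 / 2 ^ k} y \<partial>lborel) = 1" for k
    proof -
      have "emeasure lborel {1 / 2 ^ Suc k..1 / 2 ^ k :: real} = ennreal (1 / 2 ^ k - 1 / 2 ^ Suc k)"
        by (intro emeasure_lborel_Icc) (simp add: field_simps)
      also have "1 / 2 ^ k - 1 / 2 ^ Suc k = (1 / 2 ^ Suc k :: real)" by (simp add: field_simps)
      finally have e: "emeasure lborel {1 / 2 ^ Suc k..1 / 2 ^ k :: real} = ennreal (1 / 2 ^ Suc k)" .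
      have "ennreal (2 ^ Suc k) * ennreal (1 / 2 ^ Suc k) = 1" by (subst ennreal_mult[symmetric]) auto
      then show ?thesis unfolding e[symmetric] by (subst nn_integral_cmult_indicator) simp_all
    qed
    have "sq_inner g \<epsilon> x \<le> (\<integral>\<^sup>+(y::real). (\<Sum>w\<in>W. \<Sum>k. of_bool (?A x w k) * (ennreal (2 ^ Suc k) * indicator {1 / 2 ^ Suc k..1 / 2 ^ k} y)) \<partial>lborel)"
      unfolding sq_inner_def by (intro nn_integral_mono key)
    also have "\<dots> = (\<Sum>w\<in>W. \<Sum>k. of_bool (?A x w k) * (\<integral>\<^sup>+(y::real). ennreal (2 ^ Suc k) * indicator {1 / 2 ^ Suc k..1 / 2 ^ k} y \<partial>lborel))"
      by (subst nn_integral_sum, measurable) (subst nn_integral_suminf, measurable, subst nn_integral_cmult, auto)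
    also have "\<dots> = (\<Sum>w\<in>W. \<Sum>k. of_bool (?A x w k))" by (simp only: len mult_1_right)
    finally show "sq_inner g \<epsilon> x \<le> (\<Sum>w\<in>W. \<Sum>k. of_bool (?A x w k))" .
  qed
qed

text \<open>This holds at every positive level, although the bound obtained depends on the level;
  hence \<open>eps_Lambda\<close> vanishes on the approximating class.\<close>

theorem W1p_Lambda1_sq_Lp_finite:
  fixes g :: "'a::euclidean_space \<Rightarrow> real"
  assumes p: "p > 1" and g: "g \<in> W1p p" "g \<in> Lambda1" and \<epsilon>: "\<epsilon> > 0"
  shows "sq_Lp_finite p g \<epsilon>"
proof -
  have "continuous_on UNIV g" using g(2) by (simp add: Lambda1_def)
  then have [measurable]: "g \<in> borel_measurable borel" by (rule borel_measurable_continuous_onI)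
  have q: "0 < p / 2" and \<delta>: "\<epsilon> / 4 > 0" using p \<epsilon> by auto
  define A where "A = (\<lambda>w k x. 2 * (\<epsilon> / 4) / 2 ^ Suc k < \<bar>Dh2 ((1 / 2 ^ Suc k) *\<^sub>R w) g x\<bar>)"
  have [measurable]: "Measurable.pred borel (A w k)" for w k unfolding A_def Dh2_eq by measurable
  obtain W where W1: "finite W"
    "\<And>x. sq_inner g \<epsilon> x \<le> (\<Sum>w\<in>W. \<Sum>k. of_bool (2 * (\<epsilon> / 4) / 2 ^ Suc k < \<bar>Dh2 ((1 / 2 ^ Suc k) *\<^sub>R w) g x\<bar>))"
    by (rule sq_inner_le_counts[OF g(2) \<epsilon>]) (rule that; blast)
  have W: "finite W" "\<And>x. sq_inner g \<epsilon> x \<le> (\<Sum>w\<in>W. \<Sum>k. of_bool (A w k x))"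
    using W1 by (simp_all only: A_def)
  have fin: "(\<integral>\<^sup>+x. enn_powr (\<Sum>k. of_bool (A w k x)) (p / 2) \<partial>lborel) < \<infinity>" for w
  proof -
    obtain D :: ennreal where D1: "D < \<infinity>"
      "\<And>K. (\<integral>\<^sup>+x. ennreal (real (count_upto (\<lambda>k x. 2 * (\<epsilon> / 4) / 2 ^ Suc k < \<bar>Dh2 ((1 / 2 ^ Suc k) *\<^sub>R w) g x\<bar>) K x) powr (p / 2)) \<partial>lborel) \<le> D"
      by (rule point_counts_bounded[OF p g \<delta>, of w]) (rule that; blast)
    have D: "D < \<infinity>" "\<And>K. (\<integral>\<^sup>+x. ennreal (real (count_upto (A w) K x) powr (p / 2)) \<partial>lborel) \<le> D"
      using D1 by (simp_all only: A_def)
    have sm: "(\<Sum>k. of_bool (A w k x)) = (SUP K. ennreal (real (count_upto (A w) K x)))" for x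
    proof -
      have "(\<Sum>k<K. of_bool (A w k x)) = ennreal (real (count_upto (A w) K x))" for K
        using sum_of_bool_ennreal[of "\<lambda>_. 1" "\<lambda>k. A w k x" "{..<K}"] by (simp add: count_upto_eq_sum)
      then show ?thesis by (simp add: suminf_eq_SUP)
    qed
    have "(\<integral>\<^sup>+x. enn_powr (\<Sum>k. of_bool (A w k x)) (p / 2) \<partial>lborel)
        = (\<integral>\<^sup>+x. (SUP K. ennreal (real (count_upto (A w) K x) powr (p / 2))) \<partial>lborel)"
      unfolding sm by (simp add: enn_powr_SUP[OF q])
    also have "\<dots> = (SUP K. \<integral>\<^sup>+x. ennreal (real (count_upto (A w) K x) powr (p / 2)) \<partial>lborel)"
    proof (rule nn_integral_monotone_convergence_SUP)
      show "incseq (\<lambda>K x. ennreal (real (count_upto (A w) K x) powr (p / 2)))"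
        using q by (intro incseq_SucI le_funI ennreal_leI powr_mono2) (auto simp: count_upto_Suc)
    qed measurable
    also have "\<dots> \<le> D" by (intro SUP_least D)
    finally show ?thesis using D(1) by simp
  qed
  have "(\<integral>\<^sup>+x. enn_powr (sq_inner g \<epsilon> x) (p / 2) \<partial>lebesgue) = (\<integral>\<^sup>+x. enn_powr (sq_inner g \<epsilon> x) (p / 2) \<partial>lborel)"
    by (rule nn_integral_completion)
  also have "\<dots> \<le> (\<integral>\<^sup>+x. ennreal (real (card W) powr (p / 2)) * (\<Sum>w\<in>W. enn_powr (\<Sum>k. of_bool (A w k x)) (p / 2)) \<partial>lborel)"
    using q W by (intro nn_integral_mono order_trans[OF enn_powr_mono enn_powr_sum_le]) auto
  also have "\<dots> = ennreal (real (card W) powr (p / 2)) * (\<Sum>w\<in>W. \<integral>\<^sup>+x. enn_powr (\<Sum>k. of_bool (A w k x)) (p / 2) \<partial>lborel)"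
    by (subst nn_integral_cmult, measurable) (subst nn_integral_sum, auto)
  also have "\<dots> < \<infinity>" using fin W(1) by (auto simp: ennreal_mult_less_top)
  finally show ?thesis by (simp add: sq_Lp_finite_def)
qed

section \<open>The tent kernel\<close>

definition tent :: "'a::euclidean_space \<Rightarrow> real" where
  "tent z = (\<Prod>b\<in>Basis. max 0 (1 - \<bar>z \<bullet> b\<bar>))"

definition half_cube :: "'a::euclidean_space set" where
  "half_cube = cbox (- (1/2) *\<^sub>R One) ((1/2) *\<^sub>R One)"

lemma half_cube_iff: "v \<in> half_cube \<longleftrightarrow> (\<forall>b\<in>Basis. \<bar>v \<bullet> b\<bar> \<le> 1/2)"
  by (auto simp: half_cube_def mem_box abs_le_iff)

lemma half_cube_measurable [measurable]: "half_cube \<in> sets borel"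
  by (simp add: half_cube_def)

lemma tent_measurable [measurable]: "tent \<in> borel_measurable borel"
  unfolding tent_def[abs_def] by measurable

lemma tent_nonneg: "0 \<le> tent z"
  unfolding tent_def by (intro prod_nonneg) auto

lemma tent_le_1: "tent z \<le> 1"
  unfolding tent_def by (intro prod_le_1) auto

lemma tent_uminus: "tent (- z) = tent z"
  by (simp add: tent_def)

lemma tent_eq_0: "b \<in> Basis \<Longrightarrow> 1 \<le> \<bar>z \<bullet> b\<bar> \<Longrightarrow> tent z = 0"
  unfolding tent_def by (intro prod_zero bexI[of _ b]) auto

lemma half_cube_uminus: "- v \<in> half_cube \<longleftrightarrow> v \<in> half_cube"
  by (simp add: half_cube_iff)

lemma tent_support:
  fixes z :: "'a::euclidean_space"
  assumes "tent z \<noteq> 0"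
  shows "norm z \<le> real DIM('a)"
proof -
  have "\<bar>z \<bullet> b\<bar> \<le> 1" if "b \<in> Basis" for b using tent_eq_0[OF that, of z] assms by linarith
  then have "(\<Sum>b\<in>Basis. \<bar>z \<bullet> b\<bar>) \<le> (\<Sum>b\<in>(Basis::'a set). 1)" by (intro sum_mono)
  then show ?thesis using norm_le_l1[of z] by simp
qed

lemma tent_ge: "1 - (\<Sum>b\<in>Basis. \<bar>z \<bullet> b\<bar>) \<le> tent z"
proof (cases "\<forall>b\<in>Basis. \<bar>z \<bullet> b\<bar> \<le> 1")
  case True
  have "1 - (\<Sum>b\<in>Basis. \<bar>z \<bullet> b\<bar>) \<le> (\<Prod>b\<in>Basis. 1 - \<bar>z \<bullet> b\<bar>)"
    by (rule Weierstrass_prod_ineq) (use True in auto)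
  also have "\<dots> = tent z" unfolding tent_def using True by (intro prod.cong) auto
  finally show ?thesis .
next
  case False
  then obtain b where b: "b \<in> Basis" "1 < \<bar>z \<bullet> b\<bar>" by auto
  then have "1 < (\<Sum>b\<in>Basis. \<bar>z \<bullet> b\<bar>)" using member_le_sum[of b Basis "\<lambda>b. \<bar>z \<bullet> b\<bar>"] by fastforce
  then show ?thesis using tent_nonneg[of z] by linarith
qed

text \<open>Two translates of a unit cube meet in a box whose sides are the positive parts of
  \<open>1 - |z_b|\<close>. The total mass 1 and the moduli of continuity of the tent follow from
  this representation without differentiation.\<close>

lemma nn_integral_half_cube_convolution:
  "(\<integral>\<^sup>+v. indicator half_cube v * indicator half_cube (z - v) \<partial>lborel) = ennreal (tent z)"
proof -
  let ?l = "\<Sum>b\<in>Basis. max (- 1/2) (z \<bullet> b - 1/2) *\<^sub>R b" and ?u = "\<Sum>b\<in>Basis. min (1/2) (z \<bullet> b + 1/2) *\<^sub>R b"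
  have "indicator half_cube v * indicator half_cube (z - v) = (indicator (cbox ?l ?u) v :: ennreal)" for v
  proof -
    have "v \<in> half_cube \<and> z - v \<in> half_cube \<longleftrightarrow> v \<in> cbox ?l ?u"
    proof -
      have "\<bar>a\<bar> \<le> 1/2 \<and> \<bar>c - a\<bar> \<le> 1/2 \<longleftrightarrow> max (- 1/2) (c - 1/2) \<le> a \<and> a \<le> min (1/2) (c + 1/2)" for a c :: real
        by (auto simp: max_def min_def abs_if split: if_splits)
      from this[of "v \<bullet> b" "z \<bullet> b" for b] show ?thesis
        unfolding half_cube_iff mem_box ball_conj_distrib[symmetric]
        by (intro ball_cong refl) (simp add: inner_diff_left)
    qed
    then show ?thesis by (auto simp: indicator_def)
  qed
  then have "(\<integral>\<^sup>+v. indicator half_cube v * indicator half_cube (z - v) \<partial>lborel) = emeasure lborel (cbox ?l ?u)"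
    by simp
  also have "\<dots> = ennreal (tent z)"
  proof (cases "\<forall>b\<in>Basis. \<bar>z \<bullet> b\<bar> \<le> 1")
    case True
    have "?l \<bullet> b \<le> ?u \<bullet> b" if "b \<in> Basis" for b using True that by (auto simp: abs_le_iff max_def min_def)
    then have "emeasure lborel (cbox ?l ?u) = ennreal (\<Prod>b\<in>Basis. (?u - ?l) \<bullet> b)" by (rule emeasure_lborel_cbox)
    also have "(\<Prod>b\<in>Basis. (?u - ?l) \<bullet> b) = tent z"
      unfolding tent_def using True
      by (intro prod.cong refl) (auto simp: inner_diff_left max_def min_def abs_if split: if_splits)
    finally show ?thesis .
  next
    case False
    then obtain b where b: "b \<in> Basis" "1 < \<bar>z \<bullet> b\<bar>" by auto
    then have "?u \<bullet> b < ?l \<bullet> b" by (auto simp: max_def min_def abs_if split: if_splits)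
    then have "cbox ?l ?u = {}" using b by (auto simp: box_eq_empty)
    then show ?thesis using tent_eq_0[of b z] b by simp
  qed
  finally show ?thesis .
qed

lemma emeasure_half_cube: "emeasure lborel (half_cube :: 'a::euclidean_space set) = 1"
proof -
  have "indicator half_cube v * indicator half_cube (0 - v) = (indicator half_cube v :: ennreal)" for v :: 'a
    by (auto simp: indicator_def half_cube_iff)
  then show ?thesis using nn_integral_half_cube_convolution[of "0::'a"] by (simp add: tent_def)
qed

lemma nn_integral_tent: "(\<integral>\<^sup>+z. ennreal (tent z) \<partial>(lborel :: 'a::euclidean_space measure)) = 1"
proof -
  let ?c = "indicator half_cube :: 'a \<Rightarrow> ennreal"
  have "(\<integral>\<^sup>+z. ennreal (tent z) \<partial>(lborel :: 'a measure)) = (\<integral>\<^sup>+z. (\<integral>\<^sup>+v. ?c v * ?c (z - v) \<partial>lborel) \<partial>lborel)"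
    by (simp add: nn_integral_half_cube_convolution)
  also have "\<dots> = (\<integral>\<^sup>+v. (\<integral>\<^sup>+z. ?c v * ?c (z - v) \<partial>lborel) \<partial>lborel)"
    by (rule lborel_pair.Fubini') measurable
  also have "\<dots> = (\<integral>\<^sup>+v. ?c v \<partial>lborel)"
  proof (rule nn_integral_cong)
    fix v :: 'a
    have "(\<integral>\<^sup>+z. ?c (z - v) \<partial>lborel) = 1"
      using nn_integral_lborel_shift[of ?c "- v"] emeasure_half_cube[where 'a='a] by simp
    then show "(\<integral>\<^sup>+z. ?c v * ?c (z - v) \<partial>lborel) = ?c v" by (simp add: nn_integral_cmult)
  qed
  finally show ?thesis using emeasure_half_cube[where 'a='a] by simp
qed

definition cube_shift :: "'a::euclidean_space \<Rightarrow> 'a \<Rightarrow> real" where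
  "cube_shift h v = indicator half_cube (v + h) - indicator half_cube v"

lemma cube_shift_measurable [measurable]: "cube_shift h \<in> borel_measurable borel"
  unfolding cube_shift_def[abs_def] by measurable

text \<open>The symmetric difference of two translated unit cubes has measure
  \<open>2 - 2 * tent h\<close>, and \<open>tent h\<close> is close to 1 by the Weierstrass product
  inequality.\<close>

lemma nn_integral_cube_shift:
  fixes h :: "'a::euclidean_space"
  shows "(\<integral>\<^sup>+v. ennreal \<bar>cube_shift h v\<bar> \<partial>lborel) \<le> ennreal (2 * real DIM('a) * norm h)"
proof -
  let ?c = "indicator half_cube :: 'a \<Rightarrow> real" and ?e = "indicator half_cube :: 'a \<Rightarrow> ennreal"
  have refl: "?e (- h - v) = ?e (v + h)" for v
    using half_cube_uminus[of "v + h"] by (simp add: indicator_def algebra_simps)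
  have 1: "(\<integral>\<^sup>+v. ?e v * ?e (v + h) \<partial>lborel) = ennreal (tent h)"
    using nn_integral_half_cube_convolution[of "- h"] by (simp add: refl tent_uminus)
  have 2: "(\<integral>\<^sup>+v. ?e (v + h) \<partial>lborel) = 1" "(\<integral>\<^sup>+v. ?e v \<partial>lborel) = 1"
    using nn_integral_lborel_shift[of ?e h] emeasure_half_cube[where 'a='a] by simp_all
  \<comment> \<open>Written as a sum so that no subtraction of extended reals occurs before
    finiteness is known.\<close>
  have "ennreal \<bar>cube_shift h v\<bar> + 2 * (?e v * ?e (v + h)) = ?e (v + h) + ?e v" for v
    by (auto simp: cube_shift_def indicator_def)
  then have "(\<integral>\<^sup>+v. ennreal \<bar>cube_shift h v\<bar> + 2 * (?e v * ?e (v + h)) \<partial>lborel) = (\<integral>\<^sup>+v. ?e (v + h) + ?e v \<partial>lborel)"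
    by simp
  also have "\<dots> = 2" using 2 by (subst nn_integral_add) auto
  finally have "(\<integral>\<^sup>+v. ennreal \<bar>cube_shift h v\<bar> \<partial>lborel) + 2 * ennreal (tent h) = 2"
    using 1 by (subst (asm) nn_integral_add) (auto simp: nn_integral_cmult)
  then have "(\<integral>\<^sup>+v. ennreal \<bar>cube_shift h v\<bar> \<partial>lborel) = ennreal (2 - 2 * tent h)"
    using tent_nonneg[of h] tent_le_1[of h]
    by (cases "\<integral>\<^sup>+v. ennreal \<bar>cube_shift h v\<bar> \<partial>lborel")
       (auto simp: ennreal_mult[symmetric] ennreal_plus[symmetric] simp del: ennreal_plus simp flip: ennreal_numeral)
  also have "\<dots> \<le> ennreal (2 * real DIM('a) * norm h)"
  proof (rule ennreal_leI)
    have "(\<Sum>b\<in>Basis. \<bar>h \<bullet> b\<bar>) \<le> (\<Sum>b\<in>(Basis::'a set). norm h)" by (intro sum_mono Basis_le_norm)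
    then show "2 - 2 * tent h \<le> 2 * real DIM('a) * norm h" using tent_ge[of h] by simp
  qed
  finally show ?thesis .
qed

lemma tent_eq_integral: "tent z = (\<integral>v. indicator half_cube v * indicator half_cube (z - v) \<partial>lborel)"
  and integrable_half_cube_convolution:
    "integrable lborel (\<lambda>v. indicator half_cube v * indicator half_cube (z - v) :: real)"
proof -
  let ?f = "\<lambda>v. indicator half_cube v * indicator half_cube (z - v) :: real"
  have e: "(\<integral>\<^sup>+v. ennreal (?f v) \<partial>lborel) = ennreal (tent z)"
    unfolding nn_integral_half_cube_convolution[symmetric]
    by (intro nn_integral_cong) (auto simp: indicator_def)
  show i: "integrable lborel ?f"
    by (intro integrableI_nonneg) (auto simp: e)
  have "ennreal (tent z) = ennreal (\<integral>v. ?f v \<partial>lborel)"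
    unfolding e[symmetric] by (rule nn_integral_eq_integral[OF i]) auto
  then show "tent z = (\<integral>v. ?f v \<partial>lborel)" using tent_nonneg[of z] by simp
qed

lemma lborel_integral_shift:
  fixes f :: "'a::euclidean_space \<Rightarrow> real"
  assumes [measurable]: "f \<in> borel_measurable borel"
  shows "(\<integral>x. f (x + t) \<partial>lborel) = (\<integral>x. f x \<partial>lborel)"
  by (subst (2) lborel_affine[of 1 t]) (simp_all add: density_1 integral_distr add.commute)

lemma integrable_lborel_shift:
  fixes f :: "'a::euclidean_space \<Rightarrow> real"
  assumes "integrable lborel f"
  shows "integrable lborel (\<lambda>x. f (x + t))"
proof -
  have [measurable]: "f \<in> borel_measurable borel" using assms by auto
  show ?thesis
  proof (rule integrableI_bounded)
    show "(\<integral>\<^sup>+x. ennreal (norm (f (x + t))) \<partial>lborel) < \<infinity>"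
      using assms nn_integral_lborel_shift[of "\<lambda>x. ennreal (norm (f x))" t]
      by (auto simp: integrable_iff_bounded)
  qed simp
qed

lemma cube_convolution_shift:
  "integrable lborel (\<lambda>v. cube_shift h v * indicator half_cube (z - v))"
  "tent (z + h) - tent z = (\<integral>v. cube_shift h v * indicator half_cube (z - v) \<partial>lborel)"
proof -
  let ?c = "indicator half_cube :: 'a \<Rightarrow> real"
  have e: "?c v * ?c (z + h - v) = (\<lambda>w. ?c (w + h) * ?c (z - w)) (v + (- h))" for v
    by (simp add: algebra_simps)
  have i1: "integrable lborel (\<lambda>v. ?c (v + h) * ?c (z - v))"
    using integrable_lborel_shift[OF integrable_half_cube_convolution[of "z + h"], of h] by simp
  have t1: "tent (z + h) = (\<integral>v. ?c (v + h) * ?c (z - v) \<partial>lborel)"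
    unfolding tent_eq_integral[of "z + h"]
    using lborel_integral_shift[of "\<lambda>v. ?c v * ?c (z + h - v)" h] by simp
  have eq: "cube_shift h v * ?c (z - v) = ?c (v + h) * ?c (z - v) - ?c v * ?c (z - v)" for v
    by (simp add: cube_shift_def algebra_simps)
  show "integrable lborel (\<lambda>v. cube_shift h v * ?c (z - v))"
    unfolding eq by (intro Bochner_Integration.integrable_diff i1 integrable_half_cube_convolution)
  show "tent (z + h) - tent z = (\<integral>v. cube_shift h v * ?c (z - v) \<partial>lborel)"
    unfolding eq t1 tent_eq_integral[of z]
    by (rule Bochner_Integration.integral_diff[OF i1 integrable_half_cube_convolution[of z], symmetric])
qed

text \<open>The \<open>L^1\<close> convolution inequality. If the inner integral does not exist it
  has the value 0, so no integrability has to be assumed.\<close>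

lemma nn_integral_abs_convolution_le:
  fixes F G :: "'a::euclidean_space \<Rightarrow> real"
  assumes [measurable]: "F \<in> borel_measurable borel" "G \<in> borel_measurable borel"
  shows "(\<integral>\<^sup>+z. ennreal \<bar>\<integral>v. F v * G (z - v) \<partial>lborel\<bar> \<partial>lborel)
    \<le> (\<integral>\<^sup>+v. ennreal \<bar>F v\<bar> \<partial>lborel) * (\<integral>\<^sup>+v. ennreal \<bar>G v\<bar> \<partial>lborel)"
proof -
  have "(\<integral>\<^sup>+z. ennreal \<bar>\<integral>v. F v * G (z - v) \<partial>lborel\<bar> \<partial>lborel)
      \<le> (\<integral>\<^sup>+z. (\<integral>\<^sup>+v. ennreal \<bar>F v\<bar> * ennreal \<bar>G (z - v)\<bar> \<partial>lborel) \<partial>lborel)"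
  proof (rule nn_integral_mono)
    fix z
    show "ennreal \<bar>\<integral>v. F v * G (z - v) \<partial>lborel\<bar> \<le> (\<integral>\<^sup>+v. ennreal \<bar>F v\<bar> * ennreal \<bar>G (z - v)\<bar> \<partial>lborel)"
      using integral_norm_bound_ennreal[of lborel "\<lambda>v. F v * G (z - v)"]
      by (cases "integrable lborel (\<lambda>v. F v * G (z - v))")
         (auto simp: abs_mult ennreal_mult not_integrable_integral_eq)
  qed
  also have "\<dots> = (\<integral>\<^sup>+v. (\<integral>\<^sup>+z. ennreal \<bar>F v\<bar> * ennreal \<bar>G (z - v)\<bar> \<partial>lborel) \<partial>lborel)"
    by (rule lborel_pair.Fubini') measurable
  also have "\<dots> = (\<integral>\<^sup>+v. ennreal \<bar>F v\<bar> * (\<integral>\<^sup>+z. ennreal \<bar>G z\<bar> \<partial>lborel) \<partial>lborel)"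
  proof (rule nn_integral_cong)
    fix v
    show "(\<integral>\<^sup>+z. ennreal \<bar>F v\<bar> * ennreal \<bar>G (z - v)\<bar> \<partial>lborel) = ennreal \<bar>F v\<bar> * (\<integral>\<^sup>+z. ennreal \<bar>G z\<bar> \<partial>lborel)"
      using nn_integral_lborel_shift[of "\<lambda>z. ennreal \<bar>G z\<bar>" "- v"] by (simp add: nn_integral_cmult)
  qed
  also have "\<dots> = (\<integral>\<^sup>+v. ennreal \<bar>F v\<bar> \<partial>lborel) * (\<integral>\<^sup>+v. ennreal \<bar>G v\<bar> \<partial>lborel)"
    by (rule nn_integral_multc) measurable
  finally show ?thesis .
qed

lemma tent_first_modulus:
  fixes h :: "'a::euclidean_space"
  shows "(\<integral>\<^sup>+z. ennreal \<bar>tent (z + h) - tent z\<bar> \<partial>lborel) \<le> ennreal (2 * real DIM('a) * norm h)"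
proof -
  have "(\<integral>\<^sup>+z. ennreal \<bar>tent (z + h) - tent z\<bar> \<partial>lborel)
     \<le> (\<integral>\<^sup>+v. ennreal \<bar>cube_shift h v\<bar> \<partial>lborel) * (\<integral>\<^sup>+v. ennreal \<bar>indicator half_cube v\<bar> \<partial>(lborel :: 'a measure))"
    unfolding cube_convolution_shift(2) by (rule nn_integral_abs_convolution_le) measurable
  also have "(\<integral>\<^sup>+v. ennreal \<bar>indicator half_cube v\<bar> \<partial>(lborel :: 'a measure)) = 1"
    using emeasure_half_cube[where 'a='a] by (simp add: ennreal_indicator)
  finally show ?thesis using nn_integral_cube_shift[of h] by simp
qed

text \<open>\<open>tent\<close> is the convolution square of \<open>half_cube\<close>, so its second difference is the convolution
  square of a first difference.\<close>

lemma tent_second_modulus: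
  fixes h :: "'a::euclidean_space"
  shows "(\<integral>\<^sup>+z. ennreal \<bar>tent (z + h) - 2 * tent z + tent (z - h)\<bar> \<partial>lborel) \<le> ennreal ((2 * real DIM('a) * norm h)\<^sup>2)"
proof -
  let ?c = "indicator half_cube :: 'a \<Rightarrow> real"
  \<comment> \<open>One difference is put on each factor of the convolution, so that each factor
    contributes one power of \<open>norm h\<close>.\<close>
  have eq: "tent (z + h) - 2 * tent z + tent (z - h) = (\<integral>v. cube_shift h v * cube_shift h (z - h - v) \<partial>lborel)" for z
  proof -
    have "tent (z + h) - 2 * tent z + tent (z - h) = (tent (z + h) - tent z) - (tent ((z - h) + h) - tent (z - h))" by simp
    also have "\<dots> = (\<integral>v. cube_shift h v * ?c (z - v) - cube_shift h v * ?c (z - h - v) \<partial>lborel)"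
      unfolding cube_convolution_shift(2)
      using cube_convolution_shift(1)[of h z] cube_convolution_shift(1)[of h "z - h"] by simp
    also have "\<dots> = (\<integral>v. cube_shift h v * cube_shift h (z - h - v) \<partial>lborel)"
    proof -
      have "cube_shift h (z - h - v) = ?c (z - v) - ?c (z - h - v)" for v by (simp add: cube_shift_def)
      then show ?thesis by (simp add: right_diff_distrib)
    qed
    finally show ?thesis .
  qed
  have "(\<integral>\<^sup>+z. ennreal \<bar>tent (z + h) - 2 * tent z + tent (z - h)\<bar> \<partial>lborel)
      = (\<integral>\<^sup>+z. ennreal \<bar>\<integral>v. cube_shift h v * (\<lambda>y. cube_shift h (y - h)) (z - v) \<partial>lborel\<bar> \<partial>lborel)"
    unfolding eq by (intro nn_integral_cong) (simp add: algebra_simps)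
  also have "\<dots> \<le> (\<integral>\<^sup>+v. ennreal \<bar>cube_shift h v\<bar> \<partial>lborel) * (\<integral>\<^sup>+v. ennreal \<bar>cube_shift h (v - h)\<bar> \<partial>lborel)"
    by (rule nn_integral_abs_convolution_le) measurable
  also have "(\<integral>\<^sup>+v. ennreal \<bar>cube_shift h (v - h)\<bar> \<partial>lborel) = (\<integral>\<^sup>+v. ennreal \<bar>cube_shift h v\<bar> \<partial>lborel)"
    using nn_integral_lborel_shift[of "\<lambda>v. ennreal \<bar>cube_shift h v\<bar>" "- h"] by simp
  also have "(\<integral>\<^sup>+v. ennreal \<bar>cube_shift h v\<bar> \<partial>lborel) * \<dots> \<le> ennreal (2 * real DIM('a) * norm h) * ennreal (2 * real DIM('a) * norm h)"
    by (intro mult_mono nn_integral_cube_shift) auto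
  also have "\<dots> = ennreal ((2 * real DIM('a) * norm h)\<^sup>2)"
    by (simp add: ennreal_mult[symmetric] power2_eq_square)
  finally show ?thesis .
qed

section \<open>Averages against the tent kernel\<close>

definition tent_measure :: "'a::euclidean_space measure" where
  "tent_measure = density lborel (\<lambda>z. ennreal (tent z))"

definition tent_avg :: "real \<Rightarrow> ('a::euclidean_space \<Rightarrow> real) \<Rightarrow> 'a \<Rightarrow> real" where
  "tent_avg t f x = (\<integral>z. f (x + t *\<^sub>R z) \<partial>tent_measure)"

lemma sets_tent_measure [measurable_cong, simp]: "sets tent_measure = sets borel"
  and space_tent_measure [simp]: "space tent_measure = UNIV"
  by (auto simp: tent_measure_def)

lemma prob_space_tent_measure: "prob_space (tent_measure :: 'a::euclidean_space measure)"
proof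
  show "emeasure (tent_measure :: 'a measure) (space tent_measure) = 1"
    using nn_integral_tent[where 'a='a] by (simp add: tent_measure_def emeasure_density)
qed

interpretation tent: prob_space "tent_measure :: 'a::euclidean_space measure"
  by (rule prob_space_tent_measure)

lemma tent_prob_UNIV [simp]: "tent.prob UNIV = 1" "emeasure tent_measure UNIV = 1"
  using tent.prob_space tent.emeasure_space_1 by simp_all

lemma AE_tent_measure: "AE z in (tent_measure :: 'a::euclidean_space measure). norm z \<le> real DIM('a)"
  unfolding tent_measure_def using tent_support[where 'a='a] by (subst AE_density) (auto intro!: AE_I2)

lemma tent_integral_abs_le:
  fixes F :: "'a::euclidean_space \<Rightarrow> real"
  assumes [measurable]: "F \<in> borel_measurable borel" and b: "\<And>z. norm z \<le> real DIM('a) \<Longrightarrow> \<bar>F z\<bar> \<le> b"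
  shows "\<bar>\<integral>z. F z \<partial>tent_measure\<bar> \<le> b"
proof -
  have ae: "AE z in tent_measure. \<bar>F z\<bar> \<le> b" using AE_tent_measure by eventually_elim (rule b)
  have "\<bar>\<integral>z. F z \<partial>tent_measure\<bar> \<le> (\<integral>z. \<bar>F z\<bar> \<partial>tent_measure)" by (rule integral_abs_bound)
  also have "\<dots> \<le> (\<integral>z. b \<partial>(tent_measure :: 'a measure))"
  proof (rule integral_mono_AE)
    show "integrable tent_measure (\<lambda>z. \<bar>F z\<bar>)" using ae by (intro tent.integrable_const_bound[where B=b]) auto
  qed (use ae in auto)
  finally show ?thesis by simp
qed

lemma tent_integral_eq:
  assumes [measurable]: "F \<in> borel_measurable borel"
  shows "(\<integral>z. F z \<partial>tent_measure) = (\<integral>z. tent z * F z \<partial>lborel)"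
  unfolding tent_measure_def using tent_nonneg by (subst integral_density) auto

lemma tent_avg_abs_le:
  assumes [measurable]: "f \<in> borel_measurable borel" and S: "\<And>x. \<bar>f x\<bar> \<le> S"
  shows "\<bar>tent_avg t f x\<bar> \<le> S"
  unfolding tent_avg_def using S by (intro tent_integral_abs_le) auto

lemma integrable_tent: "integrable lborel (tent :: 'a::euclidean_space \<Rightarrow> real)"
  using nn_integral_tent[where 'a='a] tent_nonneg by (intro integrableI_nonneg) auto

lemma integrable_tent_times:
  assumes [measurable]: "F \<in> borel_measurable borel" and S: "\<And>x. \<bar>F x\<bar> \<le> S"
  shows "integrable lborel (\<lambda>z. tent (z + h) * F z)"
proof (rule Bochner_Integration.integrable_bound)
  show "integrable lborel (\<lambda>z. S * tent (z + h))"
    by (intro integrable_mult_right integrable_lborel_shift integrable_tent)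
  show "AE z in lborel. norm (tent (z + h) * F z) \<le> norm (S * tent (z + h))"
  proof (intro AE_I2)
    fix z
    have "\<bar>F z\<bar> \<le> \<bar>S\<bar>" using S[of z] by linarith
    then have "\<bar>tent (z + h)\<bar> * \<bar>F z\<bar> \<le> \<bar>tent (z + h)\<bar> * \<bar>S\<bar>" by (intro mult_left_mono) auto
    then show "norm (tent (z + h) * F z) \<le> norm (S * tent (z + h))" by (simp add: abs_mult mult.commute)
  qed
qed simp

text \<open>A translation of the argument becomes a translation of the kernel. The regularity of the
  average is therefore that of the tent, and \<open>f\<close> itself needs only to be
  bounded.\<close>

lemma tent_avg_shift:
  fixes f :: "'a::euclidean_space \<Rightarrow> real"
  assumes [measurable]: "f \<in> borel_measurable borel" and t: "t > 0"
  shows "tent_avg t f (x + h) = (\<integral>z. tent (z + - (1 / t) *\<^sub>R h) * f (x + t *\<^sub>R z) \<partial>lborel)"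
proof -
  have "tent_avg t f (x + h) = (\<integral>z. tent z * f (x + h + t *\<^sub>R z) \<partial>lborel)"
    unfolding tent_avg_def by (rule tent_integral_eq) simp
  also have "\<dots> = (\<integral>z. tent (z + - (1 / t) *\<^sub>R h) * f (x + h + t *\<^sub>R (z + - (1 / t) *\<^sub>R h)) \<partial>lborel)"
    by (rule lborel_integral_shift[symmetric]) simp
  also have "\<dots> = (\<integral>z. tent (z + - (1 / t) *\<^sub>R h) * f (x + t *\<^sub>R z) \<partial>lborel)"
    using t by (simp add: algebra_simps)
  finally show ?thesis .
qed

lemma abs_integral_kernel_le:
  fixes F k :: "'a::euclidean_space \<Rightarrow> real"
  assumes [measurable]: "F \<in> borel_measurable borel" "k \<in> borel_measurable borel" and S: "\<And>x. \<bar>F x\<bar> \<le> S"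
    and k: "(\<integral>\<^sup>+z. ennreal \<bar>k z\<bar> \<partial>lborel) \<le> ennreal L" and L: "L \<ge> 0"
  shows "\<bar>\<integral>z. k z * F z \<partial>lborel\<bar> \<le> S * L"
proof -
  have S0: "S \<ge> 0" using S[of 0] by linarith
  have ik: "integrable lborel (\<lambda>z. \<bar>k z\<bar>)" using k by (intro integrableI_bounded) (auto simp: le_less_trans)
  have kL: "(\<integral>z. \<bar>k z\<bar> \<partial>lborel) \<le> L" using k L ik by (simp add: nn_integral_eq_integral)
  have bd: "\<bar>k z\<bar> * \<bar>F z\<bar> \<le> S * \<bar>k z\<bar>" for z
    using mult_left_mono[OF S[of z], of "\<bar>k z\<bar>"] by (simp add: mult.commute)
  have "\<bar>\<integral>z. k z * F z \<partial>lborel\<bar> \<le> (\<integral>z. \<bar>k z * F z\<bar> \<partial>lborel)" by (rule integral_abs_bound)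
  also have "\<dots> \<le> (\<integral>z. S * \<bar>k z\<bar> \<partial>lborel)"
  proof (rule integral_mono)
    show "integrable lborel (\<lambda>z. \<bar>k z * F z\<bar>)"
      by (rule Bochner_Integration.integrable_bound[OF integrable_mult_right[OF ik, of S]]) (use bd S0 in \<open>auto simp: abs_mult\<close>)
  qed (use ik bd in \<open>auto simp: abs_mult\<close>)
  also have "\<dots> \<le> S * L" using kL S0 by (simp add: mult_left_mono)
  finally show ?thesis .
qed

lemma tent_avg_lipschitz:
  fixes f :: "'a::euclidean_space \<Rightarrow> real"
  assumes [measurable]: "f \<in> borel_measurable borel" and S: "\<And>x. \<bar>f x\<bar> \<le> S" and t: "t > 0"
  shows "\<bar>tent_avg t f (x + h) - tent_avg t f x\<bar> \<le> S * (2 * real DIM('a) * (norm h / t))"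
proof -
  let ?h = "- (1 / t) *\<^sub>R h"
  have "tent_avg t f (x + h) - tent_avg t f x = (\<integral>z. (tent (z + ?h) - tent z) * f (x + t *\<^sub>R z) \<partial>lborel)"
    unfolding tent_avg_shift[OF assms(1) t] using tent_avg_shift[OF assms(1) t, of x 0]
      integrable_tent_times[of "\<lambda>z. f (x + t *\<^sub>R z)" S ?h] integrable_tent_times[of "\<lambda>z. f (x + t *\<^sub>R z)" S 0] S
    by (simp add: left_diff_distrib)
  also have "\<bar>\<dots>\<bar> \<le> S * (2 * real DIM('a) * norm ?h)"
    using S by (intro abs_integral_kernel_le tent_first_modulus) auto
  also have "norm ?h = norm h / t" using t by simp
  finally show ?thesis .
qed

text \<open>The gain is quadratic in \<open>norm h / t\<close>. A linear gain would leave a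
  logarithm when pieces of size comparable to their scale are summed over all scales coarser than
  \<open>norm h\<close>; see \<open>tent_series_Lambda1\<close>.\<close>

lemma tent_avg_Dh2:
  fixes f :: "'a::euclidean_space \<Rightarrow> real"
  assumes [measurable]: "f \<in> borel_measurable borel" and S: "\<And>x. \<bar>f x\<bar> \<le> S" and t: "t > 0"
  shows "\<bar>Dh2 h (tent_avg t f) x\<bar> \<le> S * (2 * real DIM('a) * (norm h / t))\<^sup>2"
proof -
  define h' where "h' = - (1 / t) *\<^sub>R h"
  let ?f = "\<lambda>z. f (x + t *\<^sub>R z)"
  have i: "integrable lborel (\<lambda>z. tent (z + v) * ?f z)" for v
    using S by (intro integrable_tent_times) auto
  have i': "integrable lborel (\<lambda>z. tent z * ?f z)" "integrable lborel (\<lambda>z. tent (z - h') * ?f z)"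
    using i[of 0] i[of "- h'"] by simp_all
  have "Dh2 h (tent_avg t f) x = (\<integral>z. tent (z + h') * ?f z \<partial>lborel) - 2 * (\<integral>z. tent z * ?f z \<partial>lborel) + (\<integral>z. tent (z - h') * ?f z \<partial>lborel)"
    unfolding Dh2_eq using tent_avg_shift[OF assms(1) t, of x h] tent_avg_shift[OF assms(1) t, of x 0] tent_avg_shift[OF assms(1) t, of x "- h"]
    by (simp add: h'_def)
  also have "\<dots> = (\<integral>z. tent (z + h') * ?f z - 2 * (tent z * ?f z) + tent (z - h') * ?f z \<partial>lborel)"
    using i[of h'] i' by simp
  also have "\<dots> = (\<integral>z. (tent (z + h') - 2 * tent z + tent (z - h')) * ?f z \<partial>lborel)"
    by (intro Bochner_Integration.integral_cong) (auto simp: algebra_simps)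
  also have "\<bar>\<dots>\<bar> \<le> S * (2 * real DIM('a) * norm h')\<^sup>2"
    using S by (intro abs_integral_kernel_le tent_second_modulus) auto
  also have "norm h' = norm h / t" using t by (simp add: h'_def)
  finally show ?thesis .
qed

lemma tent_avg_continuous:
  fixes f :: "'a::euclidean_space \<Rightarrow> real"
  assumes [measurable]: "f \<in> borel_measurable borel" and S: "\<And>x. \<bar>f x\<bar> \<le> S" and t: "t > 0"
  shows "continuous_on UNIV (tent_avg t f)"
proof -
  have S0: "S \<ge> 0" using S[of 0] by linarith
  define L where "L = S * (2 * real DIM('a) / t)"
  have "L-lipschitz_on UNIV (tent_avg t f)"
  proof (rule lipschitz_onI)
    show "dist (tent_avg t f x) (tent_avg t f y) \<le> L * dist x y" for x y
      using tent_avg_lipschitz[OF assms, of y "x - y"] by (simp add: dist_norm L_def)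
    show "0 \<le> L" using S0 t by (simp add: L_def)
  qed
  then show ?thesis by (rule lipschitz_on_continuous_on)
qed

lemma tent_avg_measurable [measurable]:
  assumes [measurable]: "f \<in> borel_measurable borel"
  shows "tent_avg t f \<in> borel_measurable borel"
  unfolding tent_avg_def by measurable

lemma integrable_tent_avg:
  fixes f :: "'a::euclidean_space \<Rightarrow> real"
  assumes [measurable]: "f \<in> borel_measurable borel" and "\<And>x. \<bar>f x\<bar> \<le> S"
  shows "integrable tent_measure (\<lambda>z. f (x + t *\<^sub>R z))"
  using assms by (intro tent.integrable_const_bound[where B=S]) auto

lemma tent_avg_add:
  fixes f g :: "'a::euclidean_space \<Rightarrow> real"
  assumes [measurable]: "f \<in> borel_measurable borel" "g \<in> borel_measurable borel"
    and "\<And>x. \<bar>f x\<bar> \<le> S" "\<And>x. \<bar>g x\<bar> \<le> S'"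
  shows "tent_avg t (\<lambda>x. f x + g x) x = tent_avg t f x + tent_avg t g x"
    and "tent_avg t (\<lambda>x. f x - g x) x = tent_avg t f x - tent_avg t g x"
  unfolding tent_avg_def using integrable_tent_avg[of f S x t] integrable_tent_avg[of g S' x t] assms by auto

lemma tent_avg_commute:
  fixes f :: "'a::euclidean_space \<Rightarrow> real"
  assumes [measurable]: "f \<in> borel_measurable borel" and S: "\<And>x. \<bar>f x\<bar> \<le> S"
  shows "tent_avg s (tent_avg t f) x = tent_avg t (tent_avg s f) x"
proof -
  interpret P: pair_prob_space "tent_measure :: 'a measure" "tent_measure :: 'a measure" ..
  have "integrable (tent_measure \<Otimes>\<^sub>M tent_measure) (\<lambda>(z, y). f (x + s *\<^sub>R z + t *\<^sub>R y))"
    using S by (intro P.integrable_const_bound[where B=S]) auto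
  from P.Fubini_integral[OF this] show ?thesis
    unfolding tent_avg_def by (simp add: add_ac)
qed

text \<open>The tent is even, so the values at \<open>z\<close> and \<open>- z\<close> can be
  paired; the error of the average is then a mean of second differences with no first-order
  part.\<close>

lemma tent_avg_minus_id:
  fixes f :: "'a::euclidean_space \<Rightarrow> real"
  assumes [measurable]: "f \<in> borel_measurable borel" and S: "\<And>x. \<bar>f x\<bar> \<le> S"
  shows "tent_avg t f x - f x = (\<integral>z. Dh2 (t *\<^sub>R z) f x \<partial>tent_measure) / 2"
proof -
  have i: "integrable tent_measure (\<lambda>z. f (x + t *\<^sub>R z))" for t
    using S by (intro integrable_tent_avg) auto
  have neg: "(\<integral>z. f (x - t *\<^sub>R z) \<partial>tent_measure) = tent_avg t f x"
  proof -
    have "(\<integral>z. f (x - t *\<^sub>R z) \<partial>tent_measure) = (\<integral>z. tent z * f (x - t *\<^sub>R z) \<partial>lborel)"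
      by (rule tent_integral_eq) simp
    also have "\<dots> = (\<integral>z. tent (0 - z) * f (x - t *\<^sub>R (0 - z)) \<partial>lborel)"
      by (rule lborel_integral_reflect[symmetric]) simp
    also have "\<dots> = (\<integral>z. tent z * f (x + t *\<^sub>R z) \<partial>lborel)" by (simp add: tent_uminus)
    also have "\<dots> = tent_avg t f x" unfolding tent_avg_def by (rule tent_integral_eq[symmetric]) simp
    finally show ?thesis .
  qed
  have "(\<integral>z. Dh2 (t *\<^sub>R z) f x \<partial>tent_measure) = tent_avg t f x - 2 * f x + tent_avg t f x"
    unfolding Dh2_eq using i[of t] i[of "- t"] neg by (simp add: tent_avg_def)
  then show ?thesis by simp
qed

lemma tent_avg_nn_integral_le:
  fixes f :: "'a::euclidean_space \<Rightarrow> real"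
  assumes [measurable]: "f \<in> borel_measurable borel"
  shows "(\<integral>\<^sup>+x. ennreal \<bar>tent_avg t f x\<bar> \<partial>lborel) \<le> (\<integral>\<^sup>+x. ennreal \<bar>f x\<bar> \<partial>lborel)"
proof -
  interpret pair_sigma_finite lborel "tent_measure :: 'a measure" ..
  have "(\<integral>\<^sup>+x. ennreal \<bar>tent_avg t f x\<bar> \<partial>lborel) \<le> (\<integral>\<^sup>+x. (\<integral>\<^sup>+z. ennreal \<bar>f (x + t *\<^sub>R z)\<bar> \<partial>tent_measure) \<partial>lborel)"
    unfolding tent_avg_def using tent.jensen_powr[of "\<lambda>z. f (x + t *\<^sub>R z)" 1 for x]
    by (intro nn_integral_mono) simp
  also have "\<dots> = (\<integral>\<^sup>+z. (\<integral>\<^sup>+x. ennreal \<bar>f (x + t *\<^sub>R z)\<bar> \<partial>lborel) \<partial>tent_measure)"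
    by (rule Fubini'[symmetric]) measurable
  also have "\<dots> = (\<integral>\<^sup>+z. (\<integral>\<^sup>+x. ennreal \<bar>f x\<bar> \<partial>lborel) \<partial>(tent_measure :: 'a measure))"
  proof (rule nn_integral_cong)
    fix z :: 'a
    show "(\<integral>\<^sup>+x. ennreal \<bar>f (x + t *\<^sub>R z)\<bar> \<partial>lborel) = (\<integral>\<^sup>+x. ennreal \<bar>f x\<bar> \<partial>lborel)"
      by (rule nn_integral_lborel_shift) measurable
  qed
  finally show ?thesis by simp
qed

section \<open>The derivative of a tent average\<close>

text \<open>The half-open conventions make this the right derivative of the tent in direction
  \<open>i\<close> at every point, kinks included, and make it fit the half-open dyadic cells
  exactly.\<close>

definition tent_deriv :: "'a::euclidean_space \<Rightarrow> 'a \<Rightarrow> real" where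
  "tent_deriv i z = (if -1 \<le> z \<bullet> i \<and> z \<bullet> i < 1 then (if z \<bullet> i < 0 then 1 else -1) else 0)
     * (\<Prod>b\<in>Basis - {i}. max 0 (1 - \<bar>z \<bullet> b\<bar>))"

definition tent_avg_deriv :: "'a::euclidean_space \<Rightarrow> real \<Rightarrow> ('a \<Rightarrow> real) \<Rightarrow> 'a \<Rightarrow> real" where
  "tent_avg_deriv i t f x = - (1 / t) * (\<integral>z. tent_deriv i z * f (x + t *\<^sub>R z) \<partial>lborel)"

lemma tent_deriv_measurable [measurable]: "tent_deriv i \<in> borel_measurable borel"
  unfolding tent_deriv_def[abs_def] by measurable

lemma tent_avg_deriv_measurable [measurable]:
  assumes [measurable]: "f \<in> borel_measurable borel"
  shows "tent_avg_deriv i t f \<in> borel_measurable borel"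
  unfolding tent_avg_deriv_def[abs_def] by measurable

lemma tent_split: "i \<in> Basis \<Longrightarrow> tent z = max 0 (1 - \<bar>z \<bullet> i\<bar>) * (\<Prod>b\<in>Basis - {i}. max 0 (1 - \<bar>z \<bullet> b\<bar>))"
  unfolding tent_def by (rule prod.remove) auto

lemma tent_direction:
  assumes i: "i \<in> Basis"
  shows "tent (z + r *\<^sub>R i) - tent z = (max 0 (1 - \<bar>z \<bullet> i + r\<bar>) - max 0 (1 - \<bar>z \<bullet> i\<bar>)) * (\<Prod>b\<in>Basis - {i}. max 0 (1 - \<bar>z \<bullet> b\<bar>))"
proof -
  have "(\<Prod>b\<in>Basis - {i}. max 0 (1 - \<bar>(z + r *\<^sub>R i) \<bullet> b\<bar>)) = (\<Prod>b\<in>Basis - {i}. max 0 (1 - \<bar>z \<bullet> b\<bar>))"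
    using i by (intro prod.cong) (auto simp: inner_add_left inner_Basis)
  then show ?thesis using i by (simp add: tent_split[OF i] inner_add_left left_diff_distrib)
qed

lemma prod_max_abs_le_1: "\<bar>\<Prod>b\<in>A. max 0 (1 - \<bar>z \<bullet> b\<bar>)\<bar> \<le> (1::real)"
  unfolding abs_prod by (intro prod_le_1) auto

lemma tent_difference_bound:
  assumes i: "i \<in> Basis"
  shows "\<bar>tent (z + r *\<^sub>R i) - tent z\<bar> \<le> \<bar>r\<bar>"
proof -
  have "\<bar>max 0 (1 - \<bar>z \<bullet> i + r\<bar>) - max 0 (1 - \<bar>z \<bullet> i\<bar>)\<bar> * \<bar>\<Prod>b\<in>Basis - {i}. max 0 (1 - \<bar>z \<bullet> b\<bar>)\<bar> \<le> \<bar>r\<bar> * 1"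
    by (intro mult_mono prod_max_abs_le_1) (auto simp: max_def abs_if split: if_splits)
  then show ?thesis unfolding tent_direction[OF i] abs_mult by simp
qed

lemma tent_right_derivative:
  assumes i: "i \<in> Basis" and \<rho>: "\<And>m. 0 < \<rho> m" "\<rho> \<longlonglongrightarrow> 0"
  shows "(\<lambda>m. (tent (z + \<rho> m *\<^sub>R i) - tent z) / \<rho> m) \<longlonglongrightarrow> tent_deriv i z"
proof -
  define s where "s = z \<bullet> i"
  define d where "d = (if -1 \<le> s \<and> s < 1 then (if s < 0 then 1 else -1) else 0 :: real)"
  \<comment> \<open>The distance from \<open>s\<close> to the next kink on its right, or 1 if there
    is none. The hat function is affine up to there, so the quotient equals the derivative as soon
    as \<open>r < gap\<close>.\<close>
  define gap where "gap = (if s < -1 then -1 - s else if s < 0 then - s else if s < 1 then 1 - s else 1)"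
  have gap: "gap > 0" by (auto simp: gap_def)
  have eq: "(tent (z + r *\<^sub>R i) - tent z) / r = tent_deriv i z" if r: "0 < r" "r < gap" for r
  proof -
    have "max 0 (1 - \<bar>s + r\<bar>) - max 0 (1 - \<bar>s\<bar>) = r * d"
      using r by (auto simp: gap_def d_def max_def abs_if split: if_splits)
    then show ?thesis
      unfolding tent_direction[OF i] tent_deriv_def s_def[symmetric] d_def[symmetric] using r by simp
  qed
  have "eventually (\<lambda>m. tent_deriv i z = (tent (z + \<rho> m *\<^sub>R i) - tent z) / \<rho> m) sequentially"
    using order_tendstoD(2)[OF \<rho>(2) gap] by eventually_elim (use eq \<rho>(1) in auto)
  then show ?thesis by (rule Lim_transform_eventually[OF tendsto_const])
qed

text \<open>A backward quotient of the average is a forward quotient of the kernel, and the latter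
  converges everywhere to the right derivative with a bounded, compactly supported majorant.\<close>

lemma tent_avg_difference_quotient:
  fixes f :: "'a::euclidean_space \<Rightarrow> real"
  assumes [measurable]: "f \<in> borel_measurable borel" and S: "\<And>x. \<bar>f x\<bar> \<le> S" and t: "t > 0" and i: "i \<in> Basis"
  shows "(\<lambda>m. (tent_avg t f (x - (1 / (real m + 1)) *\<^sub>R i) - tent_avg t f x) / (1 / (real m + 1))) \<longlonglongrightarrow> - tent_avg_deriv i t f x"
proof -
  define r where "r = (\<lambda>m. 1 / (real m + 1))"
  define \<rho> where "\<rho> = (\<lambda>m. r m / t)"
  have r: "0 < r m" "r m \<le> 1" for m by (auto simp: r_def)
  have \<rho>: "0 < \<rho> m" "\<rho> m \<le> 1 / t" for m using r t by (auto simp: \<rho>_def divide_right_mono)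
  have r0: "r \<longlonglongrightarrow> 0" unfolding r_def using LIMSEQ_inverse_real_of_nat by (simp add: inverse_eq_divide add.commute)
  have \<rho>0: "\<rho> \<longlonglongrightarrow> 0" unfolding \<rho>_def using tendsto_divide[OF r0 tendsto_const[of t]] t by simp
  let ?f = "\<lambda>z. f (x + t *\<^sub>R z)"
  define R where "R = real DIM('a) + 1 / t"
  have "(\<lambda>m. \<integral>z. (tent (z + \<rho> m *\<^sub>R i) - tent z) / \<rho> m * ?f z \<partial>lborel) \<longlonglongrightarrow> (\<integral>z. tent_deriv i z * ?f z \<partial>lborel)"
  proof (rule integral_dominated_convergence[where w="\<lambda>z. S * indicator (cball 0 R) z"])
    have "emeasure lborel (cball (0::'a) R) < \<infinity>" by (intro emeasure_bounded_finite bounded_cball)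
    then show "integrable lborel (\<lambda>z::'a. S * indicator (cball 0 R) z)"
      by (intro integrable_mult_right integrable_real_indicator) auto
    show "AE z in lborel. (\<lambda>m. (tent (z + \<rho> m *\<^sub>R i) - tent z) / \<rho> m * ?f z) \<longlonglongrightarrow> tent_deriv i z * ?f z"
      by (intro AE_I2 tendsto_mult tendsto_const tent_right_derivative i \<rho>(1) \<rho>0)
    show "AE z in lborel. norm ((tent (z + \<rho> m *\<^sub>R i) - tent z) / \<rho> m * ?f z) \<le> S * indicator (cball 0 R) z" for m
    proof (rule AE_I2)
      fix z :: 'a
      show "norm ((tent (z + \<rho> m *\<^sub>R i) - tent z) / \<rho> m * ?f z) \<le> S * indicator (cball 0 R) z"
      proof (cases "norm z \<le> R")
        case True
        have "\<bar>(tent (z + \<rho> m *\<^sub>R i) - tent z) / \<rho> m\<bar> \<le> 1"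
          using tent_difference_bound[OF i, of z "\<rho> m"] \<rho>(1)[of m] by simp
        then have "\<bar>(tent (z + \<rho> m *\<^sub>R i) - tent z) / \<rho> m\<bar> * \<bar>?f z\<bar> \<le> 1 * S"
          using S by (intro mult_mono) auto
        then show ?thesis using True by (simp add: abs_mult)
      next
        case False
        have "real DIM('a) < R" using t by (simp add: R_def)
        then have "tent z = 0" using tent_support[of z] False by linarith
        moreover have "tent (z + \<rho> m *\<^sub>R i) = 0"
        proof (rule ccontr)
          assume "tent (z + \<rho> m *\<^sub>R i) \<noteq> 0"
          from tent_support[OF this] have "norm z \<le> real DIM('a) + \<rho> m"
            using norm_triangle_ineq4[of "z + \<rho> m *\<^sub>R i" "\<rho> m *\<^sub>R i"] \<rho>(1)[of m] i by simp
          then show False using False \<rho>(2)[of m] by (simp add: R_def)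
        qed
        ultimately show ?thesis using False by simp
      qed
    qed
  qed auto
  then have "(\<lambda>m. (1 / t) * (\<integral>z. (tent (z + \<rho> m *\<^sub>R i) - tent z) / \<rho> m * ?f z \<partial>lborel)) \<longlonglongrightarrow> (1 / t) * (\<integral>z. tent_deriv i z * ?f z \<partial>lborel)"
    by (intro tendsto_intros)
  moreover have "(1 / t) * (\<integral>z. (tent (z + \<rho> m *\<^sub>R i) - tent z) / \<rho> m * ?f z \<partial>lborel) = (tent_avg t f (x - r m *\<^sub>R i) - tent_avg t f x) / r m" for m
  proof -
    have i1: "integrable lborel (\<lambda>z. tent (z + \<rho> m *\<^sub>R i) * ?f z)" "integrable lborel (\<lambda>z. tent z * ?f z)"
      using integrable_tent_times[of ?f S "\<rho> m *\<^sub>R i"] integrable_tent_times[of ?f S 0] S by simp_all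
    have "tent_avg t f (x - r m *\<^sub>R i) - tent_avg t f x = (\<integral>z. tent (z + \<rho> m *\<^sub>R i) * ?f z \<partial>lborel) - (\<integral>z. tent z * ?f z \<partial>lborel)"
      using tent_avg_shift[OF assms(1) t, of x "- (r m *\<^sub>R i)"] tent_avg_shift[OF assms(1) t, of x 0]
      by (simp add: \<rho>_def)
    also have "\<dots> = (\<integral>z. (tent (z + \<rho> m *\<^sub>R i) - tent z) * ?f z \<partial>lborel)"
      using i1 by (simp add: left_diff_distrib)
    finally have "(tent_avg t f (x - r m *\<^sub>R i) - tent_avg t f x) / r m = (\<integral>z. (tent (z + \<rho> m *\<^sub>R i) - tent z) * ?f z \<partial>lborel) / r m" by simp
    also have "\<dots> = (1 / t) * ((\<integral>z. (tent (z + \<rho> m *\<^sub>R i) - tent z) * ?f z \<partial>lborel) / \<rho> m)"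
      using t r(1)[of m] by (simp add: \<rho>_def)
    also have "(\<integral>z. (tent (z + \<rho> m *\<^sub>R i) - tent z) * ?f z \<partial>lborel) / \<rho> m = (\<integral>z. (tent (z + \<rho> m *\<^sub>R i) - tent z) / \<rho> m * ?f z \<partial>lborel)"
      by simp
    finally show ?thesis by simp
  qed
  ultimately show ?thesis by (simp add: r_def tent_avg_deriv_def)
qed

text \<open>Integration by parts in discrete form: by translation invariance a forward quotient of
  the test function can be exchanged for a backward quotient of \<open>F\<close>. Both sides
  converge by dominated convergence, the second thanks to the Lipschitz bound in direction
  \<open>i\<close>.\<close>

lemma weak_pderivI_difference_quotient:
  fixes F G :: "'a::euclidean_space \<Rightarrow> real"
  assumes [measurable]: "F \<in> borel_measurable borel" "G \<in> borel_measurable borel" and i: "i \<in> Basis"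
    and S: "\<And>x. \<bar>F x\<bar> \<le> S" and L: "\<And>x r. 0 < r \<Longrightarrow> \<bar>F (x - r *\<^sub>R i) - F x\<bar> \<le> L * r"
    and lim: "\<And>x. (\<lambda>m. (F (x - (1 / (real m + 1)) *\<^sub>R i) - F x) / (1 / (real m + 1))) \<longlonglongrightarrow> - G x"
    and \<phi>: "test_function \<phi>"
  shows "(\<integral>x. F x * pderiv_dir i \<phi> x \<partial>lborel) = - (\<integral>x. G x * \<phi> x \<partial>lborel)"
proof -
  define r where "r = (\<lambda>m. 1 / (real m + 1))"
  have r: "0 < r m" "r m \<le> 1" for m by (auto simp: r_def)
  have r0: "r \<longlonglongrightarrow> 0" unfolding r_def using LIMSEQ_inverse_real_of_nat by (simp add: inverse_eq_divide add.commute)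
  have \<phi>c: "continuous_on UNIV \<phi>" "continuous_on UNIV (pderiv_dir i \<phi>)" using test_function_support[OF \<phi>] i by auto
  have [measurable]: "\<phi> \<in> borel_measurable borel" "pderiv_dir i \<phi> \<in> borel_measurable borel"
    using \<phi>c by (auto intro: borel_measurable_continuous_onI)
  obtain R where R: "\<And>x. R < norm x \<Longrightarrow> \<phi> x = 0" "\<And>x. R < norm x \<Longrightarrow> pderiv_dir i \<phi> x = 0"
    using test_function_support(4)[OF \<phi>] i by blast
  have bdd: "\<exists>K\<ge>0. \<forall>z. \<bar>f z\<bar> \<le> K" if "continuous_on UNIV f" "\<And>z. R < norm z \<Longrightarrow> f z = 0" for f :: "'a \<Rightarrow> real"
  proof -
    have "compact (f ` cball 0 R)"
      using that(1) by (intro compact_continuous_image) (auto intro: continuous_on_subset)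
    then have "bounded (f ` cball 0 R)" by (rule compact_imp_bounded)
    then obtain K where K: "\<And>z. norm z \<le> R \<Longrightarrow> \<bar>f z\<bar> \<le> K" unfolding bounded_iff by force
    have "\<bar>f z\<bar> \<le> \<bar>K\<bar>" for z using K[of z] that(2)[of z] by (cases "norm z \<le> R") auto
    then show ?thesis by (intro exI[of _ "\<bar>K\<bar>"]) auto
  qed
  obtain K where K: "K \<ge> 0" "\<And>x. \<bar>\<phi> x\<bar> \<le> K" using bdd[OF \<phi>c(1) R(1)] by blast
  obtain K' where K': "K' \<ge> 0" "\<And>x. \<bar>pderiv_dir i \<phi> x\<bar> \<le> K'" using bdd[OF \<phi>c(2) R(2)] by blast
  have S0: "S \<ge> 0" using S[of 0] by linarith
  have L0: "L \<ge> 0" using L[of 1 0] by linarith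
  have fin: "emeasure lborel (cball (0::'a) b) < \<infinity>" for b by (intro emeasure_bounded_finite bounded_cball)
  have der: "((\<lambda>s. \<phi> (x + s *\<^sub>R i)) has_real_derivative pderiv_dir i \<phi> (x + s *\<^sub>R i)) (at s)" for x s
  proof -
    have "((\<lambda>t. \<phi> ((x + s *\<^sub>R i) + t *\<^sub>R i)) has_real_derivative pderiv_dir i \<phi> (x + s *\<^sub>R i)) (at 0)"
      by (rule test_function_support(3)[OF \<phi> i])
    then have "((\<lambda>t. \<phi> (x + (s + t) *\<^sub>R i)) has_real_derivative pderiv_dir i \<phi> (x + s *\<^sub>R i)) (at 0)"
      by (simp add: algebra_simps)
    then show ?thesis using DERIV_shift[of "\<lambda>s. \<phi> (x + s *\<^sub>R i)" _ 0 s] by (simp add: add.commute)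
  qed
  have quot_bd: "\<bar>(\<phi> (x + r m *\<^sub>R i) - \<phi> x) / r m\<bar> \<le> K'" for x m
  proof -
    have "\<exists>z>0. z < r m \<and> \<phi> (x + r m *\<^sub>R i) - \<phi> (x + 0 *\<^sub>R i) = (r m - 0) * pderiv_dir i \<phi> (x + z *\<^sub>R i)"
      using r(1)[of m] der by (intro MVT2) auto
    then show ?thesis using K'(2) r(1)[of m] by (auto simp: abs_mult)
  qed
  have lim1: "(\<lambda>m. \<integral>x. F x * ((\<phi> (x + r m *\<^sub>R i) - \<phi> x) / r m) \<partial>lborel) \<longlonglongrightarrow> (\<integral>x. F x * pderiv_dir i \<phi> x \<partial>lborel)"
  proof (rule integral_dominated_convergence[where w="\<lambda>x. S * K' * indicator (cball 0 (R + 1)) x"])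
    show "integrable lborel (\<lambda>x::'a. S * K' * indicator (cball 0 (R + 1)) x)"
      using fin by (intro integrable_mult_right integrable_real_indicator) auto
    show "AE x in lborel. (\<lambda>m. F x * ((\<phi> (x + r m *\<^sub>R i) - \<phi> x) / r m)) \<longlonglongrightarrow> F x * pderiv_dir i \<phi> x"
    proof (intro AE_I2 tendsto_mult tendsto_const)
      fix x
      have "((\<lambda>h. (\<phi> (x + h *\<^sub>R i) - \<phi> x) / h) \<longlongrightarrow> pderiv_dir i \<phi> x) (at 0)"
        using test_function_support(3)[OF \<phi> i, of x] by (simp add: DERIV_def)
      then show "(\<lambda>m. (\<phi> (x + r m *\<^sub>R i) - \<phi> x) / r m) \<longlonglongrightarrow> pderiv_dir i \<phi> x"
        by (rule filterlim_compose) (use r0 r(1) in \<open>auto simp: filterlim_at less_imp_neq[THEN not_sym]\<close>)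
    qed
    show "AE x in lborel. norm (F x * ((\<phi> (x + r m *\<^sub>R i) - \<phi> x) / r m)) \<le> S * K' * indicator (cball 0 (R + 1)) x" for m
    proof (rule AE_I2)
      fix x
      show "norm (F x * ((\<phi> (x + r m *\<^sub>R i) - \<phi> x) / r m)) \<le> S * K' * indicator (cball 0 (R + 1)) x"
      proof (cases "norm x \<le> R + 1")
        case True
        have "\<bar>F x\<bar> * \<bar>(\<phi> (x + r m *\<^sub>R i) - \<phi> x) / r m\<bar> \<le> S * K'"
          using S quot_bd S0 by (intro mult_mono) auto
        then show ?thesis using True by (simp add: abs_mult)
      next
        case False
        have "norm x \<le> norm (x + r m *\<^sub>R i) + r m"
          using norm_triangle_ineq4[of "x + r m *\<^sub>R i" "r m *\<^sub>R i"] r(1)[of m] i by simp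
        then have "R < norm (x + r m *\<^sub>R i)" "R < norm x" using False r[of m] by linarith+
        then show ?thesis using R False by simp
      qed
    qed
  qed auto
  have lim2: "(\<lambda>m. \<integral>x. (F (x - r m *\<^sub>R i) - F x) / r m * \<phi> x \<partial>lborel) \<longlonglongrightarrow> (\<integral>x. - G x * \<phi> x \<partial>lborel)"
  proof (rule integral_dominated_convergence[where w="\<lambda>x. L * K * indicator (cball 0 R) x"])
    show "integrable lborel (\<lambda>x::'a. L * K * indicator (cball 0 R) x)"
      using fin by (intro integrable_mult_right integrable_real_indicator) auto
    show "AE x in lborel. (\<lambda>m. (F (x - r m *\<^sub>R i) - F x) / r m * \<phi> x) \<longlonglongrightarrow> - G x * \<phi> x"
      using lim unfolding r_def by (intro AE_I2 tendsto_mult tendsto_const) auto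
    show "AE x in lborel. norm ((F (x - r m *\<^sub>R i) - F x) / r m * \<phi> x) \<le> L * K * indicator (cball 0 R) x" for m
    proof (rule AE_I2)
      fix x
      show "norm ((F (x - r m *\<^sub>R i) - F x) / r m * \<phi> x) \<le> L * K * indicator (cball 0 R) x"
      proof (cases "norm x \<le> R")
        case True
        have "\<bar>(F (x - r m *\<^sub>R i) - F x) / r m\<bar> \<le> L"
          using L[OF r(1)[of m], of x] r(1)[of m] by (simp add: field_simps)
        then have "\<bar>(F (x - r m *\<^sub>R i) - F x) / r m\<bar> * \<bar>\<phi> x\<bar> \<le> L * K"
          using K L0 by (intro mult_mono) auto
        then show ?thesis using True by (simp add: abs_mult)
      qed (use R in auto)
    qed
  qed auto
  have eq: "(\<integral>x. F x * ((\<phi> (x + r m *\<^sub>R i) - \<phi> x) / r m) \<partial>lborel) = (\<integral>x. (F (x - r m *\<^sub>R i) - F x) / r m * \<phi> x \<partial>lborel)" for m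
  proof -
    have i1: "integrable lborel (\<lambda>x. F x * \<phi> (x + r m *\<^sub>R i))"
    proof (rule integrable_bounded_support[where K="S * K" and R="R + 1"])
      show "\<bar>F x * \<phi> (x + r m *\<^sub>R i)\<bar> \<le> S * K" for x
        unfolding abs_mult using S K S0 by (intro mult_mono) auto
      fix x :: 'a assume "R + 1 < norm x"
      moreover have "norm x \<le> norm (x + r m *\<^sub>R i) + r m"
        using norm_triangle_ineq4[of "x + r m *\<^sub>R i" "r m *\<^sub>R i"] r(1)[of m] i by simp
      ultimately have "R < norm (x + r m *\<^sub>R i)" using r[of m] by linarith
      then show "F x * \<phi> (x + r m *\<^sub>R i) = 0" using R by simp
    qed measurable
    have i2: "integrable lborel (\<lambda>x. F x * \<phi> x)"
      using R S K S0 by (intro integrable_bounded_support[where K="S * K" and R=R]) (auto simp: abs_mult intro!: mult_mono)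
    have i3: "integrable lborel (\<lambda>x. F (x - r m *\<^sub>R i) * \<phi> x)"
      using R S K S0 by (intro integrable_bounded_support[where K="S * K" and R=R]) (auto simp: abs_mult intro!: mult_mono)
    have sh: "(\<integral>x. F x * \<phi> (x + r m *\<^sub>R i) \<partial>lborel) = (\<integral>x. F (x - r m *\<^sub>R i) * \<phi> x \<partial>lborel)"
      using lborel_integral_shift[of "\<lambda>x. F (x - r m *\<^sub>R i) * \<phi> x" "r m *\<^sub>R i"] by simp
    have "(\<integral>x. F x * ((\<phi> (x + r m *\<^sub>R i) - \<phi> x) / r m) \<partial>lborel) = (\<integral>x. F x * \<phi> (x + r m *\<^sub>R i) - F x * \<phi> x \<partial>lborel) / r m"
      by (subst integral_divide_zero[symmetric]) (simp add: right_diff_distrib)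
    also have "\<dots> = ((\<integral>x. F (x - r m *\<^sub>R i) * \<phi> x \<partial>lborel) - (\<integral>x. F x * \<phi> x \<partial>lborel)) / r m"
      using i1 i2 sh by simp
    also have "\<dots> = (\<integral>x. F (x - r m *\<^sub>R i) * \<phi> x - F x * \<phi> x \<partial>lborel) / r m"
      using i2 i3 by simp
    also have "\<dots> = (\<integral>x. (F (x - r m *\<^sub>R i) - F x) / r m * \<phi> x \<partial>lborel)"
      by (subst integral_divide_zero[symmetric]) (simp add: left_diff_distrib)
    finally show ?thesis .
  qed
  have "(\<integral>x. F x * pderiv_dir i \<phi> x \<partial>lborel) = (\<integral>x. - G x * \<phi> x \<partial>lborel)"
    by (rule LIMSEQ_unique[OF lim1[unfolded eq] lim2])
  then show ?thesis by simp
qed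

lemma tent_avg_weak_derivative:
  fixes f :: "'a::euclidean_space \<Rightarrow> real"
  assumes [measurable]: "f \<in> borel_measurable borel" and S: "\<And>x. \<bar>f x\<bar> \<le> S" and t: "t > 0" and i: "i \<in> Basis"
    and \<phi>: "test_function \<phi>"
  shows "(\<integral>x. tent_avg t f x * pderiv_dir i \<phi> x \<partial>lborel) = - (\<integral>x. tent_avg_deriv i t f x * \<phi> x \<partial>lborel)"
proof (rule weak_pderivI_difference_quotient[OF _ _ i _ _ _ \<phi>])
  show "\<bar>tent_avg t f x\<bar> \<le> S" for x by (rule tent_avg_abs_le[OF assms(1) S])
  show "\<bar>tent_avg t f (x - r *\<^sub>R i) - tent_avg t f x\<bar> \<le> S * (2 * real DIM('a) / t) * r" if "0 < r" for x r
    using tent_avg_lipschitz[OF assms(1) S t, of x "- (r *\<^sub>R i)"] that i by simp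
  show "(\<lambda>m. (tent_avg t f (x - (1 / (real m + 1)) *\<^sub>R i) - tent_avg t f x) / (1 / (real m + 1))) \<longlonglongrightarrow> - tent_avg_deriv i t f x" for x
    by (rule tent_avg_difference_quotient[OF assms(1) S t i])
qed measurable

section \<open>The derivative of a tent average as an average of Haar functions\<close>

lemma distr_cell_pos: "distr cube_measure cube_measure (cell_pos k) = (cube_measure :: 'a::euclidean_space measure)"
proof (rule measure_eqI)
  fix A :: "'a set" assume "A \<in> sets (distr cube_measure cube_measure (cell_pos k))"
  then have [measurable]: "A \<in> sets borel" by simp
  interpret cube: prob_space "cube_measure :: 'a measure" by (rule prob_space_cube_measure)
  have one: "(\<integral>\<^sup>+u. 1 \<partial>(cube_measure :: 'a measure)) = 1" using cube.emeasure_space_1 by simp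
  have "emeasure (distr cube_measure cube_measure (cell_pos k)) A = (\<integral>\<^sup>+u. indicator A u \<partial>distr cube_measure cube_measure (cell_pos k))"
    by simp
  also have "\<dots> = (\<integral>\<^sup>+u. 1 * indicator A (cell_pos k u) \<partial>cube_measure)"
    by (subst nn_integral_distr) auto
  also have "\<dots> = (\<integral>\<^sup>+u. 1 \<partial>(cube_measure :: 'a measure)) * (\<integral>\<^sup>+u. indicator A u \<partial>cube_measure)"
    by (rule nn_integral_cell_independent) auto
  also have "\<dots> = emeasure cube_measure A" unfolding one by simp
  finally show "emeasure (distr cube_measure cube_measure (cell_pos k)) A = emeasure cube_measure A" .
qed simp

text \<open>The tent derivative carried over to the unit cube: a Haar function in direction
  \<open>i\<close>, multiplied by hat functions in the other coordinates. Only the sign change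
  between the two halves and the bound 1 are used of it.\<close>

definition haar :: "'a::euclidean_space \<Rightarrow> 'a \<Rightarrow> real" where
  "haar i v = (if v \<bullet> i < 1/2 then 1 else -1) * (\<Prod>b\<in>Basis - {i}. max 0 (1 - \<bar>2 * (v \<bullet> b) - 1\<bar>))"

lemma haar_measurable [measurable]: "haar i \<in> borel_measurable borel"
  unfolding haar_def[abs_def] by measurable

lemma haar_abs_le_1: "\<bar>haar i v\<bar> \<le> 1"
proof -
  have "\<bar>\<Prod>b\<in>Basis - {i}. max 0 (1 - \<bar>2 * (v \<bullet> b) - 1\<bar>)\<bar> \<le> (1::real)"
    unfolding abs_prod by (intro prod_le_1) auto
  then show ?thesis by (simp add: haar_def abs_mult)
qed

lemma tent_deriv_rescaled:
  fixes v :: "'a::euclidean_space"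
  assumes i: "i \<in> Basis"
  shows "tent_deriv i (2 *\<^sub>R v - One) = indicator unit_cube v * haar i v"
proof -
  have z: "(2 *\<^sub>R v - One) \<bullet> b = 2 * (v \<bullet> b) - 1" if "b \<in> Basis" for b
    using that by (simp add: inner_diff_left)
  have p: "(\<Prod>b\<in>Basis - {i}. max 0 (1 - \<bar>(2 *\<^sub>R v - One) \<bullet> b\<bar>)) = (\<Prod>b\<in>Basis - {i}. max 0 (1 - \<bar>2 * (v \<bullet> b) - 1\<bar>))"
    using z by (intro prod.cong) auto
  show ?thesis
  proof (cases "v \<in> unit_cube")
    case True
    then have "0 \<le> v \<bullet> i" "v \<bullet> i < 1" using i by (auto simp: unit_cube_def)
    then show ?thesis using True unfolding tent_deriv_def p haar_def z[OF i] by auto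
  next
    case False
    then obtain b where b: "b \<in> Basis" "\<not> (0 \<le> v \<bullet> b \<and> v \<bullet> b < 1)" by (auto simp: unit_cube_def)
    show ?thesis
    proof (cases "b = i")
      case True
      then show ?thesis using b False unfolding tent_deriv_def z[OF i] by auto
    next
      case neq: False
      have "(\<Prod>b\<in>Basis - {i}. max 0 (1 - \<bar>2 * (v \<bullet> b) - 1\<bar>)) = 0"
        using b neq by (intro prod_zero bexI[of _ b]) (auto simp: max_def abs_if)
      then show ?thesis using False unfolding tent_deriv_def p by simp
    qed
  qed
qed

lemma lborel_integral_affine:
  fixes f :: "'a::euclidean_space \<Rightarrow> real"
  assumes [measurable]: "f \<in> borel_measurable borel" and c: "c > 0"
  shows "(\<integral>x. f x \<partial>lborel) = c ^ DIM('a) * (\<integral>x. f (t + c *\<^sub>R x) \<partial>lborel)"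
  using c by (subst lborel_affine[of c t]) (simp_all add: integral_density integral_distr)

text \<open>The support of the tent at scale \<open>1 / 2 ^ Suc k\<close> has the side of a
  level-\<open>k\<close> cell. Since \<open>cell_pos k u\<close> is uniform, the integral over the
  kernel variable is an average over \<open>u\<close>, that is, over the position of
  \<open>x\<close> in the cell. With \<open>s = x + u\<close> fixed, the integrand is a jump of a
  martingale in \<open>u\<close>. In the constant, \<open>2 ^ DIM('a)\<close> is the Jacobian of
  \<open>z = 2 v - One\<close>, and the last factor 2 comes from
  \<open>1 / t = 2 * 2 ^ k\<close>.\<close>

lemma tent_avg_deriv_eq:
  fixes f :: "'a::euclidean_space \<Rightarrow> real"
  assumes [measurable]: "f \<in> borel_measurable borel" and i: "i \<in> Basis"
  shows "tent_avg_deriv i (1 / 2 ^ Suc k) f x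
    = (\<integral>u. - (2 ^ Suc DIM('a)) * (haar i (cell_pos k u) * (2 ^ k * f (x + u - cell_centre k u))) \<partial>cube_measure)"
proof -
  let ?t = "1 / 2 ^ Suc k :: real"
  have sc: "x + ?t *\<^sub>R (- One + 2 *\<^sub>R v) = x + (1 / 2 ^ k) *\<^sub>R (v - (1/2) *\<^sub>R One)" for v :: 'a
    by (simp add: algebra_simps)
  let ?\<Phi> = "\<lambda>v. haar i v * (2 ^ k * f (x + (1 / 2 ^ k) *\<^sub>R (v - (1/2) *\<^sub>R One)))"
  have "(\<integral>z. tent_deriv i z * f (x + ?t *\<^sub>R z) \<partial>lborel)
     = 2 ^ DIM('a) * (\<integral>v. tent_deriv i (- One + 2 *\<^sub>R v) * f (x + ?t *\<^sub>R (- One + 2 *\<^sub>R v)) \<partial>lborel)"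
    by (rule lborel_integral_affine) auto
  also have "(\<integral>v. tent_deriv i (- One + 2 *\<^sub>R v) * f (x + ?t *\<^sub>R (- One + 2 *\<^sub>R v)) \<partial>lborel)
     = (\<integral>v. indicator unit_cube v * (haar i v * f (x + (1 / 2 ^ k) *\<^sub>R (v - (1/2) *\<^sub>R One))) \<partial>lborel)"
    using tent_deriv_rescaled[OF i] unfolding sc by (simp add: mult.assoc)
  also have "\<dots> = (\<integral>v. haar i v * f (x + (1 / 2 ^ k) *\<^sub>R (v - (1/2) *\<^sub>R One)) \<partial>cube_measure)"
    unfolding cube_measure_def ennreal_indicator[symmetric] by (subst integral_density) auto
  finally have "tent_avg_deriv i ?t f x = - (2 ^ Suc DIM('a)) * (2 ^ k * (\<integral>v. haar i v * f (x + (1 / 2 ^ k) *\<^sub>R (v - (1/2) *\<^sub>R One)) \<partial>cube_measure))"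
    unfolding tent_avg_deriv_def by simp
  also have "2 ^ k * (\<integral>v. haar i v * f (x + (1 / 2 ^ k) *\<^sub>R (v - (1/2) *\<^sub>R One)) \<partial>cube_measure) = (\<integral>v. ?\<Phi> v \<partial>cube_measure)"
    by (subst integral_mult_right_zero[symmetric]) (simp add: mult.left_commute)
  also have "(\<integral>v. ?\<Phi> v \<partial>cube_measure) = (\<integral>v. ?\<Phi> v \<partial>distr cube_measure cube_measure (cell_pos k))"
    by (simp only: distr_cell_pos)
  also have "\<dots> = (\<integral>u. ?\<Phi> (cell_pos k u) \<partial>cube_measure)"
    by (rule integral_distr) measurable
  also have "\<dots> = (\<integral>u. haar i (cell_pos k u) * (2 ^ k * f (x + u - cell_centre k u)) \<partial>cube_measure)"
    unfolding cell_centre_diff[symmetric] by (simp add: algebra_simps)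
  finally show ?thesis by simp
qed

lemma haar_flip:
  assumes i: "i \<in> Basis"
  shows "haar i (cell_pos k (cell_flip i k u)) = - haar i (cell_pos k u)"
    and "j < k \<Longrightarrow> haar i (cell_pos j (cell_flip i k u)) = haar i (cell_pos j u)"
proof -
  have "(\<Prod>b\<in>Basis - {i}. max 0 (1 - \<bar>2 * (cell_pos j (cell_flip i k u) \<bullet> b) - 1\<bar>))
      = (\<Prod>b\<in>Basis - {i}. max 0 (1 - \<bar>2 * (cell_pos j u \<bullet> b) - 1\<bar>))" for j
    using cell_pos_cell_flip_other[OF _ i] by (intro prod.cong) auto
  then show "haar i (cell_pos k (cell_flip i k u)) = - haar i (cell_pos k u)"
    "j < k \<Longrightarrow> haar i (cell_pos j (cell_flip i k u)) = haar i (cell_pos j u)"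
    unfolding haar_def using cell_pos_cell_flip_half[OF i, of k u] cell_pos_cell_flip_less[OF i, of j k u] by auto
qed

text \<open>\<open>b k\<close> is evaluated at a point depending on the cell alone and is therefore
  unchanged by the flip; the Haar factor changes its sign.\<close>

lemma flip_martingale_haar:
  fixes b :: "nat \<Rightarrow> 'a::euclidean_space \<Rightarrow> real"
  assumes i: "i \<in> Basis" and [measurable]: "\<And>k. b k \<in> borel_measurable borel" and A: "\<And>k x. \<bar>2 ^ k * b k x\<bar> \<le> 1"
  shows "flip_martingale cube_measure (cell_flip i) (\<lambda>_. 0)
    (\<lambda>k u. haar i (cell_pos k u) * (2 ^ k * b k (s - cell_centre k u))) (\<lambda>k u. b k (s - cell_centre k u) \<noteq> 0)"
proof (rule flip_martingale.intro[OF prob_space_cube_measure], unfold_locales)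
  have centre: "cell_centre j (cell_flip i k u) = cell_centre j u" if "j \<le> k" for j k u
    using cell_cell_flip[OF i that, of u] by (simp add: cell_centre_def)
  show "cell_flip i k \<in> measurable cube_measure cube_measure" for k by measurable
  show "distr cube_measure cube_measure (cell_flip i k) = cube_measure" for k by (rule distr_cell_flip[OF i])
  show "\<bar>haar i (cell_pos k u) * (2 ^ k * b k (s - cell_centre k u))\<bar> \<le> 1" for k u
  proof -
    have "\<bar>haar i (cell_pos k u)\<bar> * \<bar>2 ^ k * b k (s - cell_centre k u)\<bar> \<le> 1 * 1"
      by (intro mult_mono haar_abs_le_1 A) auto
    then show ?thesis by (simp add: abs_mult)
  qed
  show "haar i (cell_pos k (cell_flip i k u)) * (2 ^ k * b k (s - cell_centre k (cell_flip i k u)))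
     = - (haar i (cell_pos k u) * (2 ^ k * b k (s - cell_centre k u)))" for k u
    using haar_flip(1)[OF i] centre[of k k u] by simp
  show "haar i (cell_pos j (cell_flip i k u)) * (2 ^ j * b j (s - cell_centre j (cell_flip i k u)))
     = haar i (cell_pos j u) * (2 ^ j * b j (s - cell_centre j u))" if "j < k" for j k u
    using haar_flip(2)[OF i that] centre[of j k u] that by simp
  show "(b j (s - cell_centre j (cell_flip i k u)) \<noteq> 0) = (b j (s - cell_centre j u) \<noteq> 0)" if "j \<le> k" for j k u
    using centre[OF that] by simp
qed auto

text \<open>The strict inequality makes the set of such \<open>x\<close> open, being a union of
  balls, and thus Borel. The neighbourhood is needed because the martingale reads \<open>b k\<close>
  at the centre of a cell, not at the point itself.\<close>

definition near_support :: "real \<Rightarrow> (nat \<Rightarrow> 'a::euclidean_space \<Rightarrow> real) \<Rightarrow> nat \<Rightarrow> 'a \<Rightarrow> bool" where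
  "near_support \<kappa> b k x \<longleftrightarrow> (\<exists>c. b k c \<noteq> 0 \<and> dist x c < \<kappa> / 2 ^ k)"

lemma near_support_measurable [measurable]: "Measurable.pred borel (near_support \<kappa> b k)"
proof -
  have "{x. near_support \<kappa> b k x} = (\<Union>c\<in>{c. b k c \<noteq> 0}. ball c (\<kappa> / 2 ^ k))"
    by (auto simp: near_support_def dist_commute)
  then have "open {x. near_support \<kappa> b k x}" by auto
  then show ?thesis by (simp add: pred_def borel_open)
qed

text \<open>The events of the martingale concern \<open>b k\<close> at
  \<open>s - cell_centre k u\<close>; the result must concern the actual point \<open>s - u\<close>.
  Near the centre of its cell the two are within \<open>\<kappa> / 2 ^ k\<close> of each other, and
  the position in the cell is independent of the events up to level \<open>k\<close>, so thinning
  costs only a constant.\<close>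

lemma haar_sum_bound:
  fixes p \<kappa> :: real
  assumes p: "p > 1" and \<kappa>: "\<kappa> > 0"
  obtains C where "C \<ge> 0"
    "\<And>(b :: nat \<Rightarrow> 'a::euclidean_space \<Rightarrow> real) i s K. i \<in> Basis \<Longrightarrow> (\<And>k. b k \<in> borel_measurable borel) \<Longrightarrow>
       (\<And>k x. \<bar>2 ^ k * b k x\<bar> \<le> 1) \<Longrightarrow>
       (\<integral>\<^sup>+u. ennreal (\<bar>\<Sum>k<K. haar i (cell_pos k u) * (2 ^ k * b k (s - cell_centre k u))\<bar> powr p) \<partial>cube_measure)
       \<le> ennreal C * (\<integral>\<^sup>+u. ennreal (real (count_upto (near_support \<kappa> b) K (s - u)) powr (p / 2)) \<partial>cube_measure)"
proof -
  have q: "p / 2 > 1/2" "0 < p / 2" using p by auto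
  interpret cube: prob_space "cube_measure :: 'a measure" by (rule prob_space_cube_measure)
  obtain C1 where C1: "C1 \<ge> 0" and sq: "\<And>(MM :: 'a measure) T d e K. flip_martingale MM T (\<lambda>_. 0) d e \<Longrightarrow> (\<And>k \<omega>. \<not> e k \<omega> \<Longrightarrow> d k \<omega> = 0) \<Longrightarrow>
       (\<integral>\<^sup>+\<omega>. ennreal (\<bar>\<Sum>k<K. d k \<omega>\<bar> powr (2 * (p / 2))) \<partial>MM)
        \<le> ennreal C1 * (\<integral>\<^sup>+\<omega>. ennreal (real (count_upto e K \<omega>) powr (p / 2)) \<partial>MM)"
    by (rule square_function_upper[OF q(1), where 'b='a]) (rule that; blast)
  \<comment> \<open>A bound \<kappa>' in every coordinate gives a Euclidean distance below \<kappa>;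
    the minimum with \<open>1/2\<close> keeps the box inside the unit cube, so that its probability
    is its volume.\<close>
  define \<kappa>' where "\<kappa>' = min (1/2) (\<kappa> / (2 * real DIM('a)))"
  have \<kappa>': "0 < \<kappa>'" "\<kappa>' \<le> 1/2" "real DIM('a) * \<kappa>' < \<kappa>"
  proof -
    have "real DIM('a) * \<kappa>' \<le> real DIM('a) * (\<kappa> / (2 * real DIM('a)))" by (intro mult_left_mono) (auto simp: \<kappa>'_def)
    also have "\<dots> < \<kappa>" using \<kappa> by simp
    finally show "real DIM('a) * \<kappa>' < \<kappa>" .
  qed (use \<kappa> in \<open>auto simp: \<kappa>'_def\<close>)
  define B where "B = (\<lambda>v::'a. v \<in> box ((1/2 - \<kappa>') *\<^sub>R One) ((1/2 + \<kappa>') *\<^sub>R One))"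
  have [measurable]: "Measurable.pred borel B" unfolding B_def by simp
  define m where "m = (2 * \<kappa>') ^ DIM('a)"
  have m: "m > 0" using \<kappa>' by (simp add: m_def)
  have mB: "(\<integral>\<^sup>+v. of_bool (B v) \<partial>cube_measure) = ennreal m"
  proof -
    have "(\<integral>\<^sup>+v. of_bool (B v) \<partial>cube_measure) = (\<integral>\<^sup>+v. indicator unit_cube v * of_bool (B v) \<partial>lborel)"
      by (rule nn_integral_cube_measure) measurable
    also have "\<dots> = (\<integral>\<^sup>+v. indicator (box ((1/2 - \<kappa>') *\<^sub>R One) ((1/2 + \<kappa>') *\<^sub>R One)) v \<partial>(lborel :: 'a measure))"
    proof (rule nn_integral_cong)
      fix v :: 'a
      have "v \<in> unit_cube" if "B v"
        unfolding unit_cube_def mem_Collect_eq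
      proof
        fix b :: 'a assume "b \<in> Basis"
        then have "1/2 - \<kappa>' < v \<bullet> b \<and> v \<bullet> b < 1/2 + \<kappa>'"
          using that unfolding B_def mem_box by (auto dest!: bspec[of _ _ b])
        then show "0 \<le> v \<bullet> b \<and> v \<bullet> b < 1" using \<kappa>' by linarith
      qed
      then show "indicator unit_cube v * of_bool (B v) = (indicator (box ((1/2 - \<kappa>') *\<^sub>R One) ((1/2 + \<kappa>') *\<^sub>R One)) v :: ennreal)"
        by (auto simp: B_def indicator_def)
    qed
    also have "\<dots> = emeasure lborel (box ((1/2 - \<kappa>') *\<^sub>R One) ((1/2 + \<kappa>') *\<^sub>R One) :: 'a set)" by simp
    also have "\<dots> = ennreal (\<Prod>b\<in>(Basis::'a set). ((1/2 + \<kappa>') *\<^sub>R One - (1/2 - \<kappa>') *\<^sub>R One) \<bullet> b)"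
      using \<kappa>' by (intro emeasure_lborel_box) auto
    also have "(\<Prod>b\<in>(Basis::'a set). ((1/2 + \<kappa>') *\<^sub>R One - (1/2 - \<kappa>') *\<^sub>R One) \<bullet> b) = (\<Prod>b\<in>(Basis::'a set). 2 * \<kappa>')"
      by (intro prod.cong) (auto simp: inner_diff_left)
    finally show ?thesis by (simp add: m_def)
  qed
  have c0: "0 < 1 / m" using m by simp
  obtain C2 where C2: "C2 \<ge> 0" and dom: "\<And>(MM :: 'a measure) e e' K. finite_measure MM \<Longrightarrow> (\<And>k. Measurable.pred MM (e k)) \<Longrightarrow>
       (\<And>k. Measurable.pred MM (e' k)) \<Longrightarrow> (\<And>k \<omega>. e' k \<omega> \<Longrightarrow> e k \<omega>) \<Longrightarrow>
       (\<And>k h. (\<integral>\<^sup>+\<omega>. of_bool (e k \<omega>) * h (count_upto e (Suc k) \<omega>) \<partial>MM)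
          \<le> ennreal (1 / m) * (\<integral>\<^sup>+\<omega>. of_bool (e' k \<omega>) * h (count_upto e (Suc k) \<omega>) \<partial>MM)) \<Longrightarrow>
       (\<integral>\<^sup>+\<omega>. ennreal (real (count_upto e K \<omega>) powr (p / 2)) \<partial>MM)
        \<le> ennreal C2 * (\<integral>\<^sup>+\<omega>. ennreal (real (count_upto e' K \<omega>) powr (p / 2)) \<partial>MM)"
    by (rule count_powr_dominated[OF q(2) c0, where 'b='a]) (rule that; blast)
  show ?thesis
  proof (rule that[of "C1 * C2"])
    show "0 \<le> C1 * C2" using C1 C2 by simp
    fix b :: "nat \<Rightarrow> 'a \<Rightarrow> real" and i s :: 'a and K
    assume i: "i \<in> Basis" and b [measurable]: "\<And>k. b k \<in> borel_measurable borel" and A: "\<And>k x. \<bar>2 ^ k * b k x\<bar> \<le> 1"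
    let ?d = "\<lambda>k u. haar i (cell_pos k u) * (2 ^ k * b k (s - cell_centre k u))"
    let ?e = "\<lambda>k u. b k (s - cell_centre k u) \<noteq> 0"
    let ?e' = "\<lambda>k u. ?e k u \<and> B (cell_pos k u)"
    have e_cell: "?e j u = ?e j v" if "cell k u = cell k v" "j \<le> k" for j k u v
      using cell_nested[OF that] by (simp add: cell_centre_def)
    have 1: "(\<integral>\<^sup>+u. ennreal (\<bar>\<Sum>k<K. ?d k u\<bar> powr (2 * (p / 2))) \<partial>cube_measure)
        \<le> ennreal C1 * (\<integral>\<^sup>+u. ennreal (real (count_upto ?e K u) powr (p / 2)) \<partial>cube_measure)"
      by (rule sq[OF flip_martingale_haar[OF i b A]]) auto
    have 2: "(\<integral>\<^sup>+u. ennreal (real (count_upto ?e K u) powr (p / 2)) \<partial>cube_measure)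
        \<le> ennreal C2 * (\<integral>\<^sup>+u. ennreal (real (count_upto ?e' K u) powr (p / 2)) \<partial>cube_measure)"
    proof (rule dom)
      fix k and h :: "nat \<Rightarrow> ennreal"
      \<comment> \<open>The counter up to \<open>Suc k\<close> includes the event of level
        \<open>k\<close>, which is still constant on level-\<open>k\<close> cells; this is what
        independence requires.\<close>
      let ?Y = "\<lambda>u. of_bool (?e k u) * h (count_upto ?e (Suc k) u)"
      have one: "ennreal (1 / m) * ennreal m = 1" using m by (simp add: ennreal_mult[symmetric])
      have "(\<integral>\<^sup>+u. of_bool (?e' k u) * h (count_upto ?e (Suc k) u) \<partial>cube_measure) = (\<integral>\<^sup>+u. ?Y u * of_bool (B (cell_pos k u)) \<partial>cube_measure)"
        by (intro nn_integral_cong) auto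
      also have "\<dots> = (\<integral>\<^sup>+u. ?Y u \<partial>cube_measure) * (\<integral>\<^sup>+u. of_bool (B u) \<partial>cube_measure)"
      proof (rule nn_integral_cell_independent)
        have [measurable]: "count_upto ?e (Suc k) \<in> measurable borel (count_space UNIV)"
          by (rule measurable_count_upto) measurable
        have [measurable]: "(\<lambda>u. h (count_upto ?e (Suc k) u)) \<in> borel_measurable borel"
          by (rule measurable_compose[where N="count_space UNIV"]) auto
        show "?Y \<in> borel_measurable borel" by measurable
        show "?Y u = ?Y v" if "cell k u = cell k v" for u v
        proof -
          have "count_upto ?e (Suc k) u = count_upto ?e (Suc k) v"
            by (rule count_upto_cong) (use e_cell[OF that] in auto)
          then show ?thesis using e_cell[OF that order_refl] by simp
        qed
      qed measurable
      finally have "ennreal (1 / m) * (\<integral>\<^sup>+u. of_bool (?e' k u) * h (count_upto ?e (Suc k) u) \<partial>cube_measure)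
          = (ennreal (1 / m) * ennreal m) * (\<integral>\<^sup>+u. ?Y u \<partial>cube_measure)"
        unfolding mB by (simp only: mult_ac)
      then show "(\<integral>\<^sup>+u. ?Y u \<partial>cube_measure) \<le> ennreal (1 / m) * (\<integral>\<^sup>+u. of_bool (?e' k u) * h (count_upto ?e (Suc k) u) \<partial>cube_measure)"
        by (simp add: one)
    qed (auto intro: cube.finite_measure_axioms)
    have 3: "(\<integral>\<^sup>+u. ennreal (real (count_upto ?e' K u) powr (p / 2)) \<partial>cube_measure)
        \<le> (\<integral>\<^sup>+u. ennreal (real (count_upto (near_support \<kappa> b) K (s - u)) powr (p / 2)) \<partial>cube_measure)"
    proof (rule nn_integral_mono)
      fix u
      have "count_upto ?e' K u \<le> count_upto (near_support \<kappa> b) K (s - u)"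
      proof (rule count_upto_mono)
        fix k assume e': "?e' k u"
        have "norm (cell_pos k u - (1/2) *\<^sub>R One) \<le> (\<Sum>b\<in>Basis. \<bar>(cell_pos k u - (1/2) *\<^sub>R One) \<bullet> b\<bar>)" by (rule norm_le_l1)
        also have "\<dots> \<le> (\<Sum>b\<in>(Basis::'a set). \<kappa>')"
        proof (rule sum_mono)
          fix b :: 'a assume bB: "b \<in> Basis"
          then have "(1/2 - \<kappa>') < cell_pos k u \<bullet> b \<and> cell_pos k u \<bullet> b < 1/2 + \<kappa>'"
            using e' unfolding B_def mem_box by (auto dest!: bspec[of _ _ b])
          then show "\<bar>(cell_pos k u - (1/2) *\<^sub>R One) \<bullet> b\<bar> \<le> \<kappa>'" using bB by (simp add: inner_diff_left abs_le_iff)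
        qed
        also have "\<dots> < \<kappa>" using \<kappa>' by simp
        finally have n: "norm (cell_pos k u - (1/2) *\<^sub>R One) < \<kappa>" .
        have "dist (s - u) (s - cell_centre k u) = norm (u - cell_centre k u)"
          by (simp add: dist_norm norm_minus_commute)
        also have "\<dots> = norm (cell_pos k u - (1/2) *\<^sub>R One) / 2 ^ k" unfolding cell_centre_diff by simp
        also have "\<dots> < \<kappa> / 2 ^ k" using n by (simp add: divide_strict_right_mono)
        finally show "near_support \<kappa> b k (s - u)" unfolding near_support_def using e' by blast
      qed
      then show "ennreal (real (count_upto ?e' K u) powr (p / 2)) \<le> ennreal (real (count_upto (near_support \<kappa> b) K (s - u)) powr (p / 2))"
        using q by (intro ennreal_leI powr_mono2) auto
    qed
    have "(\<integral>\<^sup>+u. ennreal (\<bar>\<Sum>k<K. ?d k u\<bar> powr p) \<partial>cube_measure)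
       \<le> ennreal C1 * (ennreal C2 * (\<integral>\<^sup>+u. ennreal (real (count_upto (near_support \<kappa> b) K (s - u)) powr (p / 2)) \<partial>cube_measure))"
      using 1 by (simp, elim order_trans) (intro mult_left_mono order_trans[OF 2] 3, auto)
    then show "(\<integral>\<^sup>+u. ennreal (\<bar>\<Sum>k<K. ?d k u\<bar> powr p) \<partial>cube_measure)
       \<le> ennreal (C1 * C2) * (\<integral>\<^sup>+u. ennreal (real (count_upto (near_support \<kappa> b) K (s - u)) powr (p / 2)) \<partial>cube_measure)"
      using C1 C2 by (simp add: ennreal_mult mult.assoc)
  qed
qed

section \<open>Convergence of tent series in the Sobolev space\<close>

text \<open>Completeness with the rate carried over to the limit. A rapidly converging subsequence
  is chosen, the limit is taken almost everywhere, and Fatou's lemma preserves the bounds. No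
  triangle inequality in \<open>L^p\<close> is used.\<close>

lemma Lp_complete:
  fixes G :: "nat \<Rightarrow> 'b \<Rightarrow> real" and \<epsilon> :: "nat \<Rightarrow> ennreal"
  assumes p: "0 < p" and [measurable]: "\<And>k. G k \<in> borel_measurable M"
    and cauchy: "\<And>J K. J \<le> K \<Longrightarrow> (\<integral>\<^sup>+x. ennreal (\<bar>G K x - G J x\<bar> powr p) \<partial>M) \<le> \<epsilon> J"
    and lim: "\<epsilon> \<longlonglongrightarrow> 0"
  obtains v where "v \<in> borel_measurable M" "\<And>J. (\<integral>\<^sup>+x. ennreal (\<bar>v x - G J x\<bar> powr p) \<partial>M) \<le> \<epsilon> J"
proof -
  have ev: "\<exists>j>m. \<epsilon> j < ennreal ((1/4) powr (p * real n))" for n m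
  proof -
    have "(0::ennreal) < ennreal ((1/4) powr (p * real n))" by simp
    from order_tendstoD(2)[OF lim this] obtain N where "\<And>j. j \<ge> N \<Longrightarrow> \<epsilon> j < ennreal ((1/4) powr (p * real n))"
      by (auto simp: eventually_sequentially)
    then show ?thesis by (intro exI[of _ "Suc (max N m)"]) auto
  qed
  obtain r where r: "\<And>n. \<epsilon> (r n) < ennreal ((1/4) powr (p * real n))" "\<And>n. r n < r (Suc n)"
    using dependent_nat_choice[of "\<lambda>n j. \<epsilon> j < ennreal ((1/4) powr (p * real n))" "\<lambda>n i j. i < j"] ev by blast
  have mono: "strict_mono r" using r(2) by (simp add: strict_mono_Suc_iff)
  define \<Delta> where "\<Delta> = (\<lambda>i x. G (r (Suc i)) x - G (r i) x)"
  have [measurable]: "\<Delta> i \<in> borel_measurable M" for i unfolding \<Delta>_def by measurable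
  \<comment> \<open>The weights grow more slowly than the increments decay. Integrability of the
    weighted sum therefore forces \<open>|\<Delta> i x|\<close> below a constant times
    \<open>(1/2) ^ i\<close> almost everywhere, which is summable.\<close>
  define a where "a = (\<lambda>i x. ennreal (2 powr (p * real i) * \<bar>\<Delta> i x\<bar> powr p))"
  have [measurable]: "a i \<in> borel_measurable M" for i unfolding a_def by measurable
  have ia: "(\<integral>\<^sup>+x. a i x \<partial>M) \<le> ennreal ((2 powr (- p)) ^ i)" for i
  proof -
    have "(\<integral>\<^sup>+x. a i x \<partial>M) = ennreal (2 powr (p * real i)) * (\<integral>\<^sup>+x. ennreal (\<bar>\<Delta> i x\<bar> powr p) \<partial>M)"
      unfolding a_def by (subst nn_integral_cmult[symmetric]) (auto simp: ennreal_mult)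
    also have "\<dots> \<le> ennreal (2 powr (p * real i)) * ennreal ((1/4) powr (p * real i))"
      unfolding \<Delta>_def using cauchy[of "r i" "r (Suc i)"] r[of i] by (intro mult_left_mono) auto
    also have "\<dots> = ennreal ((2 powr (- p)) ^ i)"
    proof -
      have "2 powr (p * real i) * (1/4) powr (p * real i) = (1/2) powr (p * real i)"
        by (simp add: powr_mult[symmetric])
      also have "\<dots> = (2 powr (-1)) powr (p * real i)" by (simp add: powr_neg_one)
      also have "\<dots> = (2 powr (- p)) powr real i" unfolding powr_powr by simp
      also have "\<dots> = (2 powr (- p)) ^ i" by (rule powr_realpow) simp
      finally show ?thesis by (simp add: ennreal_mult[symmetric])
    qed
    finally show ?thesis .
  qed
  have "(\<integral>\<^sup>+x. (\<Sum>i. a i x) \<partial>M) = (\<Sum>i. \<integral>\<^sup>+x. a i x \<partial>M)" by (rule nn_integral_suminf) measurable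
  also have "\<dots> \<le> (\<Sum>i. ennreal ((2 powr (- p)) ^ i))" by (intro suminf_le ia summableI)
  also have "\<dots> < \<infinity>"
  proof -
    have "2 powr (- p) < 2 powr 0" using p by (intro powr_less_mono) auto
    then have "summable (\<lambda>i. (2 powr (- p)) ^ i)" by (intro summable_geometric) auto
    then have "(\<Sum>i. ennreal ((2 powr (- p)) ^ i)) \<noteq> top" by (rule ennreal_suminf_neq_top) simp
    then show ?thesis by (simp only: less_top[symmetric] infinity_ennreal_def not_False_eq_True)
  qed
  finally have "AE x in M. (\<Sum>i. a i x) \<noteq> \<infinity>" by (intro nn_integral_PInf_AE) auto
  then have conv: "AE x in M. convergent (\<lambda>i. G (r i) x)"
  proof eventually_elim
    case (elim x)
    then obtain s where s: "s \<ge> 0" "(\<Sum>i. a i x) = ennreal s" by (cases "\<Sum>i. a i x") auto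
    have bd: "\<bar>\<Delta> i x\<bar> \<le> s powr (1 / p) * (1/2) ^ i" for i
    proof -
      have "a i x \<le> ennreal s" unfolding s(2)[symmetric] by (rule le_suminf_ennreal)
      then have "2 powr (p * real i) * \<bar>\<Delta> i x\<bar> powr p \<le> s" using s(1) by (simp add: a_def)
      moreover have "2 powr (p * real i) * \<bar>\<Delta> i x\<bar> powr p = (2 ^ i * \<bar>\<Delta> i x\<bar>) powr p"
      proof -
        have "2 powr (p * real i) = (2 powr real i) powr p" unfolding powr_powr by (simp add: mult.commute)
        also have "2 powr real i = 2 ^ i" by (rule powr_realpow) simp
        finally show ?thesis by (simp add: powr_mult)
      qed
      ultimately have "((2 ^ i * \<bar>\<Delta> i x\<bar>) powr p) powr (1 / p) \<le> s powr (1 / p)"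
        using p by (intro powr_mono2) auto
      then have "2 ^ i * \<bar>\<Delta> i x\<bar> \<le> s powr (1 / p)" using p by (simp add: powr_powr)
      then show ?thesis by (simp add: field_simps power_one_over)
    qed
    have "summable (\<lambda>i. s powr (1 / p) * (1/2) ^ i)" by (intro summable_mult summable_geometric) auto
    then have "summable (\<lambda>i. \<Delta> i x)" by (rule summable_comparison_test'[where N=0]) (simp add: bd)
    then have "convergent (\<lambda>n. \<Sum>i<n. \<Delta> i x)" by (simp add: summable_iff_convergent)
    moreover have "(\<Sum>i<n. \<Delta> i x) = G (r n) x - G (r 0) x" for n
      unfolding \<Delta>_def by (rule sum_lessThan_telescope)
    ultimately have "convergent (\<lambda>n. (G (r n) x - G (r 0) x) + G (r 0) x)" by (intro convergent_add convergent_const) simp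
    then show ?case by simp
  qed
  define v where "v = (\<lambda>x. lim (\<lambda>i. G (r i) x))"
  have vm [measurable]: "v \<in> borel_measurable M" unfolding v_def by measurable
  show ?thesis
  proof (rule that[OF vm])
    fix J
    have "(\<integral>\<^sup>+x. ennreal (\<bar>v x - G J x\<bar> powr p) \<partial>M) \<le> (\<integral>\<^sup>+x. liminf (\<lambda>i. ennreal (\<bar>G (r i) x - G J x\<bar> powr p)) \<partial>M)"
    proof (rule nn_integral_mono_AE)
      show "AE x in M. ennreal (\<bar>v x - G J x\<bar> powr p) \<le> liminf (\<lambda>i. ennreal (\<bar>G (r i) x - G J x\<bar> powr p))"
        using conv
      proof eventually_elim
        case (elim x)
        then have "(\<lambda>i. G (r i) x) \<longlonglongrightarrow> v x" by (simp add: v_def convergent_LIMSEQ_iff)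
        then have "(\<lambda>i. \<bar>G (r i) x - G J x\<bar>) \<longlonglongrightarrow> \<bar>v x - G J x\<bar>" by (intro tendsto_intros)
        then have "(\<lambda>i. \<bar>G (r i) x - G J x\<bar> powr p) \<longlonglongrightarrow> \<bar>v x - G J x\<bar> powr p"
          using p by (intro tendsto_powr') (auto intro: tendsto_const)
        then have "(\<lambda>i. ennreal (\<bar>G (r i) x - G J x\<bar> powr p)) \<longlonglongrightarrow> ennreal (\<bar>v x - G J x\<bar> powr p)"
          by (rule tendsto_ennrealI)
        from lim_imp_Liminf[OF _ this] show ?case by (simp only: sequentially_bot not_False_eq_True order_refl)
      qed
    qed
    also have "\<dots> \<le> liminf (\<lambda>i. \<integral>\<^sup>+x. ennreal (\<bar>G (r i) x - G J x\<bar> powr p) \<partial>M)"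
      by (rule nn_integral_liminf) measurable
    also have "\<dots> \<le> liminf (\<lambda>i. \<epsilon> J)"
    proof (rule Liminf_mono)
      have "eventually (\<lambda>i. J \<le> r i) sequentially"
        using filterlim_subseq[OF mono] by (simp add: filterlim_at_top)
      then show "eventually (\<lambda>i. (\<integral>\<^sup>+x. ennreal (\<bar>G (r i) x - G J x\<bar> powr p) \<partial>M) \<le> \<epsilon> J) sequentially"
        by eventually_elim (rule cauchy)
    qed
    also have "\<dots> = \<epsilon> J" by (simp add: Liminf_const)
    finally show "(\<integral>\<^sup>+x. ennreal (\<bar>v x - G J x\<bar> powr p) \<partial>M) \<le> \<epsilon> J" .
  qed
qed

text \<open>At each \<open>x\<close> the derivative is an average over \<open>u\<close> of the
  martingale with parameter \<open>s = x + u\<close>, so Jensen reduces the claim to integrals over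
  \<open>x\<close> and \<open>u\<close>. \<open>haar_sum_bound\<close> applies for fixed
  \<open>s\<close>, and translating back leaves the count at \<open>s - u = x\<close>. Division by
  \<open>A\<close> normalises the jumps.\<close>

lemma tent_avg_deriv_sum_bound:
  fixes p \<kappa> A :: real
  assumes p: "p > 1" and \<kappa>: "\<kappa> > 0" and A: "A > 0"
  obtains C where "C \<ge> 0"
    "\<And>(b :: nat \<Rightarrow> 'a::euclidean_space \<Rightarrow> real) i K. i \<in> Basis \<Longrightarrow> (\<And>k. b k \<in> borel_measurable borel) \<Longrightarrow>
       (\<And>k x. \<bar>2 ^ k * b k x\<bar> \<le> A) \<Longrightarrow>
       (\<integral>\<^sup>+x. ennreal (\<bar>\<Sum>k<K. tent_avg_deriv i (1 / 2 ^ Suc k) (b k) x\<bar> powr p) \<partial>lborel)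
       \<le> ennreal C * (\<integral>\<^sup>+x. ennreal (real (count_upto (near_support \<kappa> b) K x) powr (p / 2)) \<partial>lborel)"
proof -
  interpret cube: prob_space "cube_measure :: 'a measure" by (rule prob_space_cube_measure)
  interpret pair_sigma_finite lborel "cube_measure :: 'a measure" ..
  have cube1: "emeasure (cube_measure :: 'a measure) UNIV = 1" using cube.emeasure_space_1 by simp
  obtain C0 where C0: "C0 \<ge> 0" and haar: "\<And>(b :: nat \<Rightarrow> 'a \<Rightarrow> real) i s K. i \<in> Basis \<Longrightarrow> (\<And>k. b k \<in> borel_measurable borel) \<Longrightarrow>
       (\<And>k x. \<bar>2 ^ k * b k x\<bar> \<le> 1) \<Longrightarrow>
       (\<integral>\<^sup>+u. ennreal (\<bar>\<Sum>k<K. haar i (cell_pos k u) * (2 ^ k * b k (s - cell_centre k u))\<bar> powr p) \<partial>cube_measure)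
       \<le> ennreal C0 * (\<integral>\<^sup>+u. ennreal (real (count_upto (near_support \<kappa> b) K (s - u)) powr (p / 2)) \<partial>cube_measure)"
    by (rule haar_sum_bound[OF p \<kappa>, where 'a='a]) (rule that; blast)
  define c where "c = 2 ^ Suc DIM('a) * A"
  have c: "c > 0" using A by (simp add: c_def)
  show ?thesis
  proof (rule that[of "c powr p * C0"])
    show "0 \<le> c powr p * C0" using C0 by simp
    fix b :: "nat \<Rightarrow> 'a \<Rightarrow> real" and i :: 'a and K
    assume i: "i \<in> Basis" and b [measurable]: "\<And>k. b k \<in> borel_measurable borel" and bA: "\<And>k x. \<bar>2 ^ k * b k x\<bar> \<le> A"
    define b' where "b' = (\<lambda>k x. b k x / A)"
    have [measurable]: "b' k \<in> borel_measurable borel" for k unfolding b'_def by measurable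
    have b'1: "\<bar>2 ^ k * b' k x\<bar> \<le> 1" for k x using bA[of k x] A by (simp add: b'_def abs_mult)
    have ns: "near_support \<kappa> b' = near_support \<kappa> b" using A by (intro ext) (simp add: near_support_def b'_def)
    define H where "H = (\<lambda>s u. \<Sum>k<K. haar i (cell_pos k u) * (2 ^ k * b' k (s - cell_centre k u)))"
    have Hm [measurable]: "(\<lambda>z. H (f z) (h z)) \<in> borel_measurable N" if [measurable]: "f \<in> borel_measurable N" "h \<in> borel_measurable N"
      for f h and N :: "'c measure" unfolding H_def by measurable
    have eq: "(\<Sum>k<K. tent_avg_deriv i (1 / 2 ^ Suc k) (b k) x) = (\<integral>u. - c * H (x + u) u \<partial>cube_measure)" for x
    proof -
      have in1: "integrable cube_measure (\<lambda>u. - (2 ^ Suc DIM('a)) * (haar i (cell_pos k u) * (2 ^ k * b k (x + u - cell_centre k u))))" for k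
      proof (rule cube.integrable_const_bound[where B="2 ^ Suc DIM('a) * A"])
        show "AE u in cube_measure. norm (- (2 ^ Suc DIM('a)) * (haar i (cell_pos k u) * (2 ^ k * b k (x + u - cell_centre k u)))) \<le> 2 ^ Suc DIM('a) * A"
        proof (rule AE_I2)
          fix u
          have "\<bar>haar i (cell_pos k u)\<bar> * \<bar>2 ^ k * b k (x + u - cell_centre k u)\<bar> \<le> 1 * A"
            by (intro mult_mono haar_abs_le_1 bA) auto
          then show "norm (- (2 ^ Suc DIM('a)) * (haar i (cell_pos k u) * (2 ^ k * b k (x + u - cell_centre k u)))) \<le> 2 ^ Suc DIM('a) * A"
            by (simp add: abs_mult)
        qed
      qed measurable
      have "(\<Sum>k<K. tent_avg_deriv i (1 / 2 ^ Suc k) (b k) x) = (\<Sum>k<K. \<integral>u. - (2 ^ Suc DIM('a)) * (haar i (cell_pos k u) * (2 ^ k * b k (x + u - cell_centre k u))) \<partial>cube_measure)"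
        by (intro sum.cong refl tent_avg_deriv_eq b i)
      also have "\<dots> = (\<integral>u. (\<Sum>k<K. - (2 ^ Suc DIM('a)) * (haar i (cell_pos k u) * (2 ^ k * b k (x + u - cell_centre k u)))) \<partial>cube_measure)"
        by (rule Bochner_Integration.integral_sum[symmetric]) (rule in1)
      also have "\<dots> = (\<integral>u. - c * H (x + u) u \<partial>cube_measure)"
      proof (rule Bochner_Integration.integral_cong[OF refl])
        fix u
        show "(\<Sum>k<K. - (2 ^ Suc DIM('a)) * (haar i (cell_pos k u) * (2 ^ k * b k (x + u - cell_centre k u)))) = - c * H (x + u) u"
          unfolding H_def sum_distrib_left using A by (intro sum.cong) (auto simp: c_def b'_def)
      qed
      finally show ?thesis .
    qed
    have "(\<integral>\<^sup>+x. ennreal (\<bar>\<Sum>k<K. tent_avg_deriv i (1 / 2 ^ Suc k) (b k) x\<bar> powr p) \<partial>lborel)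
       \<le> (\<integral>\<^sup>+x. (\<integral>\<^sup>+u. ennreal (\<bar>- c * H (x + u) u\<bar> powr p) \<partial>cube_measure) \<partial>lborel)"
      unfolding eq using p by (intro nn_integral_mono cube.jensen_powr) auto
    also have "\<dots> = (\<integral>\<^sup>+x. (\<integral>\<^sup>+u. ennreal (c powr p) * ennreal (\<bar>H (x + u) u\<bar> powr p) \<partial>cube_measure) \<partial>lborel)"
      using c by (simp add: abs_mult powr_mult ennreal_mult)
    also have "\<dots> = (\<integral>\<^sup>+u. (\<integral>\<^sup>+x. ennreal (c powr p) * ennreal (\<bar>H (x + u) u\<bar> powr p) \<partial>lborel) \<partial>cube_measure)"
      by (rule Fubini'[symmetric]) measurable
    \<comment> \<open>Substituting \<open>s = x + u\<close> for fixed \<open>u\<close> decouples the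
      variables: after another exchange \<open>s\<close> is a parameter and \<open>u\<close> alone
      is random.\<close>
    also have "\<dots> = (\<integral>\<^sup>+u. (\<integral>\<^sup>+s. ennreal (c powr p) * ennreal (\<bar>H s u\<bar> powr p) \<partial>lborel) \<partial>cube_measure)"
      by (intro nn_integral_cong nn_integral_lborel_shift) measurable
    also have "\<dots> = (\<integral>\<^sup>+s. (\<integral>\<^sup>+u. ennreal (c powr p) * ennreal (\<bar>H s u\<bar> powr p) \<partial>cube_measure) \<partial>lborel)"
      by (rule Fubini') measurable
    also have "\<dots> = (\<integral>\<^sup>+s. ennreal (c powr p) * (\<integral>\<^sup>+u. ennreal (\<bar>H s u\<bar> powr p) \<partial>cube_measure) \<partial>lborel)"
      by (intro nn_integral_cong nn_integral_cmult) measurable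
    also have "\<dots> \<le> (\<integral>\<^sup>+s. ennreal (c powr p) * (ennreal C0 * (\<integral>\<^sup>+u. ennreal (real (count_upto (near_support \<kappa> b) K (s - u)) powr (p / 2)) \<partial>cube_measure)) \<partial>lborel)"
      unfolding H_def ns[symmetric] by (intro nn_integral_mono mult_left_mono haar i b'1) auto
    also have "\<dots> = ennreal (c powr p * C0) * (\<integral>\<^sup>+s. (\<integral>\<^sup>+u. ennreal (real (count_upto (near_support \<kappa> b) K (s - u)) powr (p / 2)) \<partial>cube_measure) \<partial>lborel)"
      unfolding count_upto_eq_sum mult.assoc[symmetric] using C0 by (subst nn_integral_cmult[symmetric]) (auto simp: ennreal_mult)
    also have "(\<integral>\<^sup>+s. (\<integral>\<^sup>+u. ennreal (real (count_upto (near_support \<kappa> b) K (s - u)) powr (p / 2)) \<partial>cube_measure) \<partial>lborel)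
      = (\<integral>\<^sup>+u. (\<integral>\<^sup>+s. ennreal (real (count_upto (near_support \<kappa> b) K (s - u)) powr (p / 2)) \<partial>lborel) \<partial>cube_measure)"
      unfolding count_upto_eq_sum by (rule Fubini'[symmetric]) measurable
    also have "\<dots> = (\<integral>\<^sup>+u. (\<integral>\<^sup>+x. ennreal (real (count_upto (near_support \<kappa> b) K x) powr (p / 2)) \<partial>lborel) \<partial>(cube_measure :: 'a measure))"
    proof (rule nn_integral_cong)
      fix u :: 'a
      show "(\<integral>\<^sup>+s. ennreal (real (count_upto (near_support \<kappa> b) K (s - u)) powr (p / 2)) \<partial>lborel)
         = (\<integral>\<^sup>+x. ennreal (real (count_upto (near_support \<kappa> b) K x) powr (p / 2)) \<partial>lborel)"
        using nn_integral_lborel_shift[of "\<lambda>x. ennreal (real (count_upto (near_support \<kappa> b) K x) powr (p / 2))" "- u"] by simp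
    qed
    also have "\<dots> = (\<integral>\<^sup>+x. ennreal (real (count_upto (near_support \<kappa> b) K x) powr (p / 2)) \<partial>lborel)" by (simp add: cube1)
    finally show "(\<integral>\<^sup>+x. ennreal (\<bar>\<Sum>k<K. tent_avg_deriv i (1 / 2 ^ Suc k) (b k) x\<bar> powr p) \<partial>lborel)
       \<le> ennreal (c powr p * C0) * (\<integral>\<^sup>+x. ennreal (real (count_upto (near_support \<kappa> b) K x) powr (p / 2)) \<partial>lborel)" .
  qed
qed

lemma of_bool_suminf_tail_tendsto_0:
  assumes "(\<Sum>k. of_bool (P k)) \<noteq> (\<top>::ennreal)"
  shows "(\<lambda>J. \<Sum>k. of_bool (J \<le> k \<and> P k) :: ennreal) \<longlonglongrightarrow> 0"
proof -
  have "(\<Sum>k. ennreal (of_bool (P k))) \<noteq> \<top>" using assms by (simp add: of_bool_def if_distrib cong: if_cong)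
  then have "summable (\<lambda>k. of_bool (P k) :: real)" by (intro summable_suminf_not_top) auto
  from order_tendstoD(2)[OF summable_LIMSEQ_zero[OF this], of "1/2"]
  obtain N where N: "\<And>k. k \<ge> N \<Longrightarrow> (of_bool (P k) :: real) < 1/2" by (auto simp: eventually_sequentially)
  have "\<not> (J \<le> k \<and> P k)" if "J \<ge> N" for J k using N[of k] that by (cases "P k") auto
  then have "(\<Sum>k. of_bool (J \<le> k \<and> P k) :: ennreal) = 0" if "J \<ge> N" for J
    using that by (subst suminf_cong[where g="\<lambda>_. 0"]) (simp_all only: of_bool_eq(1) suminf_zero)
  then have "eventually (\<lambda>J. (\<Sum>k. of_bool (J \<le> k \<and> P k) :: ennreal) = 0) sequentially"
    unfolding eventually_sequentially by blast
  then show ?thesis by (rule tendsto_eventually)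
qed

lemma tendsto_enn_powr_0:
  assumes "f \<longlonglongrightarrow> 0" "0 < r"
  shows "(\<lambda>n. enn_powr (f n) r) \<longlonglongrightarrow> 0"
proof (rule order_tendstoI)
  fix a :: ennreal assume a: "0 < a"
  define a' where "a' = min a 1"
  have a': "0 < a'" "a' \<le> a" "a' < \<top>" using a by (auto simp: a'_def min_less_iff_disj)
  then obtain c where c: "a' = ennreal c" "0 < c" by (cases a') auto
  have "0 < ennreal ((c / 2) powr (1 / r))" using c by simp
  from order_tendstoD(2)[OF assms(1) this]
  show "eventually (\<lambda>n. enn_powr (f n) r < a) sequentially"
  proof eventually_elim
    case (elim n)
    have "enn_powr (f n) r \<le> enn_powr (ennreal ((c / 2) powr (1 / r))) r"
      using elim assms(2) by (intro enn_powr_mono) auto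
    also have "\<dots> = ennreal (c / 2)" using c assms(2) by (simp add: powr_powr)
    also have "\<dots> < ennreal c" using c by (intro ennreal_lessI) auto
    finally show ?case using a' c by simp
  qed
qed simp

text \<open>A substitute for Hoelder's inequality: on a set of finite measure the \<open>L^1\<close>
  norm is at most \<tau> times the measure plus a multiple of the p-th moment. First the moment
  tends to 0, then \<tau>.\<close>

lemma abs_le_threshold_powr:
  fixes y \<tau> p :: real
  assumes "0 < \<tau>" "1 \<le> p"
  shows "\<bar>y\<bar> \<le> \<tau> + \<tau> powr (1 - p) * \<bar>y\<bar> powr p"
proof (cases "\<bar>y\<bar> \<le> \<tau>")
  case False
  have "\<bar>y\<bar> = \<bar>y\<bar> powr (1 - p) * \<bar>y\<bar> powr p"
    using False assms by (simp add: powr_add[symmetric])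
  also have "\<dots> \<le> \<tau> powr (1 - p) * \<bar>y\<bar> powr p"
    using False assms by (intro mult_right_mono powr_mono2') auto
  finally show ?thesis using assms by simp
qed (use assms in \<open>simp add: add_increasing2\<close>)

text \<open>The series converges uniformly at a geometric rate. It is integrable because
  \<open>b k\<close> lives where the count is at least 1, and a bounded integrable function is in
  \<open>L^p\<close>. The derivative bound, applied to tails of the family, makes the partial sums
  of the derivatives Cauchy; the weak derivative formula then passes to the limit.\<close>

theorem tent_series_W1p:
  fixes b :: "nat \<Rightarrow> 'a::euclidean_space \<Rightarrow> real"
  assumes p: "p > 1" and \<kappa>: "\<kappa> > 0" and A: "A > 0"
    and b [measurable]: "\<And>k. b k \<in> borel_measurable borel" and bA: "\<And>k x. \<bar>2 ^ k * b k x\<bar> \<le> A"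
    and fin: "(\<integral>\<^sup>+x. enn_powr (\<Sum>k. of_bool (near_support \<kappa> b k x)) (p / 2) \<partial>lborel) < \<infinity>"
  shows "(\<lambda>x. \<Sum>k. tent_avg (1 / 2 ^ Suc k) (b k) x) \<in> W1p p"
proof -
  define D where "D = (\<integral>\<^sup>+x. enn_powr (\<Sum>k. of_bool (near_support \<kappa> b k x)) (p / 2) \<partial>lborel)"
  define g where "g = (\<lambda>x. \<Sum>k. tent_avg (1 / 2 ^ Suc k) (b k) x)"
  define gK where "gK = (\<lambda>K x. \<Sum>k<K. tent_avg (1 / 2 ^ Suc k) (b k) x)"
  have [measurable]: "g \<in> borel_measurable borel" "gK K \<in> borel_measurable borel" for K
    unfolding g_def gK_def by measurable
  have bk: "\<bar>b k x\<bar> \<le> A * (1/2) ^ k" for k x using bA[of k x] by (simp add: abs_mult field_simps power_one_over)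
  have tk: "\<bar>tent_avg (1 / 2 ^ Suc k) (b k) x\<bar> \<le> A * (1/2) ^ k" for k x
    by (intro tent_avg_abs_le bk) measurable
  have geo: "summable (\<lambda>k. A * (1/2) ^ k)" by (intro summable_mult summable_geometric) auto
  have sm: "summable (\<lambda>k. \<bar>tent_avg (1 / 2 ^ Suc k) (b k) x\<bar>)" for x
    by (rule summable_comparison_test'[OF geo, where N=0]) (simp only: real_norm_def abs_abs, rule tk)
  have g_gK: "\<bar>g x - gK K x\<bar> \<le> 2 * A * (1/2) ^ K" for K x
  proof -
    have "g x - gK K x = (\<Sum>k. tent_avg (1 / 2 ^ Suc (k + K)) (b (k + K)) x)"
      unfolding g_def gK_def using suminf_split_initial_segment[OF summable_rabs_cancel[OF sm], of x K] by simp
    also have "\<bar>\<dots>\<bar> \<le> (\<Sum>k. \<bar>tent_avg (1 / 2 ^ Suc (k + K)) (b (k + K)) x\<bar>)"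
      using sm[of x] by (intro summable_rabs) (rule summable_ignore_initial_segment[where f="\<lambda>k. \<bar>tent_avg (1 / 2 ^ Suc k) (b k) x\<bar>"])
    also have "\<dots> \<le> (\<Sum>k. A * (1/2) ^ (k + K))"
    proof (rule suminf_le)
      show "summable (\<lambda>k. \<bar>tent_avg (1 / 2 ^ Suc (k + K)) (b (k + K)) x\<bar>)"
        using sm[of x] by (rule summable_ignore_initial_segment[where f="\<lambda>k. \<bar>tent_avg (1 / 2 ^ Suc k) (b k) x\<bar>"])
      show "summable (\<lambda>k. A * (1/2) ^ (k + K))" by (rule summable_ignore_initial_segment[OF geo])
    qed (rule tk)
    also have "\<dots> = A * (1/2) ^ K * (\<Sum>k. (1/2) ^ k)"
      by (subst suminf_mult[symmetric]) (auto simp: power_add mult_ac intro!: summable_geometric)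
    also have "\<dots> = 2 * A * (1/2) ^ K" by (simp add: suminf_geometric)
    finally show ?thesis .
  qed
  have gb: "\<bar>g x\<bar> \<le> 2 * A" for x using g_gK[of x 0] by (simp add: gK_def)
  \<comment> \<open>Where \<open>b k x\<close> is nonzero, \<open>x\<close> is near its own support,
    so the power of the count is at least 1 there and dominates the indicator of the
    support.\<close>
  have i_supp: "(\<integral>\<^sup>+x. ennreal \<bar>b k x\<bar> \<partial>lborel) \<le> ennreal (A * (1/2) ^ k) * D" for k
  proof -
    have "(\<integral>\<^sup>+x. ennreal \<bar>b k x\<bar> \<partial>lborel) \<le> (\<integral>\<^sup>+x. ennreal (A * (1/2) ^ k) * enn_powr (\<Sum>k. of_bool (near_support \<kappa> b k x)) (p / 2) \<partial>lborel)"
    proof (rule nn_integral_mono)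
      fix x
      show "ennreal \<bar>b k x\<bar> \<le> ennreal (A * (1/2) ^ k) * enn_powr (\<Sum>k. of_bool (near_support \<kappa> b k x)) (p / 2)"
      proof (cases "b k x = 0")
        case False
        then have "near_support \<kappa> b k x" unfolding near_support_def using \<kappa> by (intro exI[of _ x]) auto
        then have "1 \<le> (\<Sum>k. of_bool (near_support \<kappa> b k x) :: ennreal)"
          using le_suminf_ennreal[of "\<lambda>k. of_bool (near_support \<kappa> b k x)" k] by simp
        then have "enn_powr (ennreal 1) (p / 2) \<le> enn_powr (\<Sum>k. of_bool (near_support \<kappa> b k x)) (p / 2)"
          using p by (intro enn_powr_mono) auto
        then have "1 \<le> enn_powr (\<Sum>k. of_bool (near_support \<kappa> b k x)) (p / 2)" by (subst (asm) enn_powr_ennreal) auto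
        then have "ennreal (A * (1/2) ^ k) * 1 \<le> ennreal (A * (1/2) ^ k) * enn_powr (\<Sum>k. of_bool (near_support \<kappa> b k x)) (p / 2)"
          by (intro mult_left_mono) auto
        then show ?thesis using bk[of k x] by (intro order_trans[OF ennreal_leI[OF bk]]) simp
      qed simp
    qed
    also have "\<dots> = ennreal (A * (1/2) ^ k) * D" unfolding D_def by (rule nn_integral_cmult) measurable
    finally show ?thesis .
  qed
  have g1: "(\<integral>\<^sup>+x. ennreal \<bar>g x\<bar> \<partial>lborel) < \<infinity>"
  proof -
    have "(\<integral>\<^sup>+x. ennreal \<bar>g x\<bar> \<partial>lborel) \<le> (\<integral>\<^sup>+x. (\<Sum>k. ennreal \<bar>tent_avg (1 / 2 ^ Suc k) (b k) x\<bar>) \<partial>lborel)"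
    proof (rule nn_integral_mono)
      fix x
      have "ennreal \<bar>g x\<bar> \<le> ennreal (\<Sum>k. \<bar>tent_avg (1 / 2 ^ Suc k) (b k) x\<bar>)"
        unfolding g_def by (intro ennreal_leI summable_rabs sm)
      also have "\<dots> = (\<Sum>k. ennreal \<bar>tent_avg (1 / 2 ^ Suc k) (b k) x\<bar>)"
        by (rule suminf_ennreal2[symmetric]) (use sm in auto)
      finally show "ennreal \<bar>g x\<bar> \<le> (\<Sum>k. ennreal \<bar>tent_avg (1 / 2 ^ Suc k) (b k) x\<bar>)" .
    qed
    also have "\<dots> = (\<Sum>k. \<integral>\<^sup>+x. ennreal \<bar>tent_avg (1 / 2 ^ Suc k) (b k) x\<bar> \<partial>lborel)"
      by (rule nn_integral_suminf) measurable
    also have "\<dots> \<le> (\<Sum>k. ennreal (A * (1/2) ^ k) * D)"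
      by (intro suminf_le summableI order_trans[OF tent_avg_nn_integral_le i_supp] b)
    also have "\<dots> = (\<Sum>k. ennreal (A * (1/2) ^ k)) * D" by simp
    also have "\<dots> < \<infinity>"
    proof -
      have "(\<Sum>k. ennreal (A * (1/2) ^ k)) \<noteq> top" using geo A by (intro ennreal_suminf_neq_top) auto
      then show ?thesis using fin unfolding D_def by (simp add: ennreal_mult_less_top less_top)
    qed
    finally show ?thesis .
  qed
  have gLp: "g \<in> Lp p"
  proof -
    have "integrable lborel (\<lambda>x. \<bar>g x\<bar> powr p)"
    proof (rule Bochner_Integration.integrable_bound)
      show "integrable lborel (\<lambda>x. (2 * A) powr (p - 1) * \<bar>g x\<bar>)"
        using g1 by (intro integrable_mult_right integrableI_bounded) auto
      show "AE x in lborel. norm (\<bar>g x\<bar> powr p) \<le> norm ((2 * A) powr (p - 1) * \<bar>g x\<bar>)"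
      proof (rule AE_I2)
        fix x
        have "\<bar>g x\<bar> powr p = \<bar>g x\<bar> powr (p - 1) * \<bar>g x\<bar>" by (cases "g x = 0") (auto simp: powr_diff)
        also have "\<dots> \<le> (2 * A) powr (p - 1) * \<bar>g x\<bar>" using gb[of x] p by (intro mult_right_mono powr_mono2) auto
        finally show "norm (\<bar>g x\<bar> powr p) \<le> norm ((2 * A) powr (p - 1) * \<bar>g x\<bar>)" by (simp add: abs_mult)
      qed
    qed simp
    then show ?thesis unfolding Lp_def by (auto simp: integrable_completion measurable_completion)
  qed
  obtain C where C: "C \<ge> 0" and bnd: "\<And>(b :: nat \<Rightarrow> 'a \<Rightarrow> real) i K. i \<in> Basis \<Longrightarrow> (\<And>k. b k \<in> borel_measurable borel) \<Longrightarrow>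
       (\<And>k x. \<bar>2 ^ k * b k x\<bar> \<le> A) \<Longrightarrow>
       (\<integral>\<^sup>+x. ennreal (\<bar>\<Sum>k<K. tent_avg_deriv i (1 / 2 ^ Suc k) (b k) x\<bar> powr p) \<partial>lborel)
       \<le> ennreal C * (\<integral>\<^sup>+x. ennreal (real (count_upto (near_support \<kappa> b) K x) powr (p / 2)) \<partial>lborel)"
    by (rule tent_avg_deriv_sum_bound[OF p \<kappa> A, where 'a='a]) (rule that; blast)
  \<comment> \<open>The tail of the count from scale \<open>J\<close> on. Where the full count is
    finite, its tail is eventually zero, and dominated convergence gives \<open>\<epsilon> J\<close>
    tending to 0.\<close>
  define \<epsilon> where "\<epsilon> = (\<lambda>J. ennreal C * (\<integral>\<^sup>+x. enn_powr (\<Sum>k. of_bool (J \<le> k \<and> near_support \<kappa> b k x)) (p / 2) \<partial>lborel))"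
  have \<epsilon>0: "\<epsilon> \<longlonglongrightarrow> 0"
  proof -
    have "(\<lambda>J. \<integral>\<^sup>+x. enn_powr (\<Sum>k. of_bool (J \<le> k \<and> near_support \<kappa> b k x)) (p / 2) \<partial>lborel) \<longlonglongrightarrow> (\<integral>\<^sup>+(x::'a). 0 \<partial>lborel)"
    proof (rule nn_integral_dominated_convergence[where w="\<lambda>x. enn_powr (\<Sum>k. of_bool (near_support \<kappa> b k x)) (p / 2)"])
      show "AE x in lborel. enn_powr (\<Sum>k. of_bool (j \<le> k \<and> near_support \<kappa> b k x)) (p / 2) \<le> enn_powr (\<Sum>k. of_bool (near_support \<kappa> b k x)) (p / 2)" for j
        using p by (intro AE_I2 enn_powr_mono suminf_le summableI) auto
      have "AE x in lborel. enn_powr (\<Sum>k. of_bool (near_support \<kappa> b k x)) (p / 2) \<noteq> \<infinity>"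
        using fin by (intro nn_integral_PInf_AE) auto
      then show "AE x in lborel. (\<lambda>J. enn_powr (\<Sum>k. of_bool (J \<le> k \<and> near_support \<kappa> b k x)) (p / 2)) \<longlonglongrightarrow> 0"
      proof eventually_elim
        case (elim x)
        then have "(\<Sum>k. of_bool (near_support \<kappa> b k x)) \<noteq> (\<top>::ennreal)" by (metis enn_powr_top infinity_ennreal_def)
        from of_bool_suminf_tail_tendsto_0[OF this] show ?case using p by (intro tendsto_enn_powr_0) auto
      qed
    qed (use fin in auto)
    then have "(\<lambda>J. ennreal C * (\<integral>\<^sup>+x. enn_powr (\<Sum>k. of_bool (J \<le> k \<and> near_support \<kappa> b k x)) (p / 2) \<partial>lborel)) \<longlonglongrightarrow> ennreal C * 0"
      by (intro tendsto_mult_ennreal tendsto_const) auto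
    then show ?thesis by (simp add: \<epsilon>_def)
  qed
  have "\<exists>v. v \<in> Lp p \<and> weak_pderiv i g v" if i: "i \<in> Basis" for i
  proof -
    define G where "G = (\<lambda>K x. \<Sum>k<K. tent_avg_deriv i (1 / 2 ^ Suc k) (b k) x)"
    have Gm [measurable]: "G K \<in> borel_measurable borel" for K unfolding G_def by measurable
    have cauchy: "(\<integral>\<^sup>+x. ennreal (\<bar>G K x - G J x\<bar> powr p) \<partial>lborel) \<le> \<epsilon> J" if JK: "J \<le> K" for J K
    proof -
      \<comment> \<open>Setting the first \<open>J\<close> members to zero turns the difference of
        two partial sums into a single partial sum, to which the same bound applies.\<close>
      define b' where "b' = (\<lambda>k x. if J \<le> k then b k x else 0)"
      have [measurable]: "b' k \<in> borel_measurable borel" for k unfolding b'_def by measurable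
      have b'A: "\<bar>2 ^ k * b' k x\<bar> \<le> A" for k x using bA[of k x] A by (simp add: b'_def)
      have "G K x - G J x = (\<Sum>k<K. tent_avg_deriv i (1 / 2 ^ Suc k) (b' k) x)" for x
      proof -
        have z: "tent_avg_deriv i t (\<lambda>x. 0) x = 0" for t x by (simp add: tent_avg_deriv_def)
        have "(\<Sum>k<K. tent_avg_deriv i (1 / 2 ^ Suc k) (b' k) x) = (\<Sum>k\<in>{J..<K}. tent_avg_deriv i (1 / 2 ^ Suc k) (b k) x)"
          by (rule sum.mono_neutral_cong_right) (auto simp: b'_def z)
        then show ?thesis unfolding G_def using sum_diff_nat_ivl[of 0 J K "\<lambda>k. tent_avg_deriv i (1 / 2 ^ Suc k) (b k) x"] JK
          by (simp add: atLeast0LessThan)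
      qed
      then have "(\<integral>\<^sup>+x. ennreal (\<bar>G K x - G J x\<bar> powr p) \<partial>lborel)
         \<le> ennreal C * (\<integral>\<^sup>+x. ennreal (real (count_upto (near_support \<kappa> b') K x) powr (p / 2)) \<partial>lborel)"
        using bnd[OF i, of b' K] b'A by simp
      also have "\<dots> \<le> \<epsilon> J" unfolding \<epsilon>_def
      proof (intro mult_left_mono nn_integral_mono)
        fix x
        have "ennreal (real (count_upto (near_support \<kappa> b') K x)) \<le> (\<Sum>k. of_bool (J \<le> k \<and> near_support \<kappa> b k x))"
        proof -
          have "ennreal (real (count_upto (near_support \<kappa> b') K x)) = (\<Sum>k<K. of_bool (near_support \<kappa> b' k x))"
            using sum_of_bool_ennreal[of "\<lambda>_. 1" "\<lambda>k. near_support \<kappa> b' k x" "{..<K}"] by (simp add: count_upto_eq_sum)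
          also have "\<dots> \<le> (\<Sum>k<K. of_bool (J \<le> k \<and> near_support \<kappa> b k x))"
            by (intro sum_mono) (auto simp: near_support_def b'_def split: if_splits)
          also have "\<dots> \<le> (\<Sum>k. of_bool (J \<le> k \<and> near_support \<kappa> b k x))"
            by (intro sum_le_suminf summableI) auto
          finally show ?thesis .
        qed
        then have "enn_powr (ennreal (real (count_upto (near_support \<kappa> b') K x))) (p / 2) \<le> enn_powr (\<Sum>k. of_bool (J \<le> k \<and> near_support \<kappa> b k x)) (p / 2)"
          using p by (intro enn_powr_mono) auto
        then show "ennreal (real (count_upto (near_support \<kappa> b') K x) powr (p / 2)) \<le> enn_powr (\<Sum>k. of_bool (J \<le> k \<and> near_support \<kappa> b k x)) (p / 2)"
          by simp
      qed auto
      finally show ?thesis .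
    qed
    have p0: "0 < p" using p by simp
    obtain v where vm [measurable]: "v \<in> borel_measurable lborel" and v: "\<And>J. (\<integral>\<^sup>+x. ennreal (\<bar>v x - G J x\<bar> powr p) \<partial>lborel) \<le> \<epsilon> J"
    proof (rule Lp_complete[OF p0 _ cauchy \<epsilon>0])
      show "G k \<in> borel_measurable lborel" for k by simp
    qed (use that in auto)
    have \<epsilon>fin: "\<epsilon> J < \<infinity>" for J
    proof -
      have "(\<integral>\<^sup>+x. enn_powr (\<Sum>k. of_bool (J \<le> k \<and> near_support \<kappa> b k x)) (p / 2) \<partial>lborel) \<le> D"
        unfolding D_def using p by (intro nn_integral_mono enn_powr_mono suminf_le summableI) auto
      also have "D < \<infinity>" using fin by (simp add: D_def)
      finally show ?thesis by (simp add: \<epsilon>_def ennreal_mult_less_top)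
    qed
    have vLp: "v \<in> Lp p"
    proof -
      have "(\<integral>\<^sup>+x. ennreal (\<bar>v x\<bar> powr p) \<partial>lborel) < \<infinity>"
        using v[of 0] \<epsilon>fin[of 0] by (simp add: G_def le_less_trans)
      then have "integrable lborel (\<lambda>x. \<bar>v x\<bar> powr p)" by (intro integrableI_bounded) auto
      then show ?thesis unfolding Lp_def using vm by (auto simp: integrable_completion measurable_completion)
    qed
    have weak: "(\<integral>x. g x * pderiv_dir i \<phi> x \<partial>lborel) = - (\<integral>x. v x * \<phi> x \<partial>lborel)" if \<phi>: "test_function \<phi>" for \<phi>
    proof -
      have \<phi>c: "continuous_on UNIV \<phi>" "continuous_on UNIV (pderiv_dir i \<phi>)" using test_function_support[OF \<phi>] i by auto
      have [measurable]: "\<phi> \<in> borel_measurable borel" "pderiv_dir i \<phi> \<in> borel_measurable borel"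
        using \<phi>c by (auto intro: borel_measurable_continuous_onI)
      obtain R where R: "\<And>x. R < norm x \<Longrightarrow> \<phi> x = 0" "\<And>x. R < norm x \<Longrightarrow> pderiv_dir i \<phi> x = 0"
        using test_function_support(4)[OF \<phi>] i by blast
      have bdd: "\<exists>K\<ge>0. \<forall>z. \<bar>f z\<bar> \<le> K" if "continuous_on UNIV f" "\<And>z. R < norm z \<Longrightarrow> f z = 0" for f :: "'a \<Rightarrow> real"
      proof -
        have "compact (f ` cball 0 R)"
          using that(1) by (intro compact_continuous_image) (auto intro: continuous_on_subset)
        then have "bounded (f ` cball 0 R)" by (rule compact_imp_bounded)
        then obtain K where K: "\<And>z. norm z \<le> R \<Longrightarrow> \<bar>f z\<bar> \<le> K" unfolding bounded_iff by force
        have "\<bar>f z\<bar> \<le> \<bar>K\<bar>" for z using K[of z] that(2)[of z] by (cases "norm z \<le> R") auto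
        then show ?thesis by (intro exI[of _ "\<bar>K\<bar>"]) auto
      qed
      obtain K1 where K1: "K1 \<ge> 0" "\<And>x. \<bar>\<phi> x\<bar> \<le> K1" using bdd[OF \<phi>c(1) R(1)] by blast
      obtain K2 where K2: "K2 \<ge> 0" "\<And>x. \<bar>pderiv_dir i \<phi> x\<bar> \<le> K2" using bdd[OF \<phi>c(2) R(2)] by blast
      define B where "B = cball (0::'a) R"
      have Bfin: "emeasure lborel B < \<infinity>" unfolding B_def by (intro emeasure_bounded_finite bounded_cball)
      have [measurable]: "B \<in> sets borel" by (simp add: B_def)
      define V where "V = measure lborel B"
      have iB: "integrable lborel (indicator B :: 'a \<Rightarrow> real)" using Bfin by (intro integrable_real_indicator) auto
      have V0: "V \<ge> 0" "(\<integral>x. indicator B x \<partial>lborel) = V" by (simp_all add: V_def)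
      have outB: "\<phi> x = 0 \<and> pderiv_dir i \<phi> x = 0" if "x \<notin> B" for x using that R[of x] by (simp add: B_def)
      define e where "e = (\<lambda>K. enn2real (\<epsilon> K))"
      have e0: "e \<longlonglongrightarrow> 0" unfolding e_def using tendsto_enn2real[of \<epsilon> 0] \<epsilon>0 by simp
      define \<Delta> where "\<Delta> = (\<integral>x. g x * pderiv_dir i \<phi> x \<partial>lborel) + (\<integral>x. v x * \<phi> x \<partial>lborel)"
      \<comment> \<open>The defect of the weak derivative formula is compared with the partial sums,
        for which it vanishes. The first term is the uniform error of \<open>g\<close>, the second
        the \<open>L^p\<close> error of the derivative through the threshold inequality.\<close>
      have ineq: "\<bar>\<Delta>\<bar> \<le> 2 * A * (1/2) ^ K * K2 * V + K1 * (\<tau> * V + \<tau> powr (1 - p) * e K)" if \<tau>: "\<tau> > 0" for \<tau> K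
      proof -
        have ivG: "integrable lborel (\<lambda>x. \<bar>v x - G K x\<bar> powr p)" "(\<integral>x. \<bar>v x - G K x\<bar> powr p \<partial>lborel) \<le> e K"
        proof -
          show i1: "integrable lborel (\<lambda>x. \<bar>v x - G K x\<bar> powr p)"
            using v[of K] \<epsilon>fin[of K] by (intro integrableI_bounded) (auto simp: le_less_trans)
          have "ennreal (\<integral>x. \<bar>v x - G K x\<bar> powr p \<partial>lborel) \<le> \<epsilon> K"
            using v[of K] nn_integral_eq_integral[OF i1] by simp
          also have "\<epsilon> K = ennreal (e K)" using \<epsilon>fin[of K] by (simp add: e_def less_top)
          finally show "(\<integral>x. \<bar>v x - G K x\<bar> powr p \<partial>lborel) \<le> e K" by (simp add: e_def ennreal_le_iff)
        qed
        have ig: "integrable lborel (\<lambda>x. g x * pderiv_dir i \<phi> x)"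
          using outB gb K2 A by (intro integrable_bounded_support[where K="2 * A * K2" and R=R]) (auto simp: abs_mult R intro!: mult_mono)
        have igK: "integrable lborel (\<lambda>x. tent_avg (1 / 2 ^ Suc k) (b k) x * pderiv_dir i \<phi> x)" for k
          using tk K2 A by (intro integrable_bounded_support[where K="A * (1/2) ^ k * K2" and R=R]) (auto simp: abs_mult R intro!: mult_mono)
        have iGk: "integrable lborel (\<lambda>x. tent_avg_deriv i (1 / 2 ^ Suc k) (b k) x * \<phi> x)" for k
        proof -
          interpret cube: prob_space "cube_measure :: 'a measure" by (rule prob_space_cube_measure)
          have bd: "\<bar>tent_avg_deriv i (1 / 2 ^ Suc k) (b k) x\<bar> \<le> 2 ^ Suc DIM('a) * A" for x
          proof -
            have hb: "\<bar>- (2 ^ Suc DIM('a)) * (haar i (cell_pos k u) * (2 ^ k * b k (x + u - cell_centre k u)))\<bar> \<le> 2 ^ Suc DIM('a) * A" for u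
            proof -
              have "\<bar>haar i (cell_pos k u)\<bar> * \<bar>2 ^ k * b k (x + u - cell_centre k u)\<bar> \<le> 1 * A"
                by (intro mult_mono haar_abs_le_1 bA) auto
              then show ?thesis by (simp add: abs_mult)
            qed
            have "\<bar>\<integral>u. - (2 ^ Suc DIM('a)) * (haar i (cell_pos k u) * (2 ^ k * b k (x + u - cell_centre k u))) \<partial>cube_measure\<bar>
              \<le> (\<integral>u. \<bar>- (2 ^ Suc DIM('a)) * (haar i (cell_pos k u) * (2 ^ k * b k (x + u - cell_centre k u)))\<bar> \<partial>cube_measure)"
              by (rule integral_abs_bound)
            also have "\<dots> \<le> (\<integral>u. 2 ^ Suc DIM('a) * A \<partial>(cube_measure :: 'a measure))"
              by (intro integral_mono cube.integrable_const cube.integrable_const_bound[where B="2 ^ Suc DIM('a) * A"] hb) (auto simp: hb[simplified])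
            also have "\<dots> = 2 ^ Suc DIM('a) * A" using cube.prob_space by simp
            finally show ?thesis unfolding tent_avg_deriv_eq[OF b i] .
          qed
          show ?thesis
            using bd K1 A by (intro integrable_bounded_support[where K="2 ^ Suc DIM('a) * A * K1" and R=R])
              (auto simp: abs_mult R intro!: mult_mono)
        qed
        have weakK: "(\<integral>x. gK K x * pderiv_dir i \<phi> x \<partial>lborel) + (\<integral>x. G K x * \<phi> x \<partial>lborel) = 0"
        proof -
          have "(\<integral>x. gK K x * pderiv_dir i \<phi> x \<partial>lborel) = (\<Sum>k<K. \<integral>x. tent_avg (1 / 2 ^ Suc k) (b k) x * pderiv_dir i \<phi> x \<partial>lborel)"
            unfolding gK_def sum_distrib_right by (rule Bochner_Integration.integral_sum) (rule igK)
          also have "\<dots> = (\<Sum>k<K. - (\<integral>x. tent_avg_deriv i (1 / 2 ^ Suc k) (b k) x * \<phi> x \<partial>lborel))"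
            by (intro sum.cong refl tent_avg_weak_derivative[OF b bk _ i \<phi>]) simp
          also have "\<dots> = - (\<Sum>k<K. \<integral>x. tent_avg_deriv i (1 / 2 ^ Suc k) (b k) x * \<phi> x \<partial>lborel)" by (simp add: sum_negf)
          also have "(\<Sum>k<K. \<integral>x. tent_avg_deriv i (1 / 2 ^ Suc k) (b k) x * \<phi> x \<partial>lborel) = (\<integral>x. G K x * \<phi> x \<partial>lborel)"
            unfolding G_def sum_distrib_right by (rule Bochner_Integration.integral_sum[symmetric]) (rule iGk)
          finally show ?thesis by simp
        qed
        have igKK: "integrable lborel (\<lambda>x. gK K x * pderiv_dir i \<phi> x)" "integrable lborel (\<lambda>x. G K x * \<phi> x)"
          unfolding gK_def G_def sum_distrib_right by (intro Bochner_Integration.integrable_sum igK iGk)+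
        have dom: "\<bar>v x - G K x\<bar> * \<bar>\<phi> x\<bar> \<le> K1 * (\<tau> * indicator B x + \<tau> powr (1 - p) * \<bar>v x - G K x\<bar> powr p)" for x
        proof (cases "x \<in> B")
          case True
          have "\<bar>v x - G K x\<bar> * \<bar>\<phi> x\<bar> \<le> (\<tau> + \<tau> powr (1 - p) * \<bar>v x - G K x\<bar> powr p) * K1"
            using abs_le_threshold_powr[OF \<tau>, of p "v x - G K x"] p K1 \<tau> by (intro mult_mono) auto
          then show ?thesis using True by (simp add: mult.commute)
        qed (use outB K1 in auto)
        have idom: "integrable lborel (\<lambda>x. K1 * (\<tau> * indicator B x + \<tau> powr (1 - p) * \<bar>v x - G K x\<bar> powr p))"
          using iB ivG(1) by auto
        have ivG\<phi>: "integrable lborel (\<lambda>x. (v x - G K x) * \<phi> x)"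
          by (rule Bochner_Integration.integrable_bound[OF idom])
             (auto simp del: abs_mult simp: abs_mult[of "v x - G K x" "\<phi> x" for x] intro!: AE_I2 order_trans[OF dom abs_ge_self])
        have iv: "integrable lborel (\<lambda>x. v x * \<phi> x)"
          using Bochner_Integration.integrable_add[OF ivG\<phi> igKK(2)] by (simp add: algebra_simps)
        have e1: "(\<integral>x. (g x - gK K x) * pderiv_dir i \<phi> x \<partial>lborel) = (\<integral>x. g x * pderiv_dir i \<phi> x \<partial>lborel) - (\<integral>x. gK K x * pderiv_dir i \<phi> x \<partial>lborel)"
          unfolding left_diff_distrib by (rule Bochner_Integration.integral_diff[OF ig igKK(1)])
        have e2: "(\<integral>x. (v x - G K x) * \<phi> x \<partial>lborel) = (\<integral>x. v x * \<phi> x \<partial>lborel) - (\<integral>x. G K x * \<phi> x \<partial>lborel)"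
          unfolding left_diff_distrib by (rule Bochner_Integration.integral_diff[OF iv igKK(2)])
        have "\<Delta> = (\<integral>x. (g x - gK K x) * pderiv_dir i \<phi> x \<partial>lborel) + (\<integral>x. (v x - G K x) * \<phi> x \<partial>lborel)"
          unfolding e1 e2 \<Delta>_def using weakK by simp
        moreover have "\<bar>\<integral>x. (g x - gK K x) * pderiv_dir i \<phi> x \<partial>lborel\<bar> \<le> 2 * A * (1/2) ^ K * K2 * V"
        proof -
          have bd: "\<bar>(g x - gK K x) * pderiv_dir i \<phi> x\<bar> \<le> 2 * A * (1/2) ^ K * K2 * indicator B x" for x
          proof (cases "x \<in> B")
            case True
            have "\<bar>g x - gK K x\<bar> * \<bar>pderiv_dir i \<phi> x\<bar> \<le> (2 * A * (1/2) ^ K) * K2"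
              using g_gK[of x K] K2 A by (intro mult_mono) auto
            then show ?thesis using True by (simp add: abs_mult)
          qed (use outB in auto)
          have i0: "integrable lborel (\<lambda>x. (g x - gK K x) * pderiv_dir i \<phi> x)"
            unfolding left_diff_distrib by (rule Bochner_Integration.integrable_diff[OF ig igKK(1)])
          have "\<bar>\<integral>x. (g x - gK K x) * pderiv_dir i \<phi> x \<partial>lborel\<bar> \<le> (\<integral>x. \<bar>(g x - gK K x) * pderiv_dir i \<phi> x\<bar> \<partial>lborel)"
            by (rule integral_abs_bound)
          also have "\<dots> \<le> (\<integral>x. 2 * A * (1/2) ^ K * K2 * indicator B x \<partial>lborel)"
            using i0 iB bd by (intro integral_mono) auto
          also have "\<dots> = 2 * A * (1/2) ^ K * K2 * V" using V0 by simp
          finally show ?thesis .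
        qed
        moreover have "\<bar>\<integral>x. (v x - G K x) * \<phi> x \<partial>lborel\<bar> \<le> K1 * (\<tau> * V + \<tau> powr (1 - p) * e K)"
        proof -
          have "\<bar>\<integral>x. (v x - G K x) * \<phi> x \<partial>lborel\<bar> \<le> (\<integral>x. \<bar>(v x - G K x) * \<phi> x\<bar> \<partial>lborel)" by (rule integral_abs_bound)
          also have "\<dots> \<le> (\<integral>x. K1 * (\<tau> * indicator B x + \<tau> powr (1 - p) * \<bar>v x - G K x\<bar> powr p) \<partial>lborel)"
            by (intro integral_mono integrable_abs ivG\<phi> idom) (simp only: abs_mult dom)
          also have "\<dots> = K1 * (\<tau> * V + \<tau> powr (1 - p) * (\<integral>x. \<bar>v x - G K x\<bar> powr p \<partial>lborel))"
            using iB ivG(1) V0 by simp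
          also have "\<dots> \<le> K1 * (\<tau> * V + \<tau> powr (1 - p) * e K)"
            using ivG(2) K1 by (intro mult_left_mono add_left_mono) auto
          finally show ?thesis .
        qed
        ultimately show ?thesis by linarith
      qed
      have ineq2: "\<bar>\<Delta>\<bar> \<le> K1 * V * \<tau>" if \<tau>: "\<tau> > 0" for \<tau>
      proof -
        have "(\<lambda>K. 2 * A * (1/2) ^ K * K2 * V + K1 * (\<tau> * V + \<tau> powr (1 - p) * e K)) \<longlonglongrightarrow> 2 * A * 0 * K2 * V + K1 * (\<tau> * V + \<tau> powr (1 - p) * 0)"
          by (intro tendsto_intros e0 LIMSEQ_realpow_zero) auto
        from LIMSEQ_le_const[OF this, of "\<bar>\<Delta>\<bar>"] ineq[OF \<tau>] show ?thesis by (auto simp: mult_ac)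
      qed
      have "\<bar>\<Delta>\<bar> \<le> 0"
      proof (rule field_le_epsilon)
        fix e :: real assume e: "0 < e"
        define \<tau> where "\<tau> = e / (K1 * V + 1)"
        have kv: "K1 * V + 1 > 0" using K1 V0 by (simp add: add_nonneg_pos)
        have "K1 * V * \<tau> \<le> (K1 * V + 1) * \<tau>" using e kv by (intro mult_right_mono) (auto simp: \<tau>_def)
        also have "\<dots> = e" using kv by (simp add: \<tau>_def)
        finally show "\<bar>\<Delta>\<bar> \<le> 0 + e" using ineq2[of \<tau>] e kv by (simp add: \<tau>_def)
      qed
      then show ?thesis by (simp add: \<Delta>_def)
    qed
    have "weak_pderiv i g v"
      unfolding weak_pderiv_def
    proof (intro allI impI)
      fix \<phi> :: "'a \<Rightarrow> real" assume \<phi>: "test_function \<phi>"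
      have [measurable]: "\<phi> \<in> borel_measurable borel" "pderiv_dir i \<phi> \<in> borel_measurable borel"
        using test_function_support[OF \<phi>] i by (auto intro: borel_measurable_continuous_onI)
      have "(\<integral>x. g x * pderiv_dir i \<phi> x \<partial>lebesgue) = (\<integral>x. g x * pderiv_dir i \<phi> x \<partial>lborel)"
        by (rule integral_completion) simp
      moreover have "(\<integral>x. v x * \<phi> x \<partial>lebesgue) = (\<integral>x. v x * \<phi> x \<partial>lborel)"
        by (rule integral_completion) simp
      ultimately show "(\<integral>x. g x * pderiv_dir i \<phi> x \<partial>lebesgue) = - (\<integral>x. v x * \<phi> x \<partial>lebesgue)"
        using weak[OF \<phi>] by simp
    qed
    then show ?thesis using vLp by blast
  qed
  then show ?thesis unfolding W1p_def g_def[symmetric] using gLp by blast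
qed

section \<open>Decomposition into tent averages\<close>

text \<open>For \<open>y = norm h\<close> the scales are split where \<open>1 / 2 ^ m\<close> is
  comparable to \<open>y\<close>. Coarser scales use the quadratic gain and sum to a multiple of
  \<open>y^2 2^m <= 2 y\<close>; finer ones use only their size. This gives
  \<open>32 n^2 + 8\<close> for the second differences, and the sup norm adds 2.\<close>

lemma tent_series_Lambda1:
  fixes c :: "nat \<Rightarrow> 'a::euclidean_space \<Rightarrow> real"
  assumes \<Lambda>: "0 \<le> \<Lambda>" and c [measurable]: "\<And>k. c k \<in> borel_measurable borel" and cb: "\<And>k x. \<bar>c k x\<bar> \<le> \<Lambda> * (1/2) ^ k"
  defines "r \<equiv> \<lambda>x. \<Sum>k. tent_avg (1 / 2 ^ Suc k) (c k) x"
  shows "r \<in> Lambda1" and "Lambda1_norm r \<le> (10 + 32 * (real DIM('a))\<^sup>2) * \<Lambda>"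
proof -
  define n where "n = real DIM('a)"
  define T where "T = (\<lambda>k. tent_avg (1 / 2 ^ Suc k) (c k))"
  have T: "\<bar>T k x\<bar> \<le> \<Lambda> * (1/2) ^ k" for k x
    unfolding T_def by (intro tent_avg_abs_le cb c)
  have geo: "(\<lambda>k. \<Lambda> * (1/2) ^ k) sums (\<Lambda> * 2)" using sums_mult[OF geometric_sums[of "1/2::real"], of \<Lambda>] by simp
  have sm: "summable (\<lambda>k. T k x)" for x
    by (rule summable_comparison_test'[OF sums_summable[OF geo], where N=0]) (simp only: real_norm_def T)
  have r: "r = (\<lambda>x. \<Sum>k. T k x)" by (simp add: r_def T_def)
  have lim: "(\<lambda>K. \<Sum>k<K. T k x) \<longlonglongrightarrow> r x" for x unfolding r by (rule summable_LIMSEQ[OF sm])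
  have rb: "\<bar>r x\<bar> \<le> 2 * \<Lambda>" for x
  proof -
    have "\<bar>\<Sum>k<K. T k x\<bar> \<le> 2 * \<Lambda>" for K
    proof -
      have "\<bar>\<Sum>k<K. T k x\<bar> \<le> (\<Sum>k<K. \<Lambda> * (1/2) ^ k)" by (rule order_trans[OF sum_abs sum_mono[OF T]])
      also have "\<dots> \<le> (\<Sum>k. \<Lambda> * (1/2) ^ k)" using \<Lambda> by (intro sum_le_suminf sums_summable[OF geo]) auto
      finally show ?thesis using sums_unique[OF geo] by simp
    qed
    then show ?thesis using LIMSEQ_le_const2[OF tendsto_rabs[OF lim[of x]]] by blast
  qed
  have cont: "continuous_on UNIV r"
  proof (rule uniform_limit_theorem)
    show "uniform_limit UNIV (\<lambda>K x. \<Sum>k<K. T k x) r sequentially"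
      unfolding r by (rule Weierstrass_m_test[OF _ sums_summable[OF geo]]) (simp add: T)
    show "\<forall>\<^sub>F K in sequentially. continuous_on UNIV (\<lambda>x. \<Sum>k<K. T k x)"
      unfolding T_def by (intro always_eventually allI continuous_on_sum tent_avg_continuous[OF c cb]) simp
  qed simp
  have Dh2T: "\<bar>Dh2 h r x\<bar> \<le> (8 + 32 * n\<^sup>2) * \<Lambda> * norm h" if h1: "norm h \<le> 1" for x h
  proof (cases "h = 0")
    case True
    then show ?thesis by (simp add: Dh2_eq)
  next
    case False
    define y where "y = norm h"
    have y: "0 < y" "y \<le> 1" using False h1 by (auto simp: y_def)
    obtain m where m: "(1/2) ^ m \<le> y" "y * 2 ^ m \<le> 2"
    proof -
      have ex: "\<exists>m. (1/2::real) ^ m \<le> y"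
        using real_arch_pow_inv[OF y(1), of "1/2"] less_imp_le by auto
      define m where "m = (LEAST m. (1/2::real) ^ m \<le> y)"
      have 1: "(1/2) ^ m \<le> y" unfolding m_def by (rule LeastI_ex[OF ex])
      have "y * 2 ^ m \<le> 2"
      proof (cases m)
        case 0 then show ?thesis using y by simp
      next
        case (Suc j)
        then have "\<not> (1/2) ^ j \<le> y" using not_less_Least[of j "\<lambda>m. (1/2::real) ^ m \<le> y"] by (simp add: m_def)
        then show ?thesis using Suc by (simp add: field_simps power_one_over)
      qed
      with 1 show ?thesis by (rule that)
    qed
    define w where "w = (\<lambda>k. \<bar>Dh2 h (T k) x\<bar>)"
    have w1: "w k \<le> 4 * (\<Lambda> * (1/2) ^ k)" for k unfolding w_def by (rule Dh2_bounded[OF T])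
    have w2: "w k \<le> 16 * n\<^sup>2 * \<Lambda> * y\<^sup>2 * 2 ^ k" for k
    proof -
      have "w k \<le> \<Lambda> * (1/2) ^ k * (2 * real DIM('a) * (norm h / (1 / 2 ^ Suc k)))\<^sup>2"
        unfolding w_def T_def by (intro tent_avg_Dh2 cb c) simp
      also have "\<dots> = 16 * n\<^sup>2 * \<Lambda> * y\<^sup>2 * ((1/2) ^ k * 2 ^ k) * 2 ^ k"
        by (simp add: n_def y_def power2_eq_square)
      also have "(1/2) ^ k * 2 ^ k = (1::real)" by (simp add: power_mult_distrib[symmetric])
      finally show ?thesis by simp
    qed
    have s1: "(\<Sum>k<K. w k) \<le> 16 * n\<^sup>2 * \<Lambda> * y\<^sup>2 * 2 ^ K" for K
    proof (induction K)
      case (Suc K)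
      then show ?case using w2[of K] by simp
    qed (use \<Lambda> in simp)
    \<comment> \<open>The subtracted last term is the unspent rest of the geometric series; with it
      the induction closes exactly.\<close>
    have s2: "(\<Sum>k<K. w k) \<le> 16 * n\<^sup>2 * \<Lambda> * y\<^sup>2 * 2 ^ m + 8 * \<Lambda> * (1/2) ^ m - 8 * \<Lambda> * (1/2) ^ K" if "m \<le> K" for K
      using that
    proof (induction K rule: dec_induct)
      case base
      then show ?case using s1[of m] by simp
    next
      case (step K)
      then show ?case using w1[of K] by simp
    qed
    have fin: "\<bar>Dh2 h (\<lambda>x. \<Sum>k<K. T k x) x\<bar> \<le> (8 + 32 * n\<^sup>2) * \<Lambda> * norm h" if K: "m \<le> K" for K
    proof -
      have "Dh2 h (\<lambda>x. \<Sum>k<K. T k x) x = (\<Sum>k<K. Dh2 h (T k) x)"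
        by (simp add: Dh2_eq sum.distrib sum_subtractf sum_distrib_left)
      then have "\<bar>Dh2 h (\<lambda>x. \<Sum>k<K. T k x) x\<bar> \<le> (\<Sum>k<K. w k)" unfolding w_def by (simp add: sum_abs)
      also have "\<dots> \<le> 16 * n\<^sup>2 * \<Lambda> * y\<^sup>2 * 2 ^ m + 8 * \<Lambda> * (1/2) ^ m - 8 * \<Lambda> * (1/2) ^ K" by (rule s2[OF K])
      also have "\<dots> \<le> 16 * n\<^sup>2 * \<Lambda> * y\<^sup>2 * 2 ^ m + 8 * \<Lambda> * (1/2) ^ m" using \<Lambda> by simp
      also have "\<dots> = (16 * n\<^sup>2 * \<Lambda> * y) * (y * 2 ^ m) + 8 * \<Lambda> * (1/2) ^ m" by (simp add: power2_eq_square)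
      also have "\<dots> \<le> (16 * n\<^sup>2 * \<Lambda> * y) * 2 + 8 * \<Lambda> * y"
        using \<Lambda> m y by (intro add_mono mult_left_mono) auto
      finally show ?thesis by (simp add: y_def algebra_simps)
    qed
    have "(\<lambda>K. \<bar>Dh2 h (\<lambda>x. \<Sum>k<K. T k x) x\<bar>) \<longlonglongrightarrow> \<bar>Dh2 h r x\<bar>"
      unfolding Dh2_eq by (intro tendsto_intros lim)
    then show ?thesis by (rule LIMSEQ_le_const2) (use fin in blast)
  qed
  show "r \<in> Lambda1" by (rule Lambda1I(1)[OF cont rb Dh2T])
  have "Lambda1_norm r \<le> 2 * \<Lambda> + (8 + 32 * n\<^sup>2) * \<Lambda>" by (rule Lambda1I(2)[OF cont rb Dh2T])
  then show "Lambda1_norm r \<le> (10 + 32 * (real DIM('a))\<^sup>2) * \<Lambda>" by (simp add: n_def algebra_simps)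
qed

lemma tent_avg_minus_id_le:
  fixes f :: "'a::euclidean_space \<Rightarrow> real"
  assumes [measurable]: "f \<in> borel_measurable borel" and S: "\<And>x. \<bar>f x\<bar> \<le> S"
    and b: "\<And>z. norm z \<le> real DIM('a) \<Longrightarrow> \<bar>Dh2 (t *\<^sub>R z) f x\<bar> \<le> b"
  shows "\<bar>tent_avg t f x - f x\<bar> \<le> b / 2"
proof -
  have "\<bar>\<integral>z. Dh2 (t *\<^sub>R z) f x \<partial>tent_measure\<bar> \<le> b"
    by (rule tent_integral_abs_le[OF _ b]) (simp_all add: Dh2_eq)
  then show ?thesis unfolding tent_avg_minus_id[OF assms(1) S] by simp
qed

text \<open>The place where membership in \<open>C0\<close> is used: it makes the large part of each
  piece vanish outside a bounded set.\<close>

lemma tent_avg_vanishes_at_infinity: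
  fixes f :: "'a::euclidean_space \<Rightarrow> real"
  assumes f: "f \<in> C0" and t: "0 \<le> t" and e: "0 < e"
  obtains R where "\<And>x. R \<le> norm x \<Longrightarrow> \<bar>tent_avg t f x\<bar> \<le> e"
proof -
  have [measurable]: "f \<in> borel_measurable borel" using f by (auto simp: C0_def intro: borel_measurable_continuous_onI)
  have "eventually (\<lambda>x. dist (f x) 0 < e) at_infinity" using f e unfolding C0_def by (blast intro: tendstoD)
  then obtain R where R: "\<And>x. R \<le> norm x \<Longrightarrow> \<bar>f x\<bar> < e" by (auto simp: eventually_at_infinity)
  show ?thesis
  proof
    fix x :: 'a assume x: "R + t * real DIM('a) \<le> norm x"
    show "\<bar>tent_avg t f x\<bar> \<le> e"
      unfolding tent_avg_def
    proof (rule tent_integral_abs_le)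
      fix z :: 'a assume z: "norm z \<le> real DIM('a)"
      have "norm (t *\<^sub>R z) \<le> t * real DIM('a)" using z t by (simp add: mult_left_mono)
      moreover have "norm x \<le> norm (x + t *\<^sub>R z) + norm (t *\<^sub>R z)" using norm_triangle_ineq4[of "x + t *\<^sub>R z" "t *\<^sub>R z"] by simp
      ultimately show "\<bar>f (x + t *\<^sub>R z)\<bar> \<le> e" using R[of "x + t *\<^sub>R z"] x by linarith
    qed simp
  qed
qed

text \<open>The two scales are the neighbours of \<open>1 / 2 ^ (k + 1)\<close>, at which the piece
  is averaged once more. For \<open>k = 0\<close> the coarse average is omitted, so that the
  telescoping sum starts from nothing.\<close>

definition tent_piece :: "('a::euclidean_space \<Rightarrow> real) \<Rightarrow> nat \<Rightarrow> 'a \<Rightarrow> real" where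
  "tent_piece f k x = (if k = 0 then tent_avg (1/4) f x else tent_avg (1 / 2 ^ (k + 2)) f x - tent_avg (1 / 2 ^ k) f x)"

lemma tent_piece_measurable [measurable]:
  assumes [measurable]: "f \<in> borel_measurable borel"
  shows "tent_piece f k \<in> borel_measurable borel"
  unfolding tent_piece_def by measurable

text \<open>Averages at different scales commute, so the subtracted product of the averages at the
  scales with exponents \<open>k + 1\<close> and \<open>k\<close> is the one added at the previous
  index. This is why the pieces skip one scale.\<close>

lemma tent_piece_telescope:
  fixes f :: "'a::euclidean_space \<Rightarrow> real"
  assumes f [measurable]: "f \<in> borel_measurable borel" and S: "\<And>x. \<bar>f x\<bar> \<le> S"
  shows "(\<Sum>k<Suc K. tent_avg (1 / 2 ^ Suc k) (tent_piece f k) x) = tent_avg (1 / 2 ^ Suc K) (tent_avg (1 / 2 ^ (K + 2)) f) x"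
proof (induction K)
  case 0
  have "tent_piece f 0 = tent_avg (1 / 4) f" by (rule ext) (simp add: tent_piece_def)
  then show ?case by simp
next
  case (Suc K)
  have p: "tent_piece f (Suc K) = (\<lambda>x. tent_avg (1 / 2 ^ (Suc K + 2)) f x - tent_avg (1 / 2 ^ Suc K) f x)"
    by (rule ext) (simp add: tent_piece_def)
  have "tent_avg (1 / 2 ^ Suc (Suc K)) (tent_piece f (Suc K)) x
    = tent_avg (1 / 2 ^ Suc (Suc K)) (tent_avg (1 / 2 ^ (Suc K + 2)) f) x - tent_avg (1 / 2 ^ Suc (Suc K)) (tent_avg (1 / 2 ^ Suc K) f) x"
    unfolding p by (rule tent_avg_add(2)[where S=S and S'=S]) (auto intro!: tent_avg_abs_le S)
  moreover have "tent_avg (1 / 2 ^ Suc (Suc K)) (tent_avg (1 / 2 ^ Suc K) f) x = tent_avg (1 / 2 ^ Suc K) (tent_avg (1 / 2 ^ (K + 2)) f) x"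
    using tent_avg_commute[OF f S, of "1 / 2 ^ Suc (Suc K)" "1 / 2 ^ Suc K" x] by simp
  ultimately show ?case using Suc by (simp only: sum.lessThan_Suc[of _ "Suc K"])
qed

text \<open>Piece 0 is controlled by the sup norm only; the later pieces are differences of two
  averages, each within a multiple of its scale of \<open>f\<close>.\<close>

lemma tent_piece_bounds:
  fixes f :: "'a::euclidean_space \<Rightarrow> real"
  assumes f [measurable]: "f \<in> borel_measurable borel" and S: "\<And>x. \<bar>f x\<bar> \<le> S"
    and M: "0 \<le> M" "\<And>x h. \<bar>Dh2 h f x\<bar> \<le> M * norm h"
  shows tent_piece_abs_le: "\<bar>tent_piece f k x\<bar> \<le> (S + M * real DIM('a)) * (1/2) ^ k"
    and tent_piece_sums: "(\<lambda>k. tent_avg (1 / 2 ^ Suc k) (tent_piece f k) x) sums f x"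
proof -
  define n where "n = real DIM('a)"
  have n: "n \<ge> 0" by (simp add: n_def)
  have S0: "0 \<le> S" using S[of 0] by linarith
  have u: "\<bar>tent_avg t f x - f x\<bar> \<le> M * (t * n) / 2" if "t \<ge> 0" for t x
  proof (rule tent_avg_minus_id_le[OF f S])
    fix z :: 'a assume "norm z \<le> real DIM('a)"
    then have "M * norm (t *\<^sub>R z) \<le> M * (t * n)" using that M by (auto simp: n_def intro!: mult_left_mono)
    then show "\<bar>Dh2 (t *\<^sub>R z) f x\<bar> \<le> M * (t * n)" using M(2)[of "t *\<^sub>R z" x] by linarith
  qed
  show "\<bar>tent_piece f k x\<bar> \<le> (S + M * real DIM('a)) * (1/2) ^ k"
  proof (cases "k = 0")
    case True
    have "\<bar>tent_avg (1/4) f x\<bar> \<le> S" by (rule tent_avg_abs_le[OF f S])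
    then show ?thesis using True M by (simp add: tent_piece_def add_increasing2)
  next
    case False
    have 1: "\<bar>tent_avg (1 / 2 ^ (k + 2)) f x - f x\<bar> \<le> M * (1 / 2 ^ (k + 2) * n) / 2"
      and 2: "\<bar>tent_avg (1 / 2 ^ k) f x - f x\<bar> \<le> M * (1 / 2 ^ k * n) / 2" by (rule u; simp)+
    define q where "q = M * n * (1/2) ^ k"
    have q: "0 \<le> q" using M n by (simp add: q_def)
    have e1: "M * (1 / 2 ^ (k + 2) * n) / 2 = q / 8" by (simp add: q_def power_one_over power_add)
    have e2: "M * (1 / 2 ^ k * n) / 2 = q / 2" by (simp add: q_def power_one_over)
    have "\<bar>tent_piece f k x\<bar> = \<bar>tent_avg (1 / 2 ^ (k + 2)) f x - tent_avg (1 / 2 ^ k) f x\<bar>" using False by (simp add: tent_piece_def)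
    then have "\<bar>tent_piece f k x\<bar> \<le> q" using 1[unfolded e1] 2[unfolded e2] q by linarith
    also have "q \<le> (S + M * real DIM('a)) * (1/2) ^ k" using S0 by (simp add: q_def n_def)
    finally show ?thesis .
  qed
  have "(\<lambda>K. \<Sum>k<Suc K. tent_avg (1 / 2 ^ Suc k) (tent_piece f k) x) \<longlonglongrightarrow> f x"
  proof (rule LIM_zero_cancel, rule tendsto_rabs_zero_cancel, rule tendsto_sandwich[where f="\<lambda>_. 0"])
    show "\<forall>\<^sub>F K in sequentially. \<bar>(\<Sum>k<Suc K. tent_avg (1 / 2 ^ Suc k) (tent_piece f k) x) - f x\<bar> \<le> M * n * (1 / 2) ^ K"
    proof (intro always_eventually allI)
      fix K
      have t1: "\<bar>tent_avg (1 / 2 ^ (K + 2)) f z - f z\<bar> \<le> M * (1 / 2 ^ (K + 2) * n) / 2" for z by (rule u) simp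
      have t2: "\<bar>tent_avg (1 / 2 ^ Suc K) f x - f x\<bar> \<le> M * (1 / 2 ^ Suc K * n) / 2" by (rule u) simp
      have "\<bar>tent_avg (1 / 2 ^ Suc K) (\<lambda>z. tent_avg (1 / 2 ^ (K + 2)) f z - f z) x\<bar> \<le> M * (1 / 2 ^ (K + 2) * n) / 2"
        by (rule tent_avg_abs_le[OF _ t1]) measurable
      moreover have "tent_avg (1 / 2 ^ Suc K) (\<lambda>z. tent_avg (1 / 2 ^ (K + 2)) f z - f z) x
          = tent_avg (1 / 2 ^ Suc K) (tent_avg (1 / 2 ^ (K + 2)) f) x - tent_avg (1 / 2 ^ Suc K) f x"
        by (rule tent_avg_add(2)[where S=S and S'=S]) (auto intro!: tent_avg_abs_le S)
      ultimately have "\<bar>tent_avg (1 / 2 ^ Suc K) (tent_avg (1 / 2 ^ (K + 2)) f) x - f x\<bar> \<le> M * (1 / 2 ^ (K + 2) * n) / 2 + M * (1 / 2 ^ Suc K * n) / 2"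
        using t2 by linarith
      also have "\<dots> = (3/8) * (M * n * (1/2) ^ K)" by (simp add: power_one_over field_simps)
      also have "\<dots> \<le> M * n * (1/2) ^ K" using M n by simp
      finally show "\<bar>(\<Sum>k<Suc K. tent_avg (1 / 2 ^ Suc k) (tent_piece f k) x) - f x\<bar> \<le> M * n * (1 / 2) ^ K"
        by (simp only: tent_piece_telescope[OF f S])
    qed
    have "(\<lambda>K. M * n * (1 / 2) ^ K) \<longlonglongrightarrow> M * n * 0" by (intro tendsto_intros LIMSEQ_realpow_zero) auto
    then show "(\<lambda>K. M * n * (1 / 2) ^ K) \<longlonglongrightarrow> 0" by simp
  qed simp_all
  then show "(\<lambda>k. tent_avg (1 / 2 ^ Suc k) (tent_piece f k) x) sums f x"
    unfolding sums_def by (rule LIMSEQ_imp_Suc)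
qed

text \<open>By contraposition: if all second differences up to that length are at most
  \<open>b\<close>, both averages are within \<open>b / 2\<close> of \<open>f x\<close>. Piece 0 is
  excluded because it is not a difference.\<close>

lemma tent_piece_large:
  fixes f :: "'a::euclidean_space \<Rightarrow> real"
  assumes f [measurable]: "f \<in> borel_measurable borel" and S: "\<And>x. \<bar>f x\<bar> \<le> S"
    and k: "1 \<le> k" and large: "b < \<bar>tent_piece f k x\<bar>"
  obtains h where "norm h \<le> real DIM('a) / 2 ^ k" "b < \<bar>Dh2 h f x\<bar>"
proof (rule ccontr)
  assume no: "\<not> thesis"
  note found = that
  have small: "\<bar>Dh2 h f x\<bar> \<le> b" if "norm h \<le> real DIM('a) / 2 ^ k" for h
    using no found that by force
  have "\<bar>tent_avg t f x - f x\<bar> \<le> b / 2" if t: "0 \<le> t" "t \<le> 1 / 2 ^ k" for t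
  proof (rule tent_avg_minus_id_le[OF f S])
    fix z :: 'a assume "norm z \<le> real DIM('a)"
    then have "t * norm z \<le> 1 / 2 ^ k * real DIM('a)" using t by (intro mult_mono) auto
    then show "\<bar>Dh2 (t *\<^sub>R z) f x\<bar> \<le> b" using t by (intro small) simp
  qed
  from this[of "1 / 2 ^ (k + 2)"] this[of "1 / 2 ^ k"]
  have "\<bar>tent_avg (1 / 2 ^ (k + 2)) f x - f x\<bar> \<le> b / 2" "\<bar>tent_avg (1 / 2 ^ k) f x - f x\<bar> \<le> b / 2"
    by (simp_all add: field_simps)
  then have "\<bar>tent_avg (1 / 2 ^ (k + 2)) f x - tent_avg (1 / 2 ^ k) f x\<bar> \<le> b" by linarith
  then show False using large k by (simp add: tent_piece_def)
qed

section \<open>From the square function to the supports\<close>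

text \<open>\<open>Delta2\<close> is a supremum over an uncountable sphere. Its superlevel sets are
  unions, over unit vectors, of open sets, which gives joint measurability in \<open>x\<close> and
  \<open>y\<close>.\<close>

lemma open_Delta2_superlevel:
  fixes f :: "'a::euclidean_space \<Rightarrow> real"
  assumes f: "continuous_on UNIV f" "bounded (range f)"
  shows "open {(x, y). 0 < y \<and> \<epsilon> < Delta2 f x y / y}"
proof -
  have "{(x, y). 0 < y \<and> \<epsilon> < Delta2 f x y / y}
    = (\<Union>u\<in>{u. norm u = 1}. {z. 0 < snd z \<and> \<epsilon> * snd z < \<bar>Dh2 (snd z *\<^sub>R u) f (fst z)\<bar>})" (is "?L = ?R")
  proof (intro equalityI subsetI)
    fix z assume "z \<in> ?L"
    then have y: "0 < snd z" "\<epsilon> * snd z < Delta2 f (fst z) (snd z)" by (auto simp: field_simps)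
    obtain h where h: "norm h = snd z" "\<epsilon> * snd z < \<bar>Dh2 h f (fst z)\<bar>"
      by (rule less_Delta2D[OF _ y(2)]) (use y in auto)
    have "snd z *\<^sub>R ((1 / snd z) *\<^sub>R h) = h" using y by simp
    then show "z \<in> ?R" using h y by (intro UN_I[of "(1 / snd z) *\<^sub>R h"]) auto
  next
    fix z assume "z \<in> ?R"
    then obtain u where u: "norm u = 1" "0 < snd z" "\<epsilon> * snd z < \<bar>Dh2 (snd z *\<^sub>R u) f (fst z)\<bar>" by auto
    have "\<bar>Dh2 (snd z *\<^sub>R u) f (fst z)\<bar> \<le> Delta2 f (fst z) (snd z)" by (rule Delta2_ge[OF f(2)]) (use u in simp)
    then show "z \<in> ?L" using u by (auto simp: field_simps)
  qed
  moreover have "open \<dots>"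
  proof (intro open_UN ballI open_Collect_conj open_Collect_less)
    fix u :: 'a
    show "continuous_on UNIV (\<lambda>z. \<bar>Dh2 (snd z *\<^sub>R u) f (fst z)\<bar>)"
      unfolding Dh2_eq by (intro continuous_intros continuous_on_compose2[OF f(1)]) auto
  qed (auto intro!: continuous_intros)
  ultimately show ?thesis by simp
qed

lemma sq_inner_integrand_measurable:
  fixes f :: "'a::euclidean_space \<Rightarrow> real"
  assumes f: "continuous_on UNIV f" "bounded (range f)"
  shows "(\<lambda>(x, y). indicator {y \<in> {0<..1}. Delta2 f x y / y > \<epsilon>} y * ennreal (1 / y)) \<in> borel_measurable (borel \<Otimes>\<^sub>M borel)"
proof -
  define U where "U = {(x, y). 0 < y \<and> \<epsilon> < Delta2 f x y / y}"
  have [measurable]: "U \<in> sets (borel \<Otimes>\<^sub>M borel)"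
    unfolding U_def borel_prod by (intro borel_open open_Delta2_superlevel f)
  have "(\<lambda>(x, y). indicator {y \<in> {0<..1}. Delta2 f x y / y > \<epsilon>} y * ennreal (1 / y))
    = (\<lambda>z. indicator U z * (indicator {0<..1} (snd z) * ennreal (1 / snd z)))"
    by (auto simp: U_def indicator_def fun_eq_iff)
  moreover have "\<dots> \<in> borel_measurable (borel \<Otimes>\<^sub>M borel)" by measurable
  ultimately show ?thesis by simp
qed

lemma sq_inner_measurable:
  fixes f :: "'a::euclidean_space \<Rightarrow> real"
  assumes f: "continuous_on UNIV f" "bounded (range f)"
  shows "sq_inner f \<epsilon> \<in> borel_measurable borel"
  unfolding sq_inner_def
  by (rule lborel.borel_measurable_nn_integral)
     (use sq_inner_integrand_measurable[OF f] in \<open>simp add: measurable_cong_sets[OF sets_pair_measure_cong[OF refl sets_lborel] refl]\<close>)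

text \<open>Bounded overlap of the windows from \<open>\<kappa> / 2 ^ k\<close> to
  \<open>n / 2 ^ k\<close>: the endpoints of one window have ratio below
  \<open>2 ^ N\<close>.\<close>

lemma dyadic_scales_count:
  fixes \<kappa> n y :: real
  assumes \<kappa>: "0 < \<kappa>" and n: "0 \<le> n" and N: "n < \<kappa> * 2 ^ N"
  shows "(\<Sum>k. of_bool (\<kappa> / 2 ^ k \<le> y \<and> y \<le> n / 2 ^ k) :: ennreal) \<le> of_nat N"
proof -
  define P where "P = (\<lambda>k. \<kappa> / 2 ^ k \<le> y \<and> y \<le> n / 2 ^ k)"
  have "(\<Sum>k. of_bool (P k) :: ennreal) \<le> of_nat N"
  proof (cases "\<exists>k. P k")
    case False
    then have "(\<Sum>k. of_bool (P k) :: ennreal) = (\<Sum>k. 0)" by (intro suminf_cong) simp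
    then show ?thesis by simp
  next
    case True
    define j where "j = (LEAST k. P k)"
    have Pj: "P j" unfolding j_def by (rule LeastI_ex[OF True])
    have "k \<in> {j..<j + N}" if "P k" for k
    proof -
      have "j \<le> k" unfolding j_def by (rule Least_le[of P, OF that])
      moreover have "k < j + N"
      proof (rule ccontr)
        assume "\<not> k < j + N"
        then have "(2::real) ^ (j + N) \<le> 2 ^ k" by (intro power_increasing) auto
        then have "n / 2 ^ k \<le> n / 2 ^ (j + N)" using n by (intro divide_left_mono) auto
        then have "y \<le> n / 2 ^ (j + N)" using that by (simp add: P_def)
        also have "\<dots> < \<kappa> / 2 ^ j" using N by (simp add: power_add field_simps)
        finally show False using Pj by (simp add: P_def)
      qed
      ultimately show ?thesis by simp
    qed
    then have "(\<Sum>k. of_bool (P k) :: ennreal) = (\<Sum>k\<in>{j..<j + N}. of_bool (P k))" by (intro suminf_finite) auto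
    also have "\<dots> \<le> of_nat (card {j..<j + N}) * 1" by (intro sum_bounded_above) auto
    finally show ?thesis by simp
  qed
  then show ?thesis by (simp add: P_def)
qed

text \<open>One large second difference at a nearby point produces a whole interval of lengths
  \<open>y\<close> just below \<open>norm h\<close> at which \<open>Delta2\<close> is large at
  \<open>x\<close>. Of the threshold \<open>(n + 1) * \<epsilon> * t\<close>, one part
  \<open>\<epsilon> * t\<close> is lost to oscillation, and the remaining
  \<open>n * \<epsilon> * t\<close> is at least \<open>\<epsilon> * y\<close> because
  \<open>y <= n * t\<close>. The interval has length \<open>\<kappa> * t\<close> and
  \<open>1 / y >= 1 / (n * t)\<close> on it, whence the mass \<open>\<kappa> / n\<close>.\<close>

lemma Delta2_near_large:
  fixes f :: "'a::euclidean_space \<Rightarrow> real"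
  assumes bd: "bounded (range f)" and \<epsilon>: "\<epsilon> > 0" and M: "M \<ge> 1" "\<And>x h. \<bar>Dh2 h f x\<bar> \<le> M * norm h"
    and n: "n \<ge> 1" and t: "t > 0" "n * t \<le> 1" and \<kappa>: "\<kappa> > 0" "\<kappa> \<le> \<epsilon> / (2 * M)"
    and osc: "\<And>h'. norm (h' - h) \<le> \<kappa> * t \<Longrightarrow> \<bar>Dh2 h' f x - Dh2 h f c\<bar> \<le> \<epsilon> * t"
    and h: "norm h \<le> n * t" "(n + 1) * \<epsilon> * t < \<bar>Dh2 h f c\<bar>"
  shows "ennreal (\<kappa> / n) \<le> (\<integral>\<^sup>+y. of_bool (\<kappa> * t \<le> y \<and> y \<le> n * t) *
      (indicator {y \<in> {0<..1}. Delta2 f x y / y > \<epsilon>} y * ennreal (1 / y)) \<partial>lborel)"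
proof -
  \<comment> \<open>A second difference is at most \<open>M * norm h\<close>, so a large one forces
    \<open>norm h > 2 * \<kappa> * t\<close>; the interval of lengths then stays above
    \<open>\<kappa> * t\<close>.\<close>
  have "2 * M * \<kappa> \<le> \<epsilon>" using \<kappa> M by (simp add: field_simps)
  also have "\<epsilon> \<le> (n + 1) * \<epsilon>" using \<epsilon> n by simp
  finally have "2 * M * \<kappa> * t \<le> (n + 1) * \<epsilon> * t" using t by (intro mult_right_mono) auto
  also have "\<dots> < M * norm h" using h(2) M(2)[of h c] by linarith
  finally have "M * (2 * (\<kappa> * t)) < M * norm h" by (simp add: mult_ac)
  then have hl: "2 * (\<kappa> * t) < norm h" using M by (simp add: mult_less_cancel_left)
  have kt: "0 < \<kappa> * t" using \<kappa> t by simp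
  have D: "\<epsilon> * y < Delta2 f x y" if y: "norm h - \<kappa> * t \<le> y" "y \<le> norm h" for y
  proof -
    define h' where "h' = (y / norm h) *\<^sub>R h"
    have y0: "0 < y" "norm h > 0" using y hl kt by linarith+
    have nh: "norm h' = y" using y0 by (simp add: h'_def)
    have "h' - h = (y / norm h - 1) *\<^sub>R h" by (simp add: h'_def algebra_simps)
    then have "norm (h' - h) = \<bar>y / norm h - 1\<bar> * norm h" by simp
    also have "\<dots> = norm h - y" using y0 y by (simp add: abs_if field_simps)
    finally have "\<bar>Dh2 h' f x - Dh2 h f c\<bar> \<le> \<epsilon> * t" using y by (intro osc) simp
    then have "n * \<epsilon> * t < \<bar>Dh2 h' f x\<bar>" using h(2) by (simp add: algebra_simps)
    moreover have "\<epsilon> * y \<le> \<epsilon> * (n * t)" using y h(1) \<epsilon> by (intro mult_left_mono) auto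
    moreover have "\<bar>Dh2 h' f x\<bar> \<le> Delta2 f x y" by (rule Delta2_ge[OF bd nh])
    ultimately show ?thesis by (simp add: mult_ac)
  qed
  have nt: "0 < n * t" using n t by simp
  have "ennreal (\<kappa> / n) = ennreal (1 / (n * t)) * ennreal (\<kappa> * t)"
    using n t \<kappa> by (simp add: ennreal_mult[symmetric])
  also have "\<dots> = (\<integral>\<^sup>+y. ennreal (1 / (n * t)) * indicator {norm h - \<kappa> * t..norm h} y \<partial>lborel)"
    using kt by (subst nn_integral_cmult_indicator) auto
  also have "\<dots> \<le> (\<integral>\<^sup>+y. of_bool (\<kappa> * t \<le> y \<and> y \<le> n * t) *
      (indicator {y \<in> {0<..1}. Delta2 f x y / y > \<epsilon>} y * ennreal (1 / y)) \<partial>lborel)"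
  proof (rule nn_integral_mono)
    fix y :: real
    show "ennreal (1 / (n * t)) * indicator {norm h - \<kappa> * t..norm h} y
      \<le> of_bool (\<kappa> * t \<le> y \<and> y \<le> n * t) * (indicator {y \<in> {0<..1}. Delta2 f x y / y > \<epsilon>} y * ennreal (1 / y))"
    proof (cases "y \<in> {norm h - \<kappa> * t..norm h}")
      case True
      then have y: "norm h - \<kappa> * t \<le> y" "y \<le> norm h" by auto
      then have y1: "\<kappa> * t \<le> y" "0 < y" "y \<le> n * t" "y \<le> 1" using hl kt h(1) t by linarith+
      have "\<epsilon> < Delta2 f x y / y" using D[OF y] y1 by (simp add: field_simps)
      moreover have "1 / (n * t) \<le> 1 / y" using y1 by (intro divide_left_mono) auto
      ultimately show ?thesis using True y1 by (simp add: ennreal_leI)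
    qed simp
  qed
  finally show ?thesis .
qed

text \<open>A scale at which \<open>x\<close> is near the support contributes the mass of
  \<open>Delta2_near_large\<close> in its window, and the windows overlap boundedly, so the number
  of such scales is controlled by \<open>sq_inner\<close>. The first \<open>m\<close> scales are
  kept apart because their second differences may be longer than 1, beyond the range of the square
  function.\<close>

lemma near_support_count_le:
  fixes f :: "'a::euclidean_space \<Rightarrow> real"
  assumes f: "f \<in> Lambda1" and \<epsilon>: "\<epsilon> > 0"
  obtains \<kappa> C :: real and m :: nat where "\<kappa> > 0" "C > 0"
    "\<And>b x. (\<And>k c. b k c \<noteq> 0 \<Longrightarrow> (real DIM('a) + 1) * \<epsilon> / 2 ^ k < \<bar>tent_piece f k c\<bar>) \<Longrightarrow>
       (\<Sum>k. of_bool (near_support \<kappa> b k x)) \<le> (\<Sum>k<m. of_bool (near_support \<kappa> b k x)) + ennreal C * sq_inner f \<epsilon> x"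
proof -
  define n where "n = real DIM('a)"
  have n: "n \<ge> 1" using DIM_positive[where 'a='a] by (simp add: n_def Suc_le_eq)
  have fc: "continuous_on UNIV f" and fb: "bounded (range f)" using f by (auto simp: Lambda1_def)
  have [measurable]: "f \<in> borel_measurable borel" by (rule borel_measurable_continuous_onI[OF fc])
  obtain S where S: "\<And>x. \<bar>f x\<bar> \<le> S" using fb by (auto simp: bounded_iff)
  obtain M where M: "M \<ge> 1" "\<And>x h. \<bar>Dh2 h f x\<bar> \<le> M * norm h" by (rule Lambda1_Dh2_bound[OF f]) (rule that; blast)
  obtain \<kappa>\<^sub>0 where \<kappa>\<^sub>0: "\<kappa>\<^sub>0 > 0"
    and osc: "\<And>(f :: 'a \<Rightarrow> real) x x' h h' t. (\<And>x h. \<bar>Dh2 h f x\<bar> \<le> M * norm h) \<Longrightarrow> t > 0 \<Longrightarrow>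
       norm h \<le> n * t \<Longrightarrow> norm (x' - x) \<le> \<kappa>\<^sub>0 * t \<Longrightarrow> norm (h' - h) \<le> \<kappa>\<^sub>0 * t \<Longrightarrow> \<bar>Dh2 h' f x' - Dh2 h f x\<bar> \<le> \<epsilon> * t"
    by (rule Dh2_scale_invariant_continuity[where M=M and R=n and \<eta>=\<epsilon> and 'a='a]) (use M n \<epsilon> in auto)
  define \<kappa> where "\<kappa> = min \<kappa>\<^sub>0 (\<epsilon> / (2 * M))"
  have \<kappa>: "\<kappa> > 0" "\<kappa> \<le> \<kappa>\<^sub>0" "\<kappa> \<le> \<epsilon> / (2 * M)" using \<kappa>\<^sub>0 \<epsilon> M by (auto simp: \<kappa>_def)
  obtain N where N: "n / \<kappa> < 2 ^ N" using real_arch_pow[of 2 "n / \<kappa>"] by auto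
  then have N': "n < \<kappa> * 2 ^ N" using \<kappa> by (simp add: field_simps)
  obtain m\<^sub>0 where m\<^sub>0: "n < 2 ^ m\<^sub>0" using real_arch_pow[of 2 n] by auto
  \<comment> \<open>The successor guarantees \<open>k >= 1\<close> for the scales from
    \<open>m\<close> on, as \<open>tent_piece_large\<close> requires.\<close>
  define m where "m = Suc m\<^sub>0"
  have nm: "n * (1 / 2 ^ k) \<le> 1" if "m \<le> k" for k
  proof -
    have "(2::real) ^ m\<^sub>0 \<le> 2 ^ k" using that by (intro power_increasing) (auto simp: m_def)
    then have "n \<le> 2 ^ k" using m\<^sub>0 by linarith
    then show ?thesis by simp
  qed
  \<comment> \<open>\<open>n / \<kappa>\<close> inverts the mass gained per scale and
    \<open>N\<close> is the overlap; the successor makes positivity of \<open>C\<close>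
    immediate.\<close>
  define C where "C = n / \<kappa> * real (Suc N)"
  have C: "C > 0" using n \<kappa> by (simp add: C_def)
  show ?thesis
  proof (rule that[OF \<kappa>(1) C])
    fix b :: "nat \<Rightarrow> 'a \<Rightarrow> real" and x :: 'a
    assume b: "\<And>k c. b k c \<noteq> 0 \<Longrightarrow> (real DIM('a) + 1) * \<epsilon> / 2 ^ k < \<bar>tent_piece f k c\<bar>"
    define P where "P = (\<lambda>k. near_support \<kappa> b k x)"
    define J where "J = (\<lambda>y::real. indicator {y \<in> {0<..1}. Delta2 f x y / y > \<epsilon>} y * ennreal (1 / y))"
    have [measurable]: "J \<in> borel_measurable borel"
      using measurable_compose[OF measurable_Pair1' sq_inner_integrand_measurable[OF fc fb, of \<epsilon>], of x] by (simp add: J_def)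
    have key: "ennreal (\<kappa> / n) * of_bool (m \<le> k \<and> P k) \<le> (\<integral>\<^sup>+y. of_bool (\<kappa> / 2 ^ k \<le> y \<and> y \<le> n / 2 ^ k) * J y \<partial>lborel)" for k
    proof (cases "m \<le> k \<and> P k")
      case True
      then obtain c where c: "b k c \<noteq> 0" "dist x c < \<kappa> / 2 ^ k" by (auto simp: P_def near_support_def)
      obtain h where h: "norm h \<le> real DIM('a) / 2 ^ k" "(real DIM('a) + 1) * \<epsilon> / 2 ^ k < \<bar>Dh2 h f c\<bar>"
        by (rule tent_piece_large[OF _ S _ b[OF c(1)]]) (use True in \<open>auto simp: m_def\<close>)
      have "ennreal (\<kappa> / n) \<le> (\<integral>\<^sup>+y. of_bool (\<kappa> * (1 / 2 ^ k) \<le> y \<and> y \<le> n * (1 / 2 ^ k)) *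
        (indicator {y \<in> {0<..1}. Delta2 f x y / y > \<epsilon>} y * ennreal (1 / y)) \<partial>lborel)"
      proof (rule Delta2_near_large[OF fb \<epsilon> M n _ nm \<kappa>(1,3), where h=h and c=c])
        fix h' assume h': "norm (h' - h) \<le> \<kappa> * (1 / 2 ^ k)"
        have le: "\<kappa> * (1 / 2 ^ k) \<le> \<kappa>\<^sub>0 * (1 / 2 ^ k)" using \<kappa> by (intro mult_right_mono) auto
        show "\<bar>Dh2 h' f x - Dh2 h f c\<bar> \<le> \<epsilon> * (1 / 2 ^ k)"
          by (rule osc[OF M(2)]) (use h' le c h in \<open>auto simp: n_def dist_norm\<close>)
      qed (use True h in \<open>auto simp: n_def\<close>)
      then show ?thesis using True by (simp add: J_def)
    qed auto
    have "ennreal (\<kappa> / n) * (\<Sum>k. of_bool (m \<le> k \<and> P k)) = (\<Sum>k. ennreal (\<kappa> / n) * of_bool (m \<le> k \<and> P k))" by simp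
    also have "\<dots> \<le> (\<Sum>k. \<integral>\<^sup>+y. of_bool (\<kappa> / 2 ^ k \<le> y \<and> y \<le> n / 2 ^ k) * J y \<partial>lborel)"
      by (intro suminf_le summableI key)
    also have "\<dots> = (\<integral>\<^sup>+y. (\<Sum>k. of_bool (\<kappa> / 2 ^ k \<le> y \<and> y \<le> n / 2 ^ k) * J y) \<partial>lborel)"
      by (rule nn_integral_suminf[symmetric]) measurable
    also have "\<dots> \<le> (\<integral>\<^sup>+y. of_nat N * J y \<partial>lborel)"
    proof (rule nn_integral_mono)
      fix y :: real
      have "(\<Sum>k. of_bool (\<kappa> / 2 ^ k \<le> y \<and> y \<le> n / 2 ^ k) * J y) = (\<Sum>k. of_bool (\<kappa> / 2 ^ k \<le> y \<and> y \<le> n / 2 ^ k)) * J y"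
        by (rule ennreal_suminf_multc)
      also have "\<dots> \<le> of_nat N * J y" using n by (intro mult_right_mono dyadic_scales_count[OF \<kappa>(1) _ N']) auto
      finally show "(\<Sum>k. of_bool (\<kappa> / 2 ^ k \<le> y \<and> y \<le> n / 2 ^ k) * J y) \<le> of_nat N * J y" .
    qed
    also have "\<dots> = of_nat N * sq_inner f \<epsilon> x" unfolding sq_inner_def J_def[symmetric] by (rule nn_integral_cmult) measurable
    also have "\<dots> \<le> ennreal (real (Suc N)) * sq_inner f \<epsilon> x" by (intro mult_right_mono) (auto simp: ennreal_of_nat_eq_real_of_nat)
    finally have "ennreal (n / \<kappa>) * (ennreal (\<kappa> / n) * (\<Sum>k. of_bool (m \<le> k \<and> P k))) \<le> ennreal (n / \<kappa>) * (ennreal (real (Suc N)) * sq_inner f \<epsilon> x)"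
      by (intro mult_left_mono) auto
    then have tail: "(\<Sum>k. of_bool (m \<le> k \<and> P k)) \<le> ennreal C * sq_inner f \<epsilon> x"
      using n \<kappa> by (simp add: mult.assoc[symmetric] ennreal_mult[symmetric] C_def del: of_nat_Suc)
    have "(\<Sum>k. of_bool (P k) :: ennreal) = (\<Sum>k. of_bool (k < m \<and> P k) + of_bool (m \<le> k \<and> P k))"
      by (intro suminf_cong) auto
    also have "\<dots> = (\<Sum>k. of_bool (k < m \<and> P k)) + (\<Sum>k. of_bool (m \<le> k \<and> P k))"
      by (rule suminf_add[OF summableI summableI, symmetric])
    also have "(\<Sum>k. of_bool (k < m \<and> P k) :: ennreal) = (\<Sum>k<m. of_bool (k < m \<and> P k))" by (rule suminf_finite) auto
    also have "\<dots> = (\<Sum>k<m. of_bool (P k))" by (rule sum.cong) auto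
    finally show "(\<Sum>k. of_bool (near_support \<kappa> b k x)) \<le> (\<Sum>k<m. of_bool (near_support \<kappa> b k x)) + ennreal C * sq_inner f \<epsilon> x"
      using tail by (simp add: P_def add_left_mono)
  qed
qed

section \<open>The distance formula\<close>

text \<open>Each piece is truncated at the threshold \<open>\<Lambda> / 2 ^ k\<close>. The small
  parts give \<open>r\<close> and its norm through \<open>tent_series_Lambda1\<close>, the large
  parts give \<open>g\<close> through \<open>tent_series_W1p\<close>. That \<open>g\<close> is in
  \<open>Lambda1\<close> follows from \<open>g = f - r\<close>, not from an estimate of its own
  series.\<close>

theorem W1p_approximation:
  fixes f :: "'a::euclidean_space \<Rightarrow> real"
  assumes p: "p > 1" and f: "f \<in> C0" "f \<in> Lambda1" and \<epsilon>: "\<epsilon> > 0" and fin: "sq_Lp_finite p f \<epsilon>"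
  shows "\<exists>g \<in> W1p p \<inter> Lambda1. Lambda1_norm (\<lambda>x. f x - g x) \<le> (10 + 32 * (real DIM('a))\<^sup>2) * ((real DIM('a) + 1) * \<epsilon>)"
proof -
  \<comment> \<open>The factor is the one of \<open>Delta2_near_large\<close> with
    \<open>n = DIM('a)\<close>, the bound on the radius of the support of the tent.\<close>
  define \<Lambda> where "\<Lambda> = (real DIM('a) + 1) * \<epsilon>"
  have \<Lambda>: "\<Lambda> > 0" using \<epsilon> by (simp add: \<Lambda>_def add_nonneg_pos)
  have fc: "continuous_on UNIV f" and fb: "bounded (range f)" using f by (auto simp: Lambda1_def)
  have fm [measurable]: "f \<in> borel_measurable borel" by (rule borel_measurable_continuous_onI[OF fc])
  obtain S where S: "\<And>x. \<bar>f x\<bar> \<le> S" using fb by (auto simp: bounded_iff)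
  have S0: "0 \<le> S" using S[of 0] by linarith
  obtain M where M: "M \<ge> 1" "\<And>x h. \<bar>Dh2 h f x\<bar> \<le> M * norm h" by (rule Lambda1_Dh2_bound[OF f(2)]) (rule that; blast)
  have M0: "0 \<le> M" using M by simp
  define A where "A = S + M * real DIM('a)"
  have A: "A > 0" using S0 M by (simp add: A_def add_nonneg_pos)
  define b where "b = (\<lambda>k x. if \<Lambda> / 2 ^ k < \<bar>tent_piece f k x\<bar> then tent_piece f k x else 0)"
  define c where "c = (\<lambda>k x. tent_piece f k x - b k x)"
  have bm [measurable]: "b k \<in> borel_measurable borel" for k unfolding b_def by measurable
  have cm [measurable]: "c k \<in> borel_measurable borel" for k unfolding c_def by measurable
  have aA: "\<bar>tent_piece f k x\<bar> \<le> A * (1/2) ^ k" for k x unfolding A_def by (rule tent_piece_abs_le[OF fm S M0 M(2)])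
  have bA: "\<bar>b k x\<bar> \<le> A * (1/2) ^ k" for k x using aA[of k x] A by (auto simp: b_def)
  have c\<Lambda>: "\<bar>c k x\<bar> \<le> \<Lambda> * (1/2) ^ k" for k x using \<Lambda> by (auto simp: c_def b_def power_one_over field_simps)
  obtain \<kappa> C :: real and m :: nat where \<kappa>: "\<kappa> > 0" and C: "C > 0" and cnt:
    "\<And>b x. (\<And>k c. b k c \<noteq> 0 \<Longrightarrow> (real DIM('a) + 1) * \<epsilon> / 2 ^ k < \<bar>tent_piece f k c\<bar>) \<Longrightarrow>
       (\<Sum>k. of_bool (near_support \<kappa> b k x)) \<le> (\<Sum>k<m. of_bool (near_support \<kappa> b k x)) + ennreal C * sq_inner f \<epsilon> x"
    by (rule near_support_count_le[OF f(2) \<epsilon>]) (rule that; blast)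
  define q where "q = p / 2"
  have q: "q > 0" using p by (simp add: q_def)
  have [measurable]: "sq_inner f \<epsilon> \<in> borel_measurable borel" by (rule sq_inner_measurable[OF fc fb])
  \<comment> \<open>Only for the first \<open>m\<close> scales is this used: their indicators are
    not controlled by the square function and must be integrable on their own.\<close>
  have bounded_near: "bounded {x. near_support \<kappa> b k x}" for k
  proof -
    have "\<exists>R. \<forall>x. R \<le> norm x \<longrightarrow> \<bar>tent_piece f k x\<bar> \<le> \<Lambda> / 2 ^ k"
    proof -
      have e: "0 < \<Lambda> / 2 ^ k / 2" using \<Lambda> by simp
      have vanish: "\<exists>R. \<forall>x. R \<le> norm x \<longrightarrow> \<bar>tent_avg t f x\<bar> \<le> \<Lambda> / 2 ^ k / 2" if "0 \<le> t" for t
        by (rule tent_avg_vanishes_at_infinity[OF f(1) that e]) blast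
      have t: "0 \<le> (1/4 :: real)" "0 \<le> (1 / 2 ^ (k + 2) :: real)" "0 \<le> (1 / 2 ^ k :: real)" by simp_all
      obtain R1 where R1: "\<And>x. R1 \<le> norm x \<Longrightarrow> \<bar>tent_avg (1 / 4) f x\<bar> \<le> \<Lambda> / 2 ^ k / 2"
        using vanish[OF t(1)] by blast
      obtain R2 where R2: "\<And>x. R2 \<le> norm x \<Longrightarrow> \<bar>tent_avg (1 / 2 ^ (k + 2)) f x\<bar> \<le> \<Lambda> / 2 ^ k / 2"
        using vanish[OF t(2)] by blast
      obtain R3 where R3: "\<And>x. R3 \<le> norm x \<Longrightarrow> \<bar>tent_avg (1 / 2 ^ k) f x\<bar> \<le> \<Lambda> / 2 ^ k / 2"
        using vanish[OF t(3)] by blast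
      have "\<bar>tent_piece f k x\<bar> \<le> \<Lambda> / 2 ^ k" if "max R1 (max R2 R3) \<le> norm x" for x
      proof -
        have "R1 \<le> norm x" "R2 \<le> norm x" "R3 \<le> norm x" using that by auto
        note R = R1[OF this(1)] R2[OF this(2)] R3[OF this(3)]
        show ?thesis
        proof (cases "k = 0")
          case True
          then have "tent_piece f k x = tent_avg (1 / 4) f x" by (simp add: tent_piece_def)
          then show ?thesis using R e by linarith
        next
          case False
          then have "tent_piece f k x = tent_avg (1 / 2 ^ (k + 2)) f x - tent_avg (1 / 2 ^ k) f x" by (simp add: tent_piece_def)
          moreover have "\<bar>u - v\<bar> \<le> L" if "\<bar>u\<bar> \<le> L / 2" "\<bar>v\<bar> \<le> L / 2" for u v L :: real using that by linarith
          ultimately show ?thesis using R(2,3) by (simp only:)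
        qed
      qed
      then show ?thesis by blast
    qed
    then obtain R where R: "\<And>x. R \<le> norm x \<Longrightarrow> \<bar>tent_piece f k x\<bar> \<le> \<Lambda> / 2 ^ k" by blast
    have "norm x \<le> R + \<kappa> / 2 ^ k" if near: "near_support \<kappa> b k x" for x
    proof -
      obtain z where z: "b k z \<noteq> 0" "dist x z < \<kappa> / 2 ^ k" using near by (auto simp: near_support_def)
      then have "norm z < R" using R[of z] by (force simp: b_def split: if_splits)
      then show ?thesis using z(2) norm_triangle_ineq2[of x z] by (simp add: dist_norm)
    qed
    then show ?thesis unfolding bounded_iff by blast
  qed
  have near_fin: "(\<integral>\<^sup>+x. enn_powr (of_bool (near_support \<kappa> b k x)) q \<partial>lborel) < \<infinity>" for k
  proof -
    have "(\<integral>\<^sup>+x. enn_powr (of_bool (near_support \<kappa> b k x)) q \<partial>lborel) = (\<integral>\<^sup>+x. indicator {x. near_support \<kappa> b k x} x \<partial>lborel)"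
      using q by (intro nn_integral_cong) (auto simp: enn_powr_def indicator_def)
    also have "\<dots> = emeasure lborel {x. near_support \<kappa> b k x}" by (intro nn_integral_indicator) measurable
    also have "\<dots> < \<infinity>" using emeasure_bounded_finite[OF bounded_near[of k]] by simp
    finally show ?thesis .
  qed
  have sq_fin: "(\<integral>\<^sup>+x. enn_powr (ennreal C * sq_inner f \<epsilon> x) q \<partial>lborel) < \<infinity>"
  proof -
    have "(\<integral>\<^sup>+x. enn_powr (ennreal C * sq_inner f \<epsilon> x) q \<partial>lborel) = ennreal (C powr q) * (\<integral>\<^sup>+x. enn_powr (sq_inner f \<epsilon> x) q \<partial>lborel)"
      unfolding enn_powr_cmult[OF C q] by (rule nn_integral_cmult) measurable
    moreover have "(\<integral>\<^sup>+x. enn_powr (sq_inner f \<epsilon> x) q \<partial>lborel) < \<infinity>"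
      using fin unfolding sq_Lp_finite_def q_def nn_integral_completion .
    ultimately show ?thesis by (simp add: ennreal_mult_less_top)
  qed
  have nfin: "(\<integral>\<^sup>+x. enn_powr (\<Sum>k. of_bool (near_support \<kappa> b k x)) (p / 2) \<partial>lborel) < \<infinity>"
  proof -
    \<comment> \<open>The \<open>m\<close> coarse indicators and the square function as
      \<open>Suc m\<close> terms of one sum, so that \<open>enn_powr_sum_le\<close> splits the
      power.\<close>
    define F where "F = (\<lambda>k x. if k < m then of_bool (near_support \<kappa> b k x) else ennreal C * sq_inner f \<epsilon> x)"
    have [measurable]: "F k \<in> borel_measurable borel" for k unfolding F_def by (cases "k < m") simp_all
    have "(\<Sum>k. of_bool (near_support \<kappa> b k x)) \<le> (\<Sum>k<Suc m. F k x)" for x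
      using cnt[of b x] by (simp add: F_def b_def \<Lambda>_def split: if_splits)
    then have "(\<integral>\<^sup>+x. enn_powr (\<Sum>k. of_bool (near_support \<kappa> b k x)) q \<partial>lborel)
      \<le> (\<integral>\<^sup>+x. ennreal (real (card {..<Suc m}) powr q) * (\<Sum>k<Suc m. enn_powr (F k x) q) \<partial>lborel)"
      using q by (intro nn_integral_mono order_trans[OF enn_powr_mono enn_powr_sum_le]) auto
    also have "\<dots> = ennreal (real (card {..<Suc m}) powr q) * (\<Sum>k<Suc m. \<integral>\<^sup>+x. enn_powr (F k x) q \<partial>lborel)"
      by (subst nn_integral_cmult, measurable, subst nn_integral_sum, measurable)
    also have "\<dots> < \<infinity>"
    proof -
      have "(\<integral>\<^sup>+x. enn_powr (F k x) q \<partial>lborel) < \<infinity>" for k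
        using near_fin[of k] sq_fin by (cases "k < m") (simp_all add: F_def)
      then have "(\<Sum>k<Suc m. \<integral>\<^sup>+x. enn_powr (F k x) q \<partial>lborel) < \<top>" by (subst ennreal_sum_less_top) auto
      then show ?thesis by (simp add: ennreal_mult_less_top del: sum.lessThan_Suc)
    qed
    finally show ?thesis by (simp add: q_def)
  qed
  define g where "g = (\<lambda>x. \<Sum>k. tent_avg (1 / 2 ^ Suc k) (b k) x)"
  have gW: "g \<in> W1p p" unfolding g_def
  proof (rule tent_series_W1p[OF p \<kappa> A bm _ nfin])
    fix k x
    show "\<bar>2 ^ k * b k x\<bar> \<le> A" using bA[of k x] by (simp add: abs_mult power_one_over field_simps)
  qed
  define r where "r = (\<lambda>x. \<Sum>k. tent_avg (1 / 2 ^ Suc k) (c k) x)"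
  have r: "r \<in> Lambda1" "Lambda1_norm r \<le> (10 + 32 * (real DIM('a))\<^sup>2) * \<Lambda>"
    unfolding r_def by (rule tent_series_Lambda1[OF less_imp_le[OF \<Lambda>] cm c\<Lambda>])+
  have fgr: "f x - g x = r x" for x
  proof -
    have geo: "summable (\<lambda>k. A * (1/2) ^ k)" by (intro summable_mult summable_geometric) auto
    have tb: "\<bar>tent_avg (1 / 2 ^ Suc k) (b k) x\<bar> \<le> A * (1/2) ^ k" for k by (intro tent_avg_abs_le bA bm)
    have sb: "summable (\<lambda>k. tent_avg (1 / 2 ^ Suc k) (b k) x)"
      by (rule summable_comparison_test'[OF geo, where N=0]) (simp only: real_norm_def tb)
    have sums: "(\<lambda>k. tent_avg (1 / 2 ^ Suc k) (tent_piece f k) x) sums f x" by (rule tent_piece_sums[OF fm S M0 M(2)])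
    have "(\<lambda>k. tent_avg (1 / 2 ^ Suc k) (tent_piece f k) x - tent_avg (1 / 2 ^ Suc k) (b k) x) sums (f x - g x)"
      unfolding g_def by (rule sums_diff[OF sums summable_sums[OF sb]])
    moreover have "tent_avg (1 / 2 ^ Suc k) (c k) x = tent_avg (1 / 2 ^ Suc k) (tent_piece f k) x - tent_avg (1 / 2 ^ Suc k) (b k) x" for k
      unfolding c_def by (rule tent_avg_add(2)[OF tent_piece_measurable[OF fm] bm aA bA])
    ultimately have "(\<lambda>k. tent_avg (1 / 2 ^ Suc k) (c k) x) sums (f x - g x)" by (simp only:)
    then show ?thesis unfolding r_def by (rule sums_unique)
  qed
  have "(\<lambda>x. f x - r x) = g" by (rule ext) (simp add: fgr[symmetric])
  then have "g \<in> Lambda1" using Lambda1_diff[OF f(2) r(1)] by simp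
  moreover have "(\<lambda>x. f x - g x) = r" by (rule ext) (rule fgr)
  ultimately show ?thesis using gW r(2) by (intro bexI[of _ g]) (auto simp: \<Lambda>_def)
qed

text \<open>Above the norm of \<open>f\<close> no level is ever exceeded. The set of admissible
  levels is therefore nonempty, and its infimum is meaningful.\<close>

lemma sq_Lp_finite_large:
  fixes f :: "'a::euclidean_space \<Rightarrow> real"
  assumes f: "f \<in> Lambda1" and \<epsilon>: "Lambda1_norm f \<le> \<epsilon>"
  shows "sq_Lp_finite p f \<epsilon>"
proof -
  have "Delta2 f x y / y \<le> \<epsilon>" if y: "y \<in> {0<..1}" for x y
  proof -
    have "Delta2 f x y \<le> Lambda1_norm f * y"
      by (rule Delta2_le) (use y Lambda1_norm_ge_Dh2[OF f, of _ x] in auto)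
    also have "\<dots> \<le> \<epsilon> * y" using \<epsilon> y by (intro mult_right_mono) auto
    finally show ?thesis using y by (simp add: field_simps)
  qed
  then have "{y \<in> {0<..1}. Delta2 f x y / y > \<epsilon>} = {}" for x unfolding not_less[symmetric] by blast
  then have "sq_inner f \<epsilon> x = 0" for x by (simp add: sq_inner_def)
  then show ?thesis by (simp add: sq_Lp_finite_def enn_powr_def)
qed

lemma sq_inner_perturb:
  fixes f g :: "'a::euclidean_space \<Rightarrow> real"
  assumes g: "g \<in> Lambda1" and fg: "(\<lambda>x. f x - g x) \<in> Lambda1" and L: "Lambda1_norm (\<lambda>x. f x - g x) \<le> \<epsilon>"
  shows "sq_inner f (2 * \<epsilon>) x \<le> sq_inner g \<epsilon> x"
proof -
  have "Delta2 g x y / y > \<epsilon>" if y: "y \<in> {0<..1}" and D: "Delta2 f x y / y > 2 * \<epsilon>" for y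
  proof -
    have "2 * \<epsilon> * y < Delta2 f x y" using y D by (simp add: field_simps)
    then obtain h where h: "norm h = y" "2 * \<epsilon> * y < \<bar>Dh2 h f x\<bar>" using y by (auto elim: less_Delta2D[rotated])
    have "\<bar>Dh2 h f x - Dh2 h g x\<bar> \<le> Lambda1_norm (\<lambda>x. f x - g x) * y"
      using Lambda1_norm_ge_Dh2[OF fg, of h x] h y by (simp add: Dh2_diff)
    also have "\<dots> \<le> \<epsilon> * y" using L y by (intro mult_right_mono) auto
    finally have "\<epsilon> * y < \<bar>Dh2 h g x\<bar>" using h by linarith
    also have "\<dots> \<le> Delta2 g x y" using g h by (intro Delta2_ge) (auto simp: Lambda1_def)
    finally show ?thesis using y by (simp add: field_simps)
  qed
  then show ?thesis unfolding sq_inner_def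
    by (intro nn_integral_mono mult_right_mono) (auto simp: indicator_def)
qed

theorem mainTheorem13:
  fixes p :: real
  assumes "1 < p"
  shows "\<exists>C1 C2. C1 > 0 \<and> C2 > 0 \<and>
    (\<forall>f :: 'a::euclidean_space \<Rightarrow> real. f \<in> C0 \<inter> Lambda1 \<longrightarrow>
       C1 * eps_Lambda p f \<le> dist_Lambda1 f (W1p p \<inter> Lambda1) \<and>
       dist_Lambda1 f (W1p p \<inter> Lambda1) \<le> C2 * eps_Lambda p f)"
proof -
  define C2 where "C2 = (10 + 32 * (real DIM('a))\<^sup>2) * (real DIM('a) + 1)"
  have C2: "C2 > 0" unfolding C2_def by (intro mult_pos_pos add_pos_nonneg add_nonneg_pos) auto
  have "1 / 2 * eps_Lambda p f \<le> dist_Lambda1 f (W1p p \<inter> Lambda1) \<and> dist_Lambda1 f (W1p p \<inter> Lambda1) \<le> C2 * eps_Lambda p f"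
    if f0: "f \<in> C0 \<inter> Lambda1" for f :: "'a \<Rightarrow> real"
  proof -
    have f: "f \<in> C0" "f \<in> Lambda1" using f0 by auto
    define V where "V = (W1p p \<inter> Lambda1 :: ('a \<Rightarrow> real) set)"
    define E where "E = {\<epsilon>. \<epsilon> > 0 \<and> sq_Lp_finite p f \<epsilon>}"
    have appr: "\<exists>g\<in>V. Lambda1_norm (\<lambda>x. f x - g x) \<le> C2 * \<epsilon>" if "\<epsilon> \<in> E" for \<epsilon>
      using W1p_approximation[OF assms f, of \<epsilon>] that unfolding V_def C2_def E_def mult.assoc by simp
    have nn: "0 \<le> Lambda1_norm (\<lambda>x. f x - g x)" if "g \<in> V" for g
      using that f(2) by (intro Lambda1_norm_nonneg Lambda1_diff) (auto simp: V_def)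
    have E_mem: "Lambda1_norm f + 1 \<in> E" unfolding E_def
      using Lambda1_norm_nonneg[OF f(2)] sq_Lp_finite_large[OF f(2), of "Lambda1_norm f + 1" p] by auto
    have bddE: "bdd_below E" unfolding E_def by (intro bdd_belowI[of _ 0]) auto
    have "dist_Lambda1 f V \<le> C2 * \<epsilon>" if \<epsilon>: "\<epsilon> \<in> E" for \<epsilon>
    proof -
      obtain g where g: "g \<in> V" "Lambda1_norm (\<lambda>x. f x - g x) \<le> C2 * \<epsilon>" using appr[OF \<epsilon>] by blast
      have "dist_Lambda1 f V \<le> Lambda1_norm (\<lambda>x. f x - g x)"
        unfolding dist_Lambda1_def by (rule cINF_lower[OF bdd_belowI2[of V 0] g(1)]) (rule nn)
      then show ?thesis using g by simp
    qed
    then have "dist_Lambda1 f V / C2 \<le> Inf E"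
      using E_mem C2 by (intro cInf_greatest) (auto simp: field_simps)
    then have upper: "dist_Lambda1 f V \<le> C2 * eps_Lambda p f"
      using C2 by (simp add: eps_Lambda_def E_def field_simps)
    have "eps_Lambda p f / 2 \<le> Lambda1_norm (\<lambda>x. f x - g x)" if g: "g \<in> V" for g
    proof (rule field_le_epsilon)
      fix e :: real assume e: "0 < e"
      \<comment> \<open>The summand \<open>e\<close> makes the level positive even if
        \<open>f = g\<close>. Passing from \<open>g\<close> at level \<epsilon> to \<open>f\<close>
        at level \<open>2 * \<epsilon>\<close> produces the lower constant
        \<open>1 / 2\<close>.\<close>
      define \<epsilon> where "\<epsilon> = Lambda1_norm (\<lambda>x. f x - g x) + e"
      have \<epsilon>: "\<epsilon> > 0" using nn[OF g] e by (simp add: \<epsilon>_def)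
      have g': "g \<in> W1p p" "g \<in> Lambda1" using g by (auto simp: V_def)
      have "sq_inner f (2 * \<epsilon>) x \<le> sq_inner g \<epsilon> x" for x
        using e by (intro sq_inner_perturb[OF g'(2) Lambda1_diff[OF f(2) g'(2)]]) (simp add: \<epsilon>_def)
      then have "(\<integral>\<^sup>+x. enn_powr (sq_inner f (2 * \<epsilon>) x) (p / 2) \<partial>lebesgue) \<le> (\<integral>\<^sup>+x. enn_powr (sq_inner g \<epsilon> x) (p / 2) \<partial>lebesgue)"
        using assms by (intro nn_integral_mono enn_powr_mono) auto
      also have "\<dots> < \<infinity>" using W1p_Lambda1_sq_Lp_finite[OF assms g' \<epsilon>] by (simp add: sq_Lp_finite_def)
      finally have "2 * \<epsilon> \<in> E" using \<epsilon> by (simp add: E_def sq_Lp_finite_def)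
      then have "Inf E \<le> 2 * \<epsilon>" by (rule cInf_lower[OF _ bddE])
      then show "eps_Lambda p f / 2 \<le> Lambda1_norm (\<lambda>x. f x - g x) + e" by (simp add: eps_Lambda_def E_def \<epsilon>_def)
    qed
    moreover have "V \<noteq> {}" using appr[OF E_mem] by blast
    ultimately have "eps_Lambda p f / 2 \<le> dist_Lambda1 f V"
      unfolding dist_Lambda1_def by (intro cINF_greatest) auto
    then show ?thesis using upper by (simp add: V_def)
  qed
  then show ?thesis using C2 by (intro exI[of _ "1/2"] exI[of _ C2]) auto
qed

end
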